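(* Let $\Omega\subset\mathbb{R}^n$ be a bounded open set with Lipschitz boundary. Let $\mu\in\mathcal M_{\mathcal H}(\Omega)$ be a non-extremal measure of the form $\mu=h\mathcal L^n+\mu^s$, where $h\in L^q(\Omega)$ for some $q>n$, both $h\mathcal L^n$ and $\mu^s$ are admissible measures in $\mathcal M_{\mathcal H}(\Omega)$, and $|\mu^s|(\Omega\setminus\Gamma)=0$ for some compact set $\Gamma\subset\Omega$ with $|\Gamma|=0$. Let $(\mu_j)_j\subset C^\infty(\Omega)$ be a sequence of functions such that: (i) $\mu_j\mathcal L^n$ is admissible and uniformly non-extremal for $j$ large enough, and $\mu_j\mathcal L^n\rightharpoonup\mu$ weakly-$*$ as $j\to+\infty$; (ii) for every open set $\Omega'\Subset\Omega$ containing the support of $\mu^s$: there exists $(h_j)_j\subset C^\infty(\Omega)$ such that $h_j\to h$ in $L^p(\Omega)$ for all $p\in[1,q)$, and also for $p=q$ if $q<+\infty$, and $\mu_j-h_j\to0$ in $L^n(\Omega\setminus\Omega')$; moreover $\mu_j=\rho_j*\mu^s+h_j$ on $\Omega'$ for $j$ large enough, where $\rho_j(x)=\delta_j^{-n}\rho(x/\delta_j)$ for some sequence $\delta_j\downarrow0$ and some fixed mollifier $\rho\in C_c^\infty(B_1)$. Assume that a sequence $(u_j)_j\subset\mathcal S(\phi)$ satisfies $\sup_{j\in\mathbb{N}}\mathfrak J_{\mu_j}[u_j]<+\infty$. Then $(u_j)_j$ is relatively compact in $L^1(B)$.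
   Context: $\mathcal M(\Omega)$: finite signed Radon measures on $\Omega$. $\mathcal M_{\mathcal H}(\Omega)$: those $\mu\in\mathcal M(\Omega)$ with $|\mu|(A)=0$ for every Borel $A\subset\Omega$ with $\mathcal H^{n-1}(A)=0$. For $u\in BV(\Omega)$, $u^*$ is the precise representative (approximate limit where it exists, mean of the two one-sided traces at jump points). $\mu\in\mathcal M_{\mathcal H}(\Omega)$ is admissible if $|\mu|\in BV(\Omega)^*$, i.e. there is a continuous linear functional on $BV(\Omega)$ equal to $u\mapsto\int_\Omega u^*\,d|\mu|$ on $BV(\Omega)\cap L^\infty(\Omega)$. $\mu\in\mathcal M(\Omega)$ is non-extremal if there is $L\in(0,1)$ with $|\mu(E^1\cap\Omega)|\le L\,P(E)$ for all measurable $E\subset\Omega$, where $E^1$ is the set of points of density $1$ of $E$ and $P$ is the perimeter in $\mathbb{R}^n$; a sequence is uniformly non-extremal for $j$ large if a single $L\in(0,1)$ works for all $j$ large. A mollifier is $\rho\in C_c^\infty(B_1)$ with $\rho\ge0$, $\rho(-x)=\rho(x)$, $\int\rho=1$. Fix a ball $B$ with $\Omega\Subset B$ and $\phi\in W^{1,1}(B)$; $\mathcal S(\phi)=\{u\in BV(B):u=\phi\text{ on }B\setminus\Omega\}$. For $u\in BV$, $\sqrt{1+|Du|^2}=\sqrt{1+|\nabla u|^2}\,\mathcal L^n+|D^su|$ as a measure, where $Du=\nabla u\,\mathcal L^n+D^su$ is the Lebesgue decomposition. For $u\in\mathcal S(\phi)$, $\mathfrak J_{\mu_j}[u]=\sqrt{1+|Du|^2}(B)+\int_\Omega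 u(x)\mu_j(x)\,dx$. *)

theory Defs
  imports "HOL-Analysis.Analysis"
begin

section \<open>Smooth functions and test functions\<close>

text \<open>Meant for open \<open>U\<close> only.\<close>

primrec Ck_on :: "nat \<Rightarrow> 'a::euclidean_space set \<Rightarrow> ('a \<Rightarrow> 'b::real_normed_vector) \<Rightarrow> bool" where
  "Ck_on 0 U = (\<lambda>f. continuous_on U f)"
| "Ck_on (Suc k) U = (\<lambda>f. f differentiable_on U \<and>
     (\<forall>i\<in>Basis. Ck_on k U (\<lambda>x. frechet_derivative f (at x) i)))"

definition smooth_on :: "'a::euclidean_space set \<Rightarrow> ('a \<Rightarrow> 'b::real_normed_vector) \<Rightarrow> bool" where
  "smooth_on U f \<longleftrightarrow> (\<forall>k. Ck_on k U f)"

text \<open>The space \<open>C\<^sub>c\<^sup>\<infinity>(U)\<close>; its elements are functions on the whole space, vanishing outside \<open>U\<close>.\<close>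

definition test_fun :: "'a::euclidean_space set \<Rightarrow> ('a \<Rightarrow> 'b::real_normed_vector) \<Rightarrow> bool" where
  "test_fun U \<psi> \<longleftrightarrow> smooth_on UNIV \<psi> \<and> compact (closure {x. \<psi> x \<noteq> 0}) \<and> closure {x. \<psi> x \<noteq> 0} \<subseteq> U"

definition partial_deriv :: "('a::euclidean_space \<Rightarrow> real) \<Rightarrow> 'a \<Rightarrow> 'a \<Rightarrow> real" where
  "partial_deriv f i x = frechet_derivative f (at x) i"

definition divergence :: "('a::euclidean_space \<Rightarrow> 'a) \<Rightarrow> 'a \<Rightarrow> real" where
  "divergence \<psi> x = (\<Sum>i\<in>Basis. frechet_derivative \<psi> (at x) i \<bullet> i)"

text \<open>The space \<open>C\<^sub>0(U)\<close> of continuous functions vanishing at the boundary and at infinity.\<close>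

definition C0_on :: "'a::euclidean_space set \<Rightarrow> ('a \<Rightarrow> real) \<Rightarrow> bool" where
  "C0_on U f \<longleftrightarrow> continuous_on U f \<and> (\<forall>\<epsilon>>0. compact {x\<in>U. \<epsilon> \<le> \<bar>f x\<bar>})"

definition mollifier :: "('a::euclidean_space \<Rightarrow> real) \<Rightarrow> bool" where
  "mollifier \<rho> \<longleftrightarrow> test_fun (ball 0 1) \<rho> \<and> (\<forall>x. 0 \<le> \<rho> x) \<and> (\<forall>x. \<rho> (- x) = \<rho> x) \<and>
     (LINT x|lebesgue. \<rho> x) = 1"

definition rescale :: "real \<Rightarrow> ('a::euclidean_space \<Rightarrow> real) \<Rightarrow> 'a \<Rightarrow> real" where
  "rescale \<delta> \<rho> x = \<rho> (x /\<^sub>R \<delta>) / \<delta> ^ DIM('a)"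


section \<open>Lebesgue spaces\<close>

definition in_Lp :: "ereal \<Rightarrow> 'a::euclidean_space set \<Rightarrow> ('a \<Rightarrow> real) \<Rightarrow> bool" where
  "in_Lp p U f \<longleftrightarrow> set_borel_measurable lebesgue U f \<and>
     (if p = \<infinity> then \<exists>C. AE x\<in>U in lebesgue. \<bar>f x\<bar> \<le> C
      else set_integrable lebesgue U (\<lambda>x. \<bar>f x\<bar> powr real_of_ereal p))"

text \<open>Convergence of (possibly infinite for finitely many indices) \<open>L\<^sup>p\<close> distances, \<open>p < \<infinity>\<close>.\<close>

definition tendsto_Lp :: "real \<Rightarrow> 'a::euclidean_space set \<Rightarrow> (nat \<Rightarrow> 'a \<Rightarrow> real) \<Rightarrow> ('a \<Rightarrow> real) \<Rightarrow> bool" where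
  "tendsto_Lp p U f g \<longleftrightarrow>
     (\<lambda>j. \<integral>\<^sup>+x\<in>U. ennreal (\<bar>f j x - g x\<bar> powr p) \<partial>lebesgue) \<longlonglongrightarrow> 0"

text \<open>\<open>L\<^sup>1(U)\<close> as a metric space, consisting of classes of functions that agree almost everywhere
  on \<open>U\<close>.\<close>

definition L1_class :: "'a::euclidean_space set \<Rightarrow> ('a \<Rightarrow> real) \<Rightarrow> ('a \<Rightarrow> real) set" where
  "L1_class U f = {g. set_integrable lebesgue U g \<and> (AE x\<in>U in lebesgue. g x = f x)}"

definition L1_space :: "'a::euclidean_space set \<Rightarrow> ('a \<Rightarrow> real) set set" where
  "L1_space U = L1_class U ` {f. set_integrable lebesgue U f}"

definition L1_dist :: "'a::euclidean_space set \<Rightarrow> ('a \<Rightarrow> real) set \<Rightarrow> ('a \<Rightarrow> real) set \<Rightarrow> real" where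
  "L1_dist U X Y = (LINT x:U|lebesgue. \<bar>(SOME f. f \<in> X) x - (SOME g. g \<in> Y) x\<bar>)"

abbreviation L1_topology :: "'a::euclidean_space set \<Rightarrow> ('a \<Rightarrow> real) set topology" where
  "L1_topology U \<equiv> Metric_space.mtopology (L1_space U) (L1_dist U)"

definition relatively_compactin :: "'b topology \<Rightarrow> 'b set \<Rightarrow> bool" where
  "relatively_compactin T S \<longleftrightarrow> S \<subseteq> topspace T \<and> compactin T (T closure_of S)"

lemma L1_some:
  assumes "set_integrable lebesgue U f"
  shows "set_integrable lebesgue U (SOME g. g \<in> L1_class U f)"
    and "AE x\<in>U in lebesgue. (SOME g. g \<in> L1_class U f) x = f x"
proof -
  have "f \<in> L1_class U f"
    using assms by (auto simp: L1_class_def)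
  then have "(SOME g. g \<in> L1_class U f) \<in> L1_class U f"
    by (rule someI[where P = "\<lambda>g. g \<in> L1_class U f"])
  then show "set_integrable lebesgue U (SOME g. g \<in> L1_class U f)"
    and "AE x\<in>U in lebesgue. (SOME g. g \<in> L1_class U f) x = f x"
    by (auto simp: L1_class_def)
qed

lemma L1_dist_class:
  assumes f: "set_integrable lebesgue U f" and g: "set_integrable lebesgue U g"
  shows "L1_dist U (L1_class U f) (L1_class U g) = (LINT x:U|lebesgue. \<bar>f x - g x\<bar>)"
  unfolding L1_dist_def set_lebesgue_integral_def
proof (rule integral_cong_AE)
  show "AE x in lebesgue. indicat_real U x *\<^sub>R
      \<bar>(SOME h. h \<in> L1_class U f) x - (SOME h. h \<in> L1_class U g) x\<bar> =
      indicat_real U x *\<^sub>R \<bar>f x - g x\<bar>"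
    using L1_some(2)[OF f] L1_some(2)[OF g] by eventually_elim (auto simp: indicator_def)
  show "(\<lambda>x. indicat_real U x *\<^sub>R \<bar>f x - g x\<bar>) \<in> borel_measurable lebesgue"
    using set_integrable_abs[OF set_integral_diff(1)[OF f g]]
    by (auto simp: set_integrable_def)
  show "(\<lambda>x. indicat_real U x *\<^sub>R \<bar>(SOME h. h \<in> L1_class U f) x - (SOME h. h \<in> L1_class U g) x\<bar>)
      \<in> borel_measurable lebesgue"
    using set_integrable_abs[OF set_integral_diff(1)[OF L1_some(1)[OF f] L1_some(1)[OF g]]]
    by (auto simp: set_integrable_def)
qed

lemma Metric_space_L1: "Metric_space (L1_space U) (L1_dist U)"
proof
  fix X Y :: "('a \<Rightarrow> real) set"
  show "0 \<le> L1_dist U X Y"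
    unfolding L1_dist_def set_lebesgue_integral_def
    by (rule Bochner_Integration.integral_nonneg) auto
  show "L1_dist U X Y = L1_dist U Y X"
    unfolding L1_dist_def by (simp add: abs_minus_commute)
next
  fix X Y :: "('a \<Rightarrow> real) set"
  assume "X \<in> L1_space U" "Y \<in> L1_space U"
  then obtain f g where f: "set_integrable lebesgue U f" "X = L1_class U f"
    and g: "set_integrable lebesgue U g" "Y = L1_class U g"
    by (auto simp: L1_space_def)
  have int: "set_integrable lebesgue U (\<lambda>x. \<bar>f x - g x\<bar>)"
    using f g by (intro set_integrable_abs set_integral_diff(1))
  have "L1_dist U X Y = 0 \<longleftrightarrow> (LINT x|lebesgue. indicat_real U x *\<^sub>R \<bar>f x - g x\<bar>) = 0"
    using L1_dist_class[OF f(1) g(1)] f g by (simp add: set_lebesgue_integral_def)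
  also have "\<dots> \<longleftrightarrow> (AE x in lebesgue. indicat_real U x *\<^sub>R \<bar>f x - g x\<bar> = 0)"
    using int unfolding set_integrable_def
    by (intro integral_nonneg_eq_0_iff_AE) auto
  also have "\<dots> \<longleftrightarrow> (AE x\<in>U in lebesgue. f x = g x)"
    by (intro AE_cong) (auto simp: indicator_def)
  also have "\<dots> \<longleftrightarrow> X = Y"
  proof
    assume ae: "AE x\<in>U in lebesgue. f x = g x"
    have "(AE x\<in>U in lebesgue. k x = f x) \<longleftrightarrow> (AE x\<in>U in lebesgue. k x = g x)" for k
    proof
      assume "AE x\<in>U in lebesgue. k x = f x"
      with ae show "AE x\<in>U in lebesgue. k x = g x" by eventually_elim auto
    next
      assume "AE x\<in>U in lebesgue. k x = g x"
      with ae show "AE x\<in>U in lebesgue. k x = f x" by eventually_elim auto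
    qed
    then show "X = Y" using f g by (auto simp: L1_class_def)
  next
    assume "X = Y"
    then have "f \<in> L1_class U g" using f g by (auto simp: L1_class_def)
    then show "AE x\<in>U in lebesgue. f x = g x" by (auto simp: L1_class_def)
  qed
  finally show "L1_dist U X Y = 0 \<longleftrightarrow> X = Y" .
next
  fix X Y Z :: "('a \<Rightarrow> real) set"
  assume "X \<in> L1_space U" "Y \<in> L1_space U" "Z \<in> L1_space U"
  then obtain f g h where f: "set_integrable lebesgue U f" "X = L1_class U f"
    and g: "set_integrable lebesgue U g" "Y = L1_class U g"
    and h: "set_integrable lebesgue U h" "Z = L1_class U h"
    by (auto simp: L1_space_def)
  have i: "set_integrable lebesgue U (\<lambda>x. \<bar>a x - b x\<bar>)"
    if "set_integrable lebesgue U a" "set_integrable lebesgue U b" for a b :: "'a \<Rightarrow> real"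
    using that by (intro set_integrable_abs set_integral_diff(1))
  have "(LINT x:U|lebesgue. \<bar>f x - h x\<bar>) \<le> (LINT x:U|lebesgue. \<bar>f x - g x\<bar> + \<bar>g x - h x\<bar>)"
    by (intro set_integral_mono set_integral_add(1) i f g h) auto
  also have "\<dots> = (LINT x:U|lebesgue. \<bar>f x - g x\<bar>) + (LINT x:U|lebesgue. \<bar>g x - h x\<bar>)"
    by (intro set_integral_add(2) i f g h)
  finally show "L1_dist U X Z \<le> L1_dist U X Y + L1_dist U Y Z"
    using f g h by (simp add: L1_dist_class)
qed


section \<open>Finite signed and vector-valued Radon measures\<close>

text \<open>A finite (signed or vector-valued) Radon measure on an open set \<open>U\<close> is a countably additive
  set function on the Borel subsets of \<open>U\<close>; its values on other sets are irrelevant.\<close>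

definition radon_measure :: "'a::euclidean_space set \<Rightarrow> ('a set \<Rightarrow> 'b::euclidean_space) \<Rightarrow> bool" where
  "radon_measure U \<nu> \<longleftrightarrow>
     (\<forall>A::nat \<Rightarrow> 'a set. (\<forall>i. A i \<in> sets borel \<and> A i \<subseteq> U) \<and> disjoint_family A \<longrightarrow>
        (\<lambda>i. \<nu> (A i)) sums \<nu> (\<Union>i. A i))"

definition tvar :: "('a::euclidean_space set \<Rightarrow> 'b::euclidean_space) \<Rightarrow> 'a set \<Rightarrow> ennreal" where
  "tvar \<nu> A = (SUP P\<in>{P::nat \<Rightarrow> 'a set. (\<forall>i. P i \<in> sets borel) \<and> disjoint_family P \<and> (\<Union>i. P i) = A}.
                 \<Sum>i. ennreal (norm (\<nu> (P i))))"

definition tv_measure :: "'a::euclidean_space set \<Rightarrow> ('a set \<Rightarrow> 'b::euclidean_space) \<Rightarrow> 'a measure" where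
  "tv_measure U \<nu> = measure_of U (sets (restrict_space borel U)) (tvar \<nu>)"

text \<open>Jordan decomposition: the positive part is \<open>(\<bar>\<nu>\<bar> + \<nu>) / 2\<close>, the negative part is
  the positive part of \<open>- \<nu>\<close>.\<close>

definition pos_part :: "'a::euclidean_space set \<Rightarrow> ('a set \<Rightarrow> real) \<Rightarrow> 'a measure" where
  "pos_part U \<nu> = measure_of U (sets (restrict_space borel U))
     (\<lambda>A. ennreal ((enn2real (tvar \<nu> A) + \<nu> A) / 2))"

definition signed_integral :: "'a::euclidean_space set \<Rightarrow> ('a set \<Rightarrow> real) \<Rightarrow> ('a \<Rightarrow> real) \<Rightarrow> real" where
  "signed_integral U \<nu> f =
     (LINT x|pos_part U \<nu>. f x) - (LINT x|pos_part U (\<lambda>A. - \<nu> A). f x)"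

text \<open>The measure \<open>f \<L>\<^sup>n\<close>.  If \<open>f\<close> is not integrable on \<open>U\<close>, this set function is not countably
  additive on \<open>U\<close>, so \<open>radon_measure U (dens f)\<close> fails.\<close>

definition dens :: "('a::euclidean_space \<Rightarrow> real) \<Rightarrow> 'a set \<Rightarrow> real" where
  "dens f A = (LINT x:A|lebesgue. f x)"

definition measure_support :: "'a::euclidean_space set \<Rightarrow> ('a set \<Rightarrow> real) \<Rightarrow> 'a set" where
  "measure_support U \<nu> = {x\<in>U. \<forall>r>0. 0 < tvar \<nu> (U \<inter> ball x r)}"

definition weak_star_conv ::
  "'a::euclidean_space set \<Rightarrow> (nat \<Rightarrow> 'a set \<Rightarrow> real) \<Rightarrow> ('a set \<Rightarrow> real) \<Rightarrow> bool" where
  "weak_star_conv U \<nu> \<mu> \<longleftrightarrow>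
     (\<forall>f. C0_on U f \<longrightarrow> (\<lambda>j. signed_integral U (\<nu> j) f) \<longlonglongrightarrow> signed_integral U \<mu> f)"

definition convolve_measure ::
  "'a::euclidean_space set \<Rightarrow> ('a \<Rightarrow> real) \<Rightarrow> ('a set \<Rightarrow> real) \<Rightarrow> 'a \<Rightarrow> real" where
  "convolve_measure U \<rho> \<nu> x = signed_integral U \<nu> (\<lambda>y. \<rho> (x - y))"

definition lebesgue_decomposition ::
  "'a::euclidean_space set \<Rightarrow> ('a set \<Rightarrow> 'b::euclidean_space) \<Rightarrow> ('a \<Rightarrow> 'b) \<Rightarrow> ('a set \<Rightarrow> 'b) \<Rightarrow> bool" where
  "lebesgue_decomposition U \<nu> g \<sigma> \<longleftrightarrow>
     set_integrable lebesgue U g \<and> radon_measure U \<sigma> \<and>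
     (\<exists>N\<in>sets borel. N \<subseteq> U \<and> emeasure lebesgue N = 0 \<and> tvar \<sigma> (U - N) = 0) \<and>
     (\<forall>A\<in>sets borel. A \<subseteq> U \<longrightarrow> \<nu> A = (LINT x:A|lebesgue. g x) + \<sigma> A)"

text \<open>By uniqueness of the Lebesgue decomposition, the choices below are determined almost
  everywhere on \<open>U\<close>, respectively on all Borel subsets of \<open>U\<close>.\<close>

definition ac_density ::
  "'a::euclidean_space set \<Rightarrow> ('a set \<Rightarrow> 'b::euclidean_space) \<Rightarrow> 'a \<Rightarrow> 'b" where
  "ac_density U \<nu> = (SOME g. \<exists>\<sigma>. lebesgue_decomposition U \<nu> g \<sigma>)"

definition sing_part ::
  "'a::euclidean_space set \<Rightarrow> ('a set \<Rightarrow> 'b::euclidean_space) \<Rightarrow> 'a set \<Rightarrow> 'b" where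
  "sing_part U \<nu> = (SOME \<sigma>. lebesgue_decomposition U \<nu> (ac_density U \<nu>) \<sigma>)"


section \<open>Hausdorff measure\<close>

text \<open>Integer dimension \<open>k\<close>, normalised by the volume of the \<open>k\<close>-dimensional unit ball.  Empty covering
  sets contribute \<open>0\<close> also for \<open>k = 0\<close>, where \<open>0 ^ 0 = 1\<close>; boundedness is required because
  \<^const>\<open>diameter\<close> is unspecified on unbounded sets.\<close>

definition hausdorff_pre :: "nat \<Rightarrow> real \<Rightarrow> 'a::euclidean_space set \<Rightarrow> ennreal" where
  "hausdorff_pre k \<delta> A =
     (INF C\<in>{C::nat \<Rightarrow> 'a set. A \<subseteq> (\<Union>i. C i) \<and> (\<forall>i. bounded (C i) \<and> diameter (C i) \<le> \<delta>)}.
        \<Sum>i. if C i = {} then 0 else ennreal (unit_ball_vol (real k) * (diameter (C i) / 2) ^ k))"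

definition hausdorff :: "nat \<Rightarrow> 'a::euclidean_space set \<Rightarrow> ennreal" where
  "hausdorff k A = (SUP \<delta>\<in>{0<..}. hausdorff_pre k \<delta> A)"


section \<open>Functions of bounded variation and perimeter\<close>

definition distr_grad ::
  "'a::euclidean_space set \<Rightarrow> ('a \<Rightarrow> real) \<Rightarrow> ('a set \<Rightarrow> 'a) \<Rightarrow> bool" where
  "distr_grad U u \<nu> \<longleftrightarrow> radon_measure U \<nu> \<and>
     (\<forall>\<psi>. test_fun U \<psi> \<longrightarrow> (\<forall>i\<in>Basis.
        (LINT x:U|lebesgue. u x * partial_deriv \<psi> i x) = - signed_integral U (\<lambda>A. \<nu> A \<bullet> i) \<psi>))"

definition BV :: "'a::euclidean_space set \<Rightarrow> ('a \<Rightarrow> real) set" where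
  "BV U = {u. set_integrable lebesgue U u \<and> (\<exists>\<nu>. distr_grad U u \<nu>)}"

text \<open>The measure \<open>Du\<close>, determined on all Borel subsets of \<open>U\<close>.\<close>

definition BV_grad :: "'a::euclidean_space set \<Rightarrow> ('a \<Rightarrow> real) \<Rightarrow> 'a set \<Rightarrow> 'a" where
  "BV_grad U u = (SOME \<nu>. distr_grad U u \<nu>)"

definition BV_norm :: "'a::euclidean_space set \<Rightarrow> ('a \<Rightarrow> real) \<Rightarrow> real" where
  "BV_norm U u = (LINT x:U|lebesgue. \<bar>u x\<bar>) + enn2real (tvar (BV_grad U u) U)"

definition W11 :: "'a::euclidean_space set \<Rightarrow> ('a \<Rightarrow> real) set" where
  "W11 U = {u. set_integrable lebesgue U u \<and>
     (\<exists>g::'a \<Rightarrow> 'a. set_integrable lebesgue U g \<and>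
       (\<forall>\<psi>. test_fun U \<psi> \<longrightarrow> (\<forall>i\<in>Basis.
          (LINT x:U|lebesgue. u x * partial_deriv \<psi> i x) = - (LINT x:U|lebesgue. (g x \<bullet> i) * \<psi> x))))}"

definition perimeter :: "'a::euclidean_space set \<Rightarrow> ereal" where
  "perimeter E = (SUP \<psi>\<in>{\<psi>::'a \<Rightarrow> 'a. test_fun UNIV \<psi> \<and> (\<forall>x. norm (\<psi> x) \<le> 1)}.
                    ereal (LINT x:E|lebesgue. divergence \<psi> x))"

definition density_one :: "'a::euclidean_space set \<Rightarrow> 'a set" where
  "density_one E =
     {x. ((\<lambda>r. measure lebesgue (E \<inter> ball x r) / measure lebesgue (ball x r)) \<longlongrightarrow> 1) (at_right 0)}"

definition approx_limit :: "('a::euclidean_space \<Rightarrow> real) \<Rightarrow> 'a \<Rightarrow> real \<Rightarrow> bool" where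
  "approx_limit u x z \<longleftrightarrow>
     ((\<lambda>r. (LINT y:ball x r|lebesgue. \<bar>u y - z\<bar>) / measure lebesgue (ball x r)) \<longlongrightarrow> 0) (at_right 0)"

definition half_ball :: "'a::euclidean_space \<Rightarrow> real \<Rightarrow> 'a \<Rightarrow> 'a set" where
  "half_ball x r v = {y\<in>ball x r. 0 < (y - x) \<bullet> v}"

definition one_sided_trace :: "('a::euclidean_space \<Rightarrow> real) \<Rightarrow> 'a \<Rightarrow> 'a \<Rightarrow> real \<Rightarrow> bool" where
  "one_sided_trace u x v a \<longleftrightarrow>
     ((\<lambda>r. (LINT y:half_ball x r v|lebesgue. \<bar>u y - a\<bar>) / measure lebesgue (half_ball x r v))
        \<longlongrightarrow> 0) (at_right 0)"

definition jump_triple :: "('a::euclidean_space \<Rightarrow> real) \<Rightarrow> 'a \<Rightarrow> real \<Rightarrow> real \<Rightarrow> 'a \<Rightarrow> bool" where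
  "jump_triple u x a b v \<longleftrightarrow>
     a \<noteq> b \<and> norm v = 1 \<and> one_sided_trace u x v a \<and> one_sided_trace u x (- v) b"

text \<open>For \<open>u\<close> in \<open>BV\<close> the remaining set, where the value is \<open>0\<close>, is negligible for the
  \<open>(n - 1)\<close>-dimensional Hausdorff measure.\<close>

definition precise_rep :: "('a::euclidean_space \<Rightarrow> real) \<Rightarrow> 'a \<Rightarrow> real" where
  "precise_rep u x =
     (if \<exists>z. approx_limit u x z then THE z. approx_limit u x z
      else if \<exists>a b v. jump_triple u x a b v
        then THE m. \<exists>a b v. jump_triple u x a b v \<and> m = (a + b) / 2
      else 0)"


section \<open>Admissible and non-extremal measures\<close>

definition M_H :: "'a::euclidean_space set \<Rightarrow> ('a set \<Rightarrow> real) \<Rightarrow> bool" where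
  "M_H U \<mu> \<longleftrightarrow> radon_measure U \<mu> \<and>
     (\<forall>A\<in>sets borel. A \<subseteq> U \<and> hausdorff (DIM('a) - 1) A = 0 \<longrightarrow> tvar \<mu> A = 0)"

text \<open>\<open>BV U\<close> consists of functions rather than classes; linearity and boundedness in \<open>BV_norm\<close> force
  \<open>T\<close> to respect equality almost everywhere.\<close>

definition BV_dual :: "'a::euclidean_space set \<Rightarrow> (('a \<Rightarrow> real) \<Rightarrow> real) \<Rightarrow> bool" where
  "BV_dual U T \<longleftrightarrow>
     (\<forall>u\<in>BV U. \<forall>v\<in>BV U. T (\<lambda>x. u x + v x) = T u + T v) \<and>
     (\<forall>u\<in>BV U. \<forall>c. T (\<lambda>x. c * u x) = c * T u) \<and>
     (\<exists>C. \<forall>u\<in>BV U. \<bar>T u\<bar> \<le> C * BV_norm U u)"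

definition admissible :: "'a::euclidean_space set \<Rightarrow> ('a set \<Rightarrow> real) \<Rightarrow> bool" where
  "admissible U \<mu> \<longleftrightarrow> M_H U \<mu> \<and>
     (\<exists>T. BV_dual U T \<and>
        (\<forall>u\<in>BV U. in_Lp \<infinity> U u \<longrightarrow> T u = (LINT x|tv_measure U \<mu>. precise_rep u x)))"

definition non_extremal_with :: "real \<Rightarrow> 'a::euclidean_space set \<Rightarrow> ('a set \<Rightarrow> real) \<Rightarrow> bool" where
  "non_extremal_with L U \<mu> \<longleftrightarrow>
     (\<forall>E\<in>sets lebesgue. E \<subseteq> U \<longrightarrow> ereal \<bar>\<mu> (density_one E \<inter> U)\<bar> \<le> ereal L * perimeter E)"

definition non_extremal :: "'a::euclidean_space set \<Rightarrow> ('a set \<Rightarrow> real) \<Rightarrow> bool" where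
  "non_extremal U \<mu> \<longleftrightarrow> (\<exists>L\<in>{0<..<1}. non_extremal_with L U \<mu>)"


section \<open>The Dirichlet problem\<close>

text \<open>Near each boundary point, \<open>U\<close> is the region strictly above the graph, in direction \<open>v\<close>, of a
  Lipschitz function \<open>\<gamma>\<close> on the hyperplane orthogonal to \<open>v\<close>.\<close>

definition lipschitz_boundary :: "'a::euclidean_space set \<Rightarrow> bool" where
  "lipschitz_boundary U \<longleftrightarrow>
     (\<forall>x0\<in>frontier U. \<exists>r>0. \<exists>v \<gamma> M. norm v = 1 \<and> M-lipschitz_on {y. y \<bullet> v = 0} \<gamma> \<and>
        (\<forall>x\<in>ball x0 r. x \<in> U \<longleftrightarrow> \<gamma> (x - (x \<bullet> v) *\<^sub>R v) < x \<bullet> v))"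

definition S_class ::
  "'a::euclidean_space set \<Rightarrow> 'a set \<Rightarrow> ('a \<Rightarrow> real) \<Rightarrow> ('a \<Rightarrow> real) set" where
  "S_class B \<Omega> \<phi> = {u\<in>BV B. AE x\<in>B - \<Omega> in lebesgue. u x = \<phi> x}"

text \<open>The total mass \<open>\<surd>(1 + \<bar>Du\<bar>\<^sup>2)(B)\<close>.\<close>

definition area_mass :: "'a::euclidean_space set \<Rightarrow> ('a \<Rightarrow> real) \<Rightarrow> real" where
  "area_mass B u = (LINT x:B|lebesgue. sqrt (1 + (norm (ac_density B (BV_grad B u) x))\<^sup>2)) +
     enn2real (tvar (sing_part B (BV_grad B u)) B)"

definition J_functional ::
  "'a::euclidean_space set \<Rightarrow> 'a set \<Rightarrow> ('a \<Rightarrow> real) \<Rightarrow> ('a \<Rightarrow> real) \<Rightarrow> real" where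
  "J_functional B \<Omega> m u = area_mass B u + (LINT x:\<Omega>|lebesgue. u x * m x)"

end

theory Submission imports Defs
begin

text \<open>
  Let \<open>w\<^sub>j = u\<^sub>j - \<phi>\<close>, which vanishes outside \<open>\<Omega>\<close> and satisfies \<open>\<bar>Dw\<^sub>j\<bar>(\<real>\<^sup>n) \<le> a\<^sub>j + \<bar>D\<phi>\<bar>(B)\<close>, where \<open>a\<^sub>j\<close>
  is the area term of the functional. If \<open>L < 1\<close> is a constant of uniform non-extremality, the layer cake
  and coarea formulas applied to the level sets of \<open>w\<^sub>j\<close> give \<open>\<bar>\<integral> w\<^sub>j \<mu>\<^sub>j\<bar> \<le> L (a\<^sub>j + \<bar>D\<phi>\<bar>(B))\<close>. The
  remaining \<open>\<integral>\<^sub>\<Omega> \<phi> \<mu>\<^sub>j\<close> is bounded in \<open>j\<close>: with a cutoff \<open>\<eta>\<close> that equals \<open>1\<close> on a neighbourhood \<open>\<Omega>'\<close> of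
  \<open>\<Gamma>\<close>, the function \<open>\<eta> \<phi>\<close> is treated like \<open>w\<^sub>j\<close>, while on \<open>\<Omega> - \<Omega>'\<close> the functions \<open>\<mu>\<^sub>j\<close> are bounded in
  \<open>L\<^sup>n\<close>, which pairs with \<open>BV\<close> by the isoperimetric inequality. Since \<open>L < 1\<close>, the \<open>a\<^sub>j\<close> are bounded.

  The mollifier supplied by the hypotheses also regularises all \<open>BV\<close> functions. A bound on \<open>\<bar>Dw\<^sub>j\<bar>\<close> makes translations
  equicontinuous in \<open>L\<^sup>1\<close>, so the mollified \<open>w\<^sub>j\<close> are uniformly close to \<open>w\<^sub>j\<close> and, at a fixed scale,
  equi-Lipschitz; hence the \<open>w\<^sub>j\<close> are totally bounded.
\<close>

text \<open>Non-extremality speaks only of sets contained in \<Omega>, whereas the level sets of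
  \<phi> may reach across its boundary; hence the passage to differences and the cutoff of \<phi>.
  It also bounds the modulus of the signed integral of \<mu>_j over E, not the integral of
  |\<mu>_j|, so functions must be sliced into level sets before any absolute value is taken. As
  \<mu>_j is a density, the points of density one of E may be exchanged for E.

  The area terms are absorbed with a factor L that may be close to 1. Every estimate of gradient
  mass must therefore have constant exactly 1, which rules out estimating vector measures coordinate
  by coordinate.

  BV is given by set functions that satisfy an integration by parts. Geometric information is drawn
  from C^1 functions converging in L^1 with gradients bounded in L^1; it passes to the limit by
  lower semicontinuity, and one inequality of the coarea formula suffices. A single majorant of the
  perimeters of level sets also controls their translations, and averaging over translations gives
  an isoperimetric inequality with a constant that is not sharp.\<close>

section \<open>Total variation of vector measures\<close>

text \<open>Convergence is not assumed to be absolute: if the norms sum to infinity, the bound is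
  trivial.\<close>

lemma ennreal_norm_sums_le:
  fixes f :: "nat \<Rightarrow> 'b::euclidean_space"
  assumes "f sums s"
  shows "ennreal (norm s) \<le> (\<Sum>i. ennreal (norm (f i)))"
proof (cases "(\<Sum>i. ennreal (norm (f i))) = top")
  case False
  then have sm: "summable (\<lambda>i. norm (f i))"
    by (intro summable_suminf_not_top) auto
  have "norm s \<le> (\<Sum>i. norm (f i))"
    using summable_norm[OF sm] sums_unique[OF assms] by simp
  then show ?thesis
    by (subst suminf_ennreal2[OF _ sm]) (auto intro: ennreal_leI)
qed simp

lemma radon_sums:
  assumes "radon_measure U \<nu>" "\<And>i::nat. A i \<in> sets borel" "\<And>i. A i \<subseteq> U" "disjoint_family A"
  shows "(\<lambda>i. \<nu> (A i)) sums \<nu> (\<Union>i. A i)"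
  using assms unfolding radon_measure_def by blast

lemma radon_empty:
  assumes "radon_measure U \<nu>" shows "\<nu> {} = 0"
proof -
  \<comment> \<open>The constant sequence of empty sets is disjoint, and a constant series converges
    only if its term is 0.\<close>
  have "(\<lambda>i::nat. \<nu> {}) sums \<nu> (\<Union>i::nat. {})"
    by (rule radon_sums[OF assms]) (auto simp: disjoint_family_on_def)
  then show ?thesis using sums_summable summable_const_iff by blast
qed

lemma radon_Un:
  assumes "radon_measure U \<nu>" "A \<in> sets borel" "B \<in> sets borel" "A \<subseteq> U" "B \<subseteq> U" "A \<inter> B = {}"
  shows "\<nu> (A \<union> B) = \<nu> A + \<nu> B"
proof -
  have "(\<lambda>i. \<nu> (binaryset A B i)) sums \<nu> (\<Union>i. binaryset A B i)"
    using assms by (intro radon_sums[OF assms(1)])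
      (auto simp: binaryset_def disjoint_family_on_def split: nat.splits)
  moreover have "(\<lambda>i. \<nu> (binaryset A B i)) sums (\<nu> A + \<nu> B)"
    by (rule binaryset_sums[of \<nu>]) (rule radon_empty[OF assms(1)])
  ultimately show ?thesis by (simp add: UN_binaryset_eq sums_unique2)
qed

lemma radon_Diff:
  assumes "radon_measure U \<nu>" "A \<in> sets borel" "B \<in> sets borel" "A \<subseteq> B" "B \<subseteq> U"
  shows "\<nu> (B - A) = \<nu> B - \<nu> A"
proof -
  have "A \<union> (B - A) = B" using assms(4) by blast
  moreover have "\<nu> (A \<union> (B - A)) = \<nu> A + \<nu> (B - A)"
    using assms by (intro radon_Un[OF assms(1)]) auto
  ultimately show ?thesis by simp
qed

lemma disjoint_family_onD':
  "disjoint_family_on A I \<Longrightarrow> x \<in> A i \<Longrightarrow> x \<in> A j \<Longrightarrow> i \<in> I \<Longrightarrow> j \<in> I \<Longrightarrow> i = j"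
  by (auto simp: disjoint_family_on_def)

lemma radon_finite_UN:
  assumes "radon_measure U \<nu>" "finite I" "\<And>i. i \<in> I \<Longrightarrow> A i \<in> sets borel" "\<And>i. i \<in> I \<Longrightarrow> A i \<subseteq> U"
    "disjoint_family_on A I"
  shows "\<nu> (\<Union>i\<in>I. A i) = (\<Sum>i\<in>I. \<nu> (A i))"
  using assms(2-)
proof (induction I)
  case empty then show ?case by (simp add: radon_empty[OF assms(1)])
next
  case (insert i I)
  have "\<nu> (A i \<union> (\<Union>i\<in>I. A i)) = \<nu> (A i) + \<nu> (\<Union>i\<in>I. A i)"
    using insert by (intro radon_Un[OF assms(1)]) (auto simp: disjoint_family_on_def)
  then show ?case using insert by (simp add: disjoint_family_on_def)
qed

text \<open>\<open>tvar\<close> is a supremum over countable partitions of the whole of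
  \<open>A\<close>. A finite disjoint family inside \<open>A\<close> becomes one by adding the
  remainder and infinitely many empty sets, and additional terms only raise the sum.\<close>

lemma tvar_geI:
  assumes "finite I" "\<And>i. i \<in> I \<Longrightarrow> P i \<in> sets borel" "disjoint_family_on P I" "(\<Union>i\<in>I. P i) \<subseteq> A" "A \<in> sets borel"
  shows "(\<Sum>i\<in>I. ennreal (norm (\<nu> (P i)))) \<le> tvar \<nu> A"
proof -
  obtain f where f: "bij_betw f {0..<card I} I"
    using ex_bij_betw_nat_finite[OF assms(1)] by blast
  define n where "n = card I"
  define Q where "Q i = (if i < n then P (f i) else if i = n then A - (\<Union>i\<in>I. P i) else {})" for i
  have fI: "f i \<in> I" if "i < n" for i using f that unfolding n_def bij_betw_def by auto
  have fim: "f ` {..<n} = I" using f by (auto simp: bij_betw_def n_def lessThan_atLeast0)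
  have inj: "f i = f j \<Longrightarrow> i < n \<Longrightarrow> j < n \<Longrightarrow> i = j" for i j
    using f by (auto simp: bij_betw_def n_def inj_on_def)
  have dis: "disjoint_family Q"
  proof (unfold disjoint_family_on_def, intro ballI impI equals0I)
    fix i j x assume ne: "i \<noteq> j" and x: "x \<in> Q i \<inter> Q j"
    have "i < n \<or> i = n" "j < n \<or> j = n" using x by (auto simp: Q_def split: if_splits)
    then show False
      using x ne fI inj disjoint_family_onD'[OF assms(3)] by (auto simp: Q_def)
  qed
  have un: "(\<Union>i. Q i) = A"
  proof
    show "(\<Union>i. Q i) \<subseteq> A" using assms(4) fI by (auto simp: Q_def split: if_splits)
    show "A \<subseteq> (\<Union>i. Q i)"
    proof
      fix x assume x: "x \<in> A"
      show "x \<in> (\<Union>i. Q i)"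
      proof (cases "x \<in> (\<Union>i\<in>I. P i)")
        case True
        then obtain i where "i < n" "x \<in> P (f i)" using fim by (metis UN_E imageE lessThan_iff)
        then show ?thesis by (auto simp: Q_def intro!: exI[of _ i])
      next
        case False
        then show ?thesis using x by (auto simp: Q_def intro!: exI[of _ n])
      qed
    qed
  qed
  have "(\<Sum>i\<in>I. ennreal (norm (\<nu> (P i)))) = (\<Sum>i<n. ennreal (norm (\<nu> (Q i))))"
    using f by (subst sum.reindex_bij_betw[OF f, symmetric]) (auto simp: n_def lessThan_atLeast0 Q_def intro!: sum.cong)
  also have "\<dots> \<le> (\<Sum>i. ennreal (norm (\<nu> (Q i))))"
    by (intro sum_le_suminf) auto
  also have "\<dots> \<le> tvar \<nu> A"
  proof -
    have "Q i \<in> sets borel" for i using assms(1,2,5) fI by (auto simp: Q_def intro!: sets.finite_UN)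
    then show ?thesis unfolding tvar_def using dis un by (intro SUP_upper) auto
  qed
  finally show ?thesis .
qed

text \<open>A series in \<open>ennreal\<close> is the supremum of its partial sums, so only initial
  segments of a partition have to be bounded.\<close>

lemma tvar_leI:
  assumes "\<And>P N. (\<And>i::nat. P i \<in> sets borel) \<Longrightarrow> disjoint_family P \<Longrightarrow> (\<Union>i. P i) = A \<Longrightarrow>
     (\<Sum>i<N. ennreal (norm (\<nu> (P i)))) \<le> c"
  shows "tvar \<nu> A \<le> c"
  unfolding tvar_def
  by (intro SUP_least suminf_le_const) (auto simp del: sum_ennreal intro!: assms)

lemma tvar_ge_norm:
  "A \<in> sets borel \<Longrightarrow> ennreal (norm (\<nu> A)) \<le> tvar \<nu> A"
  using tvar_geI[of "{()}" "\<lambda>_. A" A \<nu>] by (auto simp: disjoint_family_on_def)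

lemma tvar_mono:
  assumes "A \<subseteq> B" "B \<in> sets borel"
  shows "tvar \<nu> A \<le> tvar \<nu> B"
proof (rule tvar_leI)
  fix P :: "nat \<Rightarrow> 'a set" and N
  assume P: "\<And>i. P i \<in> sets borel" "disjoint_family P" "(\<Union>i. P i) = A"
  have "(\<Union>i\<in>{..<N}. P i) \<subseteq> B" using P(3) assms(1) by blast
  then show "(\<Sum>i<N. ennreal (norm (\<nu> (P i)))) \<le> tvar \<nu> B"
    using P assms by (intro tvar_geI) (auto simp: disjoint_family_on_def)
qed

lemma tvar_empty: "\<nu> {} = 0 \<Longrightarrow> tvar \<nu> {} = 0"
  using tvar_leI[of "{}" \<nu> 0] by auto

lemma tvar_uminus: "tvar (\<lambda>A. - \<nu> A) = tvar \<nu>"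
  unfolding tvar_def by simp

text \<open>A partition \<open>P\<close> of the union is refined by the sets \<open>A i\<close>:
  countable additivity writes the value on \<open>P j\<close> as a series over the pieces
  \<open>P j \<inter> A i\<close>, and exchanging the sums leaves, for every i, a partition of
  \<open>A i\<close>.\<close>

lemma tvar_UN_le:
  assumes \<nu>: "radon_measure U \<nu>" and A: "\<And>i::nat. A i \<in> sets borel" "\<And>i. A i \<subseteq> U" "disjoint_family A"
  shows "tvar \<nu> (\<Union>i. A i) \<le> (\<Sum>i. tvar \<nu> (A i))"
proof (rule tvar_leI)
  fix P :: "nat \<Rightarrow> 'a set" and N
  assume P: "\<And>i. P i \<in> sets borel" "disjoint_family P" "(\<Union>i. P i) = (\<Union>i. A i)"
  have "(\<Sum>j<N. ennreal (norm (\<nu> (P j)))) \<le> (\<Sum>j<N. \<Sum>i. ennreal (norm (\<nu> (P j \<inter> A i))))"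
  proof (intro sum_mono ennreal_norm_sums_le)
    fix j
    have "(\<lambda>i. \<nu> (P j \<inter> A i)) sums \<nu> (\<Union>i. P j \<inter> A i)"
      using A(1,2) P(1) disjoint_family_onD'[OF A(3)] by (intro radon_sums[OF \<nu>]) (auto simp: disjoint_family_on_def)
    moreover have "(\<Union>i. P j \<inter> A i) = P j" using P(3) by blast
    ultimately show "(\<lambda>i. \<nu> (P j \<inter> A i)) sums \<nu> (P j)" by simp
  qed
  also have "\<dots> = (\<Sum>i. \<Sum>j<N. ennreal (norm (\<nu> (P j \<inter> A i))))"
    by (subst suminf_sum) (auto simp del: sum_ennreal)
  also have "\<dots> \<le> (\<Sum>i. tvar \<nu> (A i))"
    using A(1,2) P(1) disjoint_family_onD'[OF P(2)] by (intro suminf_le tvar_geI) (auto simp: disjoint_family_on_def)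
  finally show "(\<Sum>j<N. ennreal (norm (\<nu> (P j)))) \<le> (\<Sum>i. tvar \<nu> (A i))" .
qed

lemma tvar_Un_le:
  assumes "radon_measure U \<nu>" "A \<in> sets borel" "B \<in> sets borel" "A \<subseteq> U" "B \<subseteq> U" "A \<inter> B = {}"
  shows "tvar \<nu> (A \<union> B) \<le> tvar \<nu> A + tvar \<nu> B"
proof -
  have "tvar \<nu> (\<Union>i. binaryset A B i) \<le> (\<Sum>i. tvar \<nu> (binaryset A B i))"
    using assms by (intro tvar_UN_le[OF assms(1)])
      (auto simp: binaryset_def disjoint_family_on_def split: nat.splits)
  also have "\<dots> = tvar \<nu> A + tvar \<nu> B"
    by (rule suminf_binaryset_eq) (rule tvar_empty, rule radon_empty[OF assms(1)])
  finally show ?thesis by (simp add: UN_binaryset_eq)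
qed

text \<open>A partition inside \<open>A\<close> and one inside \<open>B\<close> are joined to a
  single family indexed by the disjoint sum of the index sets, which avoids renumbering.\<close>

lemma tvar_Un_ge_aux:
  fixes P Q :: "nat \<Rightarrow> 'a::euclidean_space set"
  assumes P: "\<And>i. P i \<in> sets borel" "disjoint_family P" "\<And>i. P i \<subseteq> A"
    and Q: "\<And>i. Q i \<in> sets borel" "disjoint_family Q" "\<And>i. Q i \<subseteq> B"
    and AB: "A \<in> sets borel" "B \<in> sets borel" "A \<inter> B = {}"
  shows "(\<Sum>i<N. ennreal (norm (\<nu> (P i)))) + (\<Sum>i<N. ennreal (norm (\<nu> (Q i)))) \<le> tvar \<nu> (A \<union> B)"
proof -
  define R where "R k = (case k of Inl i \<Rightarrow> P i | Inr i \<Rightarrow> Q i)" for k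
  have R: "R (Inl i) = P i" "R (Inr i) = Q i" for i by (simp_all add: R_def)
  have "R k \<inter> R l = {}" if "k \<noteq> l" for k l
  proof (cases k; cases l)
    fix i j assume "k = Inl i" "l = Inl j"
    then show ?thesis using that P(2) by (simp add: R disjoint_family_on_def)
  next
    fix i j assume "k = Inr i" "l = Inr j"
    then show ?thesis using that Q(2) by (simp add: R disjoint_family_on_def)
  next
    fix i j assume "k = Inl i" "l = Inr j"
    then show ?thesis using P(3)[of i] Q(3)[of j] AB(3) by (simp add: R) blast
  next
    fix i j assume "k = Inr i" "l = Inl j"
    then show ?thesis using P(3)[of j] Q(3)[of i] AB(3) by (simp add: R) blast
  qed
  then have dis: "disjoint_family_on R ({..<N} <+> {..<N})"
    by (simp add: disjoint_family_on_def)
  have bo: "R k \<in> sets borel" for k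
    using P(1) Q(1) by (cases k) (simp_all add: R)
  have "R k \<subseteq> A \<union> B" for k
    using P(3) Q(3) by (cases k) (simp_all add: R le_supI1 le_supI2)
  then have un: "(\<Union>k\<in>{..<N} <+> {..<N}. R k) \<subseteq> A \<union> B"
    by (rule UN_least)
  have "(\<Sum>k\<in>{..<N} <+> {..<N}. ennreal (norm (\<nu> (R k)))) \<le> tvar \<nu> (A \<union> B)"
    using AB by (intro tvar_geI bo dis un) simp_all
  then show ?thesis
    by (subst (asm) sum.Plus) (simp_all only: o_def R finite_lessThan)
qed

text \<open>The partitions of \<open>A\<close> and of \<open>B\<close> vary independently, so the
  two suprema can be pulled out of the sum one after the other, provided that neither set of
  partitions is empty.\<close>

lemma tvar_Un_ge:
  fixes A B :: "'a::euclidean_space set"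
  assumes AB: "A \<in> sets borel" "B \<in> sets borel" "A \<inter> B = {}"
  shows "tvar \<nu> A + tvar \<nu> B \<le> tvar \<nu> (A \<union> B)"
proof -
  define S where "S A = {P::nat \<Rightarrow> 'a set. (\<forall>i. P i \<in> sets borel) \<and> disjoint_family P \<and> (\<Union>i. P i) = A}" for A
  define f where "f P = (\<Sum>i. ennreal (norm (\<nu> (P i))))" for P :: "nat \<Rightarrow> 'a set"
  have tv: "tvar \<nu> A = (SUP P\<in>S A. f P)" for A
    by (simp only: tvar_def S_def f_def)
  have ne: "S A \<noteq> {}" if "A \<in> sets borel" for A
  proof -
    have "binaryset A {} i \<in> sets borel" for i
      using that by (simp add: binaryset_def)
    moreover have "disjoint_family (binaryset A {})"
      by (simp add: binaryset_def disjoint_family_on_def)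
    ultimately have "binaryset A {} \<in> S A"
      by (simp add: S_def UN_binaryset_eq)
    then show ?thesis by blast
  qed
  have le: "f P + f Q \<le> tvar \<nu> (A \<union> B)" if "P \<in> S A" "Q \<in> S B" for P Q
  proof -
    have P: "\<And>i. P i \<in> sets borel" "disjoint_family P" "\<And>i. P i \<subseteq> A"
      and Q: "\<And>i. Q i \<in> sets borel" "disjoint_family Q" "\<And>i. Q i \<subseteq> B"
      using that unfolding S_def by blast+
    have "(\<lambda>N. (\<Sum>i<N. ennreal (norm (\<nu> (P i)))) + (\<Sum>i<N. ennreal (norm (\<nu> (Q i))))) \<longlonglongrightarrow> f P + f Q"
      unfolding f_def by (intro tendsto_add summable_LIMSEQ summableI)
    then show ?thesis
      by (rule LIMSEQ_le_const2) (intro exI allI impI tvar_Un_ge_aux P Q AB)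
  qed
  have "tvar \<nu> A + tvar \<nu> B = (SUP P\<in>S A. f P + tvar \<nu> B)"
    using ennreal_SUP_add_left[OF ne[OF AB(1)], of f "tvar \<nu> B"] by (simp only: tv[of A])
  also have "\<dots> \<le> tvar \<nu> (A \<union> B)"
  proof (rule SUP_least)
    fix P assume P: "P \<in> S A"
    have "f P + tvar \<nu> B = (SUP Q\<in>S B. f P + f Q)"
      using ennreal_SUP_add_right[OF ne[OF AB(2)], of "f P" f] by (simp only: tv[of B])
    also have "\<dots> \<le> tvar \<nu> (A \<union> B)" by (intro SUP_least le[OF P])
    finally show "f P + tvar \<nu> B \<le> tvar \<nu> (A \<union> B)" .
  qed
  finally show ?thesis .
qed

lemma tvar_UN:
  assumes \<nu>: "radon_measure U \<nu>" and A: "\<And>i::nat. A i \<in> sets borel" "\<And>i. A i \<subseteq> U" "disjoint_family A"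
  shows "(\<Sum>i. tvar \<nu> (A i)) = tvar \<nu> (\<Union>i. A i)"
proof (rule antisym)
  have 1: "(\<Sum>i<n. tvar \<nu> (A i)) \<le> tvar \<nu> (\<Union>i<n. A i)" for n
  proof (induction n)
    case (Suc n)
    have "A i \<inter> A n = {}" if "i < n" for i
      using A(3) that by (simp add: disjoint_family_on_def)
    then have "(\<Union>i<n. A i) \<inter> A n = {}" by blast
    then have "tvar \<nu> (\<Union>i<n. A i) + tvar \<nu> (A n) \<le> tvar \<nu> ((\<Union>i<n. A i) \<union> A n)"
      using A(1) by (intro tvar_Un_ge sets.finite_UN) simp_all
    also have "(\<Union>i<n. A i) \<union> A n = (\<Union>i<Suc n. A i)"
      by (simp add: lessThan_Suc Un_commute)
    finally have "tvar \<nu> (\<Union>i<n. A i) + tvar \<nu> (A n) \<le> tvar \<nu> (\<Union>i<Suc n. A i)" .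
    then show ?case
      unfolding sum.lessThan_Suc by (rule order_trans[OF add_right_mono[OF Suc]])
  qed simp
  have 2: "tvar \<nu> (\<Union>i<n. A i) \<le> tvar \<nu> (\<Union>i. A i)" for n :: nat
    using A(1) by (intro tvar_mono UN_mono) simp_all
  show "(\<Sum>i. tvar \<nu> (A i)) \<le> tvar \<nu> (\<Union>i. A i)"
    by (intro suminf_le_const summableI order_trans[OF 1 2])
qed (rule tvar_UN_le[OF assms])

text \<open>From a set of infinite variation one can split off a piece whose value has modulus at
  least 1 and keep a set of infinite variation. Repeating this yields disjoint pieces whose values
  cannot form a convergent series.\<close>

lemma tvar_finite_real:
  fixes \<nu> :: "'a::euclidean_space set \<Rightarrow> real"
  assumes \<nu>: "radon_measure U \<nu>" and U: "U \<in> sets borel"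
  shows "tvar \<nu> U < top"
proof (rule ccontr)
  assume "\<not> tvar \<nu> U < top"
  then have inf: "tvar \<nu> U = top" by (simp add: less_top[symmetric])
  define good where "good E \<longleftrightarrow> E \<in> sets borel \<and> E \<subseteq> U \<and> tvar \<nu> E = top" for E
  have step: "\<exists>E'. good E' \<and> E' \<subseteq> E \<and> \<bar>\<nu> (E - E')\<bar> \<ge> 1" if E: "good E" for E
  proof -
    \<comment> \<open>Otherwise all values on subsets of \<open>E\<close> have modulus at most
      |\<nu> E| + 1. Collecting the pieces of a partition with nonnegative value and those with
      negative value then bounds the variation of \<open>E\<close> by twice this number.\<close>
    have "\<exists>A. A \<in> sets borel \<and> A \<subseteq> E \<and> \<bar>\<nu> A\<bar> \<ge> \<bar>\<nu> E\<bar> + 1"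
    proof (rule ccontr)
      assume "\<not> ?thesis"
      then have small: "\<bar>\<nu> A\<bar> \<le> \<bar>\<nu> E\<bar> + 1" if "A \<in> sets borel" "A \<subseteq> E" for A
        using that by (meson linorder_le_cases)
      have "tvar \<nu> E \<le> ennreal (2 * (\<bar>\<nu> E\<bar> + 1))"
      proof (rule tvar_leI)
        fix P :: "nat \<Rightarrow> 'a set" and N
        assume P: "\<And>i. P i \<in> sets borel" "disjoint_family P" "(\<Union>i. P i) = E"
        let ?p = "{i\<in>{..<N}. \<nu> (P i) \<ge> 0}" and ?n = "{i\<in>{..<N}. \<not> \<nu> (P i) \<ge> 0}"
        have eq: "\<nu> (\<Union>i\<in>I. P i) = (\<Sum>i\<in>I. \<nu> (P i))" if "finite I" for I
          using that P(1,2) P(3)[symmetric] E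
          by (intro radon_finite_UN[OF \<nu>]) (force simp: good_def disjoint_family_on_def)+
        have "(\<Sum>i<N. norm (\<nu> (P i))) = (\<Sum>i\<in>?p. norm (\<nu> (P i))) + (\<Sum>i\<in>?n. norm (\<nu> (P i)))"
          by (subst sum.union_disjoint[symmetric]) (auto intro!: sum.cong)
        also have "\<dots> = \<nu> (\<Union>i\<in>?p. P i) - \<nu> (\<Union>i\<in>?n. P i)"
          by (subst (1 2) eq) (auto simp: sum_negf[symmetric] diff_conv_add_uminus simp del: add_uminus_conv_diff intro!: arg_cong2[where f="(+)"] sum.cong)
        also have "\<dots> \<le> 2 * (\<bar>\<nu> E\<bar> + 1)"
          using small[of "\<Union>i\<in>?p. P i"] small[of "\<Union>i\<in>?n. P i"] P by fastforce
        finally have "ennreal (\<Sum>i<N. norm (\<nu> (P i))) \<le> ennreal (2 * (\<bar>\<nu> E\<bar> + 1))"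
          by (rule ennreal_leI)
        then show "(\<Sum>i<N. ennreal (norm (\<nu> (P i)))) \<le> ennreal (2 * (\<bar>\<nu> E\<bar> + 1))"
          by (subst sum_ennreal) (rule norm_ge_zero)
      qed
      then show False using E by (auto simp: good_def top_unique)
    qed
    then obtain A where A: "A \<in> sets borel" "A \<subseteq> E" "\<bar>\<nu> A\<bar> \<ge> \<bar>\<nu> E\<bar> + 1" by blast
    \<comment> \<open>As |\<nu> A| exceeds |\<nu> E| by at least 1, both \<open>A\<close> and
      \<open>E - A\<close> have a value of modulus at least 1. One of them still has infinite
      variation and is kept; the other one is split off.\<close>
    have d: "\<nu> (E - A) = \<nu> E - \<nu> A" using A E by (intro radon_Diff[OF \<nu>]) (auto simp: good_def)
    have "tvar \<nu> (A \<union> (E - A)) \<le> tvar \<nu> A + tvar \<nu> (E - A)"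
      using A E by (intro tvar_Un_le[OF \<nu>]) (auto simp: good_def)
    moreover have "A \<union> (E - A) = E" using A by auto
    ultimately have "tvar \<nu> A = top \<or> tvar \<nu> (E - A) = top"
      using E by (simp add: good_def top_unique)
    then show ?thesis
    proof
      assume "tvar \<nu> A = top"
      then show ?thesis using A E d by (intro exI[of _ A]) (auto simp: good_def)
    next
      assume *: "tvar \<nu> (E - A) = top"
      have "E - (E - A) = A" using A by auto
      then show ?thesis using A E * by (intro exI[of _ "E - A"]) (auto simp: good_def)
    qed
  qed
  have "\<exists>f. \<forall>n. good (f n) \<and> (f (Suc n) \<subseteq> f n \<and> \<bar>\<nu> (f n - f (Suc n))\<bar> \<ge> 1)"
    by (rule dependent_nat_choice) (use inf U step in \<open>auto simp: good_def\<close>)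
  then obtain f where f: "\<And>n. good (f n)" "\<And>n. f (Suc n) \<subseteq> f n" "\<And>n. \<bar>\<nu> (f n - f (Suc n))\<bar> \<ge> 1"
    by blast
  have anti: "f n \<subseteq> f m" if "m \<le> n" for m n
    using f(2) that by (rule lift_Suc_antimono_le)
  have "disjoint_family (\<lambda>n. f n - f (Suc n))"
    unfolding disjoint_family_on_def
  proof (intro ballI impI)
    fix m n :: nat assume "m \<noteq> n"
    then have "Suc m \<le> n \<or> Suc n \<le> m" by auto
    then show "(f m - f (Suc m)) \<inter> (f n - f (Suc n)) = {}" using anti by blast
  qed
  \<comment> \<open>The pieces split off are disjoint, so their values would have to tend to
    0.\<close>
  then have "(\<lambda>n. \<nu> (f n - f (Suc n))) sums \<nu> (\<Union>n. f n - f (Suc n))"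
    using f by (intro radon_sums[OF \<nu>]) (auto simp: good_def)
  then have "(\<lambda>n. \<nu> (f n - f (Suc n))) \<longlonglongrightarrow> 0" by (blast dest: sums_summable summable_LIMSEQ_zero)
  then have "eventually (\<lambda>n. \<bar>\<nu> (f n - f (Suc n))\<bar> < 1) sequentially"
    by (auto dest!: tendstoD[where e=1])
  then show False using f(3) by (auto simp: eventually_sequentially) (meson le_refl not_le)
qed

lemma radon_inner:
  assumes "radon_measure U \<nu>" shows "radon_measure U (\<lambda>A. \<nu> A \<bullet> i)"
  unfolding radon_measure_def
proof (intro allI impI)
  fix A :: "nat \<Rightarrow> 'a set"
  assume "(\<forall>i. A i \<in> sets borel \<and> A i \<subseteq> U) \<and> disjoint_family A"
  then have "(\<lambda>i. \<nu> (A i)) sums \<nu> (\<Union>i. A i)"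
    using assms by (intro radon_sums) auto
  then show "(\<lambda>n. \<nu> (A n) \<bullet> i) sums (\<nu> (\<Union>n. A n) \<bullet> i)"
    by (rule bounded_linear.sums[OF bounded_linear_inner_left])
qed

text \<open>The norm is at most the sum of the moduli of the coordinates, which reduces the claim to
  scalar measures.\<close>

lemma tvar_finite:
  fixes \<nu> :: "'a::euclidean_space set \<Rightarrow> 'b::euclidean_space"
  assumes \<nu>: "radon_measure U \<nu>" and U: "U \<in> sets borel"
  shows "tvar \<nu> U < top"
proof -
  have "tvar \<nu> U \<le> (\<Sum>b\<in>Basis. tvar (\<lambda>A. \<nu> A \<bullet> b) U)"
  proof (rule tvar_leI)
    fix P :: "nat \<Rightarrow> 'a set" and N
    assume P: "\<And>i. P i \<in> sets borel" "disjoint_family P" "(\<Union>i. P i) = U"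
    have "(\<Sum>i<N. ennreal (norm (\<nu> (P i)))) \<le> (\<Sum>i<N. \<Sum>b\<in>Basis. ennreal (norm (\<nu> (P i) \<bullet> b)))"
    proof (rule sum_mono)
      fix i
      show "ennreal (norm (\<nu> (P i))) \<le> (\<Sum>b\<in>Basis. ennreal (norm (\<nu> (P i) \<bullet> b)))"
        using norm_le_l1[of "\<nu> (P i)"] by (subst sum_ennreal) (auto intro: ennreal_leI)
    qed
    also have "\<dots> = (\<Sum>b\<in>Basis. \<Sum>i<N. ennreal (norm (\<nu> (P i) \<bullet> b)))"
      by (rule sum.swap)
    also have "\<dots> \<le> (\<Sum>b\<in>Basis. tvar (\<lambda>A. \<nu> A \<bullet> b) U)"
    proof (rule sum_mono)
      fix b :: 'b
      have "(\<Union>i\<in>{..<N}. P i) \<subseteq> U" using P(3) by blast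
      moreover have "disjoint_family_on P {..<N}" using P(2) by (simp add: disjoint_family_on_def)
      ultimately show "(\<Sum>i<N. ennreal (norm (\<nu> (P i) \<bullet> b))) \<le> tvar (\<lambda>A. \<nu> A \<bullet> b) U"
        using P(1) U by (intro tvar_geI) auto
    qed
    finally show "(\<Sum>i<N. ennreal (norm (\<nu> (P i)))) \<le> (\<Sum>b\<in>Basis. tvar (\<lambda>A. \<nu> A \<bullet> b) U)" .
  qed
  also have "\<dots> < top"
    unfolding ennreal_sum_less_top[OF finite_Basis]
    by (intro ballI tvar_finite_real[OF _ U] radon_inner[OF \<nu>])
  finally show ?thesis .
qed

section \<open>Total variation and Jordan parts as measure spaces\<close>

lemma space_tv [simp]: "space (tv_measure U \<nu>) = U"
  and space_pos_part [simp]: "space (pos_part U \<nu>') = U"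
  and sets_tv: "sets (tv_measure U \<nu>) = sets (restrict_space borel U)"
  and sets_pos_part: "sets (pos_part U \<nu>') = sets (restrict_space borel U)"
proof -
  have sub: "sets (restrict_space borel U) \<subseteq> Pow U" by (auto simp: sets_restrict_space)
  have "sigma_sets U (sets (restrict_space borel U)) = sets (restrict_space borel U)"
    using sets.sigma_sets_eq[of "restrict_space borel U"] by (simp add: space_restrict_space)
  then show "sets (tv_measure U \<nu>) = sets (restrict_space borel U)"
    "sets (pos_part U \<nu>') = sets (restrict_space borel U)"
    using sub by (auto simp: tv_measure_def pos_part_def)
  show "space (tv_measure U \<nu>) = U" "space (pos_part U \<nu>') = U"
    using sub by (auto simp: tv_measure_def pos_part_def)
qed

lemma sets_restrict_borel:
  "U \<in> sets borel \<Longrightarrow> A \<in> sets (restrict_space borel U) \<longleftrightarrow> A \<in> sets borel \<and> A \<subseteq> U"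
  by (subst sets_restrict_space_iff) auto

text \<open>\<open>measure_of\<close> reproduces the given set function only once countable
  additivity is established; \<open>tvar_UN\<close> supplies it.\<close>

lemma emeasure_tv:
  assumes \<nu>: "radon_measure U \<nu>" and U: "U \<in> sets borel" and A: "A \<in> sets borel" "A \<subseteq> U"
  shows "emeasure (tv_measure U \<nu>) A = tvar \<nu> A"
proof (rule emeasure_measure_of[OF tv_measure_def])
  show "sets (restrict_space borel U) \<subseteq> Pow U" by (auto simp: sets_restrict_space)
  show "A \<in> sets (tv_measure U \<nu>)" using A U by (simp add: sets_tv sets_restrict_borel)
  show "positive (sets (tv_measure U \<nu>)) (tvar \<nu>)"
    by (simp add: positive_def tvar_empty radon_empty[OF \<nu>])
  show "countably_additive (sets (tv_measure U \<nu>)) (tvar \<nu>)"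
    unfolding countably_additive_def sets_tv
    using U by (auto simp: sets_restrict_borel image_subset_iff intro!: tvar_UN[OF \<nu>])
qed

lemma finite_tv:
  assumes "radon_measure U \<nu>" "U \<in> sets borel"
  shows "finite_measure (tv_measure U \<nu>)"
  using tvar_finite[OF assms] by (intro finite_measureI) (simp add: emeasure_tv[OF assms] assms(2) less_top)

lemma measure_tv:
  assumes "radon_measure U \<nu>" "U \<in> sets borel" "A \<in> sets borel" "A \<subseteq> U"
  shows "measure (tv_measure U \<nu>) A = enn2real (tvar \<nu> A)"
  using emeasure_tv[OF assms] by (simp add: measure_def)

lemma norm_le_measure_tv:
  assumes "radon_measure U \<nu>" "U \<in> sets borel" "A \<in> sets borel" "A \<subseteq> U"
  shows "norm (\<nu> A) \<le> measure (tv_measure U \<nu>) A"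
proof -
  interpret finite_measure "tv_measure U \<nu>" using finite_tv assms by blast
  have "ennreal (norm (\<nu> A)) \<le> ennreal (measure (tv_measure U \<nu>) A)"
    using tvar_ge_norm[OF assms(3), of \<nu>] emeasure_eq_measure emeasure_tv[OF assms] by metis
  then show ?thesis by simp
qed

text \<open>The prescribed value is nonnegative because |\<nu> A| is at most the total variation of
  \<open>A\<close>, and \<open>enn2real\<close> loses nothing because that variation is
  finite.\<close>

lemma measure_pos_part:
  assumes \<nu>: "radon_measure U \<nu>" and U: "U \<in> sets borel" and A: "A \<in> sets borel" "A \<subseteq> U"
  shows "emeasure (pos_part U \<nu>) A = ennreal ((enn2real (tvar \<nu> A) + \<nu> A) / 2)"
    and "measure (pos_part U \<nu>) A = (enn2real (tvar \<nu> A) + \<nu> A) / 2"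
proof -
  interpret T: finite_measure "tv_measure U \<nu>" using finite_tv assms by blast
  have nn: "0 \<le> enn2real (tvar \<nu> A) + \<nu> A" if "A \<in> sets borel" "A \<subseteq> U" for A
    using norm_le_measure_tv[OF \<nu> U that] by (simp add: measure_tv[OF \<nu> U that])
  show *: "emeasure (pos_part U \<nu>) A = ennreal ((enn2real (tvar \<nu> A) + \<nu> A) / 2)"
  proof (rule emeasure_measure_of[OF pos_part_def])
    show "sets (restrict_space borel U) \<subseteq> Pow U" by (auto simp: sets_restrict_space)
    show "A \<in> sets (pos_part U \<nu>)" using A U by (simp add: sets_pos_part sets_restrict_borel)
    show "positive (sets (pos_part U \<nu>)) (\<lambda>A. ennreal ((enn2real (tvar \<nu> A) + \<nu> A) / 2))"
      by (simp add: positive_def tvar_empty radon_empty[OF \<nu>])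
    show "countably_additive (sets (pos_part U \<nu>)) (\<lambda>A. ennreal ((enn2real (tvar \<nu> A) + \<nu> A) / 2))"
      unfolding countably_additive_def
    proof (intro allI impI)
      fix A :: "nat \<Rightarrow> 'a set"
      assume "range A \<subseteq> sets (pos_part U \<nu>)" and d: "disjoint_family A"
      then have A: "\<And>i. A i \<in> sets borel" "\<And>i. A i \<subseteq> U"
        using U by (auto simp: sets_pos_part sets_restrict_borel image_subset_iff)
      have 1: "(\<lambda>i. measure (tv_measure U \<nu>) (A i)) sums measure (tv_measure U \<nu>) (\<Union>i. A i)"
        using A U d by (intro T.finite_measure_UNION) (auto simp: sets_tv sets_restrict_borel)
      have un: "(\<Union>i. A i) \<in> sets borel" "(\<Union>i. A i) \<subseteq> U" using A by auto
      have "(\<lambda>i. (enn2real (tvar \<nu> (A i)) + \<nu> (A i)) / 2) sums ((enn2real (tvar \<nu> (\<Union>i. A i)) + \<nu> (\<Union>i. A i)) / 2)"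
        using 1 radon_sums[OF \<nu> A d] un A U by (intro sums_divide sums_add) (simp_all add: measure_tv[OF \<nu> U])
      then show "(\<Sum>i. ennreal ((enn2real (tvar \<nu> (A i)) + \<nu> (A i)) / 2)) = ennreal ((enn2real (tvar \<nu> (\<Union>i. A i)) + \<nu> (\<Union>i. A i)) / 2)"
        using nn A by (intro suminf_ennreal_eq) auto
    qed
  qed
  show "measure (pos_part U \<nu>) A = (enn2real (tvar \<nu> A) + \<nu> A) / 2"
    using nn[OF A] * by (simp add: measure_def)
qed

lemma finite_pos_part:
  assumes "radon_measure U \<nu>" "U \<in> sets borel"
  shows "finite_measure (pos_part U \<nu>)"
  using measure_pos_part(1)[OF assms] assms by (intro finite_measureI) simp

lemma radon_measureI:
  assumes "\<And>A::nat \<Rightarrow> 'a::euclidean_space set. (\<And>i. A i \<in> sets borel) \<Longrightarrow> (\<And>i. A i \<subseteq> U) \<Longrightarrow> disjoint_family A \<Longrightarrow>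
    (\<lambda>i. \<nu> (A i)) sums \<nu> (\<Union>i. A i)"
  shows "radon_measure U \<nu>"
  unfolding radon_measure_def using assms by simp

lemma radon_uminus: "radon_measure U \<nu> \<Longrightarrow> radon_measure U (\<lambda>A. - \<nu> A)"
  by (rule radon_measureI) (intro sums_minus radon_sums)

lemma radon_diff: "radon_measure U \<nu> \<Longrightarrow> radon_measure U \<nu>' \<Longrightarrow> radon_measure U (\<lambda>A. \<nu> A - \<nu>' A)"
  by (rule radon_measureI) (intro sums_diff radon_sums)

text \<open>\<nu> and its negative have the same total variation, which cancels. The identity
  carries statements about the two Jordan parts back to \<nu>.\<close>

lemma pos_part_diff:
  assumes \<nu>: "radon_measure U \<nu>" and U: "U \<in> sets borel" and A: "A \<in> sets borel" "A \<subseteq> U"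
  shows "measure (pos_part U \<nu>) A - measure (pos_part U (\<lambda>A. - \<nu> A)) A = \<nu> A"
  using measure_pos_part(2)[OF assms] measure_pos_part(2)[OF radon_uminus[OF \<nu>] U A]
  by (simp add: tvar_uminus field_simps)


section \<open>Integrals as limits of sums over slices of the range\<close>

lemma step_sum:
  fixes \<psi> :: "'a \<Rightarrow> real"
  assumes bd: "\<bar>\<psi> x\<bar> \<le> C" and x: "x \<in> U" and K: "K = \<lceil>real (Suc n) * C\<rceil> + 1"
  shows "(\<Sum>k\<in>{-K..K}. of_int k / real (Suc n) * indicat_real {x\<in>U. \<lfloor>real (Suc n) * \<psi> x\<rfloor> = k} x)
    = of_int \<lfloor>real (Suc n) * \<psi> x\<rfloor> / real (Suc n)"
proof -
  have "\<bar>real (Suc n) * \<psi> x\<bar> \<le> real (Suc n) * C"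
    using bd by (simp add: abs_mult)
  \<comment> \<open>The range of k was fixed in advance from the bound \<open>C\<close>, with one
    unit of slack for rounding, so that it contains the floor.\<close>
  then have in_K: "\<lfloor>real (Suc n) * \<psi> x\<rfloor> \<in> {-K..K}"
    unfolding K atLeastAtMost_iff by linarith
  have "(\<Sum>k\<in>{-K..K}. of_int k / real (Suc n) * indicat_real {x\<in>U. \<lfloor>real (Suc n) * \<psi> x\<rfloor> = k} x)
      = (\<Sum>k\<in>{-K..K}. if k = \<lfloor>real (Suc n) * \<psi> x\<rfloor> then of_int k / real (Suc n) else 0)"
    using x by (intro sum.cong) (auto simp: indicator_def)
  also have "\<dots> = of_int \<lfloor>real (Suc n) * \<psi> x\<rfloor> / real (Suc n)"
    using in_K by (subst sum.delta) simp_all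
  finally show ?thesis .
qed

lemma step_diff_le: "\<bar>y - of_int \<lfloor>real (Suc n) * y\<rfloor> / real (Suc n)\<bar> \<le> 1 / real (Suc n)"
proof -
  have "y - of_int \<lfloor>real (Suc n) * y\<rfloor> / real (Suc n) = (real (Suc n) * y - of_int \<lfloor>real (Suc n) * y\<rfloor>) / real (Suc n)"
    by (simp add: field_simps)
  moreover have "\<bar>real (Suc n) * y - of_int \<lfloor>real (Suc n) * y\<rfloor>\<bar> \<le> 1" by linarith
  ultimately show ?thesis
    by (simp add: divide_right_mono)
qed

lemma finite_integral_approx:
  fixes \<psi> :: "'a::euclidean_space \<Rightarrow> real"
  assumes M: "finite_measure M" and sp: "space M = U" and \<psi>: "\<psi> \<in> borel_measurable M"
    and bd: "\<And>x. x \<in> U \<Longrightarrow> \<bar>\<psi> x\<bar> \<le> C"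
    and K: "K = \<lceil>real (Suc n) * C\<rceil> + 1"
  shows "\<bar>(LINT x|M. \<psi> x) - (\<Sum>k\<in>{-K..K}. of_int k / real (Suc n) * measure M {x\<in>U. \<lfloor>real (Suc n) * \<psi> x\<rfloor> = k})\<bar>
     \<le> measure M U / real (Suc n)"
proof -
  interpret finite_measure M by fact
  define A where "A k = {x\<in>U. \<lfloor>real (Suc n) * \<psi> x\<rfloor> = k}" for k
  have A: "A k \<in> sets M" for k
    unfolding A_def sp[symmetric] using \<psi> by measurable
  define s where "s x = (\<Sum>k\<in>{-K..K}. of_int k / real (Suc n) * indicat_real (A k) x)" for x
  have s: "s x = of_int \<lfloor>real (Suc n) * \<psi> x\<rfloor> / real (Suc n)" if x: "x \<in> U" for x
    unfolding s_def A_def by (rule step_sum[where \<psi>=\<psi>, OF bd[OF x] x K])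
  have int_s: "integrable M s"
    unfolding s_def using A by (intro Bochner_Integration.integrable_sum integrable_mult_right) (simp add: integrable_indicator_iff emeasure_eq_measure)
  have int_psi: "integrable M \<psi>"
    using bd sp by (intro integrable_const_bound[where B=C] \<psi>) auto
  have "(LINT x|M. s x) = (\<Sum>k\<in>{-K..K}. of_int k / real (Suc n) * measure M (A k))"
    unfolding s_def using A
    by (subst Bochner_Integration.integral_sum) (auto simp: integrable_indicator_iff emeasure_eq_measure sets.Int_space_eq2)
  then have "\<bar>(LINT x|M. \<psi> x) - (\<Sum>k\<in>{-K..K}. of_int k / real (Suc n) * measure M (A k))\<bar> = \<bar>LINT x|M. \<psi> x - s x\<bar>"
    using int_s int_psi by simp
  also have "\<dots> \<le> (LINT x|M. \<bar>\<psi> x - s x\<bar>)"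
    by (rule integral_abs_bound)
  also have "\<dots> \<le> (LINT x|M. 1 / real (Suc n))"
  proof (rule integral_mono)
    fix x assume "x \<in> space M"
    then have "s x = of_int \<lfloor>real (Suc n) * \<psi> x\<rfloor> / real (Suc n)" using s sp by simp
    then show "\<bar>\<psi> x - s x\<bar> \<le> 1 / real (Suc n)"
      using step_diff_le[of "\<psi> x" n] by simp
  qed (use int_s int_psi in auto)
  also have "\<dots> = measure M U / real (Suc n)"
    using sp by simp
  finally show ?thesis unfolding A_def .
qed

section \<open>Integration against signed and vector measures\<close>

text \<open>A sum over slices of the range of \<psi>, of width 1 / (n + 1). It is linear in \<nu>
  and makes sense for any set function, so measures with unrelated Jordan parts can be compared
  through it. \<open>C\<close> only fixes the finite range of slices, and \<open>Suc n\<close> keeps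
  the denominator positive.\<close>

definition riemann_sum :: "'a::euclidean_space set \<Rightarrow> real \<Rightarrow> ('a set \<Rightarrow> real) \<Rightarrow> ('a \<Rightarrow> real) \<Rightarrow> nat \<Rightarrow> real" where
  "riemann_sum U C \<nu> \<psi> n = (\<Sum>k\<in>{- (\<lceil>real (Suc n) * C\<rceil> + 1)..\<lceil>real (Suc n) * C\<rceil> + 1}.
     of_int k / real (Suc n) * \<nu> {x\<in>U. \<lfloor>real (Suc n) * \<psi> x\<rfloor> = k})"

lemma riemann_sum_tendsto_measure:
  fixes \<psi> :: "'a::euclidean_space \<Rightarrow> real"
  assumes "finite_measure M" "space M = U" "\<psi> \<in> borel_measurable M" "\<And>x. x \<in> U \<Longrightarrow> \<bar>\<psi> x\<bar> \<le> C"
  shows "riemann_sum U C (measure M) \<psi> \<longlonglongrightarrow> (LINT x|M. \<psi> x)"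
proof -
  have "(\<lambda>n. riemann_sum U C (measure M) \<psi> n - (LINT x|M. \<psi> x)) \<longlonglongrightarrow> 0"
  proof (rule Lim_null_comparison)
    show "\<forall>\<^sub>F n in sequentially. norm (riemann_sum U C (measure M) \<psi> n - (LINT x|M. \<psi> x)) \<le> measure M U / real (Suc n)"
      using finite_integral_approx[OF assms refl]
      by (auto simp: riemann_sum_def abs_minus_commute)
    show "(\<lambda>n. measure M U / real (Suc n)) \<longlonglongrightarrow> 0"
      by (rule LIMSEQ_Suc[OF lim_const_over_n])
  qed
  then show ?thesis by (simp add: LIM_zero_iff)
qed

lemma floor_slice_borel:
  fixes \<psi> :: "'a::euclidean_space \<Rightarrow> real"
  assumes "U \<in> sets borel" "\<psi> \<in> borel_measurable borel"
  shows "{x\<in>U. \<lfloor>c * \<psi> x\<rfloor> = k} \<in> sets borel"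
proof -
  have "{x\<in>space borel. \<lfloor>c * \<psi> x\<rfloor> = k} \<in> sets borel"
    using assms(2) by measurable
  then have "U \<inter> {x. \<lfloor>c * \<psi> x\<rfloor> = k} \<in> sets borel"
    using assms(1) by simp
  also have "U \<inter> {x. \<lfloor>c * \<psi> x\<rfloor> = k} = {x\<in>U. \<lfloor>c * \<psi> x\<rfloor> = k}" by auto
  finally show ?thesis .
qed

lemma measurable_pos_part:
  "\<psi> \<in> borel_measurable borel \<Longrightarrow> \<psi> \<in> borel_measurable (pos_part U \<nu>)"
  "\<psi> \<in> borel_measurable borel \<Longrightarrow> \<psi> \<in> borel_measurable (tv_measure U \<nu>')"
  by (simp_all add: measurable_cong_sets[OF sets_pos_part refl] measurable_cong_sets[OF sets_tv refl] measurable_restrict_space1)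

text \<open>On each slice the Jordan parts differ by exactly the value of \<nu>, so the sums for the
  two parts subtract to the sum for \<nu>. The signed integral is thereby described by an expression
  linear in \<nu>.\<close>

lemma signed_integral_lim:
  fixes \<psi> :: "'a::euclidean_space \<Rightarrow> real"
  assumes \<nu>: "radon_measure U \<nu>" and U: "U \<in> sets borel" and \<psi>: "\<psi> \<in> borel_measurable borel"
    and bd: "\<And>x. \<bar>\<psi> x\<bar> \<le> C"
  shows "riemann_sum U C \<nu> \<psi> \<longlonglongrightarrow> signed_integral U \<nu> \<psi>"
proof -
  let ?P = "pos_part U \<nu>" and ?N = "pos_part U (\<lambda>A. - \<nu> A)"
  have "riemann_sum U C \<nu> \<psi> = (\<lambda>n. riemann_sum U C (measure ?P) \<psi> n - riemann_sum U C (measure ?N) \<psi> n)"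
    unfolding fun_eq_iff riemann_sum_def sum_subtractf[symmetric] 
  proof (intro allI sum.cong refl)
    fix n k
    let ?A = "{x\<in>U. \<lfloor>real (Suc n) * \<psi> x\<rfloor> = k}"
    have "?A \<in> sets borel" by (rule floor_slice_borel[OF U \<psi>])
    then have "measure ?P ?A - measure ?N ?A = \<nu> ?A"
      by (intro pos_part_diff[OF \<nu> U]) auto
    then show "of_int k / real (Suc n) * \<nu> ?A
        = of_int k / real (Suc n) * measure ?P ?A - of_int k / real (Suc n) * measure ?N ?A"
      by (simp only: right_diff_distrib[symmetric])
  qed
  then show ?thesis
    unfolding signed_integral_def
    using riemann_sum_tendsto_measure[OF finite_pos_part[OF \<nu> U] _ measurable_pos_part(1)[OF \<psi>] bd]
      riemann_sum_tendsto_measure[OF finite_pos_part[OF radon_uminus[OF \<nu>] U] _ measurable_pos_part(1)[OF \<psi>] bd]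
    by (simp add: tendsto_diff)
qed

text \<open>The Jordan parts of a difference are not the differences of the Jordan parts; the linear
  slice sums get around this.\<close>

lemma signed_integral_diff:
  fixes \<psi> :: "'a::euclidean_space \<Rightarrow> real"
  assumes \<nu>: "radon_measure U \<nu>" "radon_measure U \<nu>'" and U: "U \<in> sets borel" and \<psi>: "\<psi> \<in> borel_measurable borel"
    and bd: "\<And>x. \<bar>\<psi> x\<bar> \<le> C"
  shows "signed_integral U (\<lambda>A. \<nu> A - \<nu>' A) \<psi> = signed_integral U \<nu> \<psi> - signed_integral U \<nu>' \<psi>"
proof (rule LIMSEQ_unique)
  show "riemann_sum U C (\<lambda>A. \<nu> A - \<nu>' A) \<psi> \<longlonglongrightarrow> signed_integral U (\<lambda>A. \<nu> A - \<nu>' A) \<psi>"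
    by (intro signed_integral_lim radon_diff assms)
  have "riemann_sum U C (\<lambda>A. \<nu> A - \<nu>' A) \<psi> = (\<lambda>n. riemann_sum U C \<nu> \<psi> n - riemann_sum U C \<nu>' \<psi> n)"
    by (simp add: riemann_sum_def algebra_simps sum_subtractf fun_eq_iff)
  then show "riemann_sum U C (\<lambda>A. \<nu> A - \<nu>' A) \<psi> \<longlonglongrightarrow> signed_integral U \<nu> \<psi> - signed_integral U \<nu>' \<psi>"
    using signed_integral_lim[OF \<nu>(1) U \<psi> bd] signed_integral_lim[OF \<nu>(2) U \<psi> bd]
    by (simp add: tendsto_diff)
qed

text \<open>The coordinates are put together on each slice before norms are taken, and the norm of
  the vector value is at most the variation of the slice. Estimating coordinates one by one would
  cost a dimensional factor.\<close>

lemma signed_integral_vector_le: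
  fixes \<psi> :: "'a::euclidean_space \<Rightarrow> real" and \<nu> :: "'a set \<Rightarrow> 'b::euclidean_space"
  assumes \<nu>: "radon_measure U \<nu>" and U: "U \<in> sets borel" and \<psi>: "\<psi> \<in> borel_measurable borel"
    and bd: "\<And>x. \<bar>\<psi> x\<bar> \<le> C" and nn: "\<And>x. 0 \<le> \<psi> x"
  shows "norm (\<Sum>i\<in>Basis. signed_integral U (\<lambda>A. \<nu> A \<bullet> i) \<psi> *\<^sub>R i) \<le> (LINT x|tv_measure U \<nu>. \<psi> x)"
proof (rule LIMSEQ_le)
  show "(\<lambda>n. norm (\<Sum>i\<in>Basis. riemann_sum U C (\<lambda>A. \<nu> A \<bullet> i) \<psi> n *\<^sub>R i))
      \<longlonglongrightarrow> norm (\<Sum>i\<in>Basis. signed_integral U (\<lambda>A. \<nu> A \<bullet> i) \<psi> *\<^sub>R i)"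
    by (intro tendsto_norm tendsto_sum tendsto_scaleR tendsto_const signed_integral_lim radon_inner assms)
  show "riemann_sum U C (measure (tv_measure U \<nu>)) \<psi> \<longlonglongrightarrow> (LINT x|tv_measure U \<nu>. \<psi> x)"
    using bd by (intro riemann_sum_tendsto_measure finite_tv \<nu> U measurable_pos_part \<psi>) auto
  have "norm (\<Sum>i\<in>Basis. riemann_sum U C (\<lambda>A. \<nu> A \<bullet> i) \<psi> n *\<^sub>R i) \<le> riemann_sum U C (measure (tv_measure U \<nu>)) \<psi> n" for n
  proof -
    let ?L = "\<lambda>k. {x\<in>U. \<lfloor>real (Suc n) * \<psi> x\<rfloor> = k}"
    let ?K = "{- (\<lceil>real (Suc n) * C\<rceil> + 1)..\<lceil>real (Suc n) * C\<rceil> + 1}"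
    have "(\<Sum>i\<in>Basis. riemann_sum U C (\<lambda>A. \<nu> A \<bullet> i) \<psi> n *\<^sub>R i)
        = (\<Sum>i\<in>Basis. \<Sum>k\<in>?K. (of_int k / real (Suc n) * (\<nu> (?L k) \<bullet> i)) *\<^sub>R i)"
      by (simp only: riemann_sum_def scaleR_sum_left)
    also have "\<dots> = (\<Sum>k\<in>?K. (of_int k / real (Suc n)) *\<^sub>R (\<Sum>i\<in>Basis. (\<nu> (?L k) \<bullet> i) *\<^sub>R i))"
      by (subst sum.swap) (simp only: scaleR_sum_right scaleR_scaleR)
    also have "\<dots> = (\<Sum>k\<in>?K. (of_int k / real (Suc n)) *\<^sub>R \<nu> (?L k))"
      by (simp only: euclidean_representation)
    also have "norm \<dots> \<le> (\<Sum>k\<in>?K. of_int k / real (Suc n) * measure (tv_measure U \<nu>) (?L k))"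
    proof (rule sum_norm_le)
      fix k
      show "norm ((of_int k / real (Suc n)) *\<^sub>R \<nu> (?L k)) \<le> of_int k / real (Suc n) * measure (tv_measure U \<nu>) (?L k)"
      proof (cases "k < 0")
        case True
        \<comment> \<open>Since \<psi> is nonnegative, slices with negative index are empty; for the
          others the weight is nonnegative and leaves the norm unchanged.\<close>
        have "0 \<le> \<lfloor>real (Suc n) * \<psi> x\<rfloor>" for x using nn[of x] by simp
        then have "?L k = {}" using True by (auto simp: not_le[symmetric] simp del: of_nat_Suc zero_le_floor)
        then show ?thesis unfolding \<open>?L k = {}\<close> using radon_empty[OF \<nu>] by simp
      next
        case False
        then show ?thesis
          using norm_le_measure_tv[OF \<nu> U floor_slice_borel[OF U \<psi>], of "real (Suc n)" k]
          by (auto intro!: mult_left_mono divide_right_mono)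
      qed
    qed
    finally show ?thesis by (simp only: riemann_sum_def)
  qed
  then show "\<exists>N. \<forall>n\<ge>N. norm (\<Sum>i\<in>Basis. riemann_sum U C (\<lambda>A. \<nu> A \<bullet> i) \<psi> n *\<^sub>R i) \<le> riemann_sum U C (measure (tv_measure U \<nu>)) \<psi> n"
    by blast
qed

lemma radon_set_integral:
  fixes g :: "'a::euclidean_space \<Rightarrow> 'b::euclidean_space"
  assumes g: "set_integrable lebesgue U g"
  shows "radon_measure U (\<lambda>A. LINT x:A|lebesgue. g x)"
proof (rule radon_measureI)
  fix A :: "nat \<Rightarrow> 'a set"
  assume A: "\<And>i. A i \<in> sets borel" "\<And>i. A i \<subseteq> U" "disjoint_family A"
  show "(\<lambda>i. LINT x:A i|lebesgue. g x) sums (LINT x:(\<Union>i. A i)|lebesgue. g x)"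
  proof -
    have leb: "A i \<in> sets lebesgue" for i using A(1)[of i] by simp
    have si: "set_integrable lebesgue S g" if "S \<in> sets lebesgue" "S \<subseteq> U" for S
      by (rule set_integrable_subset[OF g that])
    have un: "(\<Union>i<n. A i) \<in> sets lebesgue" for n :: nat using leb by (intro sets.finite_UN) auto
    have sub: "(\<Union>i<n. A i) \<subseteq> U" for n :: nat using A(2) by (intro UN_least)
    have eq: "(\<Sum>i<n. LINT x:A i|lebesgue. g x) = (LINT x:(\<Union>i<n. A i)|lebesgue. g x)" for n
    proof (induction n)
      case (Suc n)
      have "A i \<inter> A n = {}" if "i < n" for i
        using A(3) that by (simp add: disjoint_family_on_def)
      then have "(\<Union>i<n. A i) \<inter> A n = {}" by blast
      then have "(LINT x:((\<Union>i<n. A i) \<union> A n)|lebesgue. g x) = (LINT x:(\<Union>i<n. A i)|lebesgue. g x) + (LINT x:A n|lebesgue. g x)"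
        by (intro set_integral_Un si un sub leb A(2))
      then show ?case using Suc by (simp add: lessThan_Suc Un_commute)
    qed (simp add: set_lebesgue_integral_def)
    have UN: "(\<Union>n. \<Union>i<n. A i) = (\<Union>i. A i)" by blast
    have "(\<lambda>n. LINT x:(\<Union>i<n. A i)|lebesgue. g x) \<longlonglongrightarrow> (LINT x:(\<Union>n. \<Union>i<n. A i)|lebesgue. g x)"
    proof (rule set_integral_cont_up)
      show "incseq (\<lambda>n. \<Union>i<n. A i)" by (intro incseq_SucI UN_mono) auto
      show "set_integrable lebesgue (\<Union>n. \<Union>i<n. A i) g"
        unfolding UN using leb A(2) by (intro si sets.countable_UN UN_least) auto
    qed (rule un)
    then show ?thesis unfolding sums_def eq UN .
  qed
qed

text \<open>The slice sums are integrals of g against step functions that round \<psi> down and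
  converge uniformly to it. Their bound C + 1 allows dominated convergence.\<close>

lemma signed_integral_density:
  fixes g \<psi> :: "'a::euclidean_space \<Rightarrow> real"
  assumes g: "set_integrable lebesgue U g" and U: "U \<in> sets borel" and \<psi>: "\<psi> \<in> borel_measurable borel"
    and bd: "\<And>x. \<bar>\<psi> x\<bar> \<le> C"
  shows "signed_integral U (\<lambda>A. LINT x:A|lebesgue. g x) \<psi> = (LINT x:U|lebesgue. g x * \<psi> x)"
proof (rule LIMSEQ_unique)
  show "riemann_sum U C (\<lambda>A. LINT x:A|lebesgue. g x) \<psi> \<longlonglongrightarrow> signed_integral U (\<lambda>A. LINT x:A|lebesgue. g x) \<psi>"
    by (rule signed_integral_lim[OF radon_set_integral[OF g] U \<psi> bd])
  have \<psi>L: "\<psi> \<in> borel_measurable lebesgue" using \<psi> by (simp add: measurable_completion)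
  define s where "s n x = of_int \<lfloor>real (Suc n) * \<psi> x\<rfloor> / real (Suc n)" for n x
  have s_meas: "s n \<in> borel_measurable lebesgue" for n
    unfolding s_def using \<psi>L by measurable
  have gU: "integrable lebesgue (\<lambda>x. indicat_real U x *\<^sub>R g x)"
    using g by (simp add: set_integrable_def)
  have bd_s: "\<bar>s n x\<bar> \<le> C + 1" for n x
  proof -
    have "\<bar>\<psi> x - s n x\<bar> \<le> 1" unfolding s_def
      by (rule order_trans[OF step_diff_le]) simp
    then show ?thesis using bd[of x] by linarith
  qed
  have eq: "riemann_sum U C (\<lambda>A. LINT x:A|lebesgue. g x) \<psi> n = (LINT x|lebesgue. (indicat_real U x *\<^sub>R g x) * s n x)" for n
  proof -
    define K where "K = \<lceil>real (Suc n) * C\<rceil> + 1"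
    let ?A = "\<lambda>k. {x\<in>U. \<lfloor>real (Suc n) * \<psi> x\<rfloor> = k}"
    have A: "?A k \<in> sets lebesgue" for k using floor_slice_borel[OF U \<psi>] by simp
    have int: "integrable lebesgue (\<lambda>x. indicat_real (?A k) x *\<^sub>R g x)" for k
      using set_integrable_subset[OF g A[of k]] by (auto simp: set_integrable_def)
    have "riemann_sum U C (\<lambda>A. LINT x:A|lebesgue. g x) \<psi> n
      = (\<Sum>k\<in>{-K..K}. (LINT x|lebesgue. of_int k / real (Suc n) * (indicat_real (?A k) x *\<^sub>R g x)))"
      unfolding riemann_sum_def K_def set_lebesgue_integral_def by simp
    also have "\<dots> = (LINT x|lebesgue. (\<Sum>k\<in>{-K..K}. of_int k / real (Suc n) * (indicat_real (?A k) x *\<^sub>R g x)))"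
      by (intro Bochner_Integration.integral_sum[symmetric] integrable_mult_right int)
    also have "\<dots> = (LINT x|lebesgue. (indicat_real U x *\<^sub>R g x) * s n x)"
    proof (rule Bochner_Integration.integral_cong[OF refl])
      fix x
      show "(\<Sum>k\<in>{-K..K}. of_int k / real (Suc n) * (indicat_real (?A k) x *\<^sub>R g x)) = (indicat_real U x *\<^sub>R g x) * s n x"
      proof (cases "x \<in> U")
        case True
        have "(\<Sum>k\<in>{-K..K}. of_int k / real (Suc n) * (indicat_real (?A k) x *\<^sub>R g x))
          = (\<Sum>k\<in>{-K..K}. of_int k / real (Suc n) * indicat_real (?A k) x) * g x"
          by (simp add: sum_distrib_right mult.assoc)
        also have "\<dots> = s n x * g x" unfolding s_def step_sum[where \<psi>=\<psi>, OF bd True K_def] ..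
        finally show ?thesis using True by (simp add: mult.commute)
      qed simp
    qed
    finally show ?thesis .
  qed
  have "(\<lambda>n. LINT x|lebesgue. (indicat_real U x *\<^sub>R g x) * s n x) \<longlonglongrightarrow> (LINT x|lebesgue. (indicat_real U x *\<^sub>R g x) * \<psi> x)"
  proof (rule integral_dominated_convergence[where w="\<lambda>x. \<bar>indicat_real U x *\<^sub>R g x\<bar> * (C + 1)"])
    show "(\<lambda>x. (indicat_real U x *\<^sub>R g x) * \<psi> x) \<in> borel_measurable lebesgue"
      by (intro borel_measurable_times borel_measurable_integrable[OF gU] \<psi>L)
    show "(\<lambda>x. (indicat_real U x *\<^sub>R g x) * s n x) \<in> borel_measurable lebesgue" for n
      by (intro borel_measurable_times borel_measurable_integrable[OF gU] s_meas)
    show "integrable lebesgue (\<lambda>x. \<bar>indicat_real U x *\<^sub>R g x\<bar> * (C + 1))"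
      by (intro integrable_mult_left integrable_abs gU)
    show "AE x in lebesgue. norm ((indicat_real U x *\<^sub>R g x) * s n x) \<le> \<bar>indicat_real U x *\<^sub>R g x\<bar> * (C + 1)" for n
      by (intro AE_I2) (simp only: real_norm_def abs_mult, intro mult_left_mono bd_s, simp)
    show "AE x in lebesgue. (\<lambda>n. (indicat_real U x *\<^sub>R g x) * s n x) \<longlonglongrightarrow> (indicat_real U x *\<^sub>R g x) * \<psi> x"
    proof (intro AE_I2 tendsto_mult_left)
      fix x
      have "(\<lambda>n. s n x - \<psi> x) \<longlonglongrightarrow> 0"
      proof (rule Lim_null_comparison)
        show "\<forall>\<^sub>F n in sequentially. norm (s n x - \<psi> x) \<le> 1 / real (Suc n)"
          using step_diff_le[of "\<psi> x"] by (intro always_eventually allI) (simp only: real_norm_def s_def abs_minus_commute)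
        show "(\<lambda>n. 1 / real (Suc n)) \<longlonglongrightarrow> 0" by (rule LIMSEQ_Suc[OF lim_const_over_n])
      qed
      then show "(\<lambda>n. s n x) \<longlonglongrightarrow> \<psi> x" by (simp add: LIM_zero_iff)
    qed
  qed
  moreover have "(LINT x:U|lebesgue. g x * \<psi> x) = (LINT x|lebesgue. (indicat_real U x *\<^sub>R g x) * \<psi> x)"
    by (simp add: set_lebesgue_integral_def mult.assoc)
  moreover have "riemann_sum U C (\<lambda>A. LINT x:A|lebesgue. g x) \<psi> = (\<lambda>n. LINT x|lebesgue. (indicat_real U x *\<^sub>R g x) * s n x)"
    by (rule ext) (rule eq)
  ultimately show "riemann_sum U C (\<lambda>A. LINT x:A|lebesgue. g x) \<psi> \<longlonglongrightarrow> (LINT x:U|lebesgue. g x * \<psi> x)"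
    by (simp only:)
qed

section \<open>Lebesgue decomposition\<close>

text \<open>Radon-Nikodym for Lebesgue measure restricted to \<open>U\<close>. The extended-valued
  density has finite integral, hence is finite almost everywhere and can be replaced by a real
  one.\<close>

lemma finite_ac_density:
  fixes M :: "'a::euclidean_space measure"
  assumes M: "finite_measure M" "sets M = sets (restrict_space borel U)" and U: "U \<in> sets borel"
    and ac: "\<And>A. A \<in> sets borel \<Longrightarrow> A \<subseteq> U \<Longrightarrow> emeasure lborel A = 0 \<Longrightarrow> emeasure M A = 0"
  shows "\<exists>g::'a \<Rightarrow> real. set_integrable lebesgue U g \<and>
    (\<forall>A\<in>sets borel. A \<subseteq> U \<longrightarrow> measure M A = (LINT x:A|lebesgue. g x))"
proof -
  interpret finite_measure M by fact
  have UL: "U \<inter> space lborel \<in> sets lborel" using U by simp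
  interpret L: sigma_finite_measure "restrict_space lborel U"
    using U by (intro sigma_finite_measure_restrict_space lborel.sigma_finite_measure_axioms) simp
  have setsL: "sets (restrict_space lborel U) = sets (restrict_space borel U)"
    by (simp add: sets_restrict_space)
  have "absolutely_continuous (restrict_space lborel U) M"
    unfolding absolutely_continuous_def null_sets_def M(2) setsL
    using ac U by (auto simp: sets_restrict_borel emeasure_restrict_space)
  then obtain f where f: "f \<in> borel_measurable (restrict_space lborel U)" and fM: "density (restrict_space lborel U) f = M"
    using L.Radon_Nikodym M(2) setsL by metis
  \<comment> \<open>Cut off outside \<open>U\<close>, so that integrals over the restricted space
    become integrals over the whole space.\<close>
  define f' where "f' x = f x * indicator U x" for x
  have f': "f' \<in> borel_measurable lborel"
    using f borel_measurable_restrict_space_iff_ennreal[OF UL, of f] by (simp add: f'_def[abs_def])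
  have em: "emeasure M A = (\<integral>\<^sup>+x. f' x * indicator A x \<partial>lborel)" if A: "A \<in> sets borel" "A \<subseteq> U" for A
  proof -
    have "A \<in> sets (restrict_space lborel U)" using A U by (simp add: setsL sets_restrict_borel)
    then have "emeasure M A = (\<integral>\<^sup>+x. f x * indicator A x \<partial>restrict_space lborel U)"
      unfolding fM[symmetric] by (rule emeasure_density[OF f])
    also have "\<dots> = (\<integral>\<^sup>+x. f x * indicator A x * indicator U x \<partial>lborel)"
      by (rule nn_integral_restrict_space[OF UL])
    finally show ?thesis by (simp add: f'_def mult_ac)
  qed
  define g where "g x = enn2real (f' x)" for x
  have g: "g \<in> borel_measurable lborel" unfolding g_def using f' by measurable
  have "(\<integral>\<^sup>+x. f' x \<partial>lborel) = emeasure M U"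
    unfolding em[OF U order_refl] by (intro nn_integral_cong) (simp add: f'_def indicator_def)
  then have "(\<integral>\<^sup>+x. f' x \<partial>lborel) \<noteq> \<infinity>" by (simp add: emeasure_eq_measure)
  then have fin: "AE x in lborel. f' x \<noteq> \<infinity>" by (rule nn_integral_noteq_infinite[OF f'])
  have int: "(\<integral>\<^sup>+x. ennreal (indicat_real A x *\<^sub>R g x) \<partial>lborel) = emeasure M A" if A: "A \<in> sets borel" "A \<subseteq> U" for A
    unfolding em[OF A]
  proof (rule nn_integral_cong_AE)
    show "AE x in lborel. ennreal (indicat_real A x *\<^sub>R g x) = f' x * indicator A x"
      using fin by eventually_elim (auto simp: g_def indicator_def less_top)
  qed
  have meas: "(\<lambda>x. indicat_real A x *\<^sub>R g x) \<in> borel_measurable lborel" if "A \<in> sets borel" for A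
    using g that by measurable
  have nn: "0 \<le> indicat_real A x *\<^sub>R g x" for A x by (simp add: g_def)
  have I: "integrable lborel (\<lambda>x. indicat_real U x *\<^sub>R g x)"
    using int[OF U order_refl] nn by (intro integrableI_nonneg meas U AE_I2) (simp_all add: emeasure_eq_measure)
  show ?thesis
  proof (intro exI[of _ g] conjI ballI impI)
    show "set_integrable lebesgue U g"
      unfolding set_integrable_def using I meas[OF U] by (simp add: integrable_completion)
    fix A :: "'a set" assume A: "A \<in> sets borel" "A \<subseteq> U"
    have "(LINT x:A|lebesgue. g x) = (LINT x|lborel. indicat_real A x *\<^sub>R g x)"
      unfolding set_lebesgue_integral_def by (rule integral_completion[OF meas[OF A(1)]])
    also have "\<dots> = enn2real (emeasure M A)"
      unfolding int[OF A, symmetric] by (intro integral_eq_nn_integral meas A(1) AE_I2 nn)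
    finally show "measure M A = (LINT x:A|lebesgue. g x)" by (simp add: measure_def)
  qed
qed

lemma tvar_inner_le:
  assumes "i \<in> Basis" shows "tvar (\<lambda>A. \<nu> A \<bullet> i) A \<le> tvar \<nu> A"
  unfolding tvar_def using assms
  by (intro SUP_subset_mono[OF order_refl] suminf_le summableI ennreal_leI) (simp add: Basis_le_norm)

text \<open>\<open>ac_density\<close> and \<open>sing_part\<close> are choices, so nothing is known
  about them before some decomposition exists. A null set N of maximal variation carries the
  singular part: a null subset of U - N with positive variation could be joined to N, against
  maximality. Radon-Nikodym on U - N gives the density.\<close>

lemma lebesgue_decomposition_exists:
  fixes \<nu> :: "'a::euclidean_space set \<Rightarrow> 'b::euclidean_space"
  assumes \<nu>: "radon_measure U \<nu>" and U: "U \<in> sets borel"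
  shows "\<exists>g \<sigma>. lebesgue_decomposition U \<nu> g \<sigma>"
proof -
  let ?T = "tv_measure U \<nu>"
  interpret T: finite_measure ?T by (rule finite_tv[OF \<nu> U])
  have Tset: "A \<in> sets ?T" if "A \<in> sets borel" "A \<subseteq> U" for A
    using that U by (simp add: sets_tv sets_restrict_borel)
  define Z where "Z = {N \<in> sets borel. N \<subseteq> U \<and> emeasure lborel N = 0}"
  have bdd: "bdd_above (measure ?T ` Z)"
    by (rule bdd_aboveI[of _ "measure ?T U"]) (use T.bounded_measure in auto)
  have ne: "measure ?T ` Z \<noteq> {}" unfolding Z_def by auto
  define s where "s = Sup (measure ?T ` Z)"
  \<comment> \<open>The supremum is attained, as a countable union of almost maximal null sets is
    again null.\<close>
  have "\<exists>N\<in>Z. s - 1 / real (Suc n) < measure ?T N" for n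
    using less_cSupD[OF ne, of "s - 1 / real (Suc n)"] unfolding s_def by auto
  then obtain NN where NN: "\<And>n. NN n \<in> Z" "\<And>n. s - 1 / real (Suc n) < measure ?T (NN n)" by metis
  define N where "N = (\<Union>n. NN n)"
  have N: "N \<in> sets borel" "N \<subseteq> U" "emeasure lborel N = 0"
    using NN(1) unfolding N_def Z_def by (auto intro!: emeasure_UN_eq_0)
  have "s \<le> measure ?T N"
  proof (rule LIMSEQ_le_const2)
    have "s - 1 / real (Suc n) \<le> measure ?T N" for n
    proof -
      have "measure ?T (NN n) \<le> measure ?T N"
        using N by (intro T.finite_measure_mono Tset) (auto simp: N_def)
      then show ?thesis using NN(2)[of n] by simp
    qed
    then show "\<exists>M. \<forall>n\<ge>M. s - 1 / real (Suc n) \<le> measure ?T N" by blast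
    have "(\<lambda>n. s - 1 / real (Suc n)) \<longlonglongrightarrow> s - 0"
      by (intro tendsto_diff tendsto_const LIMSEQ_Suc[OF lim_const_over_n])
    then show "(\<lambda>n. s - 1 / real (Suc n)) \<longlonglongrightarrow> s" by simp
  qed
  have ac: "tvar \<nu> A = 0" if A: "A \<in> sets borel" "A \<subseteq> U - N" "emeasure lborel A = 0" for A
  proof -
    have AU: "A \<subseteq> U" and AN: "N \<inter> A = {}" using A(2) by auto
    have "emeasure lborel (N \<union> A) = 0"
      using N A by (simp add: emeasure_Un_null_set null_sets_def)
    then have "N \<union> A \<in> Z" using N A(1) AU by (simp add: Z_def)
    then have "measure ?T (N \<union> A) \<le> s" unfolding s_def by (intro cSup_upper bdd imageI)
    moreover have "measure ?T (N \<union> A) = measure ?T N + measure ?T A"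
      using N A(1) AU AN by (intro T.finite_measure_Union Tset)
    ultimately have "measure ?T A = 0" using \<open>s \<le> measure ?T N\<close> measure_nonneg[of ?T A] by linarith
    then show ?thesis using emeasure_tv[OF \<nu> U A(1) AU] by (simp add: T.emeasure_eq_measure)
  qed
  \<comment> \<open>Restricting a Jordan part to U - N by an indicator density makes it absolutely
    continuous, because the variation of \<kappa> is dominated by that of \<nu>.\<close>
  have comp: "\<exists>g::'a \<Rightarrow> real. set_integrable lebesgue U g \<and>
    (\<forall>A\<in>sets borel. A \<subseteq> U \<longrightarrow> measure (pos_part U \<kappa>) (A - N) = (LINT x:A|lebesgue. g x))"
    if \<kappa>: "radon_measure U \<kappa>" and le: "\<And>A. tvar \<kappa> A \<le> tvar \<nu> A" for \<kappa> :: "'a set \<Rightarrow> real"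
  proof -
    let ?P = "pos_part U \<kappa>"
    interpret P: finite_measure ?P by (rule finite_pos_part[OF \<kappa> U])
    have Pset: "A \<in> sets ?P" if "A \<in> sets borel" "A \<subseteq> U" for A
      using that U by (simp add: sets_pos_part sets_restrict_borel)
    let ?M = "density ?P (indicator (U - N))"
    have UN: "U - N \<in> sets ?P" using U N by (intro Pset) auto
    have em: "emeasure ?M A = emeasure ?P (A - N)" if A: "A \<in> sets borel" "A \<subseteq> U" for A
    proof -
      have "emeasure ?M A = (\<integral>\<^sup>+x. indicator (U - N) x * indicator A x \<partial>?P)"
        using UN Pset[OF A] by (intro emeasure_density) auto
      also have "\<dots> = (\<integral>\<^sup>+x. indicator (A - N) x \<partial>?P)"
        using A by (intro nn_integral_cong) (auto simp: indicator_def)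
      also have "\<dots> = emeasure ?P (A - N)"
        using A N by (intro nn_integral_indicator Pset) auto
      finally show ?thesis .
    qed
    have "\<exists>g::'a \<Rightarrow> real. set_integrable lebesgue U g \<and>
      (\<forall>A\<in>sets borel. A \<subseteq> U \<longrightarrow> measure ?M A = (LINT x:A|lebesgue. g x))"
    proof (rule finite_ac_density[OF _ _ U])
      show "finite_measure ?M"
        using em[OF U order_refl] by (intro finite_measureI) (simp add: P.emeasure_eq_measure)
      show "sets ?M = sets (restrict_space borel U)" by (simp add: sets_pos_part)
      fix A assume A: "A \<in> sets borel" "A \<subseteq> U" "emeasure lborel A = 0"
      have AN: "A - N \<in> sets borel" "A - N \<subseteq> U" using A N by auto
      have "emeasure lborel (A - N) \<le> emeasure lborel A" using A by (intro emeasure_mono) auto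
      then have "tvar \<nu> (A - N) = 0" using A AN by (intro ac) auto
      then have t: "tvar \<kappa> (A - N) = 0" using le[of "A - N"] by simp
      have "ennreal (norm (\<kappa> (A - N))) \<le> 0" using tvar_ge_norm[OF AN(1), of \<kappa>] t by simp
      then have "\<kappa> (A - N) = 0" by simp
      then show "emeasure ?M A = 0"
        unfolding em[OF A(1,2)] measure_pos_part(1)[OF \<kappa> U AN] t by simp
    qed
    then show ?thesis using em by (simp add: measure_def)
  qed
  have "\<exists>h::'a \<Rightarrow> real. set_integrable lebesgue U h \<and>
    (\<forall>A\<in>sets borel. A \<subseteq> U \<longrightarrow> \<nu> (A - N) \<bullet> b = (LINT x:A|lebesgue. h x))" if b: "b \<in> Basis" for b
  proof -
    have r: "radon_measure U (\<lambda>A. \<nu> A \<bullet> b)" by (rule radon_inner[OF \<nu>])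
    obtain g1 where g1: "set_integrable lebesgue U g1"
      "\<forall>A\<in>sets borel. A \<subseteq> U \<longrightarrow> measure (pos_part U (\<lambda>A. \<nu> A \<bullet> b)) (A - N) = (LINT x:A|lebesgue. g1 x)"
      using comp[OF r tvar_inner_le[OF b]] by blast
    have "tvar (\<lambda>A. - (\<nu> A \<bullet> b)) A \<le> tvar \<nu> A" for A
      unfolding tvar_uminus by (rule tvar_inner_le[OF b])
    then obtain g2 where g2: "set_integrable lebesgue U g2"
      "\<forall>A\<in>sets borel. A \<subseteq> U \<longrightarrow> measure (pos_part U (\<lambda>A. - (\<nu> A \<bullet> b))) (A - N) = (LINT x:A|lebesgue. g2 x)"
      using comp[OF radon_uminus[OF r]] by blast
    show ?thesis
    proof (intro exI[of _ "\<lambda>x. g1 x - g2 x"] conjI ballI impI)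
      show "set_integrable lebesgue U (\<lambda>x. g1 x - g2 x)" using g1 g2 by (intro set_integral_diff)
      fix A :: "'a set" assume A: "A \<in> sets borel" "A \<subseteq> U"
      have AN: "A - N \<in> sets borel" "A - N \<subseteq> U" using A N by auto
      have AL: "A \<in> sets lebesgue" using A by simp
      have "(LINT x:A|lebesgue. g1 x - g2 x) = (LINT x:A|lebesgue. g1 x) - (LINT x:A|lebesgue. g2 x)"
        using set_integrable_subset[OF g1(1) AL A(2)] set_integrable_subset[OF g2(1) AL A(2)]
        by (rule set_integral_diff(2))
      also have "\<dots> = \<nu> (A - N) \<bullet> b"
        using g1(2) g2(2) A pos_part_diff[OF r U AN] by auto
      finally show "\<nu> (A - N) \<bullet> b = (LINT x:A|lebesgue. g1 x - g2 x)" by simp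
    qed
  qed
  then obtain h where h: "\<And>b. b \<in> Basis \<Longrightarrow> set_integrable lebesgue U (h b)"
    "\<And>b A. b \<in> Basis \<Longrightarrow> A \<in> sets borel \<Longrightarrow> A \<subseteq> U \<Longrightarrow> \<nu> (A - N) \<bullet> b = (LINT x:A|lebesgue. h b x)"
    by metis
  define g where "g x = (\<Sum>b\<in>Basis. h b x *\<^sub>R b)" for x
  have ind: "indicat_real A x *\<^sub>R g x = (\<Sum>b\<in>Basis. (indicat_real A x *\<^sub>R h b x) *\<^sub>R b)" for A x
    by (simp add: g_def scaleR_sum_right)
  have hA: "integrable lebesgue (\<lambda>x. indicat_real A x *\<^sub>R h b x)" if "b \<in> Basis" "A \<in> sets borel" "A \<subseteq> U" for A b
    using set_integrable_subset[OF h(1)[OF that(1)], of A] that by (simp add: set_integrable_def)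
  have gU: "set_integrable lebesgue U g"
    unfolding set_integrable_def ind
    using U by (intro Bochner_Integration.integrable_sum integrable_scaleR_left hA) auto
  define \<sigma> where "\<sigma> A = \<nu> (A \<inter> N)" for A
  have eq: "\<nu> A = (LINT x:A|lebesgue. g x) + \<sigma> A" if A: "A \<in> sets borel" "A \<subseteq> U" for A
  proof -
    have "(LINT x:A|lebesgue. g x) = (\<Sum>b\<in>Basis. (LINT x:A|lebesgue. h b x) *\<^sub>R b)"
      unfolding set_lebesgue_integral_def ind
      by (subst Bochner_Integration.integral_sum, intro integrable_scaleR_left hA A, assumption)
        (intro sum.cong refl integral_scaleR_left hA A)
    also have "\<dots> = (\<Sum>b\<in>Basis. (\<nu> (A - N) \<bullet> b) *\<^sub>R b)"
      using h(2) A by (intro sum.cong) auto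
    also have "\<dots> = \<nu> (A - N)" by (rule euclidean_representation)
    finally have *: "(LINT x:A|lebesgue. g x) = \<nu> (A - N)" .
    have "(A - N) \<union> (A \<inter> N) = A" by auto
    moreover have "\<nu> ((A - N) \<union> (A \<inter> N)) = \<nu> (A - N) + \<nu> (A \<inter> N)"
      using A N by (intro radon_Un[OF \<nu>]) auto
    ultimately show ?thesis using * by (simp add: \<sigma>_def)
  qed
  have "radon_measure U \<sigma>"
  proof (rule radon_measureI)
    fix A :: "nat \<Rightarrow> 'a set"
    assume A: "\<And>i. A i \<in> sets borel" "\<And>i. A i \<subseteq> U" "disjoint_family A"
    have "(\<lambda>i. \<nu> (A i \<inter> N)) sums \<nu> (\<Union>i. A i \<inter> N)"
    proof (rule radon_sums[OF \<nu>])
      show "disjoint_family (\<lambda>i. A i \<inter> N)" using A(3) unfolding disjoint_family_on_def by blast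
    qed (use A N in auto)
    then show "(\<lambda>i. \<sigma> (A i)) sums \<sigma> (\<Union>i. A i)" unfolding \<sigma>_def by simp
  qed
  moreover have "tvar \<sigma> (U - N) = 0"
  proof -
    have "tvar \<sigma> (U - N) \<le> 0"
    proof (rule tvar_leI)
      fix P :: "nat \<Rightarrow> 'a set" and n assume "(\<Union>i. P i) = U - N"
      then have "P i \<inter> N = {}" for i by blast
      then show "(\<Sum>i<n. ennreal (norm (\<sigma> (P i)))) \<le> 0"
        by (simp add: \<sigma>_def radon_empty[OF \<nu>])
    qed
    then show ?thesis by simp
  qed
  moreover have "emeasure lebesgue N = 0" using N by simp
  ultimately have "lebesgue_decomposition U \<nu> g \<sigma>"
    unfolding lebesgue_decomposition_def using gU eq N by blast
  then show ?thesis by blast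
qed

text \<open>On each piece of a partition the norm of the integral is at most the integral of the
  norm, and the latter add up.\<close>

lemma tvar_set_integral_le:
  fixes g :: "'a::euclidean_space \<Rightarrow> 'b::euclidean_space"
  assumes g: "set_integrable lebesgue U g" and U: "U \<in> sets borel"
  shows "tvar (\<lambda>A. LINT x:A|lebesgue. g x) U \<le> ennreal (LINT x:U|lebesgue. norm (g x))"
proof (rule tvar_leI)
  fix P :: "nat \<Rightarrow> 'a set" and n
  assume P: "\<And>i. P i \<in> sets borel" "disjoint_family P" "(\<Union>i. P i) = U"
  have PU: "P i \<subseteq> U" for i using P(3) by blast
  have PL: "P i \<in> sets lebesgue" for i using P(1)[of i] by simp
  have ng: "set_integrable lebesgue U (\<lambda>x. norm (g x))" by (rule set_integrable_norm[OF g])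
  have "(\<Sum>i<n. norm (LINT x:P i|lebesgue. g x)) \<le> (\<Sum>i<n. LINT x:P i|lebesgue. norm (g x))"
    by (intro sum_mono set_integral_norm_bound set_integrable_subset[OF g PL PU])
  also have "\<dots> = (LINT x:(\<Union>i<n. P i)|lebesgue. norm (g x))"
  proof (rule radon_finite_UN[OF radon_set_integral[OF ng], symmetric])
    show "disjoint_family_on P {..<n}" using P(2) by (simp add: disjoint_family_on_def)
  qed (use P(1) PU in auto)
  also have "\<dots> \<le> (LINT x:U|lebesgue. norm (g x))"
  proof -
    have V: "(\<Union>i<n. P i) \<in> sets lebesgue" "(\<Union>i<n. P i) \<subseteq> U"
      using PL PU by (auto intro!: sets.finite_UN)
    show ?thesis
      using set_integrable_subset[OF ng V] ng
      unfolding set_lebesgue_integral_def set_integrable_def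
      by (rule integral_mono) (use V(2) in \<open>auto simp: indicator_def\<close>)
  qed
  finally have "ennreal (\<Sum>i<n. norm (LINT x:P i|lebesgue. g x)) \<le> ennreal (LINT x:U|lebesgue. norm (g x))"
    by (rule ennreal_leI)
  then show "(\<Sum>i<n. ennreal (norm (LINT x:P i|lebesgue. g x))) \<le> ennreal (LINT x:U|lebesgue. norm (g x))"
    by (subst sum_ennreal) (rule norm_ge_zero)
qed

lemma tvar_add_le:
  assumes "\<And>A. A \<in> sets borel \<Longrightarrow> A \<subseteq> U \<Longrightarrow> norm (\<nu> A) \<le> norm (\<nu>1 A) + norm (\<nu>2 A)" and U: "U \<in> sets borel"
  shows "tvar \<nu> U \<le> tvar \<nu>1 U + tvar \<nu>2 U"
proof (rule tvar_leI)
  fix P :: "nat \<Rightarrow> 'a set" and n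
  assume P: "\<And>i. P i \<in> sets borel" "disjoint_family P" "(\<Union>i. P i) = U"
  have PU: "P i \<subseteq> U" for i using P(3) by blast
  have dis: "disjoint_family_on P {..<n}" using P(2) by (simp add: disjoint_family_on_def)
  have "(\<Sum>i<n. ennreal (norm (\<nu> (P i)))) \<le> (\<Sum>i<n. ennreal (norm (\<nu>1 (P i))) + ennreal (norm (\<nu>2 (P i))))"
  proof (rule sum_mono)
    fix i
    have "ennreal (norm (\<nu> (P i))) \<le> ennreal (norm (\<nu>1 (P i)) + norm (\<nu>2 (P i)))"
      using assms(1)[OF P(1) PU] by (rule ennreal_leI)
    then show "ennreal (norm (\<nu> (P i))) \<le> ennreal (norm (\<nu>1 (P i))) + ennreal (norm (\<nu>2 (P i)))"
      by (subst (asm) ennreal_plus) simp_all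
  qed
  also have "\<dots> = (\<Sum>i<n. ennreal (norm (\<nu>1 (P i)))) + (\<Sum>i<n. ennreal (norm (\<nu>2 (P i))))"
    by (rule sum.distrib)
  also have "\<dots> \<le> tvar \<nu>1 U + tvar \<nu>2 U"
    using P(1) dis U by (intro add_mono tvar_geI UN_least PU) auto
  finally show "(\<Sum>i<n. ennreal (norm (\<nu> (P i)))) \<le> tvar \<nu>1 U + tvar \<nu>2 U" .
qed

lemma BV_grad:
  assumes "u \<in> BV U" shows "distr_grad U u (BV_grad U u)" "radon_measure U (BV_grad U u)"
proof -
  show "distr_grad U u (BV_grad U u)"
  proof -
    have "\<exists>\<nu>. distr_grad U u \<nu>" using assms by (simp add: BV_def)
    then show ?thesis unfolding BV_grad_def by (rule someI_ex)
  qed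
  then show "radon_measure U (BV_grad U u)" by (simp add: distr_grad_def)
qed

text \<open>The area integrand dominates the norm of the density, and the singular part enters both
  sides alike. Boundedness of \<open>U\<close> makes the integrand integrable; a divergent Bochner
  integral would count as 0.\<close>

lemma tvar_BV_grad_le_area_mass:
  fixes u :: "'a::euclidean_space \<Rightarrow> real"
  assumes u: "u \<in> BV U" and U: "U \<in> sets borel" "bounded U"
  shows "tvar (BV_grad U u) U \<le> ennreal (area_mass U u)" "0 \<le> area_mass U u"
proof -
  let ?\<nu> = "BV_grad U u"
  let ?g = "ac_density U ?\<nu>" and ?s = "sing_part U ?\<nu>"
  \<comment> \<open>Two choices in succession: the density is chosen so that some singular part goes
    with it, and the singular part is chosen for that density.\<close>
  have "\<exists>\<sigma>. lebesgue_decomposition U ?\<nu> ?g \<sigma>"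
    unfolding ac_density_def by (rule someI_ex[OF lebesgue_decomposition_exists[OF BV_grad(2)[OF u] U(1)]])
  then have dec: "lebesgue_decomposition U ?\<nu> ?g ?s"
    unfolding sing_part_def by (rule someI_ex)
  have g: "set_integrable lebesgue U ?g" and s: "radon_measure U ?s"
    and eq: "\<And>A. A \<in> sets borel \<Longrightarrow> A \<subseteq> U \<Longrightarrow> ?\<nu> A = (LINT x:A|lebesgue. ?g x) + ?s A"
    using dec unfolding lebesgue_decomposition_def by blast+
  have UL: "U \<in> sets lebesgue" using U by simp
  have finU: "emeasure lebesgue U < \<infinity>"
    using emeasure_bounded_finite[OF U(2)] U(1) by simp
  have ng: "set_integrable lebesgue U (\<lambda>x. norm (?g x))" by (rule set_integrable_norm[OF g])
  have one: "set_integrable lebesgue U (\<lambda>x. 1::real)"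
    unfolding set_integrable_def using finU UL by (simp add: integrable_indicator_iff)
  have sq: "set_integrable lebesgue U (\<lambda>x. sqrt (1 + (norm (?g x))\<^sup>2))"
  proof (rule set_integrable_bound[OF set_integral_add(1)[OF one ng]])
    have "(\<lambda>x. indicat_real U x *\<^sub>R norm (?g x)) \<in> borel_measurable lebesgue"
      using ng unfolding set_integrable_def by (rule borel_measurable_integrable)
    \<comment> \<open>Measurability is available only for functions cut off outside
      \<open>U\<close>, so the square root is built from the cut-off norm.\<close>
    then have "(\<lambda>x. indicat_real U x * sqrt (1 + (indicat_real U x *\<^sub>R norm (?g x))\<^sup>2)) \<in> borel_measurable lebesgue"
      using UL by measurable
    then show "set_borel_measurable lebesgue U (\<lambda>x. sqrt (1 + (norm (?g x))\<^sup>2))"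
      unfolding set_borel_measurable_def by (rule measurable_cong[THEN iffD1, rotated]) (auto simp: indicator_def)
    show "AE x in lebesgue. x \<in> U \<longrightarrow> norm (sqrt (1 + (norm (?g x))\<^sup>2)) \<le> norm (1 + norm (?g x))"
    proof (intro AE_I2 impI)
      fix x
      have "sqrt (1 + (norm (?g x))\<^sup>2) \<le> sqrt 1 + sqrt ((norm (?g x))\<^sup>2)"
        by (rule sqrt_add_le_add_sqrt) auto
      then show "norm (sqrt (1 + (norm (?g x))\<^sup>2)) \<le> norm (1 + norm (?g x))" by simp
    qed
  qed
  have le: "(LINT x:U|lebesgue. norm (?g x)) \<le> (LINT x:U|lebesgue. sqrt (1 + (norm (?g x))\<^sup>2))"
    by (intro set_integral_mono ng sq real_le_rsqrt) auto
  have nn: "0 \<le> (LINT x:U|lebesgue. norm (?g x))"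
    unfolding set_lebesgue_integral_def by (rule Bochner_Integration.integral_nonneg) auto
  have "tvar ?\<nu> U \<le> tvar (\<lambda>A. LINT x:A|lebesgue. ?g x) U + tvar ?s U"
    using eq by (intro tvar_add_le U) (simp add: norm_triangle_ineq)
  also have "\<dots> \<le> ennreal (LINT x:U|lebesgue. norm (?g x)) + ennreal (enn2real (tvar ?s U))"
    using tvar_finite[OF s U(1)] by (intro add_mono tvar_set_integral_le g U(1)) simp
  also have "\<dots> = ennreal ((LINT x:U|lebesgue. norm (?g x)) + enn2real (tvar ?s U))"
    using nn by (simp add: ennreal_plus)
  also have "\<dots> \<le> ennreal (area_mass U u)"
    unfolding area_mass_def by (intro ennreal_leI add_mono le order_refl)
  finally show "tvar ?\<nu> U \<le> ennreal (area_mass U u)" .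
  show "0 \<le> area_mass U u"
    unfolding area_mass_def using le nn by (intro add_nonneg_nonneg) auto
qed

section \<open>Continuously differentiable functions with compact support\<close>

lemma nn_integral_lborel_shift:
  fixes f :: "'a::euclidean_space \<Rightarrow> ennreal"
  assumes "f \<in> borel_measurable borel"
  shows "(\<integral>\<^sup>+x. f (x + h) \<partial>lborel) = (\<integral>\<^sup>+x. f x \<partial>lborel)"
  using assms by (subst lborel_distr_plus[of h, symmetric], subst nn_integral_distr) (simp_all add: add.commute)

lemma nn_integral_lborel_reflect:
  fixes f :: "'a::euclidean_space \<Rightarrow> ennreal"
  assumes "f \<in> borel_measurable borel"
  shows "(\<integral>\<^sup>+y. f (x - y) \<partial>lborel) = (\<integral>\<^sup>+y. f y \<partial>lborel)"
proof -
  have "(\<integral>\<^sup>+y. f y \<partial>lborel) = (\<integral>\<^sup>+y. f y \<partial>density (distr lborel borel (\<lambda>y. x + (-1) *\<^sub>R y)) (\<lambda>_. \<bar>-1::real\<bar>^DIM('a)))"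
    using lborel_affine[of "-1" x] by simp
  also have "\<dots> = (\<integral>\<^sup>+y. f (x - y) \<partial>lborel)"
    using assms by (simp add: density_1 nn_integral_distr)
  finally show ?thesis by simp
qed

lemma lborel_shift:
  fixes f :: "'a::euclidean_space \<Rightarrow> 'b::{banach, second_countable_topology}"
  assumes "f \<in> borel_measurable borel"
  shows "integrable lborel (\<lambda>x. f (x + h)) \<longleftrightarrow> integrable lborel f"
    and "(LINT x|lborel. f (x + h)) = (LINT x|lborel. f x)"
proof -
  show "integrable lborel (\<lambda>x. f (x + h)) \<longleftrightarrow> integrable lborel f"
    using assms by (subst (2) lborel_distr_plus[of h, symmetric], subst integrable_distr_eq) (simp_all add: add.commute)
  show "(LINT x|lborel. f (x + h)) = (LINT x|lborel. f x)"
    using assms by (subst (2) lborel_distr_plus[of h, symmetric], subst integral_distr) (simp_all add: add.commute)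
qed

lemma lborel_reflect:
  fixes f :: "'a::euclidean_space \<Rightarrow> 'b::{banach, second_countable_topology}"
  assumes "f \<in> borel_measurable borel"
  shows "integrable lborel (\<lambda>y. f (x - y)) \<longleftrightarrow> integrable lborel f"
    and "(LINT y|lborel. f (x - y)) = (LINT y|lborel. f y)"
proof -
  have *: "distr lborel borel (\<lambda>y. x - y) = (lborel :: 'a measure)"
    using lborel_affine[of "-1" x] by (simp add: density_1)
  show "integrable lborel (\<lambda>y. f (x - y)) \<longleftrightarrow> integrable lborel f"
    using assms by (subst (2) *[symmetric], subst integrable_distr_eq) simp_all
  show "(LINT y|lborel. f (x - y)) = (LINT y|lborel. f y)"
    using assms by (subst (2) *[symmetric], subst integral_distr) simp_all
qed

lemma nn_Fubini:
  assumes "(\<lambda>p. f (fst p) (snd p)) \<in> borel_measurable (lborel \<Otimes>\<^sub>M lborel)"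
  shows "(\<integral>\<^sup>+y. (\<integral>\<^sup>+x. f x y \<partial>lborel) \<partial>lborel) = (\<integral>\<^sup>+x. (\<integral>\<^sup>+y. f x y \<partial>lborel) \<partial>lborel)"
  using assms by (intro lborel_pair.Fubini') (simp add: case_prod_beta')

text \<open>Extended-valued, so that the triangle inequality and limits carry no integrability side
  conditions.\<close>

definition nnL1 :: "('a::euclidean_space \<Rightarrow> real) \<Rightarrow> ('a \<Rightarrow> real) \<Rightarrow> ennreal" where
  "nnL1 f g = (\<integral>\<^sup>+x. ennreal \<bar>f x - g x\<bar> \<partial>lborel)"

lemma nnL1_commute: "nnL1 f g = nnL1 g f"
  by (simp add: nnL1_def abs_minus_commute)

lemma nnL1_triangle:
  assumes [measurable]: "f \<in> borel_measurable borel" "g \<in> borel_measurable borel" "h \<in> borel_measurable borel"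
  shows "nnL1 f h \<le> nnL1 f g + nnL1 g h"
proof -
  have "nnL1 f h \<le> (\<integral>\<^sup>+x. ennreal \<bar>f x - g x\<bar> + ennreal \<bar>g x - h x\<bar> \<partial>lborel)"
    unfolding nnL1_def by (intro nn_integral_mono) (simp add: ennreal_plus[symmetric] ennreal_leI del: ennreal_plus)
  also have "\<dots> = nnL1 f g + nnL1 g h"
    unfolding nnL1_def by (intro nn_integral_add) simp_all
  finally show ?thesis .
qed

lemma nnL1_integral:
  assumes "integrable lborel f" "integrable lborel g"
  shows "nnL1 f g = ennreal (LINT x|lborel. \<bar>f x - g x\<bar>)"
  unfolding nnL1_def using assms by (intro nn_integral_eq_integral) auto

lemma nnL1_shift:
  assumes "f \<in> borel_measurable borel" "g \<in> borel_measurable borel"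
  shows "nnL1 (\<lambda>x. f (x + h)) (\<lambda>x. g (x + h)) = nnL1 f g"
  unfolding nnL1_def using assms by (intro nn_integral_lborel_shift) simp

text \<open>The gradient is an explicit parameter, so that its continuity, bounds and integrals can
  be stated directly.\<close>

definition C1_grad :: "('a::euclidean_space \<Rightarrow> real) \<Rightarrow> ('a \<Rightarrow> 'a) \<Rightarrow> bool" where
  "C1_grad F G \<longleftrightarrow> (\<forall>x. (F has_derivative (\<lambda>h. G x \<bullet> h)) (at x)) \<and> continuous_on UNIV G"

definition C1c :: "('a::euclidean_space \<Rightarrow> real) \<Rightarrow> ('a \<Rightarrow> 'a) \<Rightarrow> bool" where
  "C1c F G \<longleftrightarrow> C1_grad F G \<and> (\<exists>r>0. \<forall>x. r \<le> norm x \<longrightarrow> F x = 0 \<and> G x = 0)"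

lemma C1_gradD:
  assumes "C1_grad F G"
  shows "(F has_derivative (\<lambda>h. G x \<bullet> h)) (at x)" "continuous_on UNIV F" "continuous_on UNIV G"
    "F \<in> borel_measurable borel" "G \<in> borel_measurable borel"
proof -
  show *: "(F has_derivative (\<lambda>h. G x \<bullet> h)) (at x)" "continuous_on UNIV G" for x
    using assms by (auto simp: C1_grad_def)
  show "continuous_on UNIV F"
    by (intro continuous_at_imp_continuous_on ballI has_derivative_continuous[OF *(1)])
  then show "F \<in> borel_measurable borel" by (rule borel_measurable_continuous_onI)
  show "G \<in> borel_measurable borel" using *(2) by (rule borel_measurable_continuous_onI)
qed

lemma C1cD: "C1c F G \<Longrightarrow> C1_grad F G"
  by (simp add: C1c_def)

lemma continuous_bounded_support:
  fixes G :: "'a::euclidean_space \<Rightarrow> 'b::euclidean_space"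
  assumes "continuous_on UNIV G" "\<And>x. r \<le> norm x \<Longrightarrow> G x = 0"
  shows "integrable lborel G" and "\<exists>M\<ge>0. \<forall>x. norm (G x) \<le> M"
proof -
  have c: "continuous_on (cball 0 r) G" using assms(1) continuous_on_subset by blast
  have "indicat_real (cball 0 r) x *\<^sub>R G x = G x" for x
    using assms(2)[of x] by (auto simp: indicator_def)
  then show "integrable lborel G"
    using borel_integrable_compact[OF compact_cball c] by simp
  have "bounded (G ` cball 0 r)" by (intro compact_imp_bounded compact_continuous_image c compact_cball)
  then obtain M where M: "\<And>x. x \<in> cball 0 r \<Longrightarrow> norm (G x) \<le> M"
    unfolding bounded_iff by blast
  have "norm (G x) \<le> max 0 M" for x
  proof (cases "r \<le> norm x")
    case False
    then show ?thesis using M[of x] by simp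
  qed (simp add: assms(2))
  then show "\<exists>M\<ge>0. \<forall>x. norm (G x) \<le> M" by (intro exI[of _ "max 0 M"]) simp
qed

lemma C1c_integrable:
  assumes "C1c F G"
  shows "integrable lborel F" "integrable lborel G" "\<exists>M\<ge>0. \<forall>x. norm (G x) \<le> M" "\<exists>M\<ge>0. \<forall>x. \<bar>F x\<bar> \<le> M"
proof -
  obtain r where r: "\<And>x. r \<le> norm x \<Longrightarrow> F x = 0" "\<And>x. r \<le> norm x \<Longrightarrow> G x = 0"
    using assms by (auto simp: C1c_def)
  note c = C1_gradD[OF C1cD[OF assms]]
  show "integrable lborel F" "integrable lborel G" "\<exists>M\<ge>0. \<forall>x. norm (G x) \<le> M"
    using continuous_bounded_support[OF c(2) r(1)] continuous_bounded_support[OF c(3) r(2)] by blast+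
  show "\<exists>M\<ge>0. \<forall>x. \<bar>F x\<bar> \<le> M"
    using continuous_bounded_support(2)[OF c(2) r(1)] by simp
qed

lemma C1_grad_line:
  assumes "C1_grad F G"
  shows "((\<lambda>s. F (x + s *\<^sub>R h)) has_real_derivative (G (x + s *\<^sub>R h) \<bullet> h)) (at s)"
proof -
  have "((\<lambda>s. x + s *\<^sub>R h) has_derivative (\<lambda>t. t *\<^sub>R h)) (at s)"
    by (auto intro!: derivative_eq_intros)
  from has_derivative_compose[OF this C1_gradD(1)[OF assms]]
  show ?thesis
    unfolding has_field_derivative_def by (rule has_derivative_eq_rhs) (auto simp: fun_eq_iff)
qed

text \<open>The fundamental theorem of calculus on the segment from x to x + h.\<close>

lemma C1_grad_FTC_bound:
  assumes "C1_grad F G"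
  shows "ennreal \<bar>F (x + h) - F x\<bar> \<le> (\<integral>\<^sup>+s. ennreal (norm h) * ennreal (norm (G (x + s *\<^sub>R h))) * indicator {0..1::real} s \<partial>lborel)"
proof -
  let ?f = "\<lambda>s::real. (G (x + s *\<^sub>R h) \<bullet> h) * indicator {0..1} s"
  have c: "isCont (\<lambda>s. G (x + s *\<^sub>R h) \<bullet> h) s" for s
  proof -
    have "isCont G (x + s *\<^sub>R h)"
      using C1_gradD(3)[OF assms] by (simp add: continuous_on_eq_continuous_at)
    then have "isCont (\<lambda>s. G (x + s *\<^sub>R h)) s"
      by (rule isCont_o2[where g=G, rotated]) (intro continuous_intros)
    then show ?thesis by (intro continuous_intros)
  qed
  have "has_bochner_integral lborel ?f (F (x + 1 *\<^sub>R h) - F (x + 0 *\<^sub>R h))"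
    by (rule has_bochner_integral_FTC_Icc_real) (use C1_grad_line[OF assms] c in auto)
  then have i: "integrable lborel ?f" and e: "integral\<^sup>L lborel ?f = F (x + h) - F x"
    by (auto simp: has_bochner_integral_iff)
  have "ennreal (norm (integral\<^sup>L lborel ?f)) \<le> (\<integral>\<^sup>+s. ennreal (norm (?f s)) \<partial>lborel)"
    by (rule integral_norm_bound_ennreal[OF i])
  also have "\<dots> \<le> (\<integral>\<^sup>+s. ennreal (norm h) * ennreal (norm (G (x + s *\<^sub>R h))) * indicator {0..1::real} s \<partial>lborel)"
  proof (rule nn_integral_mono)
    fix s :: real
    have "\<bar>G (x + s *\<^sub>R h) \<bullet> h\<bar> \<le> norm h * norm (G (x + s *\<^sub>R h))"
      using Cauchy_Schwarz_ineq2[of "G (x + s *\<^sub>R h)" h] by (simp add: mult.commute)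
    then show "ennreal (norm (?f s)) \<le> ennreal (norm h) * ennreal (norm (G (x + s *\<^sub>R h))) * indicator {0..1::real} s"
      by (auto simp: indicator_def ennreal_mult[symmetric] intro: ennreal_leI)
  qed
  finally show ?thesis by (simp add: e)
qed

text \<open>The bound along segments is integrated over x; by Fubini each s contributes a translate
  of |G|, whose integral does not depend on s.\<close>

lemma C1_grad_translation:
  assumes FG: "C1_grad F G"
  shows "nnL1 (\<lambda>x. F (x + h)) F \<le> ennreal (norm h) * (\<integral>\<^sup>+x. ennreal (norm (G x)) \<partial>lborel)"
proof -
  note [measurable] = C1_gradD(5)[OF FG]
  have "nnL1 (\<lambda>x. F (x + h)) F \<le> (\<integral>\<^sup>+x. (\<integral>\<^sup>+s. ennreal (norm h) * ennreal (norm (G (x + s *\<^sub>R h))) * indicator {0..1::real} s \<partial>lborel) \<partial>lborel)"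
    unfolding nnL1_def by (intro nn_integral_mono C1_grad_FTC_bound[OF FG])
  also have "\<dots> = (\<integral>\<^sup>+s. (\<integral>\<^sup>+x. ennreal (norm h) * ennreal (norm (G (x + s *\<^sub>R h))) * indicator {0..1::real} s \<partial>lborel) \<partial>lborel)"
    by (rule nn_Fubini[symmetric]) measurable
  also have "\<dots> = (\<integral>\<^sup>+s. (ennreal (norm h) * (\<integral>\<^sup>+x. ennreal (norm (G x)) \<partial>lborel)) * indicator {0..1::real} s \<partial>lborel)"
    by (intro nn_integral_cong) (simp add: nn_integral_multc nn_integral_cmult nn_integral_lborel_shift[where f="\<lambda>x. ennreal (norm (G x))"])
  also have "\<dots> = ennreal (norm h) * (\<integral>\<^sup>+x. ennreal (norm (G x)) \<partial>lborel)"
    by (subst nn_integral_cmult_indicator) simp_all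
  finally show ?thesis .
qed

lemma C1_grad_lipschitz:
  assumes "C1_grad F G" "\<And>x. norm (G x) \<le> M"
  shows "\<bar>F (x + h) - F x\<bar> \<le> M * norm h"
proof -
  have "norm (F (x + h) - F x) \<le> M * norm ((x + h) - x)"
  proof (rule differentiable_bound[of UNIV F "\<lambda>x h. G x \<bullet> h"])
    fix y :: 'a
    show "(F has_derivative (\<lambda>h. G y \<bullet> h)) (at y within UNIV)" using C1_gradD(1)[OF assms(1)] by simp
    have "norm (G y \<bullet> k) \<le> M * norm k" for k
      using Cauchy_Schwarz_ineq2[of "G y" k] mult_right_mono[OF assms(2)[of y], of "norm k"] by simp
    then show "onorm (\<lambda>h. G y \<bullet> h) \<le> M" by (intro onorm_bound) (auto intro: order_trans[OF norm_ge_zero assms(2)])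
  qed auto
  then show ?thesis by simp
qed

lemma C1_grad_mult:
  assumes "C1_grad F G" "C1_grad E H"
  shows "C1_grad (\<lambda>x. F x * E x) (\<lambda>x. F x *\<^sub>R H x + E x *\<^sub>R G x)"
  unfolding C1_grad_def
proof (intro conjI allI)
  fix x
  show "((\<lambda>x. F x * E x) has_derivative (\<lambda>h. (F x *\<^sub>R H x + E x *\<^sub>R G x) \<bullet> h)) (at x)"
    using has_derivative_mult[OF C1_gradD(1)[OF assms(1)] C1_gradD(1)[OF assms(2)]]
    by (rule has_derivative_eq_rhs) (simp add: fun_eq_iff inner_add_left algebra_simps)
  show "continuous_on UNIV (\<lambda>x. F x *\<^sub>R H x + E x *\<^sub>R G x)"
    by (intro continuous_intros C1_gradD[OF assms(1)] C1_gradD[OF assms(2)])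
qed

lemma C1c_mult:
  assumes "C1c F G" "C1_grad E H"
  shows "C1c (\<lambda>x. F x * E x) (\<lambda>x. F x *\<^sub>R H x + E x *\<^sub>R G x)"
  using assms(1) C1_grad_mult[OF C1cD[OF assms(1)] assms(2)] unfolding C1c_def by fastforce

text \<open>The difference quotients in direction e have integral 0 by translation invariance, and
  they converge to the directional derivative under a fixed integrable bound.\<close>

lemma C1c_integral_gradient:
  assumes C: "C1c H K"
  shows "(LINT x|lborel. K x \<bullet> e) = 0"
proof -
  note D = C1_gradD[OF C1cD[OF C]]
  obtain r where r: "r > 0" "\<And>x. r \<le> norm x \<Longrightarrow> H x = 0" "\<And>x. r \<le> norm x \<Longrightarrow> K x = 0"
    using C by (auto simp: C1c_def)
  obtain M where M: "M \<ge> 0" "\<And>x. norm (K x) \<le> M" using C1c_integrable(3)[OF C] by auto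
  define q where "q n x = (H (x + (1 / real (Suc n)) *\<^sub>R e) - H x) * real (Suc n)" for n x
  note [measurable] = D(4,5)
  have sh: "integrable lborel (\<lambda>x. H (x + h))" for h
    using C1c_integrable(1)[OF C] lborel_shift(1)[OF D(4)] by blast
  have "(LINT x|lborel. q n x) = 0" for n
  proof -
    have "(LINT x|lborel. q n x) = ((LINT x|lborel. H (x + (1 / real (Suc n)) *\<^sub>R e)) - (LINT x|lborel. H x)) * real (Suc n)"
      unfolding q_def using sh C1c_integrable(1)[OF C] by (subst Bochner_Integration.integral_diff[symmetric]) auto
    then show ?thesis by (simp add: lborel_shift(2)[OF D(4)])
  qed
  moreover have "(\<lambda>n. LINT x|lborel. q n x) \<longlonglongrightarrow> (LINT x|lborel. K x \<bullet> e)"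
  \<comment> \<open>The increments 1 / (n + 1) are at most 1, so all quotients vanish outside the
    ball of radius r + |e|; inside they are bounded by the Lipschitz constant times |e|.\<close>
  proof (rule integral_dominated_convergence[where w="\<lambda>x. M * norm e * indicator (cball 0 (r + norm e)) x"])
    show "integrable lborel (\<lambda>x. M * norm e * indicat_real (cball 0 (r + norm e)) x)"
      by (intro integrable_mult_right) (simp add: integrable_indicator_iff emeasure_bounded_finite[unfolded infinity_ennreal_def])
    show "AE x in lborel. norm (q n x) \<le> M * norm e * indicator (cball 0 (r + norm e)) x" for n
    proof (rule AE_I2)
      fix x
      show "norm (q n x) \<le> M * norm e * indicator (cball 0 (r + norm e)) x"
      proof (cases "norm x \<le> r + norm e")
        case True
        have "\<bar>H (x + (1 / real (Suc n)) *\<^sub>R e) - H x\<bar> \<le> M * norm ((1 / real (Suc n)) *\<^sub>R e)"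
          by (rule C1_grad_lipschitz[OF C1cD[OF C] M(2)])
        then have "\<bar>H (x + (1 / real (Suc n)) *\<^sub>R e) - H x\<bar> * real (Suc n) \<le> M * norm ((1 / real (Suc n)) *\<^sub>R e) * real (Suc n)"
          by (rule mult_right_mono) simp
        also have "\<dots> = M * norm e" by simp
        finally show ?thesis using True by (simp add: q_def abs_mult)
      next
        case False
        have "norm ((1 / real (Suc n)) *\<^sub>R e) \<le> norm e"
          using mult_left_mono[of 1 "1 + real n" "norm e"] by (simp add: divide_le_eq)
        then have "r \<le> norm (x + (1 / real (Suc n)) *\<^sub>R e)"
          using False norm_diff_ineq[of x "(1 / real (Suc n)) *\<^sub>R e"] by linarith
        then have "H (x + (1 / real (Suc n)) *\<^sub>R e) = 0" by (rule r(2))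
        moreover have "H x = 0" using False by (intro r(2)) (use norm_ge_zero[of e] in linarith)
        ultimately show ?thesis using False by (simp add: q_def)
      qed
    qed
    show "AE x in lborel. (\<lambda>n. q n x) \<longlonglongrightarrow> K x \<bullet> e"
    proof (rule AE_I2)
      fix x
      have "((\<lambda>s. H (x + s *\<^sub>R e)) has_real_derivative (K x \<bullet> e)) (at 0)"
        using C1_grad_line[OF C1cD[OF C], of x e 0] by simp
      then have 1: "((\<lambda>s. (H (x + s *\<^sub>R e) - H x) / s) \<longlongrightarrow> K x \<bullet> e) (at 0)"
        by (simp add: has_field_derivative_iff)
      have 2: "filterlim (\<lambda>n. 1 / real (Suc n)) (at 0) sequentially"
        by (intro filterlim_atI LIMSEQ_Suc[OF lim_const_over_n]) simp
      show "(\<lambda>n. q n x) \<longlonglongrightarrow> K x \<bullet> e"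
        using filterlim_compose[OF 1 2] by (simp add: q_def[abs_def])
    qed
    show "q n \<in> borel_measurable lborel" for n unfolding q_def by measurable
    show "(\<lambda>x. K x \<bullet> e) \<in> borel_measurable lborel" by measurable
  qed
  ultimately show ?thesis by (simp add: LIMSEQ_const_iff)
qed

lemma smooth_onD:
  assumes "smooth_on U f"
  shows "continuous_on U f" "f differentiable_on U"
    "i \<in> Basis \<Longrightarrow> continuous_on U (\<lambda>x. frechet_derivative f (at x) i)"
proof -
  have k: "Ck_on k U f" for k using assms unfolding smooth_on_def by (rule spec)
  show "continuous_on U f" using k[of 0] unfolding Ck_on.simps .
  have *: "f differentiable_on U \<and> (\<forall>i\<in>Basis. continuous_on U (\<lambda>x. frechet_derivative f (at x) i))"
    using k[of "Suc 0"] unfolding Ck_on.simps .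
  show "f differentiable_on U" by (rule conjunct1[OF *])
  show "i \<in> Basis \<Longrightarrow> continuous_on U (\<lambda>x. frechet_derivative f (at x) i)"
    by (rule bspec[OF conjunct2[OF *]])
qed

text \<open>The gradient is a row of the Jacobian matrix, read off from the values of the derivative
  on the basis.\<close>

lemma C1_grad_component:
  fixes \<psi> :: "'a::euclidean_space \<Rightarrow> 'a"
  assumes "smooth_on UNIV \<psi>"
  shows "C1_grad (\<lambda>x. \<psi> x \<bullet> i) (\<lambda>x. \<Sum>j\<in>Basis. (frechet_derivative \<psi> (at x) j \<bullet> i) *\<^sub>R j)"
  unfolding C1_grad_def
proof (intro conjI allI)
  note d = smooth_onD(2)[OF assms] and c = smooth_onD(3)[OF assms]
  show "continuous_on UNIV (\<lambda>x. \<Sum>j\<in>Basis. (frechet_derivative \<psi> (at x) j \<bullet> i) *\<^sub>R j)"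
    by (intro continuous_on_sum continuous_on_scaleR continuous_on_inner continuous_on_const c)
  fix x
  have D: "(\<psi> has_derivative frechet_derivative \<psi> (at x)) (at x)"
  proof -
    have "\<psi> differentiable (at x within UNIV)" using d unfolding differentiable_on_def by blast
    then show ?thesis by (rule frechet_derivative_works[THEN iffD1])
  qed
  then have lin: "linear (frechet_derivative \<psi> (at x))" by (rule has_derivative_linear)
  have "frechet_derivative \<psi> (at x) h \<bullet> i = (\<Sum>j\<in>Basis. (frechet_derivative \<psi> (at x) j \<bullet> i) *\<^sub>R j) \<bullet> h" for h
  proof -
    have "frechet_derivative \<psi> (at x) h = frechet_derivative \<psi> (at x) (\<Sum>j\<in>Basis. (h \<bullet> j) *\<^sub>R j)"
      by (simp only: euclidean_representation)
    also have "\<dots> = (\<Sum>j\<in>Basis. (h \<bullet> j) *\<^sub>R frechet_derivative \<psi> (at x) j)"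
      by (simp only: linear_sum[OF lin] linear_cmul[OF lin])
    finally have "frechet_derivative \<psi> (at x) h \<bullet> i = (\<Sum>j\<in>Basis. (h \<bullet> j) * (frechet_derivative \<psi> (at x) j \<bullet> i))"
      by (simp only: inner_sum_left inner_scaleR_left)
    also have "\<dots> = (\<Sum>j\<in>Basis. (frechet_derivative \<psi> (at x) j \<bullet> i) * (j \<bullet> h))"
      by (intro sum.cong refl) (metis inner_commute mult.commute)
    finally show ?thesis
      by (simp only: inner_sum_left inner_scaleR_left)
  qed
  then have "(\<lambda>h. frechet_derivative \<psi> (at x) h \<bullet> i) = (\<lambda>h. (\<Sum>j\<in>Basis. (frechet_derivative \<psi> (at x) j \<bullet> i) *\<^sub>R j) \<bullet> h)"
    by (rule ext)
  then show "((\<lambda>x. \<psi> x \<bullet> i) has_derivative (\<lambda>h. (\<Sum>j\<in>Basis. (frechet_derivative \<psi> (at x) j \<bullet> i) *\<^sub>R j) \<bullet> h)) (at x)"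
    by (rule has_derivative_eq_rhs[OF has_derivative_inner_left[OF D]])
qed

lemma divergence_sum:
  fixes \<psi> :: "'a::euclidean_space \<Rightarrow> 'a"
  shows "divergence \<psi> x = (\<Sum>i\<in>Basis. (\<Sum>j\<in>Basis. (frechet_derivative \<psi> (at x) j \<bullet> i) *\<^sub>R j) \<bullet> i)"
  unfolding divergence_def by (rule sum.cong[OF refl]) (simp only: inner_sum_left_Basis)

lemma continuous_divergence:
  fixes \<psi> :: "'a::euclidean_space \<Rightarrow> 'a"
  assumes "smooth_on UNIV \<psi>"
  shows "continuous_on UNIV (divergence \<psi>)"
  unfolding divergence_sum[abs_def]
proof (rule continuous_on_sum)
  fix i :: 'a
  show "continuous_on UNIV (\<lambda>x. (\<Sum>j\<in>Basis. (frechet_derivative \<psi> (at x) j \<bullet> i) *\<^sub>R j) \<bullet> i)"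
    by (rule continuous_on_inner[OF C1_gradD(3)[OF C1_grad_component[OF assms]] continuous_on_const])
qed

text \<open>The sum of both integrands is the divergence of F \<psi>, hence a sum of partial
  derivatives of compactly supported functions. The support comes from F; that of \<psi> is
  arbitrary.\<close>

lemma C1c_divergence:
  fixes \<psi> :: "'a::euclidean_space \<Rightarrow> 'a"
  assumes C: "C1c F G" and \<psi>: "smooth_on UNIV \<psi>"
  shows "(LINT x|lborel. F x * divergence \<psi> x) = - (LINT x|lborel. G x \<bullet> \<psi> x)"
proof -
  let ?S = "\<lambda>i x. \<Sum>j\<in>Basis. (frechet_derivative \<psi> (at x) j \<bullet> i) *\<^sub>R j"
  let ?K = "\<lambda>i x. F x *\<^sub>R ?S i x + (\<psi> x \<bullet> i) *\<^sub>R G x"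
  have K: "C1c (\<lambda>x. F x * (\<psi> x \<bullet> i)) (?K i)" for i
    by (rule C1c_mult[OF C C1_grad_component[OF \<psi>]])
  have c\<psi>: "continuous_on UNIV \<psi>"
    by (rule smooth_onD(1)[OF \<psi>])
  note cd = continuous_divergence[OF \<psi>]
  obtain r where r: "r > 0" "\<And>x. r \<le> norm x \<Longrightarrow> F x = 0" "\<And>x. r \<le> norm x \<Longrightarrow> G x = 0"
    using C by (auto simp: C1c_def)
  have i1: "integrable lborel (\<lambda>x. F x * divergence \<psi> x)"
    by (rule continuous_bounded_support(1)[where r=r])
      (intro continuous_on_mult C1_gradD(2)[OF C1cD[OF C]] cd, simp add: r(2))
  have i2: "integrable lborel (\<lambda>x. G x \<bullet> \<psi> x)"
    by (rule continuous_bounded_support(1)[where r=r])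
      (intro continuous_on_inner C1_gradD(3)[OF C1cD[OF C]] c\<psi>, simp add: r(3))
  have "0 = (\<Sum>i\<in>Basis. LINT x|lborel. ?K i x \<bullet> i)"
    by (simp only: C1c_integral_gradient[OF K] sum.neutral_const)
  also have "\<dots> = (LINT x|lborel. (\<Sum>i\<in>Basis. ?K i x \<bullet> i))"
    by (intro Bochner_Integration.integral_sum[symmetric] integrable_inner_left C1c_integrable(2)[OF K])
  also have "(\<lambda>x. \<Sum>i\<in>Basis. ?K i x \<bullet> i) = (\<lambda>x. F x * divergence \<psi> x + G x \<bullet> \<psi> x)"
  proof
    fix x
    have "(\<Sum>i\<in>Basis. ?K i x \<bullet> i) = F x * (\<Sum>i\<in>Basis. ?S i x \<bullet> i) + (\<Sum>i\<in>Basis. (G x \<bullet> i) * (\<psi> x \<bullet> i))"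
    proof -
      have "(\<Sum>i\<in>Basis. ?K i x \<bullet> i) = (\<Sum>i\<in>Basis. F x * (?S i x \<bullet> i) + (G x \<bullet> i) * (\<psi> x \<bullet> i))"
        by (intro sum.cong refl) (simp only: inner_add_left inner_scaleR_left mult.commute[of "G x \<bullet> _"])
      then show ?thesis
        by (simp only: sum.distrib sum_distrib_left)
    qed
    then show "(\<Sum>i\<in>Basis. ?K i x \<bullet> i) = F x * divergence \<psi> x + G x \<bullet> \<psi> x"
      unfolding divergence_sum euclidean_inner[of "G x" "\<psi> x"] .
  qed
  finally show "(LINT x|lborel. F x * divergence \<psi> x) = - (LINT x|lborel. G x \<bullet> \<psi> x)"
    using i1 i2 by simp
qed

section \<open>Translations and convolutions\<close>

lemma ennreal_tendsto_0I:
  fixes X :: "nat \<Rightarrow> ennreal"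
  assumes "\<And>e::real. e > 0 \<Longrightarrow> eventually (\<lambda>n. X n \<le> ennreal e) sequentially"
  shows "X \<longlonglongrightarrow> 0"
proof (rule order_tendstoI)
  fix a :: ennreal assume "a < 0" then show "eventually (\<lambda>n. a < X n) sequentially" by simp
next
  fix a :: ennreal assume a: "0 < a"
  obtain e :: real where e: "e > 0" "ennreal e < a"
  proof (cases a)
    case (real r)
    then show ?thesis using a that[of "r / 2"] by (simp add: ennreal_less_iff)
  next
    case top
    then show ?thesis using that[of 1] by simp
  qed
  show "eventually (\<lambda>n. X n < a) sequentially"
    using assms[OF e(1)] by eventually_elim (use e(2) in auto)
qed

lemma ennreal_tendsto_0D:
  fixes X :: "nat \<Rightarrow> ennreal"
  assumes "X \<longlonglongrightarrow> 0" "e > 0"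
  shows "eventually (\<lambda>n. X n \<le> ennreal e) sequentially"
  using order_tendstoD(2)[OF assms(1), of "ennreal e"] assms(2) by (auto elim: eventually_mono)

text \<open>The functions on which translations along h are continuous form a closed set in L^1: a
  function and its approximation stay equally close after translation, so three errors e/3
  suffice.\<close>

lemma L1_translation_approx:
  fixes f :: "'a::euclidean_space \<Rightarrow> real"
  assumes f: "f \<in> borel_measurable borel"
    and g: "\<And>e. e > 0 \<Longrightarrow> \<exists>g\<in>borel_measurable borel. nnL1 f g \<le> ennreal e \<and> (\<lambda>n. nnL1 (\<lambda>x. g (x + h n)) g) \<longlonglongrightarrow> 0"
  shows "(\<lambda>n. nnL1 (\<lambda>x. f (x + h n)) f) \<longlonglongrightarrow> 0"
proof (rule ennreal_tendsto_0I)
  fix e :: real assume "e > 0"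
  then obtain g where g: "g \<in> borel_measurable borel" "nnL1 f g \<le> ennreal (e/3)" "(\<lambda>n. nnL1 (\<lambda>x. g (x + h n)) g) \<longlonglongrightarrow> 0"
    using g[of "e/3"] by auto
  have m: "(\<lambda>x. f (x + k)) \<in> borel_measurable borel" "(\<lambda>x. g (x + k)) \<in> borel_measurable borel" for k
    using f g(1) by measurable
  have "eventually (\<lambda>n. nnL1 (\<lambda>x. g (x + h n)) g \<le> ennreal (e/3)) sequentially"
    using \<open>e > 0\<close> by (intro ennreal_tendsto_0D[OF g(3)]) simp
  then show "eventually (\<lambda>n. nnL1 (\<lambda>x. f (x + h n)) f \<le> ennreal e) sequentially"
  proof eventually_elim
    fix n assume n: "nnL1 (\<lambda>x. g (x + h n)) g \<le> ennreal (e/3)"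
    have "nnL1 (\<lambda>x. f (x + h n)) f \<le> nnL1 (\<lambda>x. f (x + h n)) (\<lambda>x. g (x + h n)) + nnL1 (\<lambda>x. g (x + h n)) f"
      by (intro nnL1_triangle m f)
    also have "nnL1 (\<lambda>x. f (x + h n)) (\<lambda>x. g (x + h n)) = nnL1 f g"
      by (rule nnL1_shift[OF f g(1)])
    also have "nnL1 (\<lambda>x. g (x + h n)) f \<le> nnL1 (\<lambda>x. g (x + h n)) g + nnL1 g f"
      by (intro nnL1_triangle m f g)
    also have "nnL1 f g + (nnL1 (\<lambda>x. g (x + h n)) g + nnL1 g f) \<le> ennreal (e/3) + (ennreal (e/3) + ennreal (e/3))"
      using g(2) n by (intro add_mono) (simp_all add: nnL1_commute[of g f])
    also have "\<dots> = ennreal e"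
      using \<open>e > 0\<close> by (simp add: ennreal_plus[symmetric] del: ennreal_plus)
    finally show "nnL1 (\<lambda>x. f (x + h n)) f \<le> ennreal e" by (simp add: add_left_mono)
  qed
qed

text \<open>The modulus of the difference is the sum of both indicators minus twice their product.
  At a point of \<open>T\<close> openness makes the product eventually 1, so its integral tends to
  the measure of \<open>T\<close>, even if the boundary of \<open>T\<close> has positive
  measure.\<close>

lemma L1_translation_open:
  fixes T :: "'a::euclidean_space set"
  assumes T: "open T" "emeasure lborel T < \<infinity>" and h: "h \<longlonglongrightarrow> 0"
  shows "(\<lambda>n. nnL1 (\<lambda>x. indicat_real T (x + h n)) (indicat_real T)) \<longlonglongrightarrow> 0"
proof -
  let ?i = "indicat_real T"
  have TB [measurable]: "T \<in> sets borel" using T(1) by simp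
  have I: "integrable lborel ?i" using T(2) by (simp add: integrable_indicator_iff)
  have Is: "integrable lborel (\<lambda>x. ?i (x + k))" for k
    using lborel_shift(1)[of ?i k] I by simp
  have Ip: "integrable lborel (\<lambda>x. ?i x * ?i (x + k))" for k
    by (rule Bochner_Integration.integrable_bound[OF I]) (auto simp: indicator_def)
  have "(\<lambda>n. LINT x|lborel. ?i x * ?i (x + h n)) \<longlonglongrightarrow> (LINT x|lborel. ?i x)"
  proof (rule integral_dominated_convergence[where w="?i"])
    show "AE x in lborel. (\<lambda>n. ?i x * ?i (x + h n)) \<longlonglongrightarrow> ?i x"
    proof (rule AE_I2)
      fix x
      show "(\<lambda>n. ?i x * ?i (x + h n)) \<longlonglongrightarrow> ?i x"
      proof (cases "x \<in> T")
        case True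
        have "(\<lambda>n. x + h n) \<longlonglongrightarrow> x + 0" by (intro tendsto_add tendsto_const h)
        then have "eventually (\<lambda>n. x + h n \<in> T) sequentially"
          using topological_tendstoD[OF _ T(1)] True by fastforce
        then have "eventually (\<lambda>n. ?i x * ?i (x + h n) = ?i x) sequentially"
          by eventually_elim (simp add: True)
        then show ?thesis by (rule tendsto_eventually)
      qed simp
    qed
    show "AE x in lborel. norm (?i x * ?i (x + h n)) \<le> ?i x" for n
      by (rule AE_I2) (auto simp: indicator_def)
  qed (use I in auto)
  then have lim: "(\<lambda>n. 2 * (LINT x|lborel. ?i x) - 2 * (LINT x|lborel. ?i x * ?i (x + h n))) \<longlonglongrightarrow> 2 * (LINT x|lborel. ?i x) - 2 * (LINT x|lborel. ?i x)"
    by (intro tendsto_intros)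
  have "nnL1 (\<lambda>x. ?i (x + h n)) ?i = ennreal (2 * (LINT x|lborel. ?i x) - 2 * (LINT x|lborel. ?i x * ?i (x + h n)))" for n
  proof -
    have eq: "\<bar>?i (x + h n) - ?i x\<bar> = ?i (x + h n) + ?i x - 2 * (?i x * ?i (x + h n))" for x
      by (auto simp: indicator_def)
    have "(LINT x|lborel. \<bar>?i (x + h n) - ?i x\<bar>) = (LINT x|lborel. ?i (x + h n)) + (LINT x|lborel. ?i x) - 2 * (LINT x|lborel. ?i x * ?i (x + h n))"
      unfolding eq using I Is Ip by simp
    then show ?thesis
      unfolding nnL1_integral[OF Is I] using lborel_shift(2)[of ?i "h n"] by simp
  qed
  then show ?thesis using tendsto_ennrealI[OF lim] by simp
qed

text \<open>Indicators of open sets play the part usually given to continuous functions: outer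
  regularity handles arbitrary sets, and induction over integrable functions does the rest.\<close>

lemma L1_translation_tendsto:
  fixes f :: "'a::euclidean_space \<Rightarrow> real"
  assumes "integrable lborel f" and h: "h \<longlonglongrightarrow> 0"
  shows "(\<lambda>n. nnL1 (\<lambda>x. f (x + h n)) f) \<longlonglongrightarrow> 0"
  using assms(1)
proof (induction rule: integrable_induct)
  case (base A c)
  have A: "A \<in> sets borel" using base(1) by simp
  show ?case
  proof (rule L1_translation_approx[where f="\<lambda>x. indicat_real A x *\<^sub>R c" and h=h])
    show "(\<lambda>x. indicat_real A x *\<^sub>R c) \<in> borel_measurable borel" using A by measurable
    fix e :: real assume e: "e > 0"
    \<comment> \<open>The added 1 covers c = 0, and multiplication by |c| still gives at most
      e.\<close>
    have e': "e / (\<bar>c\<bar> + 1) > 0" using e by simp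
    have AL: "A \<in> sets lebesgue" using A by simp
    obtain T where T: "open T" "A \<subseteq> T" "T - A \<in> lmeasurable" "emeasure lebesgue (T - A) < ennreal (e / (\<bar>c\<bar> + 1))"
      using sets_lebesgue_outer_open[OF AL e'] .
    have TB: "T \<in> sets borel" using T(1) by simp
    have TA: "emeasure lborel (T - A) < ennreal (e / (\<bar>c\<bar> + 1))" using T(4) TB A by simp
    have "emeasure lborel T \<le> emeasure lborel A + emeasure lborel (T - A)"
      using T(2) TB A emeasure_subadditive[of A lborel "T - A"] by (simp add: Un_absorb1)
    also have "\<dots> < \<infinity>"
      using base(2) TA by (auto simp: less_top[symmetric])
    finally have Tfin: "emeasure lborel T < \<infinity>" .
    have 1: "nnL1 (\<lambda>x. indicat_real A x *\<^sub>R c) (\<lambda>x. c * indicat_real T x) \<le> ennreal e"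
    proof -
      have "nnL1 (\<lambda>x. indicat_real A x *\<^sub>R c) (\<lambda>x. c * indicat_real T x) = (\<integral>\<^sup>+x. ennreal \<bar>c\<bar> * indicator (T - A) x \<partial>lborel)"
        unfolding nnL1_def using T(2) by (intro nn_integral_cong) (auto simp: indicator_def)
      also have "\<dots> = ennreal \<bar>c\<bar> * emeasure lborel (T - A)"
        using TB A by (intro nn_integral_cmult_indicator) auto
      also have "\<dots> \<le> ennreal \<bar>c\<bar> * ennreal (e / (\<bar>c\<bar> + 1))"
        using TA by (intro mult_left_mono) auto
      also have "\<dots> = ennreal (\<bar>c\<bar> * (e / (\<bar>c\<bar> + 1)))"
        by (rule ennreal_mult[OF abs_ge_zero less_imp_le[OF e'], symmetric])
      also have "\<dots> \<le> ennreal e"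
        using e by (intro ennreal_leI) (simp add: field_simps)
      finally show ?thesis .
    qed
    have 2: "(\<lambda>n. nnL1 (\<lambda>x. c * indicat_real T (x + h n)) (\<lambda>x. c * indicat_real T x)) \<longlonglongrightarrow> 0"
    proof -
      have "nnL1 (\<lambda>x. c * indicat_real T (x + k)) (\<lambda>x. c * indicat_real T x) = ennreal \<bar>c\<bar> * nnL1 (\<lambda>x. indicat_real T (x + k)) (indicat_real T)" for k
        unfolding nnL1_def using TB
        by (subst nn_integral_cmult[symmetric]) (auto simp: ennreal_mult[symmetric] abs_mult[symmetric] right_diff_distrib intro!: nn_integral_cong)
      moreover have "(\<lambda>n. ennreal \<bar>c\<bar> * nnL1 (\<lambda>x. indicat_real T (x + h n)) (indicat_real T)) \<longlonglongrightarrow> ennreal \<bar>c\<bar> * 0"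
        by (intro ennreal_tendsto_cmult L1_translation_open[OF T(1) Tfin h]) simp
      ultimately show ?thesis by simp
    qed
    show "\<exists>g\<in>borel_measurable borel. nnL1 (\<lambda>x. indicat_real A x *\<^sub>R c) g \<le> ennreal e \<and> (\<lambda>n. nnL1 (\<lambda>x. g (x + h n)) g) \<longlonglongrightarrow> 0"
      using 1 2 TB by (intro bexI[of _ "\<lambda>x. c * indicat_real T x"] conjI) auto
  qed
next
  case (add f g)
  have [measurable]: "f \<in> borel_measurable borel" "g \<in> borel_measurable borel"
    using add.hyps[THEN borel_measurable_integrable] by simp_all
  have "nnL1 (\<lambda>x. f (x + k) + g (x + k)) (\<lambda>x. f x + g x) \<le> nnL1 (\<lambda>x. f (x + k)) f + nnL1 (\<lambda>x. g (x + k)) g" for k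
  proof -
    have "nnL1 (\<lambda>x. f (x + k) + g (x + k)) (\<lambda>x. f x + g x) \<le> (\<integral>\<^sup>+x. ennreal \<bar>f (x + k) - f x\<bar> + ennreal \<bar>g (x + k) - g x\<bar> \<partial>lborel)"
      unfolding nnL1_def by (intro nn_integral_mono) (simp add: ennreal_plus[symmetric] ennreal_leI del: ennreal_plus)
    also have "\<dots> = nnL1 (\<lambda>x. f (x + k)) f + nnL1 (\<lambda>x. g (x + k)) g"
      unfolding nnL1_def by (intro nn_integral_add) simp_all
    finally show ?thesis .
  qed
  then have le: "\<forall>n. nnL1 (\<lambda>x. f (x + h n) + g (x + h n)) (\<lambda>x. f x + g x) \<le> nnL1 (\<lambda>x. f (x + h n)) f + nnL1 (\<lambda>x. g (x + h n)) g"
    by blast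
  have lim: "(\<lambda>n. nnL1 (\<lambda>x. f (x + h n)) f + nnL1 (\<lambda>x. g (x + h n)) g) \<longlonglongrightarrow> 0"
    using tendsto_add[OF add.IH] by simp
  show ?case
  proof (rule tendsto_sandwich[OF _ _ tendsto_const lim])
    show "\<forall>\<^sub>F n in sequentially. 0 \<le> nnL1 (\<lambda>x. f (x + h n) + g (x + h n)) (\<lambda>x. f x + g x)" by simp
    show "\<forall>\<^sub>F n in sequentially. nnL1 (\<lambda>x. f (x + h n) + g (x + h n)) (\<lambda>x. f x + g x) \<le> nnL1 (\<lambda>x. f (x + h n)) f + nnL1 (\<lambda>x. g (x + h n)) g"
      by (rule always_eventually[OF le])
  qed
next
  case (lim f s)
  have f: "f \<in> borel_measurable borel" and s: "\<And>i. s i \<in> borel_measurable borel"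
    using lim.hyps(1,4)[THEN borel_measurable_integrable] by simp_all
  show ?case
  proof (rule L1_translation_approx[OF f])
    fix e :: real assume e: "e > 0"
    \<comment> \<open>Dominated convergence: the approximating functions satisfy |s_i| \<le> 2 |f|,
      hence the bound 3 |f|.\<close>
    have "(\<lambda>i. LINT x|lborel. \<bar>f x - s i x\<bar>) \<longlonglongrightarrow> (LINT x|(lborel::'a measure). 0)"
    proof (rule integral_dominated_convergence[where w="\<lambda>x. 3 * \<bar>f x\<bar>"])
      show "AE x in lborel. (\<lambda>i. \<bar>f x - s i x\<bar>) \<longlonglongrightarrow> 0"
      proof (rule AE_I2)
        fix x
        have "(\<lambda>i. \<bar>f x - s i x\<bar>) \<longlonglongrightarrow> \<bar>f x - f x\<bar>"
          using lim.hyps(2)[of x] by (intro tendsto_intros) simp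
        then show "(\<lambda>i. \<bar>f x - s i x\<bar>) \<longlonglongrightarrow> 0" by simp
      qed
      show "AE x in lborel. norm \<bar>f x - s i x\<bar> \<le> 3 * \<bar>f x\<bar>" for i
      proof (rule AE_I2)
        fix x
        have "\<bar>s i x\<bar> \<le> 2 * \<bar>f x\<bar>" using lim.hyps(3)[of x i] by simp
        then show "norm \<bar>f x - s i x\<bar> \<le> 3 * \<bar>f x\<bar>" by simp
      qed
    qed (use lim.hyps(4) f s in auto)
    then have "eventually (\<lambda>i. (LINT x|lborel. \<bar>f x - s i x\<bar>) < e) sequentially"
      using e by (intro order_tendstoD(2)) simp_all
    then obtain i where "(LINT x|lborel. \<bar>f x - s i x\<bar>) < e"
      by (auto simp: eventually_sequentially)
    then have "nnL1 f (s i) \<le> ennreal e"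
      unfolding nnL1_integral[OF lim.hyps(4) lim.hyps(1)] by (intro ennreal_leI) simp
    then show "\<exists>g\<in>borel_measurable borel. nnL1 f g \<le> ennreal e \<and> (\<lambda>n. nnL1 (\<lambda>x. g (x + h n)) g) \<longlonglongrightarrow> 0"
      using s lim.IH by blast
  qed
qed

text \<open>A failure at every scale would produce a null sequence of vectors contradicting the
  sequential version. The uniform form over a ball is the one that kernels of small support call
  for.\<close>

lemma L1_translation:
  fixes f :: "'a::euclidean_space \<Rightarrow> real"
  assumes f: "integrable lborel f" and e: "e > 0"
  shows "\<exists>d>0. \<forall>z. norm z < d \<longrightarrow> nnL1 (\<lambda>x. f (x + z)) f \<le> ennreal e"
proof (rule ccontr)
  assume contra: "\<not> ?thesis"
  have "\<exists>z. norm z < 1 / real (Suc n) \<and> \<not> nnL1 (\<lambda>x. f (x + z)) f \<le> ennreal e" for n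
  proof -
    have "1 / real (Suc n) > 0" by simp
    then show ?thesis using contra by blast
  qed
  then obtain z where z: "\<And>n. norm (z n) < 1 / real (Suc n)" "\<And>n. \<not> nnL1 (\<lambda>x. f (x + z n)) f \<le> ennreal e"
    by metis
  have "z \<longlonglongrightarrow> 0"
    by (rule Lim_null_comparison[OF always_eventually LIMSEQ_Suc[OF lim_const_over_n[of 1]]])
      (intro allI less_imp_le z(1))
  then have "eventually (\<lambda>n. nnL1 (\<lambda>x. f (x + z n)) f \<le> ennreal e) sequentially"
    by (rule ennreal_tendsto_0D[OF L1_translation_tendsto[OF f] e])
  then show False using z(2) by simp
qed

definition conv :: "('a::euclidean_space \<Rightarrow> real) \<Rightarrow> ('a \<Rightarrow> real) \<Rightarrow> 'a \<Rightarrow> real" where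
  "conv k f x = (LINT y|lborel. k (x - y) * f y)"

definition conv_grad :: "('a::euclidean_space \<Rightarrow> 'a) \<Rightarrow> ('a \<Rightarrow> real) \<Rightarrow> 'a \<Rightarrow> 'a" where
  "conv_grad \<kappa> f x = (LINT y|lborel. f y *\<^sub>R \<kappa> (x - y))"

text \<open>Points closer than 1 lie either both in the compact ball of radius r + 1 or both where G
  vanishes.\<close>

lemma uniformly_continuous_bounded_support:
  fixes G :: "'a::euclidean_space \<Rightarrow> 'b::euclidean_space"
  assumes c: "continuous_on UNIV G" and r: "\<And>x. r \<le> norm x \<Longrightarrow> G x = 0" and e: "e > 0"
  shows "\<exists>d>0. \<forall>x y. norm (x - y) < d \<longrightarrow> norm (G x - G y) \<le> e"
proof -
  have "uniformly_continuous_on (cball 0 (r + 1)) G"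
    using c by (intro compact_uniformly_continuous compact_cball continuous_on_subset[OF c]) simp
  then obtain d where d: "d > 0" "\<And>x y. x \<in> cball 0 (r + 1) \<Longrightarrow> y \<in> cball 0 (r + 1) \<Longrightarrow> dist y x < d \<Longrightarrow> dist (G y) (G x) < e"
    unfolding uniformly_continuous_on_def using e by metis
  have "norm (G x - G y) \<le> e" if xy: "norm (x - y) < min d 1" for x y
  proof (cases "norm x \<le> r + 1 \<and> norm y \<le> r + 1")
    case True
    then show ?thesis using d(2)[of y x] xy by (simp add: dist_norm norm_minus_commute)
  next
    case False
    have "norm x \<le> norm y + norm (x - y)" "norm y \<le> norm x + norm (x - y)"
      using norm_triangle_sub[of x y] norm_triangle_sub[of y x] by (simp_all add: norm_minus_commute)
    then have "r \<le> norm x" "r \<le> norm y" using False xy by linarith+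
    then show ?thesis using r e by simp
  qed
  then show ?thesis using d(1) by (intro exI[of _ "min d 1"]) simp
qed

lemma conv_integrable:
  fixes \<kappa> :: "'a::euclidean_space \<Rightarrow> 'b::euclidean_space"
  assumes \<kappa>: "continuous_on UNIV \<kappa>" "\<And>x. norm (\<kappa> x) \<le> M" and f: "integrable lborel f"
  shows "integrable lborel (\<lambda>y. f y *\<^sub>R \<kappa> (x - y))"
proof (rule Bochner_Integration.integrable_bound)
  have [measurable]: "\<kappa> \<in> borel_measurable borel" using \<kappa>(1) by (rule borel_measurable_continuous_onI)
  note [measurable] = borel_measurable_integrable[OF f]
  show "(\<lambda>y. f y *\<^sub>R \<kappa> (x - y)) \<in> borel_measurable lborel" by measurable
  show "integrable lborel (\<lambda>y. \<bar>f y\<bar> * M)" using f by (intro integrable_mult_left integrable_abs)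
  have "0 \<le> M" using order_trans[OF norm_ge_zero \<kappa>(2)] .
  then show "AE y in lborel. norm (f y *\<^sub>R \<kappa> (x - y)) \<le> norm (\<bar>f y\<bar> * M)"
    using \<kappa>(2) by (intro AE_I2) (simp add: mult_left_mono)
qed

text \<open>f is only integrable, so the derivative has to fall on the kernel. Uniform continuity of
  \<kappa> makes the first-order remainder of k small uniformly in y, and it is then integrated
  against |f|.\<close>

lemma C1_grad_conv:
  assumes C: "C1c k \<kappa>" and f: "integrable lborel f"
  shows "C1_grad (conv k f) (conv_grad \<kappa> f)"
proof -
  note D = C1_gradD[OF C1cD[OF C]]
  obtain r where r: "\<And>x. r \<le> norm x \<Longrightarrow> k x = 0" "\<And>x. r \<le> norm x \<Longrightarrow> \<kappa> x = 0"
    using C by (auto simp: C1c_def)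
  obtain M where M: "\<And>x. norm (\<kappa> x) \<le> M" using C1c_integrable(3)[OF C] by blast
  obtain M' where M': "\<And>x. norm (k x) \<le> M'" using C1c_integrable(4)[OF C] by auto
  have i1: "integrable lborel (\<lambda>y. k (x - y) * f y)" for x
    using conv_integrable[OF D(2) M' f, of x] by (simp add: mult.commute)
  have i2: "integrable lborel (\<lambda>y. f y *\<^sub>R \<kappa> (x - y))" for x
    by (rule conv_integrable[OF D(3) M f])
  have fa: "integrable lborel (\<lambda>y. \<bar>f y\<bar>)" using f by (rule integrable_abs)
  define A where "A = (LINT y|lborel. \<bar>f y\<bar>)"
  have A: "A \<ge> 0" unfolding A_def by (intro Bochner_Integration.integral_nonneg) auto
  \<comment> \<open>Division by A + 1 absorbs the factor A, the L^1 norm of f, also when A =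
    0.\<close>
  have uc: "\<exists>d>0. \<forall>x y. norm (x - y) < d \<longrightarrow> norm (\<kappa> x - \<kappa> y) \<le> e / (A + 1)" if "e > 0" for e
    using that A by (intro uniformly_continuous_bounded_support[OF D(3) r(2)]) auto
  have small: "e / (A + 1) * A \<le> e" if "e > 0" for e
    using that A by (simp add: field_simps)
  show ?thesis
    unfolding C1_grad_def
  proof (intro conjI allI)
    show "continuous_on UNIV (conv_grad \<kappa> f)"
      unfolding continuous_on_iff
    proof (intro ballI allI impI)
      fix x :: 'a and e :: real assume e: "e > 0"
      obtain d where d: "d > 0" "\<And>x y. norm (x - y) < d \<Longrightarrow> norm (\<kappa> x - \<kappa> y) \<le> e / 2 / (A + 1)"
        using uc[of "e / 2"] e by auto
      have "norm (conv_grad \<kappa> f x' - conv_grad \<kappa> f x) < e" if x': "norm (x' - x) < d" for x'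
      proof -
        have "norm (conv_grad \<kappa> f x' - conv_grad \<kappa> f x) = norm (LINT y|lborel. f y *\<^sub>R (\<kappa> (x' - y) - \<kappa> (x - y)))"
          unfolding conv_grad_def using i2 by (simp add: scaleR_diff_right)
        also have "\<dots> \<le> (LINT y|lborel. e / 2 / (A + 1) * \<bar>f y\<bar>)"
        proof (rule Bochner_Integration.integral_norm_bound_integral)
          show "integrable lborel (\<lambda>y. f y *\<^sub>R (\<kappa> (x' - y) - \<kappa> (x - y)))"
            unfolding scaleR_diff_right by (intro Bochner_Integration.integrable_diff i2)
          fix y
          have "norm (\<kappa> (x' - y) - \<kappa> (x - y)) \<le> e / 2 / (A + 1)" using x' by (intro d(2)) simp
          then have "\<bar>f y\<bar> * norm (\<kappa> (x' - y) - \<kappa> (x - y)) \<le> \<bar>f y\<bar> * (e / 2 / (A + 1))" by (intro mult_left_mono) auto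
          then show "norm (f y *\<^sub>R (\<kappa> (x' - y) - \<kappa> (x - y))) \<le> e / 2 / (A + 1) * \<bar>f y\<bar>" by (simp add: mult.commute)
        qed (intro integrable_mult_right fa)
        also have "\<dots> = e / 2 / (A + 1) * A" by (simp add: A_def)
        also have "\<dots> \<le> e / 2" by (rule small) (use e in simp)
        also have "\<dots> < e" using e by simp
        finally show ?thesis .
      qed
      then show "\<exists>d>0. \<forall>x'\<in>UNIV. dist x' x < d \<longrightarrow> dist (conv_grad \<kappa> f x') (conv_grad \<kappa> f x) < e"
        using d(1) by (intro exI[of _ d]) (simp add: dist_norm)
    qed
    fix x
    show "(conv k f has_derivative (\<lambda>h. conv_grad \<kappa> f x \<bullet> h)) (at x)"
      unfolding has_derivative_at_alt
    proof (intro conjI allI impI bounded_linear_inner_right)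
      fix e :: real assume e: "e > 0"
      obtain d where d: "d > 0" "\<And>x y. norm (x - y) < d \<Longrightarrow> norm (\<kappa> x - \<kappa> y) \<le> e / (A + 1)"
        using uc[OF e] by blast
      have "norm (conv k f x' - conv k f x - conv_grad \<kappa> f x \<bullet> (x' - x)) \<le> e * norm (x' - x)" if x': "norm (x' - x) < d" for x'
      proof -
        let ?R = "\<lambda>y. k (x' - y) - k (x - y) - \<kappa> (x - y) \<bullet> (x' - x)"
        have R: "\<bar>?R y\<bar> \<le> norm (x' - x) * (e / (A + 1))" for y
        proof -
          have "norm (k (x' - y) - k (x - y) - \<kappa> (x - y) \<bullet> ((x' - y) - (x - y))) \<le> norm ((x' - y) - (x - y)) * (e / (A + 1))"
          proof (rule differentiable_bound_linearization[where S="ball (x - y) d" and f'="\<lambda>z h. \<kappa> z \<bullet> h" and a="x - y" and b="x' - y" and f=k])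
            fix t :: real assume t: "t \<in> {0..1}"
            have "t * norm (x' - x) \<le> norm (x' - x)" using t by (simp add: mult_left_le_one_le)
            then show "(x - y) + t *\<^sub>R ((x' - y) - (x - y)) \<in> ball (x - y) d"
              using t x' by (simp add: dist_norm)
          next
            fix z assume z: "z \<in> ball (x - y) d"
            show "(k has_derivative (\<lambda>h. \<kappa> z \<bullet> h)) (at z within ball (x - y) d)"
              by (rule has_derivative_at_withinI[OF D(1)])
            have "norm (\<kappa> z - \<kappa> (x - y)) \<le> e / (A + 1)"
              using z by (intro d(2)) (simp add: dist_norm norm_minus_commute)
            then show "onorm ((\<lambda>h. \<kappa> z \<bullet> h) - (\<lambda>h. \<kappa> (x - y) \<bullet> h)) \<le> e / (A + 1)"
            proof (intro onorm_bound)
              fix h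
              have "\<bar>(\<kappa> z - \<kappa> (x - y)) \<bullet> h\<bar> \<le> norm (\<kappa> z - \<kappa> (x - y)) * norm h" by (rule Cauchy_Schwarz_ineq2)
              also have "\<dots> \<le> e / (A + 1) * norm h"
                using \<open>norm (\<kappa> z - \<kappa> (x - y)) \<le> e / (A + 1)\<close> by (rule mult_right_mono) simp
              finally show "norm (((\<lambda>h. \<kappa> z \<bullet> h) - (\<lambda>h. \<kappa> (x - y) \<bullet> h)) h) \<le> e / (A + 1) * norm h"
                by (simp add: inner_diff_left)
            qed (use e A in simp)
          next
            show "x - y \<in> ball (x - y) d" using d(1) by simp
          qed
          then show ?thesis by simp
        qed
        have eq: "conv k f x' - conv k f x - conv_grad \<kappa> f x \<bullet> (x' - x) = (LINT y|lborel. f y * ?R y)"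
        proof -
          have "conv_grad \<kappa> f x \<bullet> (x' - x) = (LINT y|lborel. (f y *\<^sub>R \<kappa> (x - y)) \<bullet> (x' - x))"
            unfolding conv_grad_def by (rule integral_inner_left[symmetric]) (use i2 in blast)
          moreover have "(\<lambda>y. f y * ?R y) = (\<lambda>y. k (x' - y) * f y - k (x - y) * f y - (f y *\<^sub>R \<kappa> (x - y)) \<bullet> (x' - x))"
            by (simp add: fun_eq_iff algebra_simps)
          moreover have "integrable lborel (\<lambda>y. (f y *\<^sub>R \<kappa> (x - y)) \<bullet> (x' - x))"
            using i2 by (intro integrable_inner_left)
          ultimately show ?thesis
            unfolding conv_def using i1 by (simp only: Bochner_Integration.integral_diff Bochner_Integration.integrable_diff)
        qed
        have iR: "integrable lborel (\<lambda>y. f y * ?R y)"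
        proof -
          have "integrable lborel (\<lambda>y. k (x' - y) * f y - k (x - y) * f y - (f y *\<^sub>R \<kappa> (x - y)) \<bullet> (x' - x))"
            using i1 i2 by (intro Bochner_Integration.integrable_diff integrable_inner_left)
          then show ?thesis by (rule Bochner_Integration.integrable_cong[THEN iffD1, rotated 2]) (simp_all add: algebra_simps)
        qed
        have "norm (LINT y|lborel. f y * ?R y) \<le> (LINT y|lborel. norm (x' - x) * (e / (A + 1)) * \<bar>f y\<bar>)"
        proof (rule Bochner_Integration.integral_norm_bound_integral[OF iR])
          fix y
          have "\<bar>f y\<bar> * \<bar>?R y\<bar> \<le> \<bar>f y\<bar> * (norm (x' - x) * (e / (A + 1)))" by (intro mult_left_mono R) simp
          then show "norm (f y * ?R y) \<le> norm (x' - x) * (e / (A + 1)) * \<bar>f y\<bar>" by (simp add: abs_mult mult.commute)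
        qed (intro integrable_mult_right fa)
        also have "\<dots> = norm (x' - x) * (e / (A + 1) * A)" by (simp add: A_def)
        also have "\<dots> \<le> norm (x' - x) * e" by (intro mult_left_mono small e) simp
        finally show ?thesis by (simp only: eq mult.commute)
      qed
      then show "\<exists>d>0. \<forall>y. norm (y - x) < d \<longrightarrow> norm (conv k f y - conv k f x - conv_grad \<kappa> f x \<bullet> (y - x)) \<le> e * norm (y - x)"
        using d(1) by blast
    qed
  qed
qed

lemma C1c_conv:
  assumes C: "C1c k \<kappa>" and f: "integrable lborel f" and R: "\<And>x. R \<le> norm x \<Longrightarrow> f x = 0"
  shows "C1c (conv k f) (conv_grad \<kappa> f)"
proof -
  obtain r where r: "r > 0" "\<And>x. r \<le> norm x \<Longrightarrow> k x = 0" "\<And>x. r \<le> norm x \<Longrightarrow> \<kappa> x = 0"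
    using C by (auto simp: C1c_def)
  have "conv k f x = 0 \<and> conv_grad \<kappa> f x = 0" if x: "\<bar>R\<bar> + r \<le> norm x" for x
  proof -
    have "f y = 0 \<or> (k (x - y) = 0 \<and> \<kappa> (x - y) = 0)" for y
    proof (cases "R \<le> norm y")
      case False
      then have "r \<le> norm (x - y)" using x norm_triangle_ineq2[of x y] by linarith
      then show ?thesis using r by simp
    qed (simp add: R)
    then have "(\<lambda>y. k (x - y) * f y) = (\<lambda>y. 0)" "(\<lambda>y. f y *\<^sub>R \<kappa> (x - y)) = (\<lambda>y. 0)"
      by (metis mult_eq_0_iff, metis scaleR_eq_0_iff)
    then show ?thesis by (simp add: conv_def conv_grad_def)
  qed
  then show ?thesis
    unfolding C1c_def using C1_grad_conv[OF C f] r(1) by (intro conjI exI[of _ "\<bar>R\<bar> + r"]) auto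
qed

text \<open>What the convolution estimates ask of a mollifier at scale \<delta>: a C^1 probability
  density with gradient \<kappa>, supported in a ball of radius \<delta>.\<close>

definition kernel :: "real \<Rightarrow> ('a::euclidean_space \<Rightarrow> real) \<Rightarrow> ('a \<Rightarrow> 'a) \<Rightarrow> bool" where
  "kernel \<delta> k \<kappa> \<longleftrightarrow> C1c k \<kappa> \<and> (\<forall>x. 0 \<le> k x) \<and> (\<forall>x. \<delta> \<le> norm x \<longrightarrow> k x = 0 \<and> \<kappa> x = 0) \<and> (LINT x|lborel. k x) = 1"

text \<open>As k has mass one, the convolution minus f is an average of translation differences of f
  over vectors shorter than \<delta>, and the L^1 norm of an average is at most the average of the
  L^1 norms.\<close>

lemma conv_L1_close:
  assumes K: "kernel \<delta> k \<kappa>" and f: "integrable lborel f"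
    and e: "\<And>z. norm z < \<delta> \<Longrightarrow> nnL1 (\<lambda>x. f (x + z)) f \<le> e"
  shows "nnL1 (conv k f) f \<le> e"
proof -
  have C: "C1c k \<kappa>" and nn: "\<And>x. 0 \<le> k x" and supp: "\<And>x. \<delta> \<le> norm x \<Longrightarrow> k x = 0" and one: "(LINT x|lborel. k x) = 1"
    using K by (auto simp: kernel_def)
  note D = C1_gradD[OF C1cD[OF C]]
  note [measurable] = D(4)
  have [measurable]: "f \<in> borel_measurable borel" using borel_measurable_integrable[OF f] by simp
  obtain M' where M': "\<And>x. norm (k x) \<le> M'" using C1c_integrable(4)[OF C] by auto
  have i1: "integrable lborel (\<lambda>y. k (x - y) * f y)" for x
    using conv_integrable[OF D(2) M' f, of x] by (simp add: mult.commute)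
  have ik: "integrable lborel (\<lambda>y. k (x - y))" for x
    using lborel_reflect(1)[OF D(4)] C1c_integrable(1)[OF C] by blast
  have k1: "(\<integral>\<^sup>+z. ennreal (k z) \<partial>lborel) = 1"
    using nn_integral_eq_integral[OF C1c_integrable(1)[OF C]] nn one by simp
  have "ennreal \<bar>conv k f x - f x\<bar> \<le> (\<integral>\<^sup>+z. ennreal (k z) * ennreal \<bar>f (x - z) - f x\<bar> \<partial>lborel)" for x
  proof -
    have "(LINT y|lborel. k (x - y)) = 1" using lborel_reflect(2)[OF D(4)] one by simp
    then have E: "conv k f x - f x = (LINT y|lborel. k (x - y) * f y - k (x - y) * f x)"
      unfolding conv_def using i1 ik by simp
    have I: "integrable lborel (\<lambda>y. k (x - y) * f y - k (x - y) * f x)" using i1 ik by simp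
    have "ennreal \<bar>conv k f x - f x\<bar> \<le> (\<integral>\<^sup>+y. ennreal (norm (k (x - y) * f y - k (x - y) * f x)) \<partial>lborel)"
      using integral_norm_bound_ennreal[OF I] unfolding E[symmetric] real_norm_def[of "conv k f x - f x"] .
    also have "\<dots> = (\<integral>\<^sup>+y. (\<lambda>z. ennreal (k z) * ennreal \<bar>f (x - z) - f x\<bar>) (x - y) \<partial>lborel)"
      using nn by (intro nn_integral_cong) (simp add: ennreal_mult[symmetric] right_diff_distrib[symmetric] abs_mult)
    also have "\<dots> = (\<integral>\<^sup>+z. ennreal (k z) * ennreal \<bar>f (x - z) - f x\<bar> \<partial>lborel)"
      by (rule nn_integral_lborel_reflect) measurable
    finally show ?thesis .
  qed
  then have "nnL1 (conv k f) f \<le> (\<integral>\<^sup>+x. (\<integral>\<^sup>+z. ennreal (k z) * ennreal \<bar>f (x - z) - f x\<bar> \<partial>lborel) \<partial>lborel)"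
    unfolding nnL1_def by (intro nn_integral_mono)
  also have "\<dots> = (\<integral>\<^sup>+z. (\<integral>\<^sup>+x. ennreal (k z) * ennreal \<bar>f (x - z) - f x\<bar> \<partial>lborel) \<partial>lborel)"
    by (rule nn_Fubini[symmetric]) measurable
  also have "\<dots> = (\<integral>\<^sup>+z. ennreal (k z) * nnL1 (\<lambda>x. f (x + - z)) f \<partial>lborel)"
    unfolding nnL1_def by (intro nn_integral_cong) (simp add: nn_integral_cmult)
  also have "\<dots> \<le> (\<integral>\<^sup>+z. ennreal (k z) * e \<partial>lborel)"
  proof (rule nn_integral_mono)
    fix z
    show "ennreal (k z) * nnL1 (\<lambda>x. f (x + - z)) f \<le> ennreal (k z) * e"
    proof (cases "norm z < \<delta>")
      case True
      then show ?thesis using e[of "- z"] by (intro mult_left_mono) simp_all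
    qed (simp add: supp)
  qed
  also have "\<dots> = e"
    using k1 by (subst nn_integral_multc) simp_all
  finally show ?thesis .
qed

lemma conv_tendsto_L1:
  assumes K: "\<And>j. kernel (\<delta> j) (k j) (\<kappa> j)" and \<delta>: "\<delta> \<longlonglongrightarrow> 0" and f: "integrable lborel f"
  shows "(\<lambda>j. nnL1 (conv (k j) f) f) \<longlonglongrightarrow> 0"
proof (rule ennreal_tendsto_0I)
  fix e :: real assume "e > 0"
  then obtain d where d: "d > 0" "\<And>z. norm z < d \<Longrightarrow> nnL1 (\<lambda>x. f (x + z)) f \<le> ennreal e"
    using L1_translation[OF f] by blast
  have "eventually (\<lambda>j. \<delta> j < d) sequentially" using order_tendstoD(2)[OF \<delta> d(1)] .
  then show "eventually (\<lambda>j. nnL1 (conv (k j) f) f \<le> ennreal e) sequentially"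
    by eventually_elim (rule conv_L1_close[OF K f], rule d(2), simp)
qed

section \<open>The coarea inequality\<close>

text \<open>A C^1 primitive of the positive part.\<close>

definition ramp_sq :: "real \<Rightarrow> real" where "ramp_sq s = (max 0 s)\<^sup>2 / 2"

lemma DERIV_ramp_sq: "(ramp_sq has_real_derivative max 0 s) (at s)"
proof (cases s "0::real" rule: linorder_cases)
  case less
  have "((\<lambda>s::real. 0) has_real_derivative 0) (at s)" by simp
  then have "(ramp_sq has_real_derivative 0) (at s)"
    by (rule has_field_derivative_transform_within_open[of _ _ _ "{..<0}"]) (use less in \<open>auto simp: ramp_sq_def\<close>)
  then show ?thesis using less by simp
next
  case equal
  have "((\<lambda>h. (ramp_sq (0 + h) - ramp_sq 0) / h) \<longlongrightarrow> 0) (at 0)"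
  proof (rule Lim_null_comparison)
    show "\<forall>\<^sub>F h in at 0. norm ((ramp_sq (0 + h) - ramp_sq 0) / h) \<le> \<bar>h\<bar>"
      by (rule always_eventually) (auto simp: ramp_sq_def max_def power2_eq_square)
    have "((\<lambda>h::real. \<bar>h\<bar>) \<longlongrightarrow> \<bar>0\<bar>) (at 0)" by (intro tendsto_rabs tendsto_ident_at)
    then show "((\<lambda>h::real. \<bar>h\<bar>) \<longlongrightarrow> 0) (at 0)" by simp
  qed
  then show ?thesis using equal by (simp add: has_field_derivative_iff)
next
  case greater
  have "((\<lambda>s::real. s\<^sup>2 / 2) has_real_derivative s) (at s)" by (auto intro!: derivative_eq_intros)
  then have "(ramp_sq has_real_derivative s) (at s)"
    by (rule has_field_derivative_transform_within_open[of _ _ _ "{0<..}"]) (use greater in \<open>auto simp: ramp_sq_def\<close>)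
  then show ?thesis using greater by simp
qed

text \<open>The Heaviside function has to be approximated by \<open>C\<^sup>1\<close> functions, so that composition with them preserves
  \<^const>\<open>C1c\<close>.\<close>

definition step :: "real \<Rightarrow> real" where
  "step s = ramp_sq s - 2 * ramp_sq (s - 1) + ramp_sq (s - 2)"

text \<open>The hat function on the interval from 0 to 2 with peak 1 at 1, written as a second
  difference of the positive part. Its integral is 1, so its primitive \<open>step\<close> rises
  from 0 to 1.\<close>

definition tent :: "real \<Rightarrow> real" where
  "tent s = max 0 s - 2 * max 0 (s - 1) + max 0 (s - 2)"

lemma DERIV_step: "(step has_real_derivative tent s) (at s)"
proof -
  have "((\<lambda>s. ramp_sq (s - c)) has_real_derivative max 0 (s - c)) (at s)" for c
  proof -
    have "((\<lambda>s. s - c) has_real_derivative 1) (at s)" by (auto intro!: derivative_eq_intros)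
    then have "((\<lambda>s. ramp_sq (s - c)) has_real_derivative max 0 (s - c) * 1) (at s)"
      by (rule DERIV_chain2[where f=ramp_sq and g="\<lambda>s. s - c", OF DERIV_ramp_sq])
    then show ?thesis by simp
  qed
  from this[of 1] this[of 2] DERIV_ramp_sq[of s] show ?thesis
    unfolding step_def[abs_def] tent_def by (intro DERIV_add DERIV_diff DERIV_cmult)
qed

lemma tent_bounds: "0 \<le> tent s" "tent s \<le> 1" "s \<le> 0 \<Longrightarrow> tent s = 0" "2 \<le> s \<Longrightarrow> tent s = 0"
  by (auto simp: tent_def max_def)

lemma continuous_tent: "continuous_on UNIV tent"
  unfolding tent_def[abs_def] by (intro continuous_intros)

lemma step_eq: "s \<le> 0 \<Longrightarrow> step s = 0" "2 \<le> s \<Longrightarrow> step s = 1"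
  by (auto simp: step_def ramp_sq_def max_def power2_eq_square field_simps)

lemma step_lipschitz: "\<bar>step a - step b\<bar> \<le> \<bar>a - b\<bar>"
proof -
  have "norm (step a - step b) \<le> 1 * norm (a - b)"
    by (rule field_differentiable_bound[where S=UNIV and f'=tent]) (use DERIV_step tent_bounds in auto)
  then show ?thesis by simp
qed

lemma step_bounds: "0 \<le> step s" "step s \<le> 1"
proof -
  have mono: "step a \<le> step b" if "a \<le> b" for a b
    using that DERIV_nonneg_imp_nondecreasing[of a b step] DERIV_step tent_bounds(1) by blast
  show "0 \<le> step s" using mono[of "min s 0" s] step_eq(1)[of "min s 0"] by simp
  show "step s \<le> 1" using mono[of s "max s 2"] step_eq(2)[of "max s 2"] by simp
qed

lemma borel_tent [measurable]: "tent \<in> borel_measurable borel"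
  using continuous_tent by (rule borel_measurable_continuous_onI)

lemma borel_step [measurable]: "step \<in> borel_measurable borel"
  by (intro borel_measurable_continuous_onI continuous_at_imp_continuous_on ballI DERIV_isCont[OF DERIV_step])

lemma nn_integral_tent: "(\<integral>\<^sup>+s. ennreal (tent s) \<partial>lborel) = 1"
proof -
  have "(\<integral>\<^sup>+s. ennreal (tent s) \<partial>lborel) = (\<integral>\<^sup>+s. ennreal (tent s) * indicator {0..2} s \<partial>lborel)"
    using tent_bounds(3,4) by (intro nn_integral_cong) (auto simp: indicator_def)
  also have "\<dots> = ennreal (step 2 - step 0)"
    by (rule nn_integral_FTC_Icc) (auto intro: DERIV_step[THEN DERIV_subset] tent_bounds)
  finally show ?thesis by (simp add: step_eq)
qed

text \<open>Independence of scale and offset is what makes the coarea bound uniform in the smoothing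
  parameter.\<close>

lemma nn_integral_tent_affine:
  assumes "c \<noteq> 0"
  shows "(\<integral>\<^sup>+t. ennreal (\<bar>c\<bar> * tent (a + c * t)) \<partial>lborel) = 1"
proof -
  have "(\<integral>\<^sup>+t. ennreal (\<bar>c\<bar> * tent (a + c * t)) \<partial>lborel) = ennreal \<bar>c\<bar> * (\<integral>\<^sup>+t. ennreal (tent (a + c * t)) \<partial>lborel)"
    using tent_bounds(1) by (subst nn_integral_cmult[symmetric]) (auto simp: ennreal_mult)
  also have "\<dots> = (\<integral>\<^sup>+s. ennreal (tent s) \<partial>lborel)"
    using assms by (intro nn_integral_real_affine[symmetric]) auto
  finally show ?thesis by (simp add: nn_integral_tent)
qed

text \<open>\<^term>\<open>level t y > 0\<close> means \<^term>\<open>y > t\<close> for positive \<^term>\<open>t\<close> and \<^term>\<open>y < t\<close> for negative \<^term>\<open>t\<close>, so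
  that a single real parameter runs through the superlevel sets of both the positive and the negative part.\<close>

definition sg :: "real \<Rightarrow> real" where "sg t = (if 0 < t then 1 else - 1)"

definition level :: "real \<Rightarrow> real \<Rightarrow> real" where "level t y = sg t * y - \<bar>t\<bar>"

lemma borel_sg [measurable]: "sg \<in> borel_measurable borel"
  unfolding sg_def[abs_def] by measurable

lemma abs_sg [simp]: "\<bar>sg t\<bar> = 1" by (simp add: sg_def)

text \<open>For fixed y only levels with the sign of y contribute, since the tent vanishes at
  nonpositive arguments; on these levels the argument is affine in t with slope of modulus
  c.\<close>

lemma nn_integral_tent_level:
  assumes "c > 0"
  shows "(\<integral>\<^sup>+t. ennreal (c * tent (c * level t y)) \<partial>lborel) \<le> 1"
proof (cases "0 \<le> y")
  case True
  have "ennreal (c * tent (c * level t y)) \<le> ennreal (\<bar>- c\<bar> * tent (c * y + (- c) * t))" for t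
  proof (cases "0 < t")
    case True
    then show ?thesis using assms by (simp add: level_def sg_def algebra_simps)
  next
    case False
    then have "c * level t y \<le> 0" using assms \<open>0 \<le> y\<close> by (simp add: level_def sg_def mult_le_0_iff)
    then show ?thesis using tent_bounds(1,3) assms by (simp add: ennreal_leI)
  qed
  then have "(\<integral>\<^sup>+t. ennreal (c * tent (c * level t y)) \<partial>lborel) \<le> (\<integral>\<^sup>+t. ennreal (\<bar>- c\<bar> * tent (c * y + (- c) * t)) \<partial>lborel)"
    by (rule nn_integral_mono)
  also have "\<dots> = 1" using assms by (intro nn_integral_tent_affine) simp
  finally show ?thesis .
next
  case False
  have "ennreal (c * tent (c * level t y)) \<le> ennreal (\<bar>c\<bar> * tent (- c * y + c * t))" for t
  proof (cases "0 < t")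
    case True
    then have "c * level t y \<le> 0" using assms False by (simp add: level_def sg_def mult_le_0_iff)
    then show ?thesis using tent_bounds(1,3) assms by (simp add: ennreal_leI)
  next
    case False
    then show ?thesis using assms by (simp add: level_def sg_def algebra_simps)
  qed
  then have "(\<integral>\<^sup>+t. ennreal (c * tent (c * level t y)) \<partial>lborel) \<le> (\<integral>\<^sup>+t. ennreal (\<bar>c\<bar> * tent (- c * y + c * t)) \<partial>lborel)"
    by (rule nn_integral_mono)
  also have "\<dots> = 1" using assms by (intro nn_integral_tent_affine) simp
  finally show ?thesis .
qed

definition level_set :: "('a \<Rightarrow> real) \<Rightarrow> real \<Rightarrow> 'a set" where
  "level_set f t = {x. 0 < level t (f x)}"

text \<open>A regularisation of the indicator of \<open>level_set f t\<close> from inside: it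
  vanishes off the set and equals 1 where the level is at least 2 / (i + 1).\<close>

definition smooth_level :: "nat \<Rightarrow> real \<Rightarrow> ('a \<Rightarrow> real) \<Rightarrow> 'a \<Rightarrow> real" where
  "smooth_level i t f x = step (real (Suc i) * level t (f x))"

text \<open>The L^1 norm of the gradient of \<open>smooth_level i t F\<close> when \<open>F\<close>
  has gradient \<open>G\<close>.\<close>

definition level_energy :: "nat \<Rightarrow> real \<Rightarrow> ('a::euclidean_space \<Rightarrow> real) \<Rightarrow> ('a \<Rightarrow> 'a) \<Rightarrow> ennreal" where
  "level_energy i t F G = (\<integral>\<^sup>+x. ennreal (real (Suc i) * tent (real (Suc i) * level t (F x))) * ennreal (norm (G x)) \<partial>lborel)"

text \<open>The chain rule. Where \<open>F\<close> vanishes the argument of \<open>step\<close> is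
  at most 0, so the support does not grow.\<close>

lemma C1c_smooth_level:
  fixes F :: "'a::euclidean_space \<Rightarrow> real"
  assumes C: "C1c F G" and t: "t \<noteq> 0"
  shows "\<exists>H. C1c (smooth_level i t F) H \<and> (\<integral>\<^sup>+x. ennreal (norm (H x)) \<partial>lborel) = level_energy i t F G"
proof -
  let ?N = "real (Suc i)"
  define H where "H x = (?N * sg t * tent (?N * level t (F x))) *\<^sub>R G x" for x
  note D = C1_gradD[OF C1cD[OF C]]
  have cl: "continuous_on UNIV (\<lambda>x. ?N * level t (F x))"
    unfolding level_def by (intro continuous_intros D(2))
  have ct: "continuous_on UNIV (\<lambda>x. tent (?N * level t (F x)))"
    using continuous_on_compose2[OF continuous_tent cl] by simp
  have "C1_grad (smooth_level i t F) H"
    unfolding C1_grad_def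
  proof (intro conjI allI)
    show "continuous_on UNIV H"
      unfolding H_def[abs_def] by (intro continuous_on_scaleR continuous_on_mult continuous_on_const ct D(3))
    fix x
    have "((\<lambda>y. ?N * level t y) has_real_derivative (?N * sg t)) (at (F x))"
      unfolding level_def by (auto intro!: derivative_eq_intros)
    from DERIV_chain2[OF DERIV_step this]
    have "((\<lambda>y. step (?N * level t y)) has_derivative (\<lambda>h. tent (?N * level t (F x)) * (?N * sg t) * h)) (at (F x))"
      by (simp add: has_field_derivative_def)
    from has_derivative_compose[OF D(1) this]
    show "(smooth_level i t F has_derivative (\<lambda>h. H x \<bullet> h)) (at x)"
      unfolding smooth_level_def[abs_def] by (rule has_derivative_eq_rhs) (simp add: H_def fun_eq_iff mult_ac)
  qed
  moreover obtain r where r: "r > 0" "\<And>x. r \<le> norm x \<Longrightarrow> F x = 0" "\<And>x. r \<le> norm x \<Longrightarrow> G x = 0"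
    using C by (auto simp: C1c_def)
  have "smooth_level i t F x = 0 \<and> H x = 0" if "r \<le> norm x" for x
    using r(2,3)[OF that] by (simp add: smooth_level_def H_def level_def step_eq(1))
  ultimately have "C1c (smooth_level i t F) H"
    unfolding C1c_def using r(1) by blast
  moreover have "(\<integral>\<^sup>+x. ennreal (norm (H x)) \<partial>lborel) = level_energy i t F G"
    unfolding level_energy_def H_def using tent_bounds(1)
    by (intro nn_integral_cong) (simp add: abs_mult ennreal_mult[symmetric])
  ultimately show ?thesis by blast
qed

lemma borel_level_energy:
  assumes [measurable]: "F \<in> borel_measurable borel" "G \<in> borel_measurable borel"
  shows "(\<lambda>t. level_energy i t F G) \<in> borel_measurable lborel"
proof -
  have "(\<lambda>p. ennreal (real (Suc i) * tent (real (Suc i) * level (fst p) (F (snd p)))) * ennreal (norm (G (snd p)))) \<in> borel_measurable (lborel \<Otimes>\<^sub>M lborel)"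
    unfolding level_def by measurable
  then show ?thesis
    unfolding level_energy_def
    by (intro lborel.borel_measurable_nn_integral) (simp add: case_prod_beta')
qed

text \<open>After Fubini the integral over the levels at a fixed x is that of a rescaled tent, at
  most 1 whatever \<open>F x\<close> and i are.\<close>

lemma coarea_smooth:
  assumes C: "C1c F G"
  shows "(\<integral>\<^sup>+t. level_energy i t F G \<partial>lborel) \<le> (\<integral>\<^sup>+x. ennreal (norm (G x)) \<partial>lborel)"
proof -
  note [measurable] = C1_gradD(4,5)[OF C1cD[OF C]]
  have "(\<integral>\<^sup>+t. level_energy i t F G \<partial>lborel) =
      (\<integral>\<^sup>+x. \<integral>\<^sup>+t. ennreal (real (Suc i) * tent (real (Suc i) * level t (F x))) * ennreal (norm (G x)) \<partial>lborel \<partial>lborel)"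
    unfolding level_energy_def by (rule nn_Fubini) (unfold level_def, measurable)
  also have "\<dots> \<le> (\<integral>\<^sup>+x. ennreal (norm (G x)) \<partial>lborel)"
  proof (rule nn_integral_mono)
    fix x
    have "(\<integral>\<^sup>+t. ennreal (real (Suc i) * tent (real (Suc i) * level t (F x))) * ennreal (norm (G x)) \<partial>lborel)
        = (\<integral>\<^sup>+t. ennreal (real (Suc i) * tent (real (Suc i) * level t (F x))) \<partial>lborel) * ennreal (norm (G x))"
      by (intro nn_integral_multc) (unfold level_def, measurable)
    also have "\<dots> \<le> 1 * ennreal (norm (G x))"
      by (intro mult_right_mono nn_integral_tent_level) auto
    finally show "(\<integral>\<^sup>+t. ennreal (real (Suc i) * tent (real (Suc i) * level t (F x))) * ennreal (norm (G x)) \<partial>lborel) \<le> ennreal (norm (G x))"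
      by simp
  qed
  finally show ?thesis .
qed

text \<open>For \<open>f \<in> BV(\<real>\<^sup>n)\<close> this is \<open>\<bar>Df\<bar>(\<real>\<^sup>n) \<le> V\<close>; coarea and translation estimates pass from the approximating
  functions to \<open>f\<close> by lower semicontinuity.\<close>

definition bv_approx :: "('a::euclidean_space \<Rightarrow> real) \<Rightarrow> ennreal \<Rightarrow> bool" where
  "bv_approx f V \<longleftrightarrow> integrable lborel f \<and> (\<exists>F G. (\<forall>k::nat. C1c (F k) (G k)) \<and> (\<lambda>k. nnL1 f (F k)) \<longlonglongrightarrow> 0 \<and>
     (\<forall>k. (\<integral>\<^sup>+x. ennreal (norm (G k x)) \<partial>lborel) \<le> V))"

text \<open>The form in which lower semicontinuity is used: an error tending to 0 disappears in the
  lower limit.\<close>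

lemma le_liminf_perturb:
  fixes A :: ennreal
  assumes "\<And>k. A \<le> X k + D k" "D \<longlonglongrightarrow> 0"
  shows "A \<le> liminf X"
proof (rule ennreal_le_epsilon)
  fix e :: real assume e: "0 < e"
  have "eventually (\<lambda>k. D k \<le> ennreal e) sequentially" by (rule ennreal_tendsto_0D[OF assms(2) e])
  then have "eventually (\<lambda>k. A - ennreal e \<le> X k) sequentially"
  proof eventually_elim
    fix k assume "D k \<le> ennreal e"
    then have "A \<le> X k + ennreal e" by (rule order_trans[OF assms(1) add_left_mono])
    then show "A - ennreal e \<le> X k" by (simp add: ennreal_minus_le_iff add.commute)
  qed
  then have "A - ennreal e \<le> liminf X" by (rule Liminf_bounded)
  then show "A \<le> liminf X + ennreal e" by (simp add: ennreal_minus_le_iff add.commute)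
qed

text \<open>\<open>step\<close> is 1-Lipschitz and the scaling contributes i + 1. As this factor
  grows with i, the limit over approximating functions has to be taken at fixed i.\<close>

lemma nnL1_smooth_level:
  "nnL1 (smooth_level i t f) (smooth_level i t g) \<le> ennreal (real (Suc i)) * nnL1 f g"
  if [measurable]: "f \<in> borel_measurable borel" "g \<in> borel_measurable borel"
proof -
  have "nnL1 (smooth_level i t f) (smooth_level i t g) \<le> (\<integral>\<^sup>+x. ennreal (real (Suc i)) * ennreal \<bar>f x - g x\<bar> \<partial>lborel)"
    unfolding nnL1_def
  proof (rule nn_integral_mono)
    fix x
    have "\<bar>smooth_level i t f x - smooth_level i t g x\<bar> \<le> \<bar>real (Suc i) * level t (f x) - real (Suc i) * level t (g x)\<bar>"
      unfolding smooth_level_def by (rule step_lipschitz)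
    also have "\<dots> = \<bar>real (Suc i) * (sg t * (f x - g x))\<bar>"
      unfolding level_def by (simp add: algebra_simps)
    also have "\<dots> = real (Suc i) * \<bar>f x - g x\<bar>"
      by (simp only: abs_mult abs_sg abs_of_nat mult_1)
    finally show "ennreal \<bar>smooth_level i t f x - smooth_level i t g x\<bar> \<le> ennreal (real (Suc i)) * ennreal \<bar>f x - g x\<bar>"
      by (subst ennreal_mult[symmetric]) (auto intro: ennreal_leI)
  qed
  also have "\<dots> = ennreal (real (Suc i)) * nnL1 f g"
    unfolding nnL1_def by (rule nn_integral_cmult) measurable
  finally show ?thesis .
qed

lemma borel_level_set:
  "f \<in> borel_measurable borel \<Longrightarrow> level_set f t \<in> sets borel"
proof -
  assume [measurable]: "f \<in> borel_measurable borel"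
  have "{x \<in> space borel. 0 < level t (f x)} \<in> sets borel"
    unfolding level_def by measurable
  then show ?thesis by (simp add: level_set_def)
qed

text \<open>Chebyshev's inequality: on the level set the modulus of \<open>f x\<close> exceeds that
  of t.\<close>

lemma level_set_bound:
  assumes "t \<noteq> 0"
  shows "indicat_real (level_set f t) x \<le> \<bar>f x\<bar> / \<bar>t\<bar>"
  using assms by (auto simp: level_set_def level_def sg_def indicator_def field_simps split: if_splits)

lemma level_set_integrable:
  assumes f: "integrable lborel f" and t: "t \<noteq> 0"
  shows "integrable lborel (indicat_real (level_set f t))" "integrable lborel (smooth_level i t f)"
    "emeasure lborel (level_set f t) < \<infinity>"
proof -
  have fm [measurable]: "f \<in> borel_measurable borel" using borel_measurable_integrable[OF f] by simp
  have S: "level_set f t \<in> sets borel" by (rule borel_level_set[OF fm])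
  have b: "integrable lborel (\<lambda>x. \<bar>f x\<bar> / \<bar>t\<bar>)" using f by simp
  show I: "integrable lborel (indicat_real (level_set f t))"
    by (rule Bochner_Integration.integrable_bound[OF b])
      (use S level_set_bound[OF t, of f] in \<open>auto intro!: AE_I2\<close>)
  have sm: "smooth_level i t f \<in> borel_measurable borel"
    unfolding smooth_level_def[abs_def] level_def by measurable
  have "\<bar>smooth_level i t f x\<bar> \<le> indicat_real (level_set f t) x" for x
    using step_bounds[of "real (Suc i) * level t (f x)"] step_eq(1)[of "real (Suc i) * level t (f x)"]
    by (auto simp: smooth_level_def level_set_def indicator_def not_less mult_nonneg_nonpos simp del: of_nat_Suc)
  then show "integrable lborel (smooth_level i t f)"
    by (intro Bochner_Integration.integrable_bound[OF I]) (use sm in \<open>auto intro!: AE_I2\<close>)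
  show "emeasure lborel (level_set f t) < \<infinity>"
    using I S by (simp add: integrable_indicator_iff)
qed

text \<open>At a point of the set the two functions agree as soon as i + 1 times the level reaches
  2, elsewhere both are 0; the indicator dominates the difference.\<close>

lemma smooth_level_tendsto:
  assumes f: "integrable lborel f" and t: "t \<noteq> 0"
  shows "(\<lambda>i. nnL1 (indicat_real (level_set f t)) (smooth_level i t f)) \<longlonglongrightarrow> 0"
proof -
  have fm [measurable]: "f \<in> borel_measurable borel" using borel_measurable_integrable[OF f] by simp
  note I = level_set_integrable[OF f t]
  have ind: "\<bar>indicat_real (level_set f t) x - smooth_level i t f x\<bar> \<le> indicat_real (level_set f t) x" for i x
    using step_bounds[of "real (Suc i) * level t (f x)"] step_eq(1)[of "real (Suc i) * level t (f x)"]
    by (auto simp: smooth_level_def level_set_def indicator_def not_less mult_nonneg_nonpos simp del: of_nat_Suc)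
  have "(\<lambda>i. LINT x|lborel. \<bar>indicat_real (level_set f t) x - smooth_level i t f x\<bar>) \<longlonglongrightarrow> (LINT x|(lborel :: 'a measure). 0)"
  proof (rule integral_dominated_convergence[where w="indicat_real (level_set f t)"])
    show "AE x in lborel. norm \<bar>indicat_real (level_set f t) x - smooth_level i t f x\<bar> \<le> indicat_real (level_set f t) x" for i
      using ind by (intro AE_I2) simp
    show "AE x in lborel. (\<lambda>i. \<bar>indicat_real (level_set f t) x - smooth_level i t f x\<bar>) \<longlonglongrightarrow> 0"
    proof (intro AE_I2 tendsto_eventually)
      fix x
      show "\<forall>\<^sub>F i in sequentially. \<bar>indicat_real (level_set f t) x - smooth_level i t f x\<bar> = 0"
      proof (cases "0 < level t (f x)")
        case True
        obtain n :: nat where n: "2 / level t (f x) < real n" using reals_Archimedean2 by blast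
        have "2 \<le> real (Suc i) * level t (f x)" if "n \<le> i" for i
        proof -
          have "2 / level t (f x) \<le> real (Suc i)" using n that by linarith
          then show ?thesis using True by (simp add: pos_divide_le_eq del: of_nat_Suc)
        qed
        then show ?thesis
          using True by (intro eventually_sequentiallyI[of n]) (simp add: smooth_level_def level_set_def step_eq(2) del: of_nat_Suc)
      next
        case False
        then have "real (Suc i) * level t (f x) \<le> 0" for i by (simp add: mult_nonneg_nonpos del: of_nat_Suc)
        then show ?thesis
          using False by (simp add: smooth_level_def level_set_def step_eq(1) del: of_nat_Suc)
      qed
    qed
    show "(\<lambda>x. \<bar>indicat_real (level_set f t) x - smooth_level i t f x\<bar>) \<in> borel_measurable lborel" for i
      using I(1) I(2)[of i] by auto
  qed (use I in auto)
  then have "(\<lambda>i. ennreal (LINT x|lborel. \<bar>indicat_real (level_set f t) x - smooth_level i t f x\<bar>)) \<longlonglongrightarrow> ennreal 0"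
    by (intro tendsto_ennrealI) simp
  then show ?thesis by (simp add: nnL1_integral[OF I(1,2)])
qed

text \<open>The functionals \<open>\<Phi>\<close> of interest are \<open>g \<mapsto> \<integral> g div \<psi>\<close>, whose supremum is the perimeter, and
  \<open>g \<mapsto> \<parallel>g(\<cdot> + h) - g\<parallel>\<^sub>1 / \<bar>h\<bar>\<close>. The bound \<open>Q\<close> does not depend on \<open>\<Phi>\<close>.\<close>

lemma bv_coarea:
  fixes f :: "'a::euclidean_space \<Rightarrow> real"
  assumes bv: "bv_approx f V"
  obtains Q :: "real \<Rightarrow> ennreal" where "Q \<in> borel_measurable lborel" "(\<integral>\<^sup>+t. Q t \<partial>lborel) \<le> V"
    "\<And>\<Phi> c t. t \<noteq> 0 \<Longrightarrow> (\<And>g g'. integrable lborel g \<Longrightarrow> integrable lborel g' \<Longrightarrow> \<Phi> g \<le> \<Phi> g' + ennreal c * nnL1 g g') \<Longrightarrow>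
      (\<And>F G. C1c F G \<Longrightarrow> \<Phi> F \<le> (\<integral>\<^sup>+x. ennreal (norm (G x)) \<partial>lborel)) \<Longrightarrow> \<Phi> (indicat_real (level_set f t)) \<le> Q t"
proof -
  obtain F G where C: "\<And>k::nat. C1c (F k) (G k)" and lim: "(\<lambda>k. nnL1 f (F k)) \<longlonglongrightarrow> 0"
    and V: "\<And>k. (\<integral>\<^sup>+x. ennreal (norm (G k x)) \<partial>lborel) \<le> V" and f: "integrable lborel f"
    using bv unfolding bv_approx_def by blast
  note D = C1_gradD(4,5)[OF C1cD[OF C]]
  have fm: "f \<in> borel_measurable borel" using borel_measurable_integrable[OF f] by simp
  define q where "q i k t = level_energy i t (F k) (G k)" for i k t
  have qm: "q i k \<in> borel_measurable lborel" for i k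
    unfolding q_def[abs_def] by (intro borel_level_energy D)
  have qV: "(\<integral>\<^sup>+t. q i k t \<partial>lborel) \<le> V" for i k
    unfolding q_def by (rule order_trans[OF coarea_smooth[OF C] V])
  \<comment> \<open>The inner lower limit replaces f by C^1 functions at fixed smoothing, the outer
    one removes the smoothing. Fatou's lemma applies to each.\<close>
  define Q where "Q t = liminf (\<lambda>i. liminf (\<lambda>k. q i k t))" for t
  have Q1m: "(\<lambda>t. liminf (\<lambda>k. q i k t)) \<in> borel_measurable lborel" for i
    by (intro borel_measurable_liminf qm)
  have le: "liminf X \<le> V" if "\<And>n. X n \<le> V" for X :: "nat \<Rightarrow> ennreal"
    using that by (intro order_trans[OF Liminf_le_Limsup[OF sequentially_bot] Limsup_bounded] always_eventually) blast
  have "(\<integral>\<^sup>+t. Q t \<partial>lborel) \<le> liminf (\<lambda>i. \<integral>\<^sup>+t. liminf (\<lambda>k. q i k t) \<partial>lborel)"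
    unfolding Q_def by (rule nn_integral_liminf[OF Q1m])
  also have "\<dots> \<le> V"
    by (intro le order_trans[OF nn_integral_liminf[OF qm]] qV)
  finally have QV: "(\<integral>\<^sup>+t. Q t \<partial>lborel) \<le> V" .
  have Qm: "Q \<in> borel_measurable lborel"
    unfolding Q_def[abs_def] by (intro borel_measurable_liminf Q1m)
  show ?thesis
  proof (rule that[OF Qm QV])
    fix \<Phi> :: "('a \<Rightarrow> real) \<Rightarrow> ennreal" and c t :: real
    assume t: "t \<noteq> 0" and lip: "\<And>g g'. integrable lborel g \<Longrightarrow> integrable lborel g' \<Longrightarrow> \<Phi> g \<le> \<Phi> g' + ennreal c * nnL1 g g'"
      and grad: "\<And>F G. C1c F G \<Longrightarrow> \<Phi> F \<le> (\<integral>\<^sup>+x. ennreal (norm (G x)) \<partial>lborel)"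
    note I = level_set_integrable[OF f t]
    \<comment> \<open>The Lipschitz dependence of \<Phi> leaves an error of c (i + 1) times the
      distance of f and \<open>F k\<close>, which vanishes as k grows.\<close>
    have 1: "\<Phi> (smooth_level i t f) \<le> liminf (\<lambda>k. q i k t)" for i
    proof (rule le_liminf_perturb)
      fix k
      obtain H where H: "C1c (smooth_level i t (F k)) H" "(\<integral>\<^sup>+x. ennreal (norm (H x)) \<partial>lborel) = q i k t"
        using C1c_smooth_level[OF C t] unfolding q_def by blast
      have "\<Phi> (smooth_level i t f) \<le> \<Phi> (smooth_level i t (F k)) + ennreal c * nnL1 (smooth_level i t f) (smooth_level i t (F k))"
        by (rule lip[OF I(2) C1c_integrable(1)[OF H(1)]])
      also have "\<dots> \<le> q i k t + ennreal c * (ennreal (real (Suc i)) * nnL1 f (F k))"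
        using grad[OF H(1)] H(2) by (intro add_mono mult_left_mono nnL1_smooth_level fm D) auto
      finally show "\<Phi> (smooth_level i t f) \<le> q i k t + ennreal c * (ennreal (real (Suc i)) * nnL1 f (F k))" .
    next
      have "(\<lambda>k. ennreal c * (ennreal (real (Suc i)) * nnL1 f (F k))) \<longlonglongrightarrow> ennreal c * (ennreal (real (Suc i)) * 0)"
        by (intro ennreal_tendsto_cmult lim) simp_all
      then show "(\<lambda>k. ennreal c * (ennreal (real (Suc i)) * nnL1 f (F k))) \<longlonglongrightarrow> 0" by simp
    qed
    show "\<Phi> (indicat_real (level_set f t)) \<le> Q t"
      unfolding Q_def
    proof (rule le_liminf_perturb)
      fix i
      show "\<Phi> (indicat_real (level_set f t)) \<le> liminf (\<lambda>k. q i k t) + ennreal c * nnL1 (indicat_real (level_set f t)) (smooth_level i t f)"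
        by (rule order_trans[OF lip[OF I(1,2)] add_right_mono[OF 1]])
    next
      have "(\<lambda>i. ennreal c * nnL1 (indicat_real (level_set f t)) (smooth_level i t f)) \<longlonglongrightarrow> ennreal c * 0"
        by (intro ennreal_tendsto_cmult smooth_level_tendsto[OF f t]) simp
      then show "(\<lambda>i. ennreal c * nnL1 (indicat_real (level_set f t)) (smooth_level i t f)) \<longlonglongrightarrow> 0" by simp
    qed
  qed
qed

section \<open>Perimeters and translations of level sets\<close>

text \<open>Off its closed support the field vanishes on a neighbourhood, hence so does its
  derivative; a continuous function of bounded support is bounded.\<close>

lemma divergence_bounded:
  fixes \<psi> :: "'a::euclidean_space \<Rightarrow> 'a"
  assumes "test_fun U \<psi>"
  shows "\<exists>M\<ge>0. \<forall>x. \<bar>divergence \<psi> x\<bar> \<le> M" "continuous_on UNIV (divergence \<psi>)"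
proof -
  have sm: "smooth_on UNIV \<psi>" and cp: "compact (closure {x. \<psi> x \<noteq> 0})"
    using assms unfolding test_fun_def by blast+
  show cont: "continuous_on UNIV (divergence \<psi>)" by (rule continuous_divergence[OF sm])
  obtain r where r: "closure {x. \<psi> x \<noteq> 0} \<subseteq> ball 0 r"
    using bounded_subset_ballD[OF compact_imp_bounded[OF cp], of 0] by (elim exE conjE)
  have "divergence \<psi> x = 0" if x: "r \<le> norm x" for x
  proof -
    have xin: "x \<in> - closure {x. \<psi> x \<noteq> 0}" using r x by auto
    have zero: "0 = \<psi> y" if "y \<in> - closure {x. \<psi> x \<noteq> 0}" for y
    proof (rule ccontr)
      assume "0 \<noteq> \<psi> y"
      then have "y \<in> {x. \<psi> x \<noteq> 0}" by simp
      then have "y \<in> closure {x. \<psi> x \<noteq> 0}" by (rule subsetD[OF closure_subset])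
      then show False using that by simp
    qed
    have "(\<psi> has_derivative (\<lambda>h. 0)) (at x)"
      by (rule has_derivative_transform_within_open[OF has_derivative_const open_Compl[OF closed_closure] xin zero])
    then have "frechet_derivative \<psi> (at x) = (\<lambda>h. 0)" by (rule frechet_derivative_at[symmetric])
    then show ?thesis unfolding divergence_def by (simp only: inner_zero_left sum.neutral_const)
  qed
  then show "\<exists>M\<ge>0. \<forall>x. \<bar>divergence \<psi> x\<bar> \<le> M"
    by (rule continuous_bounded_support(2)[OF cont, of r, unfolded real_norm_def])
qed

text \<open>The two properties that \<open>bv_coarea\<close> asks of a functional: Lipschitz
  dependence in L^1, with a bound of the divergence as constant, and control by the gradient,
  through integration by parts.\<close>

lemma divergence_functional:
  fixes \<psi> :: "'a::euclidean_space \<Rightarrow> 'a"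
  assumes \<psi>: "test_fun UNIV \<psi>" "\<And>x. norm (\<psi> x) \<le> 1"
  shows "\<exists>c. \<forall>g g'. integrable lborel g \<longrightarrow> integrable lborel g' \<longrightarrow>
      ennreal (LINT x|lborel. g x * divergence \<psi> x) \<le> ennreal (LINT x|lborel. g' x * divergence \<psi> x) + ennreal c * nnL1 g g'"
    and "C1c F G \<Longrightarrow> ennreal (LINT x|lborel. F x * divergence \<psi> x) \<le> (\<integral>\<^sup>+x. ennreal (norm (G x)) \<partial>lborel)"
proof -
  obtain M where M: "M \<ge> 0" "\<And>x. \<bar>divergence \<psi> x\<bar> \<le> M" using divergence_bounded(1)[OF \<psi>(1)] by blast
  have dm [measurable]: "divergence \<psi> \<in> borel_measurable borel"
    using divergence_bounded(2)[OF \<psi>(1)] by (rule borel_measurable_continuous_onI)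
  have int: "integrable lborel (\<lambda>x. g x * divergence \<psi> x)" if "integrable lborel g" for g
    by (rule Bochner_Integration.integrable_bound[of _ "\<lambda>x. \<bar>g x\<bar> * M"])
      (use that M in \<open>auto intro!: AE_I2 mult_left_mono simp: abs_mult\<close>)
  show "\<exists>c. \<forall>g g'. integrable lborel g \<longrightarrow> integrable lborel g' \<longrightarrow>
      ennreal (LINT x|lborel. g x * divergence \<psi> x) \<le> ennreal (LINT x|lborel. g' x * divergence \<psi> x) + ennreal c * nnL1 g g'"
  proof (intro exI[of _ M] allI impI)
    fix g g' :: "'a \<Rightarrow> real" assume g: "integrable lborel g" and g': "integrable lborel g'"
    have "(LINT x|lborel. g x * divergence \<psi> x) - (LINT x|lborel. g' x * divergence \<psi> x) = (LINT x|lborel. (g x - g' x) * divergence \<psi> x)"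
      using int[OF g] int[OF g'] by (simp add: left_diff_distrib)
    also have "\<dots> \<le> (LINT x|lborel. M * \<bar>g x - g' x\<bar>)"
    proof (rule integral_mono)
      show "integrable lborel (\<lambda>x. (g x - g' x) * divergence \<psi> x)" using g g' by (intro int) simp
      fix x
      have "(g x - g' x) * divergence \<psi> x \<le> \<bar>g x - g' x\<bar> * \<bar>divergence \<psi> x\<bar>" by (simp add: abs_mult[symmetric])
      also have "\<dots> \<le> \<bar>g x - g' x\<bar> * M" by (intro mult_left_mono M) simp
      finally show "(g x - g' x) * divergence \<psi> x \<le> M * \<bar>g x - g' x\<bar>" by (simp add: mult.commute)
    qed (use g g' in auto)
    \<comment> \<open>\<open>ennreal\<close> sends negative numbers to 0, so the comparison is made
      with the positive part of the integral.\<close>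
    finally have "(LINT x|lborel. g x * divergence \<psi> x) \<le> max 0 (LINT x|lborel. g' x * divergence \<psi> x) + M * (LINT x|lborel. \<bar>g x - g' x\<bar>)"
      by simp
    then have "ennreal (LINT x|lborel. g x * divergence \<psi> x) \<le> ennreal (max 0 (LINT x|lborel. g' x * divergence \<psi> x) + M * (LINT x|lborel. \<bar>g x - g' x\<bar>))"
      by (rule ennreal_leI)
    also have "\<dots> = ennreal (max 0 (LINT x|lborel. g' x * divergence \<psi> x)) + ennreal (M * (LINT x|lborel. \<bar>g x - g' x\<bar>))"
      using M by (intro ennreal_plus mult_nonneg_nonneg Bochner_Integration.integral_nonneg) auto
    also have "\<dots> = ennreal (LINT x|lborel. g' x * divergence \<psi> x) + ennreal M * nnL1 g g'"
      using M by (simp add: nnL1_integral[OF g g'] ennreal_mult max_def ennreal_neg)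
    finally show "ennreal (LINT x|lborel. g x * divergence \<psi> x) \<le> ennreal (LINT x|lborel. g' x * divergence \<psi> x) + ennreal M * nnL1 g g'" .
  qed
  assume C: "C1c F G"
  have sm: "smooth_on UNIV \<psi>" using \<psi>(1) by (simp add: test_fun_def)
  note [measurable] = C1_gradD(5)[OF C1cD[OF C]]
  have [measurable]: "\<psi> \<in> borel_measurable borel"
    using smooth_onD(1)[OF sm] by (rule borel_measurable_continuous_onI)
  have le: "\<bar>G x \<bullet> \<psi> x\<bar> \<le> norm (G x)" for x
    using Cauchy_Schwarz_ineq2[of "G x" "\<psi> x"] mult_left_mono[OF \<psi>(2)[of x], of "norm (G x)"] by simp
  have i: "integrable lborel (\<lambda>x. G x \<bullet> \<psi> x)"
    by (rule Bochner_Integration.integrable_bound[OF C1c_integrable(2)[OF C]]) (use le in \<open>auto intro!: AE_I2\<close>)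
  have "ennreal (LINT x|lborel. F x * divergence \<psi> x) \<le> ennreal (norm (LINT x|lborel. G x \<bullet> \<psi> x))"
    unfolding C1c_divergence[OF C sm] by (intro ennreal_leI) simp
  also have "\<dots> \<le> (\<integral>\<^sup>+x. ennreal (norm (G x \<bullet> \<psi> x)) \<partial>lborel)"
    by (rule integral_norm_bound_ennreal[OF i])
  also have "\<dots> \<le> (\<integral>\<^sup>+x. ennreal (norm (G x)) \<partial>lborel)"
    using le by (intro nn_integral_mono ennreal_leI) simp
  finally show "ennreal (LINT x|lborel. F x * divergence \<psi> x) \<le> (\<integral>\<^sup>+x. ennreal (norm (G x)) \<partial>lborel)" .
qed

lemma nnL1_shift_lipschitz:
  assumes [measurable]: "g \<in> borel_measurable borel" "g' \<in> borel_measurable borel"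
  shows "nnL1 (\<lambda>x. g (x + h)) g \<le> nnL1 (\<lambda>x. g' (x + h)) g' + 2 * nnL1 g g'"
proof -
  have "nnL1 (\<lambda>x. g (x + h)) g \<le> nnL1 (\<lambda>x. g (x + h)) (\<lambda>x. g' (x + h)) + nnL1 (\<lambda>x. g' (x + h)) g"
    by (intro nnL1_triangle) measurable
  also have "nnL1 (\<lambda>x. g' (x + h)) g \<le> nnL1 (\<lambda>x. g' (x + h)) g' + nnL1 g' g"
    by (intro nnL1_triangle) measurable
  also have "nnL1 (\<lambda>x. g (x + h)) (\<lambda>x. g' (x + h)) = nnL1 g g'"
    by (intro nnL1_shift) measurable
  finally show ?thesis
    by (simp add: nnL1_commute[of g' g] mult_2 add_left_mono ac_simps)
qed

text \<open>One majorant serves two functionals: the perimeter bound is used with non-extremality,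
  the translation bound for the isoperimetric inequality, and the two never have to be compared with
  each other.\<close>

lemma bv_coarea_perimeter:
  fixes f :: "'a::euclidean_space \<Rightarrow> real"
  assumes bv: "bv_approx f V"
  obtains Q :: "real \<Rightarrow> ennreal" where "Q \<in> borel_measurable lborel" "(\<integral>\<^sup>+t. Q t \<partial>lborel) \<le> V"
    "\<And>t. t \<noteq> 0 \<Longrightarrow> perimeter (level_set f t) \<le> enn2ereal (Q t)"
    "\<And>t h. t \<noteq> 0 \<Longrightarrow> nnL1 (\<lambda>x. indicat_real (level_set f t) (x + h)) (indicat_real (level_set f t)) \<le> ennreal (norm h) * Q t"
proof (rule bv_coarea[OF bv])
  fix Q :: "real \<Rightarrow> ennreal"
  assume Q: "Q \<in> borel_measurable lborel" "(\<integral>\<^sup>+t. Q t \<partial>lborel) \<le> V"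
    "\<And>\<Phi> c t. t \<noteq> 0 \<Longrightarrow> (\<And>g g'. integrable lborel g \<Longrightarrow> integrable lborel g' \<Longrightarrow> \<Phi> g \<le> \<Phi> g' + ennreal c * nnL1 g g') \<Longrightarrow>
      (\<And>F G. C1c F G \<Longrightarrow> \<Phi> F \<le> (\<integral>\<^sup>+x. ennreal (norm (G x)) \<partial>lborel)) \<Longrightarrow> \<Phi> (indicat_real (level_set f t)) \<le> Q t"
  have fm: "f \<in> borel_measurable borel" using bv borel_measurable_integrable by (auto simp: bv_approx_def)
  show ?thesis
  proof (rule that[OF Q(1,2)])
    fix t :: real assume t: "t \<noteq> 0"
    have S: "level_set f t \<in> sets borel" by (rule borel_level_set[OF fm])
    show "perimeter (level_set f t) \<le> enn2ereal (Q t)"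
      unfolding perimeter_def
    proof (rule SUP_least)
      fix \<psi> :: "'a \<Rightarrow> 'a" assume "\<psi> \<in> {\<psi>. test_fun UNIV \<psi> \<and> (\<forall>x. norm (\<psi> x) \<le> 1)}"
      then have \<psi>: "test_fun UNIV \<psi>" "\<And>x. norm (\<psi> x) \<le> 1" by auto
      obtain c where c: "\<And>g g'. integrable lborel g \<Longrightarrow> integrable lborel g' \<Longrightarrow>
        ennreal (LINT x|lborel. g x * divergence \<psi> x) \<le> ennreal (LINT x|lborel. g' x * divergence \<psi> x) + ennreal c * nnL1 g g'"
        using divergence_functional(1)[OF \<psi>] by blast
      have le: "ennreal (LINT x|lborel. indicat_real (level_set f t) x * divergence \<psi> x) \<le> Q t"
        by (rule Q(3)[OF t, of "\<lambda>g. ennreal (LINT x|lborel. g x * divergence \<psi> x)", OF c divergence_functional(2)[OF \<psi>]])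
      have dm: "divergence \<psi> \<in> borel_measurable borel"
        using divergence_bounded(2)[OF \<psi>(1)] by (rule borel_measurable_continuous_onI)
      have "(\<lambda>x. indicat_real (level_set f t) x *\<^sub>R divergence \<psi> x) \<in> borel_measurable lborel"
        using S dm by measurable
      then have eq: "(LINT x:level_set f t|lebesgue. divergence \<psi> x) = (LINT x|lborel. indicat_real (level_set f t) x * divergence \<psi> x)"
        unfolding set_lebesgue_integral_def by (simp add: integral_completion)
      \<comment> \<open>A negative integral is harmless, as \<open>Q t\<close> is
        nonnegative.\<close>
      show "ereal (LINT x:level_set f t|lebesgue. divergence \<psi> x) \<le> enn2ereal (Q t)"
        unfolding eq using le
        by (cases "Q t") (auto simp: enn2ereal_ennreal ennreal_le_iff2)
    qed
  next
    fix t :: real and h :: 'a assume t: "t \<noteq> 0"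
    let ?i = "indicat_real (level_set f t)"
    show "nnL1 (\<lambda>x. ?i (x + h)) ?i \<le> ennreal (norm h) * Q t"
    \<comment> \<open>The functional carries the factor 1 / |h|; for h = 0 both sides
      vanish.\<close>
    proof (cases "h = 0")
      case True
      then show ?thesis by (simp add: nnL1_def)
    next
      case False
      have "ennreal (1 / norm h) * nnL1 (\<lambda>x. ?i (x + h)) ?i \<le> Q t"
      proof (rule Q(3)[OF t, of "\<lambda>g. ennreal (1 / norm h) * nnL1 (\<lambda>x. g (x + h)) g" "1 / norm h * 2"])
        fix g g' :: "'a \<Rightarrow> real" assume "integrable lborel g" "integrable lborel g'"
        then have m: "g \<in> borel_measurable borel" "g' \<in> borel_measurable borel"
          using borel_measurable_integrable by auto
        have "ennreal (1 / norm h) * nnL1 (\<lambda>x. g (x + h)) g \<le> ennreal (1 / norm h) * (nnL1 (\<lambda>x. g' (x + h)) g' + 2 * nnL1 g g')"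
          by (intro mult_left_mono nnL1_shift_lipschitz m) simp
        also have "\<dots> = ennreal (1 / norm h) * nnL1 (\<lambda>x. g' (x + h)) g' + ennreal (1 / norm h) * 2 * nnL1 g g'"
          by (simp only: distrib_left mult.assoc)
        also have "ennreal (1 / norm h) * 2 = ennreal (1 / norm h * 2)"
          by (subst ennreal_mult) simp_all
        finally show "ennreal (1 / norm h) * nnL1 (\<lambda>x. g (x + h)) g \<le> ennreal (1 / norm h) * nnL1 (\<lambda>x. g' (x + h)) g' + ennreal (1 / norm h * 2) * nnL1 g g'" .
      next
        fix F :: "'a \<Rightarrow> real" and G assume C: "C1c F G"
        have "ennreal (1 / norm h) * nnL1 (\<lambda>x. F (x + h)) F \<le> ennreal (1 / norm h) * (ennreal (norm h) * (\<integral>\<^sup>+x. ennreal (norm (G x)) \<partial>lborel))"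
          by (intro mult_left_mono C1_grad_translation C1cD[OF C]) simp
        also have "\<dots> = ennreal (1 / norm h * norm h) * (\<integral>\<^sup>+x. ennreal (norm (G x)) \<partial>lborel)"
          by (subst ennreal_mult) (simp_all add: mult.assoc)
        also have "\<dots> = (\<integral>\<^sup>+x. ennreal (norm (G x)) \<partial>lborel)" using False by simp
        finally show "ennreal (1 / norm h) * nnL1 (\<lambda>x. F (x + h)) F \<le> (\<integral>\<^sup>+x. ennreal (norm (G x)) \<partial>lborel)" .
      qed
      then have "ennreal (norm h) * (ennreal (1 / norm h) * nnL1 (\<lambda>x. ?i (x + h)) ?i) \<le> ennreal (norm h) * Q t"
        by (rule mult_left_mono) simp
      also have "ennreal (norm h) * (ennreal (1 / norm h) * nnL1 (\<lambda>x. ?i (x + h)) ?i) = ennreal (norm h * (1 / norm h)) * nnL1 (\<lambda>x. ?i (x + h)) ?i"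
        by (subst ennreal_mult) (simp_all add: mult.assoc)
      also have "\<dots> = nnL1 (\<lambda>x. ?i (x + h)) ?i" using False by simp
      finally show ?thesis .
    qed
  qed
qed

text \<open>The bound holds for the approximating C^1 functions and survives convergence in
  L^1.\<close>

lemma bv_translation:
  fixes f :: "'a::euclidean_space \<Rightarrow> real"
  assumes bv: "bv_approx f V"
  shows "nnL1 (\<lambda>x. f (x + h)) f \<le> ennreal (norm h) * V"
proof -
  obtain F G where C: "\<And>k::nat. C1c (F k) (G k)" and lim: "(\<lambda>k. nnL1 f (F k)) \<longlonglongrightarrow> 0"
    and V: "\<And>k. (\<integral>\<^sup>+x. ennreal (norm (G k x)) \<partial>lborel) \<le> V" and f: "integrable lborel f"
    using bv unfolding bv_approx_def by blast
  have fm: "f \<in> borel_measurable borel" using borel_measurable_integrable[OF f] by simp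
  have "nnL1 (\<lambda>x. f (x + h)) f \<le> liminf (\<lambda>k::nat. ennreal (norm h) * V)"
  proof (rule le_liminf_perturb)
    fix k
    have "nnL1 (\<lambda>x. f (x + h)) f \<le> nnL1 (\<lambda>x. F k (x + h)) (F k) + 2 * nnL1 f (F k)"
      by (intro nnL1_shift_lipschitz fm C1_gradD(4)[OF C1cD[OF C]])
    also have "nnL1 (\<lambda>x. F k (x + h)) (F k) \<le> ennreal (norm h) * V"
      by (rule order_trans[OF C1_grad_translation[OF C1cD[OF C]] mult_left_mono[OF V]]) simp
    finally show "nnL1 (\<lambda>x. f (x + h)) f \<le> ennreal (norm h) * V + 2 * nnL1 f (F k)"
      by (simp add: add_right_mono)
  next
    have "(\<lambda>k. 2 * nnL1 f (F k)) \<longlonglongrightarrow> 2 * 0"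
      by (intro ennreal_tendsto_cmult lim) simp
    then show "(\<lambda>k. 2 * nnL1 f (F k)) \<longlonglongrightarrow> 0" by simp
  qed
  then show ?thesis by (simp add: Liminf_const)
qed

text \<open>Layer cake formula for a number of either sign: y > 0 is swept by the levels between 0
  and y with weight 1, y < 0 by those between y and 0 with weight -1.\<close>

lemma level_slice:
  shows "integrable lborel (\<lambda>t. if 0 < level t y then sg t else 0)"
    and "(LINT t|lborel. (if 0 < level t y then sg t else 0)) = y"
    and "(\<integral>\<^sup>+t. indicator {t. 0 < level t y} t \<partial>lborel) = ennreal \<bar>y\<bar>"
proof -
  have set: "{t. 0 < level t y} = (if 0 \<le> y then {0<..<y} else {y<..0})"
    by (auto simp: level_def sg_def split: if_splits)
  have fn: "(\<lambda>t. if 0 < level t y then sg t else 0) =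
      (if 0 \<le> y then indicat_real {0<..<y} else (\<lambda>t. - indicat_real {y<..0} t))"
  proof
    fix t
    show "(if 0 < level t y then sg t else 0) = (if 0 \<le> y then indicat_real {0<..<y} else (\<lambda>t. - indicat_real {y<..0} t)) t"
      by (auto simp: level_def sg_def indicator_def)
  qed
  show "integrable lborel (\<lambda>t. if 0 < level t y then sg t else 0)"
    unfolding fn by (cases "0 \<le> y") (simp_all add: integrable_indicator_iff)
  show "(LINT t|lborel. (if 0 < level t y then sg t else 0)) = y"
    unfolding fn by (cases "0 \<le> y") simp_all
  show "(\<integral>\<^sup>+t. indicator {t. 0 < level t y} t \<partial>lborel) = ennreal \<bar>y\<bar>"
    unfolding set by (cases "0 \<le> y") simp_all
qed

text \<open>Transfers a bound from \<open>ereal\<close>, where perimeters live, to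
  \<open>ennreal\<close>, where levels are integrated.\<close>

lemma ennreal_le_perimeter:
  assumes "ereal a \<le> ereal L * P" "P \<le> enn2ereal q" "0 \<le> L"
  shows "ennreal a \<le> ennreal L * q"
proof -
  have "ereal a \<le> ereal L * enn2ereal q"
    using assms by (intro order_trans[OF assms(1)] ereal_mult_left_mono) auto
  then have "e2ennreal (ereal a) \<le> e2ennreal (enn2ereal (ennreal L * q))"
    using assms(3) by (intro e2ennreal_mono) (simp add: times_ennreal.rep_eq enn2ereal_ennreal)
  then show ?thesis by simp
qed

text \<open>Slicing precedes the absolute value, since only the signed integral of m over a level
  set is controlled by the perimeter. Fubini is licensed by integrability of f m: at each x the
  slices have total modulus |f x m x|.\<close>

lemma bv_layer_signed:
  fixes f m :: "'a::euclidean_space \<Rightarrow> real"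
  assumes bv: "bv_approx f V" and m [measurable]: "m \<in> borel_measurable borel"
    and fm: "integrable lborel (\<lambda>x. f x * m x)" and L: "0 \<le> L"
    and per: "\<And>t. t \<noteq> 0 \<Longrightarrow> ereal \<bar>LINT x|lborel. indicat_real (level_set f t) x * m x\<bar> \<le> ereal L * perimeter (level_set f t)"
  shows "ennreal \<bar>LINT x|lborel. f x * m x\<bar> \<le> ennreal L * V"
proof (rule bv_coarea_perimeter[OF bv])
  fix Q :: "real \<Rightarrow> ennreal"
  assume Qm: "Q \<in> borel_measurable lborel" and QV: "(\<integral>\<^sup>+t. Q t \<partial>lborel) \<le> V"
    and QP: "\<And>t. t \<noteq> 0 \<Longrightarrow> perimeter (level_set f t) \<le> enn2ereal (Q t)"
  have [measurable]: "f \<in> borel_measurable borel"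
    using bv borel_measurable_integrable by (auto simp: bv_approx_def)
  define g where "g x t = (if 0 < level t (f x) then sg t else 0) * m x" for x t
  have gm: "case_prod g \<in> borel_measurable (lborel \<Otimes>\<^sub>M lborel)"
    unfolding g_def[abs_def] level_def case_prod_beta' by measurable
  have gi: "integrable lborel (g x)" "(LINT t|lborel. g x t) = f x * m x" for x
    using level_slice(1,2)[of "f x"] unfolding g_def[abs_def] by simp_all
  have ng: "(LINT t|lborel. norm (g x t)) = norm (f x * m x)" for x
  proof -
    have "(\<integral>\<^sup>+t. ennreal (norm (g x t)) \<partial>lborel) = (\<integral>\<^sup>+t. indicator {t. 0 < level t (f x)} t * ennreal \<bar>m x\<bar> \<partial>lborel)"
      by (intro nn_integral_cong) (auto simp: g_def abs_mult indicator_def)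
    also have "\<dots> = ennreal \<bar>f x\<bar> * ennreal \<bar>m x\<bar>"
      by (subst nn_integral_multc) (simp_all add: level_slice(3), unfold level_def, measurable)
    finally have "(\<integral>\<^sup>+t. ennreal (norm (g x t)) \<partial>lborel) = ennreal (norm (f x * m x))"
      by (simp add: abs_mult ennreal_mult)
    then show ?thesis
      using nn_integral_eq_integral[OF integrable_norm[OF gi(1)[of x]]] by simp
  qed
  have gI: "integrable (lborel \<Otimes>\<^sub>M lborel) (case_prod g)"
    by (rule lborel_pair.Fubini_integrable[OF gm]) (use gi ng fm in auto)
  have inner: "(LINT x|lborel. g x t) = sg t * (LINT x|lborel. indicat_real (level_set f t) x * m x)" for t
  proof -
    have "(LINT x|lborel. g x t) = (LINT x|lborel. sg t * (indicat_real (level_set f t) x * m x))"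
      by (intro Bochner_Integration.integral_cong) (auto simp: g_def level_set_def indicator_def)
    then show ?thesis by simp
  qed
  have "(LINT x|lborel. f x * m x) = (LINT x|lborel. LINT t|lborel. g x t)"
    by (simp add: gi)
  also have "\<dots> = (LINT t|lborel. LINT x|lborel. g x t)"
    by (rule lborel_pair.Fubini_integral[OF gI, symmetric])
  finally have "ennreal \<bar>LINT x|lborel. f x * m x\<bar> \<le> (\<integral>\<^sup>+t. ennreal (norm (LINT x|lborel. g x t)) \<partial>lborel)"
    using integral_norm_bound_ennreal[OF lborel_pair.integrable_snd[OF gI]] by simp
  also have "\<dots> \<le> (\<integral>\<^sup>+t. ennreal L * Q t \<partial>lborel)"
  proof (rule nn_integral_mono_AE)
    \<comment> \<open>The excluded level 0 is a null set of levels; its level set may have infinite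
      measure.\<close>
    have "AE t in lborel. t \<noteq> (0::real)" by (rule AE_lborel_singleton)
    then show "AE t in lborel. ennreal (norm (LINT x|lborel. g x t)) \<le> ennreal L * Q t"
    proof eventually_elim
      fix t :: real assume t: "t \<noteq> 0"
      show "ennreal (norm (LINT x|lborel. g x t)) \<le> ennreal L * Q t"
        using ennreal_le_perimeter[OF per[OF t] QP[OF t] L] by (simp add: inner abs_mult)
    qed
  qed
  also have "\<dots> = ennreal L * (\<integral>\<^sup>+t. Q t \<partial>lborel)" by (rule nn_integral_cmult[OF Qm])
  also have "\<dots> \<le> ennreal L * V" by (intro mult_left_mono QV) simp
  finally show ?thesis .
qed

section \<open>The isoperimetric inequality and densities in \<open>L\<^sup>n\<close>\<close>

text \<open>Average the measure of the points of \<open>E\<close> that a translation by \<open>h\<close> moves out of \<open>E\<close> over the \<open>h\<close> in a ball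
  of twice the measure of \<open>E\<close>: each point of \<open>E\<close> leaves \<open>E\<close> for at least half of these \<open>h\<close>.\<close>

lemma isoperimetric_translation:
  fixes E :: "'a::euclidean_space set"
  assumes E [measurable]: "E \<in> sets borel" and e: "emeasure lborel E = ennreal e" "0 < e"
    and Q: "\<And>h. nnL1 (\<lambda>x. indicat_real E (x + h)) (indicat_real E) \<le> ennreal (norm h) * ennreal Q" "0 \<le> Q"
    and r: "0 < r" "unit_ball_vol (real DIM('a)) * r ^ DIM('a) = 2 * e"
  shows "e \<le> 2 * r * Q"
proof -
  let ?B = "ball (0::'a) r"
  have B: "emeasure lborel ?B = ennreal (2 * e)"
    using r by (simp add: emeasure_ball)
  define D :: "'a \<Rightarrow> 'a \<Rightarrow> ennreal"
    where "D x h = indicator ?B h * (indicator E x * indicator (- E) (x + h))" for x h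
  have [measurable]: "?B \<in> sets borel" "- E \<in> sets borel" using E by auto
  have Dm: "(\<lambda>p. D (fst p) (snd p)) \<in> borel_measurable (lborel \<Otimes>\<^sub>M lborel)"
    unfolding D_def by measurable
  have upper: "(\<integral>\<^sup>+x. D x h \<partial>lborel) \<le> ennreal (r * Q) * indicator ?B h" for h
  proof (cases "h \<in> ?B")
    case True
    have "(\<integral>\<^sup>+x. D x h \<partial>lborel) \<le> nnL1 (\<lambda>x. indicat_real E (x + h)) (indicat_real E)"
      unfolding nnL1_def D_def by (intro nn_integral_mono) (auto simp: indicator_def)
    also have "\<dots> \<le> ennreal (norm h) * ennreal Q" by (rule Q)
    also have "\<dots> = ennreal (norm h * Q)" using Q(2) by (simp add: ennreal_mult)
    also have "\<dots> \<le> ennreal (r * Q)" using True Q(2) by (intro ennreal_leI mult_right_mono) auto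
    finally show ?thesis using True by simp
  qed (simp add: D_def)
  have lower: "indicator E x * ennreal e \<le> (\<integral>\<^sup>+h. D x h \<partial>lborel)" for x
  proof (cases "x \<in> E")
    case True
    \<comment> \<open>For x in \<open>E\<close> each h of the ball moves x either out of
      \<open>E\<close> or into \<open>E\<close>, and the vectors of the second kind have measure at
      most e, half of the ball.\<close>
    have "ennreal (2 * e) = (\<integral>\<^sup>+h. indicator ?B h \<partial>lborel)" by (simp add: B)
    also have "\<dots> \<le> (\<integral>\<^sup>+h. D x h + indicator E (h + x) \<partial>lborel)"
      using True by (intro nn_integral_mono) (auto simp: D_def indicator_def add.commute)
    also have "\<dots> = (\<integral>\<^sup>+h. D x h \<partial>lborel) + (\<integral>\<^sup>+h. indicator E (h + x) \<partial>lborel)"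
      unfolding D_def by (intro nn_integral_add) measurable
    also have "(\<integral>\<^sup>+h. indicator E (h + x) \<partial>lborel) = ennreal e"
      using nn_integral_lborel_shift[of "indicator E" x] e by simp
    finally have "ennreal (2 * e) \<le> (\<integral>\<^sup>+h. D x h \<partial>lborel) + ennreal e" .
    moreover have "ennreal (2 * e) = ennreal e + ennreal e"
      using e(2) by (subst ennreal_plus[symmetric]) simp_all
    ultimately have "ennreal e + ennreal e \<le> (\<integral>\<^sup>+h. D x h \<partial>lborel) + ennreal e"
      by (simp only:)
    then have "ennreal e + ennreal e \<le> ennreal e + (\<integral>\<^sup>+h. D x h \<partial>lborel)"
      by (simp only: add.commute)
    then have "ennreal e \<le> (\<integral>\<^sup>+h. D x h \<partial>lborel)"
      unfolding ennreal_add_left_cancel_le by simp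
    then show ?thesis using True by simp
  qed simp
  have "ennreal (e * e) = (\<integral>\<^sup>+x. indicator E x * ennreal e \<partial>lborel)"
    using e by (simp add: nn_integral_multc ennreal_mult)
  also have "\<dots> \<le> (\<integral>\<^sup>+x. \<integral>\<^sup>+h. D x h \<partial>lborel \<partial>lborel)"
    by (intro nn_integral_mono lower)
  also have "\<dots> = (\<integral>\<^sup>+h. \<integral>\<^sup>+x. D x h \<partial>lborel \<partial>lborel)"
    by (rule nn_Fubini[OF Dm, symmetric])
  also have "\<dots> \<le> (\<integral>\<^sup>+h. ennreal (r * Q) * indicator ?B h \<partial>lborel)"
    by (intro nn_integral_mono upper)
  also have "\<dots> = ennreal (r * Q) * ennreal (2 * e)"
    by (subst nn_integral_cmult_indicator) (simp_all add: B)
  also have "\<dots> = ennreal (r * Q * (2 * e))"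
    using r(1) Q(2) e(2) by (intro ennreal_mult[symmetric]) auto
  finally have "e * e \<le> r * Q * (2 * e)"
    using r(1) Q(2) e(2) by (subst (asm) ennreal_le_iff) auto
  then have "e * e \<le> (2 * r * Q) * e" by (simp add: mult_ac)
  then show ?thesis using e(2) by (simp only: mult_le_cancel_right_pos)
qed

text \<open>Either y is at most 1 / r, or y r is at least 1 and multiplying y by powers of y r does
  not decrease it.\<close>

lemma le_split_power:
  fixes y r :: real
  assumes "0 \<le> y" "0 < r"
  shows "y \<le> 1 / r + y ^ Suc k * r ^ k"
proof (cases "y \<le> 1 / r")
  case True
  have "0 \<le> y ^ Suc k * r ^ k" using assms by (intro mult_nonneg_nonneg zero_le_power) auto
  then show ?thesis using True by linarith
next
  case False
  then have "1 \<le> y * r" using assms by (simp add: field_simps)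
  then have "y * 1 \<le> y * (y * r) ^ k" using assms by (intro mult_left_mono one_le_power) auto
  also have "\<dots> = y ^ Suc k * r ^ k" by (simp add: power_mult_distrib)
  finally show ?thesis using assms by (simp add: add_increasing)
qed

text \<open>Split \<open>\<bar>m\<bar> \<le> s + \<bar>m\<bar>\<^sup>n / s\<^sup>n\<^sup>-\<^sup>1\<close> with \<open>s\<close> the reciprocal of the radius in the isoperimetric inequality for \<open>E\<close>.\<close>

lemma Ln_set_bound:
  fixes E :: "'a::euclidean_space set" and m :: "'a \<Rightarrow> real"
  assumes E [measurable]: "E \<in> sets borel" and fin: "emeasure lborel E < \<infinity>"
    and Q: "\<And>h. nnL1 (\<lambda>x. indicat_real E (x + h)) (indicat_real E) \<le> ennreal (norm h) * Q"
    and m [measurable]: "m \<in> borel_measurable borel"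
    and K: "(\<integral>\<^sup>+x. ennreal (\<bar>m x\<bar> ^ DIM('a)) \<partial>lborel) \<le> ennreal K" "0 \<le> K"
  shows "(\<integral>\<^sup>+x. indicator E x * ennreal \<bar>m x\<bar> \<partial>lborel) \<le> ennreal (2 * (1 + 2 * K / unit_ball_vol (real DIM('a)))) * Q"
proof -
  let ?w = "unit_ball_vol (real DIM('a))"
  have w: "?w > 0" by simp
  define e where "e = measure lborel E"
  have e: "emeasure lborel E = ennreal e" "0 \<le> e"
    using fin by (simp_all add: e_def emeasure_eq_ennreal_measure)
  \<comment> \<open>A null set and an infinite \<open>Q\<close> are settled separately, as the
    radius must be positive and \<open>Q\<close> a real number.\<close>
  consider "e = 0" | "Q = top" | Q' where "0 < e" "Q = ennreal Q'" "0 \<le> Q'"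
  proof (cases "e = 0")
    case False
    show ?thesis
    proof (cases Q)
      case (real Q')
      then show ?thesis using False e(2) that(3)[of Q'] by simp
    qed (use that(2) in simp)
  qed (use that(1) in simp)
  then show ?thesis
  proof cases
    case 1
    then have "AE x in lborel. x \<notin> E" using e by (intro AE_not_in) (simp add: null_sets_def)
    then have "(\<integral>\<^sup>+x. indicator E x * ennreal \<bar>m x\<bar> \<partial>lborel) = (\<integral>\<^sup>+x. 0 \<partial>(lborel :: 'a measure))"
      by (intro nn_integral_cong_AE) (auto elim: eventually_mono)
    then show ?thesis by simp
  next
    case 2
    \<comment> \<open>Positivity makes the right-hand side infinite; with the factor 0 it would be
      0.\<close>
    have "0 < 2 * (1 + 2 * K / ?w)" using w K(2) by (intro mult_pos_pos add_pos_nonneg divide_nonneg_pos) auto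
    then show ?thesis using 2 by (simp add: ennreal_mult_top)
  next
    case 3
    obtain k where k: "DIM('a) = Suc k" using DIM_positive[where 'a='a] by (cases "DIM('a)") auto
    \<comment> \<open>The radius of a ball of volume 2 e, as the averaging argument
      prescribes.\<close>
    define r where "r = root DIM('a) (2 * e / ?w)"
    have r: "r > 0" "r ^ DIM('a) = 2 * e / ?w"
      using 3(1) w by (simp_all add: r_def)
    have iso: "e \<le> 2 * r * Q'"
      by (rule isoperimetric_translation[OF E e(1) 3(1) _ 3(3) r(1)]) (use Q 3 r w in auto)
    have "(\<integral>\<^sup>+x. indicator E x * ennreal \<bar>m x\<bar> \<partial>lborel)
        \<le> (\<integral>\<^sup>+x. ennreal (1 / r) * indicator E x + ennreal (r ^ k) * ennreal (\<bar>m x\<bar> ^ DIM('a)) \<partial>lborel)"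
    proof (rule nn_integral_mono)
      fix x
      have "\<bar>m x\<bar> \<le> 1 / r + r ^ k * \<bar>m x\<bar> ^ DIM('a)"
        using le_split_power[of "\<bar>m x\<bar>" r k] r(1) by (simp add: k mult.commute)
      then have "ennreal \<bar>m x\<bar> \<le> ennreal (1 / r + r ^ k * \<bar>m x\<bar> ^ DIM('a))" by (rule ennreal_leI)
      also have "\<dots> = ennreal (1 / r) + ennreal (r ^ k) * ennreal (\<bar>m x\<bar> ^ DIM('a))"
        using r(1) by (simp add: ennreal_plus ennreal_mult)
      finally show "indicator E x * ennreal \<bar>m x\<bar> \<le> ennreal (1 / r) * indicator E x + ennreal (r ^ k) * ennreal (\<bar>m x\<bar> ^ DIM('a))"
        by (simp add: indicator_def)
    qed
    also have "\<dots> = (\<integral>\<^sup>+x. ennreal (1 / r) * indicator E x \<partial>lborel) + (\<integral>\<^sup>+x. ennreal (r ^ k) * ennreal (\<bar>m x\<bar> ^ DIM('a)) \<partial>lborel)"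
      by (intro nn_integral_add) measurable
    also have "\<dots> \<le> ennreal (1 / r) * ennreal e + ennreal (r ^ k) * ennreal K"
      using K(1) e(1) by (intro add_mono) (simp_all add: nn_integral_cmult_indicator nn_integral_cmult mult_left_mono)
    also have "\<dots> = ennreal (1 / r * e + r ^ k * K)"
    proof -
      have "ennreal (1 / r * e) = ennreal (1 / r) * ennreal e" "ennreal (r ^ k * K) = ennreal (r ^ k) * ennreal K"
        using r(1) e(2) K(2) by (intro ennreal_mult; simp)+
      moreover have "ennreal (1 / r * e + r ^ k * K) = ennreal (1 / r * e) + ennreal (r ^ k * K)"
        using r(1) e(2) K(2) by (intro ennreal_plus mult_nonneg_nonneg) simp_all
      ultimately show ?thesis by (simp only:)
    qed
    also have "\<dots> \<le> ennreal (2 * (1 + 2 * K / ?w) * Q')"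
    proof (rule ennreal_leI)
      \<comment> \<open>By the choice of r both terms become multiples of e / r, which the
        isoperimetric inequality bounds by 2 Q'. This produces the constant of the lemma.\<close>
      have "r ^ k = r ^ DIM('a) / r" using r(1) k by simp
      then have "r ^ k = 2 * e / ?w / r" unfolding r(2) .
      then have "1 / r * e + r ^ k * K = 1 / r * e + 2 * e / ?w / r * K" by (simp only:)
      also have "\<dots> = (1 + 2 * K / ?w) * (e / r)"
        using less_imp_neq[OF w] r(1) by (simp add: divide_simps) (simp add: algebra_simps)
      also have "(1 + 2 * K / ?w) * (e / r) \<le> (1 + 2 * K / ?w) * (2 * Q')"
        using iso r(1) w K(2) by (intro mult_left_mono add_nonneg_nonneg divide_nonneg_pos) (simp_all add: pos_divide_le_eq mult_ac)
      finally show "1 / r * e + r ^ k * K \<le> 2 * (1 + 2 * K / ?w) * Q'" by (simp add: mult_ac)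
    qed
    also have "\<dots> = ennreal (2 * (1 + 2 * K / ?w)) * Q"
      using w K(2) 3 by (simp add: ennreal_mult)
    finally show ?thesis .
  qed
qed

text \<open>The pairing of BV with L^n without a detour through Sobolev embedding: the bound for
  sets is applied to each level set and integrated over the levels. \<open>K\<close> bounds the n-th
  power of the L^n norm of m.\<close>

lemma bv_Ln_bound:
  fixes f m :: "'a::euclidean_space \<Rightarrow> real"
  assumes bv: "bv_approx f V" and m [measurable]: "m \<in> borel_measurable borel"
    and K: "(\<integral>\<^sup>+x. ennreal (\<bar>m x\<bar> ^ DIM('a)) \<partial>lborel) \<le> ennreal K" "0 \<le> K"
  shows "(\<integral>\<^sup>+x. ennreal \<bar>f x * m x\<bar> \<partial>lborel) \<le> ennreal (2 * (1 + 2 * K / unit_ball_vol (real DIM('a)))) * V"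
proof (rule bv_coarea_perimeter[OF bv])
  fix Q :: "real \<Rightarrow> ennreal"
  assume Qm: "Q \<in> borel_measurable lborel" and QV: "(\<integral>\<^sup>+t. Q t \<partial>lborel) \<le> V"
    and QT: "\<And>t h. t \<noteq> 0 \<Longrightarrow> nnL1 (\<lambda>x. indicat_real (level_set f t) (x + h)) (indicat_real (level_set f t)) \<le> ennreal (norm h) * Q t"
  let ?C = "2 * (1 + 2 * K / unit_ball_vol (real DIM('a)))"
  have f: "integrable lborel f" using bv by (simp add: bv_approx_def)
  have fm [measurable]: "f \<in> borel_measurable borel" using borel_measurable_integrable[OF f] by simp
  have "(\<integral>\<^sup>+x. ennreal \<bar>f x * m x\<bar> \<partial>lborel) = (\<integral>\<^sup>+x. \<integral>\<^sup>+t. indicator {t. 0 < level t (f x)} t * ennreal \<bar>m x\<bar> \<partial>lborel \<partial>lborel)"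
  proof (rule nn_integral_cong)
    fix x
    have "(\<integral>\<^sup>+t. indicator {t. 0 < level t (f x)} t * ennreal \<bar>m x\<bar> \<partial>lborel) = ennreal \<bar>f x\<bar> * ennreal \<bar>m x\<bar>"
      by (subst nn_integral_multc) (simp_all add: level_slice(3), unfold level_def, measurable)
    then show "ennreal \<bar>f x * m x\<bar> = (\<integral>\<^sup>+t. indicator {t. 0 < level t (f x)} t * ennreal \<bar>m x\<bar> \<partial>lborel)"
      by (simp add: abs_mult ennreal_mult)
  qed
  also have "\<dots> = (\<integral>\<^sup>+t. \<integral>\<^sup>+x. indicator {t. 0 < level t (f x)} t * ennreal \<bar>m x\<bar> \<partial>lborel \<partial>lborel)"
  proof (rule nn_Fubini[symmetric])
    have "(\<lambda>p. if 0 < level (snd p) (f (fst p)) then ennreal \<bar>m (fst p)\<bar> else 0) \<in> borel_measurable (lborel \<Otimes>\<^sub>M lborel)"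
      unfolding level_def by measurable
    then show "(\<lambda>p. indicator {t. 0 < level t (f (fst p))} (snd p) * ennreal \<bar>m (fst p)\<bar>) \<in> borel_measurable (lborel \<Otimes>\<^sub>M lborel)"
      by (rule measurable_cong[THEN iffD1, rotated]) (simp add: indicator_def)
  qed
  also have "\<dots> \<le> (\<integral>\<^sup>+t. ennreal ?C * Q t \<partial>lborel)"
  proof (rule nn_integral_mono_AE)
    have "AE t in lborel. t \<noteq> (0::real)" by (rule AE_lborel_singleton)
    then show "AE t in lborel. (\<integral>\<^sup>+x. indicator {t. 0 < level t (f x)} t * ennreal \<bar>m x\<bar> \<partial>lborel) \<le> ennreal ?C * Q t"
    proof eventually_elim
      fix t :: real assume t: "t \<noteq> 0"
      have "(\<integral>\<^sup>+x. indicator (level_set f t) x * ennreal \<bar>m x\<bar> \<partial>lborel) \<le> ennreal ?C * Q t"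
        by (rule Ln_set_bound[OF borel_level_set[OF fm] level_set_integrable(3)[OF f t] QT[OF t] m K])
      then show "(\<integral>\<^sup>+x. indicator {t. 0 < level t (f x)} t * ennreal \<bar>m x\<bar> \<partial>lborel) \<le> ennreal ?C * Q t"
        by (simp add: indicator_def level_set_def)
    qed
  qed
  also have "\<dots> = ennreal ?C * (\<integral>\<^sup>+t. Q t \<partial>lborel)" by (rule nn_integral_cmult[OF Qm])
  also have "\<dots> \<le> ennreal ?C * V" by (intro mult_left_mono QV) simp
  finally show ?thesis .
qed

section \<open>Points of density one\<close>

text \<open>Vitali's theorem selects disjoint balls inside \<open>T\<close> that cover almost all of
  \<open>A\<close> and in each of which \<open>E\<close> fills at most the fraction c. As
  \<open>A\<close> lies in \<open>E\<close>, the parts of \<open>E\<close> in these balls cover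
  \<open>A\<close> up to a null set.\<close>

lemma low_density_cover:
  fixes E :: "'a::euclidean_space set"
  assumes E: "E \<in> sets lebesgue" and AE: "A \<subseteq> E" and c: "0 \<le> c"
    and low: "\<And>x d. x \<in> A \<Longrightarrow> 0 < d \<Longrightarrow> \<exists>r>0. r < d \<and> measure lebesgue (E \<inter> ball x r) \<le> c * measure lebesgue (ball x r)"
    and T: "open T" "A \<subseteq> T"
  shows "\<exists>S\<in>sets lebesgue. A \<subseteq> S \<and> emeasure lebesgue S \<le> ennreal c * emeasure lebesgue T"
proof -
  define K where "K = {p :: 'a \<times> real. fst p \<in> A \<and> 0 < snd p \<and> ball (fst p) (snd p) \<subseteq> T \<and>
    measure lebesgue (E \<inter> ball (fst p) (snd p)) \<le> c * measure lebesgue (ball (fst p) (snd p))}"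
  have fine: "\<exists>i. i \<in> K \<and> x \<in> ball (fst i) (snd i) \<and> snd i < d" if x: "x \<in> A" and d: "0 < d" for x d
  proof -
    obtain e where e: "e > 0" "ball x e \<subseteq> T" using T x open_contains_ball by blast
    obtain r where r: "r > 0" "r < min d e" "measure lebesgue (E \<inter> ball x r) \<le> c * measure lebesgue (ball x r)"
      using low[OF x, of "min d e"] d e by auto
    have "ball x r \<subseteq> ball x e" using r(2) by (intro subset_ball) simp
    then have "ball x r \<subseteq> T" using e(2) by (rule order_trans)
    then show ?thesis using r x by (intro exI[of _ "(x, r)"]) (simp add: K_def)
  qed
  obtain C where C: "countable C" "C \<subseteq> K"
     "pairwise (\<lambda>i j. disjnt (ball (fst i) (snd i)) (ball (fst j) (snd j))) C"
     "negligible (A - (\<Union>i \<in> C. ball (fst i) (snd i)))"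
    by (rule Vitali_covering_theorem_balls[of A K fst snd]) (blast intro: fine, blast intro: that)
  let ?B = "\<lambda>i :: 'a \<times> real. ball (fst i) (snd i)"
  have dis: "disjoint_family_on ?B C"
    using C(3) by (simp add: disjoint_family_on_def pairwise_def disjnt_def)
  then have dis': "disjoint_family_on (\<lambda>i. E \<inter> ?B i) C"
    unfolding disjoint_family_on_def by blast
  have BL: "?B i \<in> sets lebesgue" for i by simp
  have UL: "(\<Union>i\<in>C. E \<inter> ?B i) \<in> sets lebesgue"
    using C(1) E BL by (intro sets.countable_UN'' sets.Int)
  have fin: "emeasure lebesgue (?B i) < top" "emeasure lebesgue (E \<inter> ?B i) < top" for i
  proof -
    show 1: "emeasure lebesgue (?B i) < top"
      using emeasure_bounded_finite[OF bounded_ball] by simp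
    have "emeasure lebesgue (E \<inter> ?B i) \<le> emeasure lebesgue (?B i)" by (intro emeasure_mono) auto
    then show "emeasure lebesgue (E \<inter> ?B i) < top" using 1 by (rule le_less_trans)
  qed
  have le: "emeasure lebesgue (E \<inter> ?B i) \<le> ennreal c * emeasure lebesgue (?B i)" if "i \<in> C" for i
  proof -
    have "measure lebesgue (E \<inter> ?B i) \<le> c * measure lebesgue (?B i)"
      using that C(2) by (auto simp: K_def)
    then have "ennreal (measure lebesgue (E \<inter> ?B i)) \<le> ennreal (c * measure lebesgue (?B i))"
      by (rule ennreal_leI)
    then show ?thesis
      using fin[of i] c by (simp add: emeasure_eq_ennreal_measure ennreal_mult)
  qed
  have "emeasure lebesgue (\<Union>i\<in>C. E \<inter> ?B i) = (\<integral>\<^sup>+i. emeasure lebesgue (E \<inter> ?B i) \<partial>count_space C)"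
    using E BL C(1) dis' by (intro emeasure_UN_countable) auto
  also have "\<dots> \<le> (\<integral>\<^sup>+i. ennreal c * emeasure lebesgue (?B i) \<partial>count_space C)"
    using le by (intro nn_integral_mono) simp
  also have "\<dots> = ennreal c * (\<integral>\<^sup>+i. emeasure lebesgue (?B i) \<partial>count_space C)"
    by (intro nn_integral_cmult) simp
  also have "(\<integral>\<^sup>+i. emeasure lebesgue (?B i) \<partial>count_space C) = emeasure lebesgue (\<Union>i\<in>C. ?B i)"
    using BL C(1) dis by (intro emeasure_UN_countable[symmetric]) auto
  also have "\<dots> \<le> emeasure lebesgue T"
    using C(2) T(1) by (intro emeasure_mono) (auto simp: K_def)
  finally have main: "emeasure lebesgue (\<Union>i\<in>C. E \<inter> ?B i) \<le> ennreal c * emeasure lebesgue T"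
    by (simp add: mult_left_mono)
  have null: "A - (\<Union>i \<in> C. ?B i) \<in> null_sets lebesgue"
    using C(4) by (simp add: negligible_iff_null_sets)
  show ?thesis
  proof (intro bexI conjI)
    show "A \<subseteq> (\<Union>i\<in>C. E \<inter> ?B i) \<union> (A - (\<Union>i \<in> C. ?B i))" using AE by blast
    show "emeasure lebesgue ((\<Union>i\<in>C. E \<inter> ?B i) \<union> (A - (\<Union>i \<in> C. ?B i))) \<le> ennreal c * emeasure lebesgue T"
      using main unfolding emeasure_Un_null_set[OF UL null] .
    show "(\<Union>i\<in>C. E \<inter> ?B i) \<union> (A - (\<Union>i \<in> C. ?B i)) \<in> sets lebesgue"
      using UL null by blast
  qed
qed

text \<open>The outer measure s of a bounded part of \<open>A\<close> satisfies s \<le> c s by the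
  covering lemma, since \<open>T\<close> may have measure close to s; with c < 1 this forces s = 0.
  Outer measure is used because \<open>A\<close> may fail to be measurable.\<close>

lemma negligible_low_density:
  fixes E :: "'a::euclidean_space set"
  assumes E: "E \<in> sets lebesgue" and AE: "A \<subseteq> E" and c: "0 \<le> c" "c < 1"
    and low: "\<And>x d. x \<in> A \<Longrightarrow> 0 < d \<Longrightarrow> \<exists>r>0. r < d \<and> measure lebesgue (E \<inter> ball x r) \<le> c * measure lebesgue (ball x r)"
  shows "negligible A"
proof -
  have "negligible D" if D: "D \<subseteq> A" "bounded D" for D
  proof -
    \<comment> \<open>s is the outer measure of \<open>D\<close>, taken over open supersets because
      these are what the covering lemma accepts.\<close>
    define Z where "Z = {emeasure lebesgue T |T. open T \<and> D \<subseteq> T}"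
    define s where "s = Inf Z"
    obtain R where R: "D \<subseteq> ball 0 R" using D(2) bounded_subset_ballD by blast
    have "s \<le> emeasure lebesgue (ball (0::'a) R)" unfolding s_def Z_def
      by (intro Inf_lower CollectI exI[of _ "ball 0 R"] conjI refl open_ball R)
    moreover have "emeasure lebesgue (ball (0::'a) R) < top"
      using emeasure_bounded_finite[OF bounded_ball] by simp
    ultimately have sfin: "s < top" by (rule le_less_trans)
    have "s \<le> ennreal c * z" if z: "z \<in> Z" for z
    proof -
      obtain T where T: "z = emeasure lebesgue T" "open T" "D \<subseteq> T" using z by (auto simp: Z_def)
      obtain S where S: "S \<in> sets lebesgue" "D \<subseteq> S" "emeasure lebesgue S \<le> ennreal c * emeasure lebesgue T"
      proof -
        have DE: "D \<subseteq> E" using D(1) AE by (rule order_trans)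
        have "\<exists>r>0. r < d \<and> measure lebesgue (E \<inter> ball x r) \<le> c * measure lebesgue (ball x r)"
          if "x \<in> D" "0 < d" for x d
          using low[of x d] that D(1) by blast
        from low_density_cover[OF E DE c(1) this T(2,3)] show ?thesis using that by blast
      qed
      show ?thesis
      proof (rule ennreal_le_epsilon)
        fix e :: real assume e: "0 < e"
        \<comment> \<open>The measurable cover is enlarged to an open one, which competes in the
          infimum s.\<close>
        obtain O' where O': "open O'" "S \<subseteq> O'" "O' - S \<in> lmeasurable" "emeasure lebesgue (O' - S) < ennreal e"
          using sets_lebesgue_outer_open[OF S(1) e] .
        have "s \<le> emeasure lebesgue O'" unfolding s_def Z_def
          by (intro Inf_lower CollectI exI[of _ O'] conjI refl O'(1) order_trans[OF S(2) O'(2)])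
        also have "O' = S \<union> (O' - S)" using O'(2) by blast
        also have "emeasure lebesgue (S \<union> (O' - S)) \<le> emeasure lebesgue S + emeasure lebesgue (O' - S)"
          using S O' by (intro emeasure_subadditive) auto
        also have "\<dots> \<le> ennreal c * z + ennreal e"
          using S(3) O'(4) T(1) by (intro add_mono) auto
        finally show "s \<le> ennreal c * z + ennreal e" .
      qed
    qed
    then have cz: "\<And>z. z \<in> Z \<Longrightarrow> s \<le> ennreal c * z" .
    have "s = 0"
    proof (rule ccontr)
      assume "s \<noteq> 0"
      then obtain t where t: "s = ennreal t" "0 < t" using sfin by (cases s) (auto simp: less_le)
      show False
      \<comment> \<open>The general argument divides by c; for c = 0 any open superset already gives
        s \<le> 0.\<close>
      proof (cases "c = 0")
        case True
        have "emeasure lebesgue (UNIV :: 'a set) \<in> Z" unfolding Z_def by blast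
        then have "s \<le> 0" using cz True by fastforce
        then show False using \<open>s \<noteq> 0\<close> by simp
      next
        case False
        have "ennreal t < ennreal (t / c)"
          using t c False by (intro ennreal_lessI) (auto simp: field_simps)
        then have "Inf Z < ennreal (t / c)" using t by (simp add: s_def)
        then obtain z where z: "z \<in> Z" "z < ennreal (t / c)" unfolding Inf_less_iff by blast
        then obtain w where w: "z = ennreal w" "0 \<le> w" by (cases z) auto
        have "w < t / c" using z(2) w by (simp add: ennreal_less_iff)
        moreover have "ennreal t \<le> ennreal (c * w)" using cz[OF z(1)] t w c by (simp add: ennreal_mult)
        then have "t \<le> c * w" using t w c by (simp add: ennreal_le_iff)
        ultimately show False using c False by (simp add: pos_less_divide_eq mult.commute)
      qed
    qed
    show "negligible D"
    proof (rule negligible_outer_le[THEN iffD2], intro allI impI)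
      fix e :: real assume "0 < e"
      then have "Inf Z < ennreal e" using \<open>s = 0\<close> by (simp add: s_def)
      then obtain T where T: "open T" "D \<subseteq> T" "emeasure lebesgue T < ennreal e"
        unfolding Inf_less_iff Z_def by auto
      have "T \<in> sets lebesgue" using T(1) by simp
      then have "T \<in> lmeasurable" using T(3) by (intro fmeasurableI) (auto intro: less_trans)
      moreover have "measure lebesgue T \<le> e"
        using T(3) \<open>0 < e\<close> by (simp add: measure_def enn2real_leI less_imp_le)
      ultimately show "\<exists>T. D \<subseteq> T \<and> T \<in> lmeasurable \<and> measure lebesgue T \<le> e" using T(2) by blast
    qed
  qed
  then have "negligible (A \<inter> ball 0 (real n))" for n
    by (meson Int_lower1 Int_lower2 bounded_ball bounded_subset)
  then have "negligible (\<Union>n. A \<inter> ball 0 (real n))" by (rule negligible_Union_nat)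
  moreover have "A \<subseteq> (\<Union>n. A \<inter> ball 0 (real n))"
    using reals_Archimedean2 by (auto simp: dist_norm)
  ultimately show ?thesis by (rule negligible_subset)
qed

text \<open>At a point without density one there is some k for which the fraction of
  \<open>E\<close> drops to 1 - 1 / (k + 1) or below at arbitrarily small radii.\<close>

lemma negligible_not_density_one:
  fixes E :: "'a::euclidean_space set"
  assumes E: "E \<in> sets lebesgue"
  shows "negligible (E - density_one E)"
proof -
  define A where "A k = {x\<in>E. \<forall>d>0. \<exists>r>0. r < d \<and>
    measure lebesgue (E \<inter> ball x r) \<le> (1 - 1 / real (Suc k)) * measure lebesgue (ball x r)}" for k
  have "negligible (A k)" for k
    by (rule negligible_low_density[OF E, of _ "1 - 1 / real (Suc k)"]) (auto simp: A_def)
  then have "negligible (\<Union>k. A k)" by (intro negligible_Union_nat)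
  moreover have "E - density_one E \<subseteq> (\<Union>k. A k)"
  proof
    fix x assume x: "x \<in> E - density_one E"
    let ?q = "\<lambda>r. measure lebesgue (E \<inter> ball x r) / measure lebesgue (ball x r)"
    have "\<not> (?q \<longlongrightarrow> 1) (at_right 0)" using x by (simp add: density_one_def)
    then obtain e where e: "e > 0" "\<not> eventually (\<lambda>r. dist (?q r) 1 < e) (at_right 0)"
      unfolding tendsto_iff by blast
    obtain k where k: "1 / real (Suc k) < e" using nat_approx_posE[OF e(1)] by blast
    have "\<exists>r>0. r < d \<and> measure lebesgue (E \<inter> ball x r) \<le> (1 - 1 / real (Suc k)) * measure lebesgue (ball x r)"
      if d: "d > 0" for d
    proof -
      have "\<not> (\<forall>r>0. r < d \<longrightarrow> dist (?q r) 1 < e)"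
        using e(2) d unfolding eventually_at_right_field by blast
      then obtain r where r: "r > 0" "r < d" "\<not> dist (?q r) 1 < e" by blast
      have pos: "measure lebesgue (ball x r) > 0" using content_ball_pos[OF r(1)] by (simp add: measure_completion)
      have "measure lebesgue (E \<inter> ball x r) \<le> measure lebesgue (ball x r)"
        using E by (intro measure_mono_fmeasurable) auto
      then have "?q r \<le> 1" using pos by simp
      then have "?q r \<le> 1 - 1 / real (Suc k)" using r(3) k unfolding dist_real_def by linarith
      then show ?thesis using r pos by (auto simp: pos_divide_le_eq)
    qed
    then show "x \<in> (\<Union>k. A k)" using x unfolding A_def by blast
  qed
  ultimately show ?thesis by (rule negligible_subset)
qed

text \<open>The preceding lemma is applied to \<open>E\<close> and to its complement. No point has
  density one for both, as the two fractions add up to 1.\<close>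

lemma AE_density_one:
  fixes E :: "'a::euclidean_space set"
  assumes E: "E \<in> sets lebesgue"
  shows "AE x in lebesgue. x \<in> density_one E \<longleftrightarrow> x \<in> E"
proof -
  have E': "- E \<in> sets lebesgue" using E by (rule Compl_in_sets_lebesgue[THEN iffD2])
  have disj: "x \<notin> density_one (- E)" if x: "x \<in> density_one E" for x
  proof
    assume x': "x \<in> density_one (- E)"
    let ?q = "\<lambda>E r. measure lebesgue (E \<inter> ball x r) / measure lebesgue (ball x r)"
    have "((\<lambda>r. ?q E r + ?q (- E) r) \<longlongrightarrow> 1 + 1) (at_right 0)"
      using x x' by (intro tendsto_add) (simp_all add: density_one_def)
    moreover have "eventually (\<lambda>r. ?q E r + ?q (- E) r = 1) (at_right 0)"
      using eventually_at_right_less[of "0::real"]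
    proof eventually_elim
      fix r :: real assume r: "0 < r"
      have pos: "measure lebesgue (ball x r) > 0" using content_ball_pos[OF r] by (simp add: measure_completion)
      have f: "E \<inter> ball x r \<in> lmeasurable" "- E \<inter> ball x r \<in> lmeasurable"
        using fmeasurable_Int_fmeasurable[OF lmeasurable_ball E] fmeasurable_Int_fmeasurable[OF lmeasurable_ball E']
        by (simp_all only: Int_commute)
      have "measure lebesgue ((E \<inter> ball x r) \<union> (- E \<inter> ball x r)) = measure lebesgue (E \<inter> ball x r) + measure lebesgue (- E \<inter> ball x r)"
        using f by (intro measure_Un3[THEN trans]) (auto simp: Int_ac)
      moreover have "(E \<inter> ball x r) \<union> (- E \<inter> ball x r) = ball x r" by blast
      ultimately show "?q E r + ?q (- E) r = 1" using pos by (simp add: add_divide_distrib[symmetric])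
    qed
    ultimately have "((\<lambda>r. 1::real) \<longlongrightarrow> 1 + 1) (at_right (0::real))"
      by (rule Lim_transform_eventually)
    then show False by (simp add: tendsto_const_iff)
  qed
  have "AE x in lebesgue. x \<notin> E - density_one E" "AE x in lebesgue. x \<notin> - E - density_one (- E)"
    using negligible_not_density_one[OF E] negligible_not_density_one[OF E']
    by (simp_all only: negligible_iff_null_sets AE_not_in)
  then show ?thesis by eventually_elim (use disj in blast)
qed

section \<open>Compactness in the space of integrable functions\<close>

text \<open>A translation by twice the radius moves the support off itself, so translation bounds
  also control the L^1 norm, as in Poincare's inequality.\<close>

lemma L1_norm_le_translation:
  fixes w :: "'a::euclidean_space \<Rightarrow> real"
  assumes supp: "\<And>x. R \<le> norm x \<Longrightarrow> w x = 0" and h: "norm h = 2 * R"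
  shows "nnL1 w (\<lambda>x. 0) \<le> nnL1 (\<lambda>x. w (x + h)) w"
  unfolding nnL1_def
proof (rule nn_integral_mono)
  fix x
  show "ennreal \<bar>w x - 0\<bar> \<le> ennreal \<bar>w (x + h) - w x\<bar>"
  proof (cases "R \<le> norm x")
    case False
    then have "R \<le> norm (x + h)" using norm_diff_ineq[of h x] h by (simp add: add.commute)
    then show ?thesis by (simp add: supp)
  qed (simp add: supp)
qed

lemma finite_representatives:
  fixes g :: "'i \<Rightarrow> 'b"
  assumes "finite (range g)"
  shows "\<exists>J. finite J \<and> (\<forall>j. \<exists>i\<in>J. g i = g j)"
proof (intro exI conjI allI)
  show "finite ((\<lambda>y. SOME i. g i = y) ` range g)" using assms by (rule finite_imageI)
  fix j
  have "g (SOME i. g i = g j) = g j" by (rule someI[where P="\<lambda>i. g i = g j"]) simp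
  then show "\<exists>i\<in>(\<lambda>y. SOME i. g i = y) ` range g. g i = g j" by blast
qed

text \<open>The argument of Arzela and Ascoli in quantitative form: values on a finite net are
  rounded to multiples of s, only finitely many rounded patterns occur, and functions with the same
  pattern are uniformly close.\<close>

lemma finite_net_equilipschitz:
  fixes v :: "'i \<Rightarrow> 'a::euclidean_space \<Rightarrow> real"
  assumes bd: "\<And>j x. \<bar>v j x\<bar> \<le> M" and lip: "\<And>j x h. \<bar>v j (x + h) - v j x\<bar> \<le> N * norm h"
    and supp: "\<And>j x. R \<le> norm x \<Longrightarrow> v j x = 0" and e: "0 < e"
  shows "\<exists>J. finite J \<and> (\<forall>j. \<exists>i\<in>J. \<forall>x. \<bar>v j x - v i x\<bar> \<le> e)"
proof -
  \<comment> \<open>Two Lipschitz errors |N| s and one rounding error s add up to at most e.\<close>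
  define s where "s = e / (2 * (\<bar>N\<bar> + 1))"
  have s: "s > 0" "\<bar>N\<bar> * s \<le> e / 2" "2 * (\<bar>N\<bar> * s) \<le> e - 2 * s"
    using e by (auto simp: s_def field_simps)
  obtain X where X: "finite X" "cball (0::'a) R \<subseteq> (\<Union>x\<in>X. ball x s)"
    using compact_cball[of "0::'a" R, unfolded compact_eq_totally_bounded] s(1) by blast
  define g where "g j = (\<lambda>x\<in>X. \<lfloor>v j x / s\<rfloor>)" for j
  have "range g \<subseteq> X \<rightarrow>\<^sub>E {\<lfloor>- M / s\<rfloor>..\<lfloor>M / s\<rfloor>}"
  proof (intro image_subsetI PiE_I)
    fix j x assume x: "x \<in> X"
    have "- M \<le> v j x" "v j x \<le> M" using bd[of j x] by auto
    then have "- M / s \<le> v j x / s" "v j x / s \<le> M / s"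
      using s(1) by (intro divide_right_mono; simp)+
    then show "g j x \<in> {\<lfloor>- M / s\<rfloor>..\<lfloor>M / s\<rfloor>}" using x by (simp add: g_def floor_mono)
  qed (simp add: g_def)
  then have "finite (range g)" by (rule finite_subset) (intro finite_PiE X(1) finite_atLeastAtMost_int)
  from finite_representatives[OF this] obtain J where J: "finite J" "\<And>j. \<exists>i\<in>J. g i = g j" by blast
  have "\<bar>v j x - v i x\<bar> \<le> e" if ij: "g i = g j" for i j x
  proof (cases "R \<le> norm x")
    case True
    then show ?thesis using e by (simp add: supp)
  next
    case False
    then have "x \<in> cball 0 R" by simp
    then obtain y where y: "y \<in> X" "x \<in> ball y s" using X(2) by blast
    have d: "norm (x - y) \<le> s" using y(2) by (simp add: dist_norm norm_minus_commute)
    have "\<lfloor>v i y / s\<rfloor> = \<lfloor>v j y / s\<rfloor>" using fun_cong[OF ij, of y] y(1) by (simp add: g_def)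
    then have "\<bar>v i y / s - v j y / s\<bar> \<le> 1" by linarith
    then have 1: "\<bar>v i y - v j y\<bar> \<le> s" using s(1) by (simp add: diff_divide_distrib[symmetric])
    have 2: "\<bar>v k x - v k y\<bar> \<le> \<bar>N\<bar> * s" for k
    proof -
      have "\<bar>v k x - v k y\<bar> \<le> N * norm (x - y)" using lip[of k y "x - y"] by simp
      also have "\<dots> \<le> \<bar>N\<bar> * s" using d by (intro mult_mono) auto
      finally show ?thesis .
    qed
    have "\<bar>v j x - v i x\<bar> \<le> \<bar>v j x - v j y\<bar> + \<bar>v i y - v j y\<bar> + \<bar>v i x - v i y\<bar>" by linarith
    then show ?thesis using 1 2[of i] 2[of j] s by linarith
  qed
  then show ?thesis using J by metis
qed

text \<open>Of the three errors e/3, the outer two come from mollification and are bounded by the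
  translation estimate uniformly in j; the middle one is the uniform distance of mollified functions
  times the volume of a ball containing all supports.\<close>

lemma L1_totally_bounded:
  fixes w :: "'i \<Rightarrow> 'a::euclidean_space \<Rightarrow> real"
  assumes w: "\<And>j. integrable lborel (w j)" and supp: "\<And>j x. R \<le> norm x \<Longrightarrow> w j x = 0"
    and tr: "\<And>j h. nnL1 (\<lambda>x. w j (x + h)) (w j) \<le> ennreal (norm h) * ennreal V" and V: "0 \<le> V"
    and K: "\<And>\<epsilon>. 0 < \<epsilon> \<Longrightarrow> \<exists>\<delta> k \<kappa>. 0 < \<delta> \<and> \<delta> \<le> \<epsilon> \<and> kernel \<delta> k (\<kappa> :: 'a \<Rightarrow> 'a)" and e: "0 < e"
  shows "\<exists>J. finite J \<and> (\<forall>j. \<exists>i\<in>J. nnL1 (w j) (w i) \<le> ennreal e)"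
proof -
  define R' where "R' = \<bar>R\<bar>"
  have supp': "w j x = 0" if "R' \<le> norm x" for j x using supp[of x j] that by (simp add: R'_def)
  \<comment> \<open>b only provides a direction for a translation of length 2 R'.\<close>
  obtain b :: 'a where b: "b \<in> Basis" using nonempty_Basis by blast
  have wm: "w j \<in> borel_measurable borel" for j using borel_measurable_integrable[OF w] by simp
  define A where "A = 2 * R' * V"
  have A: "A \<ge> 0" using V by (simp add: A_def R'_def)
  have normw: "(LINT x|lborel. \<bar>w j x\<bar>) \<le> A" for j
  proof -
    have nh: "norm ((2 * R') *\<^sub>R b) = 2 * R'" using b by (simp add: R'_def)
    have "nnL1 (w j) (\<lambda>x. 0) \<le> ennreal (2 * R') * ennreal V"
      using order_trans[OF L1_norm_le_translation[OF supp' nh] tr] unfolding nh .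
    also have "\<dots> = ennreal A" using V by (simp add: A_def ennreal_mult R'_def)
    finally have "ennreal (LINT x|lborel. \<bar>w j x\<bar>) \<le> ennreal A"
      by (subst (asm) nnL1_integral[OF w]) simp_all
    then show ?thesis using A by (simp add: ennreal_le_iff)
  qed
  \<comment> \<open>A kernel of radius at most \<epsilon> sees translation errors of at most
    \<epsilon> V \<le> e / 3; adding 1 to V covers V = 0.\<close>
  define \<epsilon> where "\<epsilon> = e / (3 * (V + 1))"
  have eps: "0 < \<epsilon>" "\<epsilon> * V \<le> e / 3" using e V by (auto simp: \<epsilon>_def field_simps)
  obtain \<delta> k \<kappa> where \<delta>: "0 < \<delta>" "\<delta> \<le> \<epsilon>" and ker: "kernel \<delta> k (\<kappa> :: 'a \<Rightarrow> 'a)" using K[OF eps(1)] by blast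
  have C: "C1c k \<kappa>" and ks: "\<And>x. \<delta> \<le> norm x \<Longrightarrow> k x = 0" using ker by (auto simp: kernel_def)
  note D = C1_gradD[OF C1cD[OF C]]
  obtain M where M: "M \<ge> 0" "\<And>x. \<bar>k x\<bar> \<le> M" using C1c_integrable(4)[OF C] by blast
  obtain N where N: "N \<ge> 0" "\<And>x. norm (\<kappa> x) \<le> N" using C1c_integrable(3)[OF C] by blast
  define v where "v j = conv k (w j)" for j
  have close: "nnL1 (v j) (w j) \<le> ennreal (e / 3)" for j
    unfolding v_def
  proof (rule conv_L1_close[OF ker w])
    fix z :: 'a assume z: "norm z < \<delta>"
    have "ennreal (norm z) * ennreal V = ennreal (norm z * V)" using V by (simp add: ennreal_mult)
    also have "\<dots> \<le> ennreal (e / 3)"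
      using z \<delta>(2) V by (intro ennreal_leI order_trans[OF mult_right_mono eps(2)]) auto
    finally show "nnL1 (\<lambda>x. w j (x + z)) (w j) \<le> ennreal (e / 3)" by (rule order_trans[OF tr])
  qed
  have vC: "C1_grad (v j) (conv_grad \<kappa> (w j))" for j unfolding v_def by (rule C1_grad_conv[OF C w])
  have vm: "v j \<in> borel_measurable borel" for j by (rule C1_gradD(4)[OF vC])
  have wa: "integrable lborel (\<lambda>x. \<bar>w j x\<bar>)" for j using w by (rule integrable_abs)
  have vb: "\<bar>v j x\<bar> \<le> M * A" for j x
  proof -
    have "norm (LINT y|lborel. k (x - y) * w j y) \<le> (LINT y|lborel. M * \<bar>w j y\<bar>)"
    proof (rule Bochner_Integration.integral_norm_bound_integral)
      show "integrable lborel (\<lambda>y. k (x - y) * w j y)"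
        using conv_integrable[OF D(2) _ w, where M=M and x=x] M(2) by (simp add: mult.commute)
      show "norm (k (x - y) * w j y) \<le> M * \<bar>w j y\<bar>" for y
        using mult_right_mono[OF M(2), of "\<bar>w j y\<bar>" "x - y"] by (simp add: abs_mult)
    qed (intro integrable_mult_right wa)
    also have "\<dots> \<le> M * A" using normw[of j] M(1) by (simp add: mult_left_mono)
    finally show ?thesis by (simp add: v_def conv_def)
  qed
  have vg: "norm (conv_grad \<kappa> (w j) x) \<le> N * A" for j x
  proof -
    have "norm (LINT y|lborel. w j y *\<^sub>R \<kappa> (x - y)) \<le> (LINT y|lborel. N * \<bar>w j y\<bar>)"
    proof (rule Bochner_Integration.integral_norm_bound_integral)
      show "integrable lborel (\<lambda>y. w j y *\<^sub>R \<kappa> (x - y))" by (rule conv_integrable[OF D(3) N(2) w])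
      show "norm (w j y *\<^sub>R \<kappa> (x - y)) \<le> N * \<bar>w j y\<bar>" for y
        using mult_right_mono[OF N(2), of "\<bar>w j y\<bar>" "x - y"] by (simp add: mult.commute)
    qed (intro integrable_mult_right wa)
    also have "\<dots> \<le> N * A" using normw[of j] N(1) by (simp add: mult_left_mono)
    finally show ?thesis by (simp add: conv_grad_def)
  qed
  have vs: "v j x = 0" if x: "R' + \<delta> \<le> norm x" for j x
  proof -
    have "k (x - y) * w j y = 0" for y
    proof (cases "R' \<le> norm y")
      case False
      then have "\<delta> \<le> norm (x - y)" using x norm_triangle_ineq2[of x y] by linarith
      then show ?thesis by (simp add: ks)
    qed (simp add: supp')
    then have "(\<lambda>y. k (x - y) * w j y) = (\<lambda>y. 0)" by (rule ext)
    then show ?thesis by (simp only: v_def conv_def Bochner_Integration.integral_zero)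
  qed
  define c where "c = measure lborel (cball (0::'a) (R' + \<delta>))"
  have c: "emeasure lborel (cball (0::'a) (R' + \<delta>)) = ennreal c" "0 \<le> c"
    unfolding c_def using emeasure_bounded_finite[OF bounded_cball, of "0::'a" "R' + \<delta>"]
    by (simp_all add: emeasure_eq_ennreal_measure)
  define s where "s = e / (3 * (c + 1))"
  have s: "0 < s" "s * c \<le> e / 3" using e c(2) by (auto simp: s_def field_simps)
  obtain J where J: "finite J" "\<And>j. \<exists>i\<in>J. \<forall>x. \<bar>v j x - v i x\<bar> \<le> s"
  proof -
    have "\<bar>v j (x + h) - v j x\<bar> \<le> N * A * norm h" for j x h
      by (rule C1_grad_lipschitz[OF vC vg])
    from finite_net_equilipschitz[of v "M * A" "N * A" "R' + \<delta>" s, OF vb this vs s(1)] show ?thesis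
      using that by blast
  qed
  have "nnL1 (w j) (w i) \<le> ennreal e" if vi: "\<forall>x. \<bar>v j x - v i x\<bar> \<le> s" for i j
  proof -
    have "nnL1 (v j) (v i) \<le> (\<integral>\<^sup>+x. ennreal s * indicator (cball (0::'a) (R' + \<delta>)) x \<partial>lborel)"
      unfolding nnL1_def
    proof (rule nn_integral_mono)
      fix x
      show "ennreal \<bar>v j x - v i x\<bar> \<le> ennreal s * indicator (cball 0 (R' + \<delta>)) x"
        using vi vs[of x j] vs[of x i] by (cases "norm x \<le> R' + \<delta>") (auto intro: ennreal_leI)
    qed
    also have "\<dots> = ennreal (s * c)" using s c by (simp add: nn_integral_cmult_indicator ennreal_mult)
    also have "\<dots> \<le> ennreal (e / 3)" by (rule ennreal_leI[OF s(2)])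
    finally have 1: "nnL1 (v j) (v i) \<le> ennreal (e / 3)" .
    have "nnL1 (w j) (w i) \<le> nnL1 (w j) (v j) + nnL1 (v j) (w i)" by (intro nnL1_triangle wm vm)
    also have "\<dots> \<le> nnL1 (w j) (v j) + (nnL1 (v j) (v i) + nnL1 (v i) (w i))"
      by (intro add_left_mono nnL1_triangle wm vm)
    also have "\<dots> \<le> ennreal (e / 3) + (ennreal (e / 3) + ennreal (e / 3))"
      using close[of j] close[of i] 1 by (intro add_mono) (simp_all add: nnL1_commute[of "w j"])
    also have "\<dots> = ennreal e" using e by (simp add: ennreal_plus[symmetric] del: ennreal_plus)
    finally show ?thesis .
  qed
  then show ?thesis using J by metis
qed

text \<open>A subsequence convergent almost everywhere provides the limit, and Fatou's lemma
  transfers the Cauchy estimate to it.\<close>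

lemma L1_complete:
  fixes s :: "nat \<Rightarrow> 'a \<Rightarrow> real"
  assumes s: "\<And>n. integrable M (s n)"
    and cau: "\<And>e. e > 0 \<Longrightarrow> \<exists>N. \<forall>i\<ge>N. \<forall>j\<ge>N. (LINT x|M. \<bar>s i x - s j x\<bar>) < e"
  shows "\<exists>g. integrable M g \<and> (\<lambda>n. LINT x|M. \<bar>s n x - g x\<bar>) \<longlonglongrightarrow> 0"
proof -
  have cau': "\<And>e. e > 0 \<Longrightarrow> \<exists>N. \<forall>i\<ge>N. \<forall>j\<ge>N. (LINT x|M. norm (s i x - s j x)) < e"
    using cau by simp
  obtain r where r: "strict_mono r" "AE x in M. Cauchy (\<lambda>i. s (r i) x)"
    by (rule cauchy_L1_AE_cauchy_subseq[OF s cau']) (assumption | rule that)+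
  define g where "g x = lim (\<lambda>i. s (r i) x)" for x
  have sm [measurable]: "s n \<in> borel_measurable M" for n using s by (rule borel_measurable_integrable)
  have gm [measurable]: "g \<in> borel_measurable M"
    unfolding g_def[abs_def] by (rule borel_measurable_lim_metric) measurable
  have lim: "AE x in M. (\<lambda>i. s (r i) x) \<longlonglongrightarrow> g x"
    using r(2) by eventually_elim (simp add: g_def Cauchy_convergent_iff convergent_LIMSEQ_iff)
  have est: "(\<integral>\<^sup>+x. ennreal \<bar>s n x - g x\<bar> \<partial>M) \<le> ennreal e"
    if N: "\<forall>i\<ge>N. \<forall>j\<ge>N. (LINT x|M. \<bar>s i x - s j x\<bar>) < e" and n: "N \<le> n" for N n e
  proof -
    have "(\<integral>\<^sup>+x. ennreal \<bar>s n x - g x\<bar> \<partial>M) = (\<integral>\<^sup>+x. liminf (\<lambda>i. ennreal \<bar>s n x - s (r i) x\<bar>) \<partial>M)"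
    proof (rule nn_integral_cong_AE)
      show "AE x in M. ennreal \<bar>s n x - g x\<bar> = liminf (\<lambda>i. ennreal \<bar>s n x - s (r i) x\<bar>)"
        using lim
      proof eventually_elim
        fix x assume "(\<lambda>i. s (r i) x) \<longlonglongrightarrow> g x"
        then have "(\<lambda>i. ennreal \<bar>s n x - s (r i) x\<bar>) \<longlonglongrightarrow> ennreal \<bar>s n x - g x\<bar>"
          by (intro tendsto_ennrealI tendsto_rabs tendsto_diff tendsto_const)
        then show "ennreal \<bar>s n x - g x\<bar> = liminf (\<lambda>i. ennreal \<bar>s n x - s (r i) x\<bar>)"
          by (intro lim_imp_Liminf[symmetric] sequentially_bot)
      qed
    qed
    also have "\<dots> \<le> liminf (\<lambda>i. \<integral>\<^sup>+x. ennreal \<bar>s n x - s (r i) x\<bar> \<partial>M)"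
      by (rule nn_integral_liminf) measurable
    also have "\<dots> \<le> limsup (\<lambda>i. \<integral>\<^sup>+x. ennreal \<bar>s n x - s (r i) x\<bar> \<partial>M)"
      by (rule Liminf_le_Limsup[OF sequentially_bot])
    also have "\<dots> \<le> ennreal e"
    proof (rule Limsup_bounded, rule eventually_sequentiallyI[of N])
      fix i assume "N \<le> i"
      then have "N \<le> r i" using seq_suble[OF r(1), of i] by simp
      have "(\<integral>\<^sup>+x. ennreal \<bar>s n x - s (r i) x\<bar> \<partial>M) = ennreal (LINT x|M. \<bar>s n x - s (r i) x\<bar>)"
        using s by (intro nn_integral_eq_integral) auto
      also have "\<dots> \<le> ennreal e" using N n \<open>N \<le> r i\<close> by (intro ennreal_leI less_imp_le) blast
      finally show "(\<integral>\<^sup>+x. ennreal \<bar>s n x - s (r i) x\<bar> \<partial>M) \<le> ennreal e" .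
    qed
    finally show ?thesis .
  qed
  have di: "integrable M (\<lambda>x. s n x - g x)" if "\<forall>i\<ge>N. \<forall>j\<ge>N. (LINT x|M. \<bar>s i x - s j x\<bar>) < e" "N \<le> n" for N n e
    using est[OF that] by (intro integrableI_bounded) (auto intro: le_less_trans)
  obtain N1 where N1: "\<forall>i\<ge>N1. \<forall>j\<ge>N1. (LINT x|M. \<bar>s i x - s j x\<bar>) < 1" using cau[of 1] by auto
  have "integrable M (\<lambda>x. s N1 x - (s N1 x - g x))"
    by (intro Bochner_Integration.integrable_diff s di[OF N1]) simp
  then have g: "integrable M g" by simp
  have "(\<lambda>n. LINT x|M. \<bar>s n x - g x\<bar>) \<longlonglongrightarrow> 0"
  proof (rule LIMSEQ_I)
    fix e :: real assume e: "0 < e"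
    then obtain N where N: "\<forall>i\<ge>N. \<forall>j\<ge>N. (LINT x|M. \<bar>s i x - s j x\<bar>) < e / 2" using cau[of "e / 2"] by auto
    have "norm ((LINT x|M. \<bar>s n x - g x\<bar>) - 0) < e" if n: "N \<le> n" for n
    proof -
      have "ennreal (LINT x|M. \<bar>s n x - g x\<bar>) = (\<integral>\<^sup>+x. ennreal \<bar>s n x - g x\<bar> \<partial>M)"
        using s g by (intro nn_integral_eq_integral[symmetric]) auto
      also have "\<dots> \<le> ennreal (e / 2)" by (rule est[OF N n])
      finally have "(LINT x|M. \<bar>s n x - g x\<bar>) \<le> e / 2" using e by (simp add: ennreal_le_iff)
      moreover have "0 \<le> (LINT x|M. \<bar>s n x - g x\<bar>)" by (intro Bochner_Integration.integral_nonneg) simp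
      ultimately show ?thesis using e by simp
    qed
    then show "\<exists>N. \<forall>n\<ge>N. norm ((LINT x|M. \<bar>s n x - g x\<bar>) - 0) < e" by blast
  qed
  then show ?thesis using g by blast
qed

text \<open>Each class is represented by a function cut off outside \<open>U\<close>; these form a
  Cauchy sequence in L^1 of the whole space, and the class of its limit is the limit of the
  classes.\<close>

lemma mcomplete_L1:
  fixes U :: "'a::euclidean_space set"
  assumes U: "U \<in> sets lebesgue"
  shows "Metric_space.mcomplete (L1_space U) (L1_dist U)"
proof -
  interpret Metric_space "L1_space U" "L1_dist U" by (rule Metric_space_L1)
  show ?thesis
    unfolding mcomplete_def
  proof (intro allI impI)
    fix \<sigma> :: "nat \<Rightarrow> ('a \<Rightarrow> real) set" assume \<sigma>: "MCauchy \<sigma>"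
    have "\<exists>f. set_integrable lebesgue U f \<and> \<sigma> n = L1_class U f" for n
    proof -
      have "\<sigma> n \<in> L1_space U" using \<sigma> unfolding MCauchy_def by blast
      then show ?thesis unfolding L1_space_def by blast
    qed
    then obtain f where f: "\<And>n. set_integrable lebesgue U (f n)" "\<And>n. \<sigma> n = L1_class U (f n)" by metis
    define s where "s n x = indicat_real U x * f n x" for n x
    have si: "integrable lebesgue (s n)" for n
      using f(1)[of n] by (simp add: set_integrable_def s_def[abs_def])
    have d: "L1_dist U (\<sigma> i) (\<sigma> j) = (LINT x|lebesgue. \<bar>s i x - s j x\<bar>)" for i j
      unfolding f(2) L1_dist_class[OF f(1) f(1)] set_lebesgue_integral_def s_def
      by (intro Bochner_Integration.integral_cong) (auto simp: indicator_def)
    have "\<exists>N. \<forall>i\<ge>N. \<forall>j\<ge>N. (LINT x|lebesgue. \<bar>s i x - s j x\<bar>) < e" if e: "e > 0" for e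
    proof -
      obtain N where "\<And>i j. N \<le> i \<Longrightarrow> N \<le> j \<Longrightarrow> L1_dist U (\<sigma> i) (\<sigma> j) < e"
        using conjunct2[OF \<sigma>[unfolded MCauchy_def]] e by meson
      then show ?thesis unfolding d by blast
    qed
    from L1_complete[OF si this] obtain g where g: "integrable lebesgue g" "(\<lambda>n. LINT x|lebesgue. \<bar>s n x - g x\<bar>) \<longlonglongrightarrow> 0"
      by blast
    have gU: "set_integrable lebesgue U g"
      unfolding set_integrable_def using U g(1) by (rule integrable_mult_indicator)
    have le: "L1_dist U (\<sigma> n) (L1_class U g) \<le> (LINT x|lebesgue. \<bar>s n x - g x\<bar>)" for n
      unfolding f(2) L1_dist_class[OF f(1) gU] set_lebesgue_integral_def
    proof (rule integral_mono)
      show "integrable lebesgue (\<lambda>x. indicat_real U x *\<^sub>R \<bar>f n x - g x\<bar>)"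
        using set_integrable_abs[OF set_integral_diff(1)[OF f(1) gU]] by (simp add: set_integrable_def)
      show "integrable lebesgue (\<lambda>x. \<bar>s n x - g x\<bar>)" using si g(1) by simp
    qed (simp add: s_def indicator_def)
    have M: "\<sigma> n \<in> L1_space U" "L1_class U g \<in> L1_space U" for n
      unfolding L1_space_def using f gU by auto
    have "limitin mtopology \<sigma> (L1_class U g) sequentially"
      unfolding limit_metric_sequentially
    proof (intro conjI allI impI M(2))
      fix e :: real assume "0 < e"
      then obtain N where "\<And>n. N \<le> n \<Longrightarrow> norm ((LINT x|lebesgue. \<bar>s n x - g x\<bar>) - 0) < e"
        using LIMSEQ_D[OF g(2)] by blast
      then have "\<And>n. N \<le> n \<Longrightarrow> (LINT x|lebesgue. \<bar>s n x - g x\<bar>) < e" by force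
      then have "\<forall>n\<ge>N. \<sigma> n \<in> L1_space U \<and> L1_dist U (\<sigma> n) (L1_class U g) < e"
        using M le le_less_trans by blast
      then show "\<exists>N. \<forall>n\<ge>N. \<sigma> n \<in> L1_space U \<and> L1_dist U (\<sigma> n) (L1_class U g) < e" by blast
    qed
    then show "\<exists>x. limitin mtopology \<sigma> x sequentially" by blast
  qed
qed

section \<open>Mollification of functions of bounded variation\<close>

definition grad_of :: "('a::euclidean_space \<Rightarrow> real) \<Rightarrow> 'a \<Rightarrow> 'a" where
  "grad_of \<psi> x = (\<Sum>j\<in>Basis. partial_deriv \<psi> j x *\<^sub>R j)"

lemma grad_of_inner: "i \<in> Basis \<Longrightarrow> grad_of \<psi> x \<bullet> i = partial_deriv \<psi> i x"
  unfolding grad_of_def by (rule inner_sum_left_Basis)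

lemma grad_of_eq:
  assumes "(\<psi> has_derivative (\<lambda>h. g \<bullet> h)) (at x)"
  shows "grad_of \<psi> x = g"
proof -
  have "frechet_derivative \<psi> (at x) = (\<lambda>h. g \<bullet> h)"
    by (rule frechet_derivative_at[OF assms, symmetric])
  then show ?thesis
    unfolding grad_of_def partial_deriv_def by (simp only: euclidean_representation)
qed

lemma smooth_C1_grad:
  fixes \<psi> :: "'a::euclidean_space \<Rightarrow> real"
  assumes "smooth_on UNIV \<psi>"
  shows "C1_grad \<psi> (grad_of \<psi>)"
  unfolding C1_grad_def
proof (intro conjI allI)
  note d = smooth_onD(2)[OF assms] and c = smooth_onD(3)[OF assms]
  show "continuous_on UNIV (grad_of \<psi>)"
    unfolding grad_of_def[abs_def] partial_deriv_def
    by (intro continuous_on_sum continuous_on_scaleR continuous_on_const c)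
  fix x
  have "\<psi> differentiable (at x within UNIV)" using d unfolding differentiable_on_def by blast
  then have D: "(\<psi> has_derivative frechet_derivative \<psi> (at x)) (at x)"
    by (rule frechet_derivative_works[THEN iffD1])
  then have lin: "linear (frechet_derivative \<psi> (at x))" by (rule has_derivative_linear)
  have "frechet_derivative \<psi> (at x) h = grad_of \<psi> x \<bullet> h" for h
  proof -
    have "frechet_derivative \<psi> (at x) h = frechet_derivative \<psi> (at x) (\<Sum>j\<in>Basis. (h \<bullet> j) *\<^sub>R j)"
      by (simp only: euclidean_representation)
    also have "\<dots> = (\<Sum>j\<in>Basis. (h \<bullet> j) *\<^sub>R frechet_derivative \<psi> (at x) j)"
      by (simp only: linear_sum[OF lin] linear_cmul[OF lin])
    also have "\<dots> = (\<Sum>j\<in>Basis. frechet_derivative \<psi> (at x) j * (j \<bullet> h))"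
      by (intro sum.cong refl) (simp add: inner_commute[of h])
    finally show ?thesis
      by (simp only: grad_of_def partial_deriv_def inner_sum_left inner_scaleR_left)
  qed
  then have "frechet_derivative \<psi> (at x) = (\<lambda>h. grad_of \<psi> x \<bullet> h)" by (rule ext)
  then show "(\<psi> has_derivative (\<lambda>h. grad_of \<psi> x \<bullet> h)) (at x)"
    by (rule has_derivative_eq_rhs[OF D])
qed

lemma test_fun_zero:
  fixes \<psi> :: "'a::euclidean_space \<Rightarrow> real"
  assumes "test_fun U \<psi>" "x \<notin> U"
  shows "\<psi> x = 0" "grad_of \<psi> x = 0"
proof -
  let ?S = "{x. \<psi> x \<noteq> 0}"
  have "closure ?S \<subseteq> U" using assms(1) unfolding test_fun_def by blast
  then have x: "x \<in> - closure ?S" using assms(2) by blast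
  have zero: "0 = \<psi> y" if "y \<in> - closure ?S" for y
  proof (rule ccontr)
    assume "0 \<noteq> \<psi> y"
    then have "y \<in> ?S" by simp
    then have "y \<in> closure ?S" by (rule subsetD[OF closure_subset])
    then show False using that by simp
  qed
  show "\<psi> x = 0" using zero[OF x] by simp
  have "(\<psi> has_derivative (\<lambda>h. 0)) (at x)"
    by (rule has_derivative_transform_within_open[OF has_derivative_const open_Compl[OF closed_closure] x zero])
  then have "(\<psi> has_derivative (\<lambda>h. 0 \<bullet> h)) (at x)" by (simp only: inner_zero_left)
  then show "grad_of \<psi> x = 0" by (rule grad_of_eq)
qed

lemma test_fun_C1c:
  fixes \<psi> :: "'a::euclidean_space \<Rightarrow> real"
  assumes \<psi>: "test_fun U \<psi>"
  shows "C1c \<psi> (grad_of \<psi>)"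
proof -
  let ?S = "{x. \<psi> x \<noteq> 0}"
  have sm: "smooth_on UNIV \<psi>" and cp: "compact (closure ?S)"
    using \<psi> unfolding test_fun_def by blast+
  have \<psi>': "test_fun (closure ?S) \<psi>" using \<psi> unfolding test_fun_def by blast
  obtain r where r: "0 < r" "closure ?S \<subseteq> ball 0 r"
    using bounded_subset_ballD[OF compact_imp_bounded[OF cp], of 0] by (elim exE conjE)
  have "\<psi> x = 0 \<and> grad_of \<psi> x = 0" if "r \<le> norm x" for x
  proof -
    have "x \<notin> ball 0 r" using that by simp
    then have "x \<notin> closure ?S" using r(2) by blast
    then show ?thesis using test_fun_zero[OF \<psi>'] by blast
  qed
  then show ?thesis unfolding C1c_def using smooth_C1_grad[OF sm] r(1) by blast
qed

text \<open>The induction runs over all f and c at once, because differentiation replaces f by a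
  partial derivative and c by c b.\<close>

lemma Ck_affine:
  fixes f :: "'a::euclidean_space \<Rightarrow> real"
  shows "Ck_on k UNIV f \<Longrightarrow> Ck_on k UNIV (\<lambda>y. c * f (a + b *\<^sub>R y))"
proof (induction k arbitrary: f c)
  case 0
  have "continuous_on UNIV f" using 0 unfolding Ck_on.simps .
  then have "continuous_on UNIV (\<lambda>y. f (a + b *\<^sub>R y))"
    by (rule continuous_on_compose2) (intro continuous_intros, simp)
  then show ?case unfolding Ck_on.simps by (intro continuous_on_mult continuous_on_const)
next
  case (Suc k)
  have *: "f differentiable_on UNIV \<and> (\<forall>i\<in>Basis. Ck_on k UNIV (\<lambda>x. frechet_derivative f (at x) i))"
    using Suc.prems unfolding Ck_on.simps .
  have D: "(f has_derivative frechet_derivative f (at x)) (at x)" for x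
  proof -
    have "f differentiable (at x within UNIV)" using * unfolding differentiable_on_def by blast
    then show ?thesis by (rule frechet_derivative_works[THEN iffD1])
  qed
  have D': "((\<lambda>y. c * f (a + b *\<^sub>R y)) has_derivative (\<lambda>h. c * frechet_derivative f (at (a + b *\<^sub>R y)) (b *\<^sub>R h))) (at y)" for y
  proof -
    have "((\<lambda>y. a + b *\<^sub>R y) has_derivative (\<lambda>h. b *\<^sub>R h)) (at y)"
      by (auto intro!: derivative_eq_intros)
    from has_derivative_mult_right[OF has_derivative_compose[OF this D]] show ?thesis .
  qed
  have fr: "frechet_derivative (\<lambda>y. c * f (a + b *\<^sub>R y)) (at y) i = (c * b) * frechet_derivative f (at (a + b *\<^sub>R y)) i" for y i
  proof -
    have "frechet_derivative (\<lambda>y. c * f (a + b *\<^sub>R y)) (at y) = (\<lambda>h. c * frechet_derivative f (at (a + b *\<^sub>R y)) (b *\<^sub>R h))"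
      by (rule frechet_derivative_at[OF D', symmetric])
    then show ?thesis
      by (simp add: linear_cmul[OF has_derivative_linear[OF D]])
  qed
  show ?case
    unfolding Ck_on.simps
  proof (intro conjI ballI)
    show "(\<lambda>y. c * f (a + b *\<^sub>R y)) differentiable_on UNIV"
      unfolding differentiable_on_def differentiable_def using D' by blast
    fix i :: 'a assume "i \<in> Basis"
    then have "Ck_on k UNIV (\<lambda>x. frechet_derivative f (at x) i)" using * by blast
    then show "Ck_on k UNIV (\<lambda>y. frechet_derivative (\<lambda>y. c * f (a + b *\<^sub>R y)) (at y) i)"
      unfolding fr by (rule Suc.IH)
  qed
qed

lemma smooth_affine:
  fixes f :: "'a::euclidean_space \<Rightarrow> real"
  assumes "smooth_on UNIV f" shows "smooth_on UNIV (\<lambda>y. c * f (a + b *\<^sub>R y))"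
  using assms unfolding smooth_on_def by (intro allI Ck_affine) (rule spec)

text \<open>\<open>distr_grad\<close> is tested with smooth functions only, so a kernel that is to
  be applied to it has to be a test function as well.\<close>

definition tkernel :: "real \<Rightarrow> ('a::euclidean_space \<Rightarrow> real) \<Rightarrow> bool" where
  "tkernel \<delta> k \<longleftrightarrow> test_fun (ball 0 \<delta>) k \<and> kernel \<delta> k (grad_of k)"

lemma lborel_scale_integral:
  fixes f :: "'a::euclidean_space \<Rightarrow> real"
  assumes "f \<in> borel_measurable borel" "c > 0"
  shows "(LINT x|lborel. f x) = c ^ DIM('a) * (LINT x|lborel. f (c *\<^sub>R x))"
proof -
  have "(LINT x|lborel. f x) = (LINT x|density (distr lborel borel (\<lambda>x. 0 + c *\<^sub>R x)) (\<lambda>_. ennreal (\<bar>c\<bar> ^ DIM('a))). f x)"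
    using lborel_affine[of c "0::'a"] assms(2) by simp
  also have "\<dots> = (LINT x|distr lborel borel (\<lambda>x. 0 + c *\<^sub>R x). \<bar>c\<bar> ^ DIM('a) *\<^sub>R f x)"
    using assms(1) by (intro integral_density) auto
  also have "\<dots> = (LINT x|lborel. \<bar>c\<bar> ^ DIM('a) *\<^sub>R f (0 + c *\<^sub>R x))"
    using assms(1) by (intro integral_distr) auto
  finally show ?thesis using assms(2) by simp
qed

lemma mollifier_tkernel:
  fixes \<rho> :: "'a::euclidean_space \<Rightarrow> real"
  assumes \<rho>: "mollifier \<rho>" and \<delta>: "0 < \<delta>"
  shows "tkernel \<delta> (rescale \<delta> \<rho>)"
proof -
  let ?k = "rescale \<delta> \<rho>"
  have t: "test_fun (ball 0 1) \<rho>" and nn: "\<And>x. 0 \<le> \<rho> x" and one: "(LINT x|lebesgue. \<rho> x) = 1"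
    using \<rho> unfolding mollifier_def by blast+
  have sm: "smooth_on UNIV \<rho>" and sub: "closure {x. \<rho> x \<noteq> 0} \<subseteq> ball 0 1"
    using t unfolding test_fun_def by blast+
  have keq: "?k = (\<lambda>x. (1 / \<delta> ^ DIM('a)) * \<rho> (0 + (1 / \<delta>) *\<^sub>R x))"
    by (simp add: rescale_def fun_eq_iff divide_inverse_commute)
  have smk: "smooth_on UNIV ?k" unfolding keq by (rule smooth_affine[OF sm])
  let ?P = "(\<lambda>x. (1 / \<delta>) *\<^sub>R x) -` closure {x. \<rho> x \<noteq> 0}"
  have "closed ?P" by (intro closed_vimage closed_closure continuous_intros)
  moreover have "{x. ?k x \<noteq> 0} \<subseteq> ?P"
  proof
    fix x assume "x \<in> {x. ?k x \<noteq> 0}"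
    then have "(1 / \<delta>) *\<^sub>R x \<in> {x. \<rho> x \<noteq> 0}" by (simp add: keq)
    then show "x \<in> ?P" using closure_subset[of "{x. \<rho> x \<noteq> 0}"] by blast
  qed
  ultimately have "closure {x. ?k x \<noteq> 0} \<subseteq> ?P" by (rule closure_minimal[rotated])
  moreover have "?P \<subseteq> ball 0 \<delta>"
  proof
    fix x assume "x \<in> ?P"
    then have "(1 / \<delta>) *\<^sub>R x \<in> ball 0 1" using sub by blast
    then show "x \<in> ball 0 \<delta>" using \<delta> by (simp add: divide_less_eq)
  qed
  ultimately have cl: "closure {x. ?k x \<noteq> 0} \<subseteq> ball 0 \<delta>" by (rule order_trans)
  have "compact (closure {x. ?k x \<noteq> 0})"
    using bounded_subset[OF bounded_ball cl] by (simp add: compact_eq_bounded_closed)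
  then have tk: "test_fun (ball 0 \<delta>) ?k" unfolding test_fun_def using smk cl by blast
  have z: "?k x = 0 \<and> grad_of ?k x = 0" if "\<delta> \<le> norm x" for x
    using test_fun_zero[OF tk, of x] that by simp
  have \<rho>m: "\<rho> \<in> borel_measurable borel" by (rule C1_gradD(4)[OF smooth_C1_grad[OF sm]])
  have "(LINT x|lborel. ?k x) = \<delta> ^ DIM('a) * (LINT x|lborel. ?k (\<delta> *\<^sub>R x))"
    by (rule lborel_scale_integral[OF C1_gradD(4)[OF smooth_C1_grad[OF smk]] \<delta>])
  also have "(\<lambda>x. ?k (\<delta> *\<^sub>R x)) = (\<lambda>x. \<rho> x / \<delta> ^ DIM('a))"
    using \<delta> by (simp add: rescale_def)
  also have "\<delta> ^ DIM('a) * (LINT x|lborel. \<rho> x / \<delta> ^ DIM('a)) = (LINT x|lborel. \<rho> x)" using \<delta> by simp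
  also have "\<dots> = 1" using one integral_completion[of \<rho> lborel] \<rho>m by simp
  finally have k1: "(LINT x|lborel. ?k x) = 1" .
  have "0 \<le> ?k x" for x using nn \<delta> by (simp add: rescale_def)
  then show ?thesis
    unfolding tkernel_def kernel_def using tk test_fun_C1c[OF tk] z k1 by blast
qed

text \<open>Reflection reverses the gradient; this sign later cancels the one in the integration by
  parts.\<close>

lemma test_fun_reflect:
  fixes k :: "'a::euclidean_space \<Rightarrow> real"
  assumes k: "test_fun (ball 0 \<delta>) k" and U: "cball x \<delta> \<subseteq> U"
  shows "test_fun U (\<lambda>y. k (x - y))"
    and "i \<in> Basis \<Longrightarrow> partial_deriv (\<lambda>y. k (x - y)) i y = - (grad_of k (x - y) \<bullet> i)"
proof -
  have sm: "smooth_on UNIV k" using k unfolding test_fun_def by blast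
  have sm': "smooth_on UNIV (\<lambda>y. k (x - y))"
    using smooth_affine[OF sm, of 1 x "-1"] by simp
  have "{y. k (x - y) \<noteq> 0} \<subseteq> cball x \<delta>"
  proof
    fix y assume "y \<in> {y. k (x - y) \<noteq> 0}"
    then have "x - y \<in> ball 0 \<delta>" using test_fun_zero(1)[OF k, of "x - y"] by blast
    then show "y \<in> cball x \<delta>" by (simp add: dist_norm norm_minus_commute)
  qed
  then have cl: "closure {y. k (x - y) \<noteq> 0} \<subseteq> cball x \<delta>" by (rule closure_minimal) (rule closed_cball)
  have "compact (closure {y. k (x - y) \<noteq> 0})"
    using bounded_subset[OF bounded_cball cl] by (simp add: compact_eq_bounded_closed)
  then show "test_fun U (\<lambda>y. k (x - y))"
    unfolding test_fun_def using sm' order_trans[OF cl U] by blast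
  assume i: "i \<in> Basis"
  have "((\<lambda>y. x - y) has_derivative (\<lambda>h. - h)) (at y)"
    by (auto intro!: derivative_eq_intros)
  from has_derivative_compose[OF this C1_gradD(1)[OF smooth_C1_grad[OF sm]]]
  have "((\<lambda>y. k (x - y)) has_derivative (\<lambda>h. (- grad_of k (x - y)) \<bullet> h)) (at y)"
    by (rule has_derivative_eq_rhs) (simp add: fun_eq_iff)
  then have "grad_of (\<lambda>y. k (x - y)) y = - grad_of k (x - y)" by (rule grad_of_eq)
  then show "partial_deriv (\<lambda>y. k (x - y)) i y = - (grad_of k (x - y) \<bullet> i)"
    using grad_of_inner[OF i, of "\<lambda>y. k (x - y)" y] by simp
qed

text \<open>Testing the distributional gradient with the reflected kernel shows that the gradient of
  the convolution at x is the kernel integrated against \<nu>. This is local: the kernel around x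
  must fit into \<open>U\<close>.\<close>

lemma norm_conv_grad_le:
  fixes f v :: "'a::euclidean_space \<Rightarrow> real"
  assumes U: "open U" and v: "distr_grad U v \<nu>" and f: "integrable lborel f"
    and fv: "AE x\<in>U in lebesgue. f x = v x" and vi: "set_integrable lebesgue U v"
    and k: "tkernel \<delta> k" and x: "cball x \<delta> \<subseteq> U"
  shows "norm (conv_grad (grad_of k) f x) \<le> (LINT y|tv_measure U \<nu>. k (x - y))"
proof -
  have tk: "test_fun (ball 0 \<delta>) k" and nn: "\<And>x. 0 \<le> k x" and z: "\<And>x. \<delta> \<le> norm x \<Longrightarrow> grad_of k x = 0"
    using k unfolding tkernel_def kernel_def by blast+
  have C: "C1c k (grad_of k)" by (rule test_fun_C1c[OF tk])
  note D = C1_gradD[OF C1cD[OF C]]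
  obtain M where M: "\<And>x. norm (grad_of k x) \<le> M" using C1c_integrable(3)[OF C] by blast
  obtain M' where M': "\<And>x. \<bar>k x\<bar> \<le> M'" using C1c_integrable(4)[OF C] by blast
  have UB: "U \<in> sets borel" using U by simp
  have \<nu>: "radon_measure U \<nu>" using v by (simp add: distr_grad_def)
  have fm: "f \<in> borel_measurable borel" using borel_measurable_integrable[OF f] by simp
  have gm: "(\<lambda>y. grad_of k (x - y) \<bullet> i) \<in> borel_measurable borel" for i
    using D(5) by measurable
  have int: "integrable lborel (\<lambda>y. f y *\<^sub>R grad_of k (x - y))" by (rule conv_integrable[OF D(3) M f])
  have comp: "conv_grad (grad_of k) f x \<bullet> i = signed_integral U (\<lambda>A. \<nu> A \<bullet> i) (\<lambda>y. k (x - y))" if i: "i \<in> Basis" for i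
  proof -
    have "conv_grad (grad_of k) f x \<bullet> i = (LINT y|lborel. (f y *\<^sub>R grad_of k (x - y)) \<bullet> i)"
      unfolding conv_grad_def by (rule integral_inner_left[symmetric]) (use int in blast)
    also have "\<dots> = (LINT y|lborel. f y * (grad_of k (x - y) \<bullet> i))" by simp
    also have "\<dots> = (LINT y|lebesgue. f y * (grad_of k (x - y) \<bullet> i))"
      by (rule integral_completion[symmetric]) (use borel_measurable_times[OF fm gm[of i]] in simp)
    also have "\<dots> = (LINT y|lebesgue. - (indicat_real U y *\<^sub>R (v y * partial_deriv (\<lambda>y. k (x - y)) i y)))"
    proof (rule integral_cong_AE)
      show "(\<lambda>y. f y * (grad_of k (x - y) \<bullet> i)) \<in> borel_measurable lebesgue"
        by (rule measurable_completion) (use borel_measurable_times[OF fm gm[of i]] in simp)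
      have "(\<lambda>y. indicat_real U y *\<^sub>R v y) \<in> borel_measurable lebesgue"
        using vi unfolding set_integrable_def by (rule borel_measurable_integrable)
      moreover have "(\<lambda>y. grad_of k (x - y) \<bullet> i) \<in> borel_measurable lebesgue"
        using gm by (intro measurable_completion) simp
      ultimately have "(\<lambda>y. (indicat_real U y *\<^sub>R v y) * (grad_of k (x - y) \<bullet> i)) \<in> borel_measurable lebesgue"
        by (rule borel_measurable_times)
      then show "(\<lambda>y. - (indicat_real U y *\<^sub>R (v y * partial_deriv (\<lambda>y. k (x - y)) i y))) \<in> borel_measurable lebesgue"
        by (simp add: test_fun_reflect(2)[OF tk x i] mult.assoc)
      show "AE y in lebesgue. f y * (grad_of k (x - y) \<bullet> i) = - (indicat_real U y *\<^sub>R (v y * partial_deriv (\<lambda>y. k (x - y)) i y))"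
        using fv
      proof eventually_elim
        fix y assume fy: "y \<in> U \<longrightarrow> f y = v y"
        show "f y * (grad_of k (x - y) \<bullet> i) = - (indicat_real U y *\<^sub>R (v y * partial_deriv (\<lambda>y. k (x - y)) i y))"
        proof (cases "y \<in> U")
          case True
          then show ?thesis using fy by (simp add: test_fun_reflect(2)[OF tk x i])
        next
          case False
          then have "y \<notin> cball x \<delta>" using x by blast
          then have "\<delta> \<le> norm (x - y)" by (simp add: dist_norm)
          then show ?thesis using False z by simp
        qed
      qed
    qed
    also have "\<dots> = - (LINT y:U|lebesgue. v y * partial_deriv (\<lambda>y. k (x - y)) i y)"
      unfolding set_lebesgue_integral_def by (rule Bochner_Integration.integral_minus)
    also have "\<dots> = signed_integral U (\<lambda>A. \<nu> A \<bullet> i) (\<lambda>y. k (x - y))"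
      using v test_fun_reflect(1)[OF tk x] i unfolding distr_grad_def by simp
    finally show ?thesis .
  qed
  have "conv_grad (grad_of k) f x = (\<Sum>i\<in>Basis. (conv_grad (grad_of k) f x \<bullet> i) *\<^sub>R i)"
    by (simp only: euclidean_representation)
  also have "\<dots> = (\<Sum>i\<in>Basis. signed_integral U (\<lambda>A. \<nu> A \<bullet> i) (\<lambda>y. k (x - y)) *\<^sub>R i)"
    by (intro sum.cong refl) (simp only: comp)
  finally have eq: "conv_grad (grad_of k) f x = (\<Sum>i\<in>Basis. signed_integral U (\<lambda>A. \<nu> A \<bullet> i) (\<lambda>y. k (x - y)) *\<^sub>R i)" .
  have km: "(\<lambda>y. k (x - y)) \<in> borel_measurable borel" using D(4) by measurable
  show ?thesis
    unfolding eq by (rule signed_integral_vector_le[OF \<nu> UB km M' nn])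
qed

lemma measurable_kernel_tv:
  fixes k :: "'a::euclidean_space \<Rightarrow> real" and \<nu> :: "'a set \<Rightarrow> 'b::euclidean_space"
  assumes k: "kernel \<delta> k \<kappa>"
  shows "(\<lambda>p. k (fst p - snd p)) \<in> borel_measurable (lborel \<Otimes>\<^sub>M tv_measure U \<nu>)"
proof -
  let ?T = "tv_measure U \<nu>"
  have C: "C1c k \<kappa>" using k unfolding kernel_def by blast
  have id: "(\<lambda>y. y) \<in> borel_measurable ?T"
    by (simp add: measurable_cong_sets[OF sets_tv refl] measurable_restrict_space1)
  have snd: "(\<lambda>p. snd p) \<in> borel_measurable ((lborel :: 'a measure) \<Otimes>\<^sub>M ?T)"
    by (rule measurable_compose[OF measurable_snd id])
  have fst: "(\<lambda>p. fst p) \<in> borel_measurable ((lborel :: 'a measure) \<Otimes>\<^sub>M ?T)" by measurable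
  show ?thesis
    by (rule measurable_compose[OF borel_measurable_diff[OF fst snd] C1_gradD(4)[OF C1cD[OF C]]])
qed

text \<open>By Fubini each y contributes the mass of k, which is 1. With the pointwise gradient
  bound this means that mollification does not increase total variation.\<close>

lemma nn_integral_kernel_tv:
  fixes k :: "'a::euclidean_space \<Rightarrow> real" and \<nu> :: "'a set \<Rightarrow> 'b::euclidean_space"
  assumes \<nu>: "radon_measure U \<nu>" and U: "U \<in> sets borel" and k: "kernel \<delta> k \<kappa>"
  shows "(\<integral>\<^sup>+x. ennreal (LINT y|tv_measure U \<nu>. k (x - y)) \<partial>lborel) = tvar \<nu> U"
proof -
  let ?T = "tv_measure U \<nu>"
  interpret T: finite_measure ?T by (rule finite_tv[OF \<nu> U])
  interpret P: pair_sigma_finite lborel ?T ..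
  have C: "C1c k \<kappa>" and nn: "\<And>x. 0 \<le> k x" and one: "(LINT x|lborel. k x) = 1"
    using k unfolding kernel_def by blast+
  note D = C1_gradD[OF C1cD[OF C]]
  obtain M' where M': "\<And>x. \<bar>k x\<bar> \<le> M'" using C1c_integrable(4)[OF C] by blast
  have km: "(\<lambda>y. k (x - y)) \<in> borel_measurable borel" for x using D(4) by measurable
  have joint: "(\<lambda>(x, y). ennreal (k (x - y))) \<in> borel_measurable (lborel \<Otimes>\<^sub>M ?T)"
    unfolding case_prod_beta' by (rule measurable_compose[OF measurable_kernel_tv[OF k] measurable_ennreal])
  have "ennreal (LINT y|?T. k (x - y)) = (\<integral>\<^sup>+y. ennreal (k (x - y)) \<partial>?T)" for x
  proof (rule nn_integral_eq_integral[symmetric])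
    show "integrable ?T (\<lambda>y. k (x - y))"
      using M' by (intro T.integrable_const_bound[where B=M'] measurable_pos_part(2)[OF km]) simp
  qed (simp add: nn)
  then have "(\<integral>\<^sup>+x. ennreal (LINT y|?T. k (x - y)) \<partial>lborel) = (\<integral>\<^sup>+x. \<integral>\<^sup>+y. ennreal (k (x - y)) \<partial>?T \<partial>lborel)"
    by simp
  also have "\<dots> = (\<integral>\<^sup>+y. \<integral>\<^sup>+x. ennreal (k (x - y)) \<partial>lborel \<partial>?T)"
    by (rule P.Fubini'[OF joint, symmetric])
  also have "\<dots> = (\<integral>\<^sup>+y. 1 \<partial>?T)"
  proof (rule nn_integral_cong)
    fix y
    have "(\<integral>\<^sup>+x. ennreal (k (x + - y)) \<partial>lborel) = (\<integral>\<^sup>+x. ennreal (k x) \<partial>lborel)"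
      using D(4) by (intro nn_integral_lborel_shift) measurable
    also have "\<dots> = 1" using nn_integral_eq_integral[OF C1c_integrable(1)[OF C]] nn one by simp
    finally show "(\<integral>\<^sup>+x. ennreal (k (x - y)) \<partial>lborel) = 1" by simp
  qed
  also have "\<dots> = tvar \<nu> U" by (simp add: emeasure_tv[OF \<nu> U U order_refl])
  finally show ?thesis .
qed

lemma borel_kernel_tv:
  fixes k :: "'a::euclidean_space \<Rightarrow> real" and \<nu> :: "'a set \<Rightarrow> 'b::euclidean_space"
  assumes \<nu>: "radon_measure U \<nu>" and U: "U \<in> sets borel" and k: "kernel \<delta> k \<kappa>"
  shows "(\<lambda>x. ennreal (LINT y|tv_measure U \<nu>. k (x - y))) \<in> borel_measurable lborel"
proof -
  let ?T = "tv_measure U \<nu>"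
  interpret T: finite_measure ?T by (rule finite_tv[OF \<nu> U])
  note joint = measurable_kernel_tv[OF k, of U \<nu>]
  show ?thesis
    by (rule measurable_compose[OF T.borel_measurable_lebesgue_integral measurable_ennreal])
      (use joint in \<open>simp add: case_prod_beta'\<close>)
qed

lemma kernel_integral_nonneg:
  assumes "kernel \<delta> k \<kappa>" shows "0 \<le> (LINT y|M. k (x - y))"
  using assms by (intro Bochner_Integration.integral_nonneg) (simp add: kernel_def)

lemma conv_zero:
  fixes f :: "'a::euclidean_space \<Rightarrow> real"
  assumes k: "kernel \<delta> k \<kappa>" and f: "\<And>y. norm (x - y) < \<delta> \<Longrightarrow> f y = 0"
  shows "conv k f x = 0" "conv_grad \<kappa> f x = 0"
proof -
  have "k (x - y) * f y = 0 \<and> f y *\<^sub>R \<kappa> (x - y) = 0" for y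
  proof (cases "norm (x - y) < \<delta>")
    case False
    then have "k (x - y) = 0" "\<kappa> (x - y) = 0" using k unfolding kernel_def by auto
    then show ?thesis by simp
  qed (simp add: f)
  then have "(\<lambda>y. k (x - y) * f y) = (\<lambda>y. 0)" "(\<lambda>y. f y *\<^sub>R \<kappa> (x - y)) = (\<lambda>y. 0)"
    by blast+
  then show "conv k f x = 0" "conv_grad \<kappa> f x = 0"
    unfolding conv_def conv_grad_def by simp_all
qed

text \<open>\<open>\<Omega>\<close> has distance at least d from the complement of \<open>U\<close>.
  For small \<delta> the gradient of the convolution at x is 0 unless x is close to
  \<open>\<Omega>\<close>, and there the whole kernel sits inside \<open>U\<close>; so extension by
  0 adds no variation.\<close>

lemma bv_approx_conv:
  fixes f v :: "'a::euclidean_space \<Rightarrow> real" and k :: "nat \<Rightarrow> 'a \<Rightarrow> real"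
  assumes U: "open U" and v: "distr_grad U v \<nu>" and f: "integrable lborel f"
    and fv: "AE x\<in>U in lebesgue. f x = v x" and vi: "set_integrable lebesgue U v"
    and \<Omega>: "bounded \<Omega>" "\<And>x. x \<notin> \<Omega> \<Longrightarrow> f x = 0" and d: "0 < d" "\<And>x. x \<in> \<Omega> \<Longrightarrow> ball x d \<subseteq> U"
    and k: "\<And>j. tkernel (\<delta> j) (k j)" and \<delta>: "\<delta> \<longlonglongrightarrow> 0"
  shows "bv_approx f (tvar \<nu> U)"
proof -
  have "eventually (\<lambda>j. \<delta> j < d / 2) sequentially" using d(1) by (intro order_tendstoD(2)[OF \<delta>]) simp
  then obtain N where N: "\<And>j. N \<le> j \<Longrightarrow> \<delta> j < d / 2" by (auto simp: eventually_sequentially)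
  have kk: "kernel (\<delta> j) (k j) (grad_of (k j))" for j using k unfolding tkernel_def by blast
  have C: "C1c (k j) (grad_of (k j))" for j using kk unfolding kernel_def by blast
  have UB: "U \<in> sets borel" using U by simp
  have \<nu>: "radon_measure U \<nu>" using v by (simp add: distr_grad_def)
  obtain r where r: "\<Omega> \<subseteq> ball 0 r" using bounded_subset_ballD[OF \<Omega>(1), of 0] by (elim exE conjE)
  have supp: "f x = 0" if "r \<le> norm x" for x
  proof -
    have "x \<notin> ball 0 r" using that by simp
    then have "x \<notin> \<Omega>" using r by blast
    then show ?thesis by (rule \<Omega>(2))
  qed
  have "(\<lambda>j. nnL1 f (conv (k j) f)) \<longlonglongrightarrow> 0"
    using conv_tendsto_L1[OF kk \<delta> f] by (simp only: nnL1_commute)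
  then have lim: "(\<lambda>j. nnL1 f (conv (k (j + N)) f)) \<longlonglongrightarrow> 0" by (rule LIMSEQ_ignore_initial_segment)
  have bound: "norm (conv_grad (grad_of (k j)) f x) \<le> (LINT y|tv_measure U \<nu>. k j (x - y))" if j: "N \<le> j" for j x
  proof (cases "\<exists>y\<in>\<Omega>. norm (x - y) < \<delta> j")
    case True
    then obtain y where y: "y \<in> \<Omega>" "norm (x - y) < \<delta> j" by blast
    \<comment> \<open>With \<delta> below d / 2, two steps of length at most \<delta> from a point
      of \<open>\<Omega>\<close> stay within distance d.\<close>
    have "cball x (\<delta> j) \<subseteq> ball y d"
    proof
      fix z assume "z \<in> cball x (\<delta> j)"
      then have "dist x z \<le> \<delta> j" by simp
      moreover have "dist y z \<le> dist x y + dist x z" by (simp add: dist_triangle3 dist_commute)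
      ultimately show "z \<in> ball y d" using y(2) N[OF j] by (simp add: dist_norm)
    qed
    then have "cball x (\<delta> j) \<subseteq> U" using d(2)[OF y(1)] by (rule order_trans)
    then show ?thesis by (rule norm_conv_grad_le[OF U v f fv vi k])
  next
    case False
    then have "conv_grad (grad_of (k j)) f x = 0"
      using \<Omega>(2) by (intro conv_zero(2)[OF kk]) blast
    then show ?thesis using kernel_integral_nonneg[OF kk] by simp
  qed
  show ?thesis
    unfolding bv_approx_def
  proof (intro conjI exI allI f)
    show "C1c (conv (k (j + N)) f) (conv_grad (grad_of (k (j + N))) f)" for j
      by (rule C1c_conv[OF C f supp])
    show "(\<lambda>j. nnL1 f (conv (k (j + N)) f)) \<longlonglongrightarrow> 0" by (rule lim)
    fix j
    have "(\<integral>\<^sup>+x. ennreal (norm (conv_grad (grad_of (k (j + N))) f x)) \<partial>lborel)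
      \<le> (\<integral>\<^sup>+x. ennreal (LINT y|tv_measure U \<nu>. k (j + N) (x - y)) \<partial>lborel)"
      using bound[of "j + N"] by (intro nn_integral_mono ennreal_leI) simp
    also have "\<dots> = tvar \<nu> U" by (rule nn_integral_kernel_tv[OF \<nu> UB kk])
    finally show "(\<integral>\<^sup>+x. ennreal (norm (conv_grad (grad_of (k (j + N))) f x)) \<partial>lborel) \<le> tvar \<nu> U" .
  qed
qed

text \<open>Averaging with a probability density does not increase the L^1 norm.\<close>

lemma nn_integral_conv_le:
  fixes f :: "'a::euclidean_space \<Rightarrow> real"
  assumes k: "kernel \<delta> k \<kappa>" and f: "integrable lborel f"
  shows "(\<integral>\<^sup>+x. ennreal \<bar>conv k f x\<bar> \<partial>lborel) \<le> (\<integral>\<^sup>+x. ennreal \<bar>f x\<bar> \<partial>lborel)"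
proof -
  have C: "C1c k \<kappa>" and nn: "\<And>x. 0 \<le> k x" and one: "(LINT x|lborel. k x) = 1"
    using k unfolding kernel_def by blast+
  note D = C1_gradD[OF C1cD[OF C]]
  note [measurable] = D(4)
  have [measurable]: "f \<in> borel_measurable borel" using borel_measurable_integrable[OF f] by simp
  obtain M' where M': "\<And>x. norm (k x) \<le> M'" using C1c_integrable(4)[OF C] by auto
  have i1: "integrable lborel (\<lambda>y. k (x - y) * f y)" for x
    using conv_integrable[OF D(2) M' f, of x] by (simp add: mult.commute)
  have "ennreal \<bar>conv k f x\<bar> \<le> (\<integral>\<^sup>+y. ennreal (k (x - y)) * ennreal \<bar>f y\<bar> \<partial>lborel)" for x
  proof -
    have "ennreal (norm (conv k f x)) \<le> (\<integral>\<^sup>+y. ennreal (norm (k (x - y) * f y)) \<partial>lborel)"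
      unfolding conv_def by (rule integral_norm_bound_ennreal[OF i1])
    also have "\<dots> = (\<integral>\<^sup>+y. ennreal (k (x - y)) * ennreal \<bar>f y\<bar> \<partial>lborel)"
      using nn by (intro nn_integral_cong) (simp add: ennreal_mult[symmetric] abs_mult)
    finally show ?thesis by simp
  qed
  then have "(\<integral>\<^sup>+x. ennreal \<bar>conv k f x\<bar> \<partial>lborel) \<le> (\<integral>\<^sup>+x. \<integral>\<^sup>+y. ennreal (k (x - y)) * ennreal \<bar>f y\<bar> \<partial>lborel \<partial>lborel)"
    by (rule nn_integral_mono)
  also have "\<dots> = (\<integral>\<^sup>+y. \<integral>\<^sup>+x. ennreal (k (x - y)) * ennreal \<bar>f y\<bar> \<partial>lborel \<partial>lborel)"
    by (rule nn_Fubini[symmetric]) measurable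
  also have "\<dots> = (\<integral>\<^sup>+y. ennreal \<bar>f y\<bar> \<partial>lborel)"
  proof (rule nn_integral_cong)
    fix y
    have "(\<integral>\<^sup>+x. ennreal (k (x + - y)) \<partial>lborel) = (\<integral>\<^sup>+x. ennreal (k x) \<partial>lborel)"
      by (intro nn_integral_lborel_shift) measurable
    also have "\<dots> = 1" using nn_integral_eq_integral[OF C1c_integrable(1)[OF C]] nn one by simp
    finally show "(\<integral>\<^sup>+x. ennreal (k (x - y)) * ennreal \<bar>f y\<bar> \<partial>lborel) = ennreal \<bar>f y\<bar>"
      by (subst nn_integral_multc) simp_all
  qed
  finally show ?thesis .
qed

text \<open>The factor \<zeta> is applied after mollification, where the product rule is classical.
  The term with the gradient of \<zeta> costs at most its bound times the L^1 norm of f, the other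
  term at most the variation of \<nu>.\<close>

lemma bv_approx_cutoff:
  fixes f v \<zeta> :: "'a::euclidean_space \<Rightarrow> real" and k :: "nat \<Rightarrow> 'a \<Rightarrow> real"
  assumes U: "open U" and v: "distr_grad U v \<nu>" and f: "integrable lborel f"
    and fv: "AE x\<in>U in lebesgue. f x = v x" and vi: "set_integrable lebesgue U v"
    and \<zeta>: "C1c \<zeta> Z" "\<And>x. \<bar>\<zeta> x\<bar> \<le> 1" and d: "0 < d" "\<And>x. \<zeta> x \<noteq> 0 \<Longrightarrow> cball x d \<subseteq> U"
    and k: "\<And>j. tkernel (\<delta> j) (k j)" and \<delta>: "\<delta> \<longlonglongrightarrow> 0"
  shows "\<exists>V\<ge>0. bv_approx (\<lambda>x. \<zeta> x * f x) (ennreal V)"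
proof -
  have "eventually (\<lambda>j. \<delta> j < d) sequentially" using d(1) by (intro order_tendstoD(2)[OF \<delta>]) simp
  then obtain N where N: "\<And>j. N \<le> j \<Longrightarrow> \<delta> j < d" by (auto simp: eventually_sequentially)
  have kk: "kernel (\<delta> j) (k j) (grad_of (k j))" for j using k unfolding tkernel_def by blast
  have C: "C1c (k j) (grad_of (k j))" for j using kk unfolding kernel_def by blast
  have UB: "U \<in> sets borel" using U by simp
  have \<nu>: "radon_measure U \<nu>" using v by (simp add: distr_grad_def)
  obtain M where M: "0 \<le> M" "\<And>x. norm (Z x) \<le> M" using C1c_integrable(3)[OF \<zeta>(1)] by blast
  have fm: "f \<in> borel_measurable borel" using borel_measurable_integrable[OF f] by simp
  note Dz = C1_gradD[OF C1cD[OF \<zeta>(1)]]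
  have zf: "integrable lborel (\<lambda>x. \<zeta> x * f x)"
  proof (rule Bochner_Integration.integrable_bound[OF f])
    show "(\<lambda>x. \<zeta> x * f x) \<in> borel_measurable lborel" using Dz(4) fm by measurable
    show "AE x in lborel. norm (\<zeta> x * f x) \<le> norm (f x)"
      using mult_right_mono[OF \<zeta>(2)] by (intro AE_I2) (simp add: abs_mult)
  qed
  let ?F = "\<lambda>j x. conv (k (j + N)) f x * \<zeta> x"
  let ?G = "\<lambda>j x. conv (k (j + N)) f x *\<^sub>R Z x + \<zeta> x *\<^sub>R conv_grad (grad_of (k (j + N))) f x"
  have cg: "C1_grad (conv (k j) f) (conv_grad (grad_of (k j)) f)" for j by (rule C1_grad_conv[OF C f])
  have "(\<lambda>j. nnL1 f (conv (k j) f)) \<longlonglongrightarrow> 0"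
    using conv_tendsto_L1[OF kk \<delta> f] by (simp only: nnL1_commute)
  then have lim: "(\<lambda>j. nnL1 f (conv (k (j + N)) f)) \<longlonglongrightarrow> 0" by (rule LIMSEQ_ignore_initial_segment)
  define A where "A = (LINT x|lborel. \<bar>f x\<bar>)"
  have A: "(\<integral>\<^sup>+x. ennreal \<bar>f x\<bar> \<partial>lborel) = ennreal A" "0 \<le> A"
    unfolding A_def using f by (simp_all add: nn_integral_eq_integral)
  define V where "V = M * A + enn2real (tvar \<nu> U)"
  have V: "0 \<le> V" "ennreal V = ennreal M * ennreal A + tvar \<nu> U"
    unfolding V_def using M(1) A(2) tvar_finite[OF \<nu> UB] by (simp_all add: ennreal_plus ennreal_mult)
  have bound: "\<bar>\<zeta> x\<bar> * norm (conv_grad (grad_of (k j)) f x) \<le> (LINT y|tv_measure U \<nu>. k j (x - y))" if j: "N \<le> j" for j x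
  proof (cases "\<zeta> x = 0")
    case False
    have "cball x (\<delta> j) \<subseteq> cball x d" using N[OF j] by (intro subset_cball) simp
    then have "cball x (\<delta> j) \<subseteq> U" using d(2)[OF False] by (rule order_trans)
    then have "norm (conv_grad (grad_of (k j)) f x) \<le> (LINT y|tv_measure U \<nu>. k j (x - y))"
      by (rule norm_conv_grad_le[OF U v f fv vi k])
    moreover have "\<bar>\<zeta> x\<bar> * norm (conv_grad (grad_of (k j)) f x) \<le> 1 * norm (conv_grad (grad_of (k j)) f x)"
      by (rule mult_right_mono[OF \<zeta>(2) norm_ge_zero])
    ultimately show ?thesis by simp
  qed (use kernel_integral_nonneg[OF kk] in simp)
  have "bv_approx (\<lambda>x. \<zeta> x * f x) (ennreal V)"
    unfolding bv_approx_def
  proof (intro conjI exI allI zf)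
    fix j
    have 1: "C1c (\<lambda>x. \<zeta> x * conv (k (j + N)) f x) (\<lambda>x. \<zeta> x *\<^sub>R conv_grad (grad_of (k (j + N))) f x + conv (k (j + N)) f x *\<^sub>R Z x)"
      by (rule C1c_mult[OF \<zeta>(1) cg])
    then show "C1c (?F j) (?G j)" by (simp only: mult.commute add.commute)
    have "(\<integral>\<^sup>+x. ennreal (norm (?G j x)) \<partial>lborel)
      \<le> (\<integral>\<^sup>+x. ennreal M * ennreal \<bar>conv (k (j + N)) f x\<bar> + ennreal (LINT y|tv_measure U \<nu>. k (j + N) (x - y)) \<partial>lborel)"
    proof (rule nn_integral_mono)
      fix x
      have "norm (?G j x) \<le> \<bar>conv (k (j + N)) f x\<bar> * norm (Z x) + \<bar>\<zeta> x\<bar> * norm (conv_grad (grad_of (k (j + N))) f x)"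
        by (rule order_trans[OF norm_triangle_ineq]) simp
      also have "\<dots> \<le> \<bar>conv (k (j + N)) f x\<bar> * M + (LINT y|tv_measure U \<nu>. k (j + N) (x - y))"
        by (intro add_mono mult_left_mono M(2) bound) simp_all
      finally have "ennreal (norm (?G j x)) \<le> ennreal (M * \<bar>conv (k (j + N)) f x\<bar> + (LINT y|tv_measure U \<nu>. k (j + N) (x - y)))"
        by (intro ennreal_leI) (simp add: mult.commute)
      also have "\<dots> = ennreal M * ennreal \<bar>conv (k (j + N)) f x\<bar> + ennreal (LINT y|tv_measure U \<nu>. k (j + N) (x - y))"
        using M(1) kernel_integral_nonneg[OF kk] by (simp add: ennreal_plus ennreal_mult)
      finally show "ennreal (norm (?G j x)) \<le> ennreal M * ennreal \<bar>conv (k (j + N)) f x\<bar> + ennreal (LINT y|tv_measure U \<nu>. k (j + N) (x - y))" .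
    qed
    also have "\<dots> = ennreal M * (\<integral>\<^sup>+x. ennreal \<bar>conv (k (j + N)) f x\<bar> \<partial>lborel) + (\<integral>\<^sup>+x. ennreal (LINT y|tv_measure U \<nu>. k (j + N) (x - y)) \<partial>lborel)"
    proof -
      have m1: "(\<lambda>x. ennreal \<bar>conv (k (j + N)) f x\<bar>) \<in> borel_measurable lborel"
        using C1_gradD(4)[OF cg[of "j + N"]] by measurable
      have "(\<integral>\<^sup>+x. ennreal M * ennreal \<bar>conv (k (j + N)) f x\<bar> + ennreal (LINT y|tv_measure U \<nu>. k (j + N) (x - y)) \<partial>lborel)
        = (\<integral>\<^sup>+x. ennreal M * ennreal \<bar>conv (k (j + N)) f x\<bar> \<partial>lborel) + (\<integral>\<^sup>+x. ennreal (LINT y|tv_measure U \<nu>. k (j + N) (x - y)) \<partial>lborel)"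
      proof (rule nn_integral_add)
        interpret T: finite_measure "tv_measure U \<nu>" by (rule finite_tv[OF \<nu> UB])
        show "(\<lambda>x. ennreal (LINT y|tv_measure U \<nu>. k (j + N) (x - y))) \<in> borel_measurable lborel"
          by (rule borel_kernel_tv[OF \<nu> UB kk])
      qed (use m1 in measurable)
      then show ?thesis using m1 by (simp add: nn_integral_cmult)
    qed
    also have "\<dots> \<le> ennreal M * ennreal A + tvar \<nu> U"
      using nn_integral_conv_le[OF kk f, of "j + N"] nn_integral_kernel_tv[OF \<nu> UB kk, of "j + N"] A(1)
      by (intro add_mono mult_left_mono) simp_all
    finally show "(\<integral>\<^sup>+x. ennreal (norm (?G j x)) \<partial>lborel) \<le> ennreal V" by (simp only: V(2))
  next
    have le: "nnL1 (\<lambda>x. \<zeta> x * f x) (?F j) \<le> nnL1 f (conv (k (j + N)) f)" for j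
      unfolding nnL1_def
    proof (rule nn_integral_mono, rule ennreal_leI)
      fix x
      have "\<bar>\<zeta> x * f x - conv (k (j + N)) f x * \<zeta> x\<bar> = \<bar>\<zeta> x\<bar> * \<bar>f x - conv (k (j + N)) f x\<bar>"
        by (simp add: abs_mult[symmetric] right_diff_distrib mult.commute)
      also have "\<dots> \<le> 1 * \<bar>f x - conv (k (j + N)) f x\<bar>" by (rule mult_right_mono[OF \<zeta>(2) abs_ge_zero])
      finally show "\<bar>\<zeta> x * f x - conv (k (j + N)) f x * \<zeta> x\<bar> \<le> \<bar>f x - conv (k (j + N)) f x\<bar>" by simp
    qed
    show "(\<lambda>j. nnL1 (\<lambda>x. \<zeta> x * f x) (?F j)) \<longlonglongrightarrow> 0"
    proof (rule tendsto_sandwich[OF _ _ tendsto_const lim])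
      show "\<forall>\<^sub>F j in sequentially. 0 \<le> nnL1 (\<lambda>x. \<zeta> x * f x) (?F j)" by simp
      show "\<forall>\<^sub>F j in sequentially. nnL1 (\<lambda>x. \<zeta> x * f x) (?F j) \<le> nnL1 f (conv (k (j + N)) f)"
        by (rule always_eventually) (rule allI, rule le)
    qed
  qed
  then show ?thesis using V(1) by blast
qed

text \<open>The mollified indicator of the e/4-neighbourhood of \<open>C\<close>, with a kernel of
  radius at most e/4. It is 1 on \<open>C\<close>, and points where it is nonzero stay within e/2 of
  \<open>C\<close>, which leaves room for a further ball of radius e/4.\<close>

lemma cutoff_exists:
  fixes C O' :: "'a::euclidean_space set"
  assumes C: "compact C" "open O'" "C \<subseteq> O'" and k: "\<And>\<epsilon>. 0 < \<epsilon> \<Longrightarrow> \<exists>\<delta> k \<kappa>. 0 < \<delta> \<and> \<delta> \<le> \<epsilon> \<and> kernel \<delta> k (\<kappa> :: 'a \<Rightarrow> 'a)"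
  obtains \<zeta> Z d where "C1c \<zeta> Z" "\<And>x. 0 \<le> \<zeta> x" "\<And>x. \<zeta> x \<le> 1" "\<And>x. x \<in> C \<Longrightarrow> \<zeta> x = 1" "0 < d"
    "\<And>x. \<zeta> x \<noteq> 0 \<Longrightarrow> cball x d \<subseteq> O'"
proof -
  obtain e where e: "e > 0" "(\<Union>x\<in>C. ball x e) \<subseteq> O'"
    using compact_subset_open_imp_ball_epsilon_subset[OF C] .
  define D where "D = (\<Union>x\<in>C. ball x (e / 4))"
  have "0 < e / 4" using e by simp
  from k[OF this] obtain \<delta> kk \<kappa> where \<delta>: "0 < \<delta>" "\<delta> \<le> e / 4" and ker: "kernel \<delta> kk (\<kappa> :: 'a \<Rightarrow> 'a)" by blast
  have Ck: "C1c kk \<kappa>" and nn: "\<And>x. 0 \<le> kk x" and z: "\<And>x. \<delta> \<le> norm x \<Longrightarrow> kk x = 0" and one: "(LINT x|lborel. kk x) = 1"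
    using ker unfolding kernel_def by blast+
  note Dk = C1_gradD[OF C1cD[OF Ck]]
  have DB: "D \<in> sets borel" unfolding D_def by (intro borel_open open_UN ballI open_ball)
  obtain r where r: "C \<subseteq> ball 0 r" using bounded_subset_ballD[OF compact_imp_bounded[OF C(1)], of 0] by (elim exE conjE)
  have Dr: "norm y < r + e" if y: "y \<in> D" for y
  proof -
    obtain x where x: "x \<in> C" "dist x y < e / 4" using y unfolding D_def by auto
    have "norm x < r" using r x(1) by auto
    moreover have "norm y \<le> norm x + dist x y" using norm_triangle_sub[of y x] by (simp add: dist_norm norm_minus_commute)
    ultimately show ?thesis using x(2) e(1) by linarith
  qed
  have D0: "indicat_real D y = 0" if "r + e \<le> norm y" for y using Dr[of y] that by (auto simp: indicator_def)
  have "bounded D" by (rule boundedI[of _ "r + e"]) (use Dr in \<open>auto intro: less_imp_le\<close>)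
  then have ID: "integrable lborel (indicat_real D)"
    using DB emeasure_bounded_finite[of D] by (simp add: integrable_indicator_iff)
  define \<zeta> where "\<zeta> = conv kk (indicat_real D)"
  have ik: "integrable lborel (\<lambda>y. kk (x - y))" for x
    using lborel_reflect(1)[OF Dk(4)] C1c_integrable(1)[OF Ck] by blast
  have k1: "(LINT y|lborel. kk (x - y)) = 1" for x using lborel_reflect(2)[OF Dk(4)] one by simp
  have Cz: "C1c \<zeta> (conv_grad \<kappa> (indicat_real D))" unfolding \<zeta>_def by (rule C1c_conv[OF Ck ID D0])
  have ikD: "integrable lborel (\<lambda>y. kk (x - y) * indicat_real D y)" for x
    by (rule Bochner_Integration.integrable_bound[OF ik[of x]])
      (use DB Dk(4) nn in \<open>auto simp: indicator_def intro!: AE_I2\<close>)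
  have z0: "0 \<le> \<zeta> x" for x
    unfolding \<zeta>_def conv_def using nn by (intro Bochner_Integration.integral_nonneg) simp
  have z1: "\<zeta> x \<le> 1" for x
  proof -
    have "\<zeta> x \<le> (LINT y|lborel. kk (x - y))"
      unfolding \<zeta>_def conv_def using nn by (intro integral_mono ikD ik) (simp add: indicator_def)
    then show ?thesis by (simp add: k1)
  qed
  have zC: "\<zeta> x = 1" if x: "x \<in> C" for x
  proof -
    have "(\<lambda>y. kk (x - y) * indicat_real D y) = (\<lambda>y. kk (x - y))"
    proof
      fix y
      show "kk (x - y) * indicat_real D y = kk (x - y)"
      proof (cases "norm (x - y) < \<delta>")
        case True
        then have "y \<in> ball x (e / 4)" using \<delta>(2) by (simp add: dist_norm)
        then have "y \<in> D" unfolding D_def using x by blast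
        then show ?thesis by simp
      qed (simp add: z)
    qed
    then show ?thesis unfolding \<zeta>_def conv_def by (simp add: k1)
  qed
  have zs: "cball x (e / 4) \<subseteq> O'" if xz: "\<zeta> x \<noteq> 0" for x
  proof -
    obtain y where y: "norm (x - y) < \<delta>" "indicat_real D y \<noteq> 0"
      using conv_zero(1)[OF ker, of x "indicat_real D"] xz unfolding \<zeta>_def by blast
    then obtain c where c: "c \<in> C" "dist c y < e / 4" unfolding D_def by (auto simp: indicator_def split: if_splits)
    have "cball x (e / 4) \<subseteq> ball c e"
    proof
      fix w assume "w \<in> cball x (e / 4)"
      then have "dist x w \<le> e / 4" by simp
      moreover have "dist y x < e / 4" using y(1) \<delta>(2) by (simp add: dist_norm norm_minus_commute)
      moreover have "dist c w \<le> dist c y + dist y x + dist x w"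
        using dist_triangle[of c w y] dist_triangle[of y w x] by linarith
      ultimately show "w \<in> ball c e" using c(2) e(1) by simp
    qed
    then show ?thesis using e(2) c(1) by blast
  qed
  show ?thesis
    by (rule that[OF Cz z0 z1 zC _ zs]) (use e in simp_all)
qed

section \<open>Uniform bounds for the functionals\<close>

lemma powr_real_of_nat:
  fixes y :: real assumes "0 \<le> y" "0 < n"
  shows "y powr real n = y ^ n"
  using assms by (cases "y = 0") (auto simp: powr_realpow)

lemma power_add3_le:
  fixes a b c :: real
  shows "\<bar>a + b + c\<bar> ^ n \<le> 3 ^ n * (\<bar>a\<bar> ^ n + \<bar>b\<bar> ^ n + \<bar>c\<bar> ^ n)"
proof -
  define t where "t = max \<bar>a\<bar> (max \<bar>b\<bar> \<bar>c\<bar>)"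
  have t: "t = \<bar>a\<bar> \<or> t = \<bar>b\<bar> \<or> t = \<bar>c\<bar>" "\<bar>a + b + c\<bar> \<le> 3 * t"
    unfolding t_def by linarith+
  have p: "0 \<le> \<bar>a\<bar> ^ n" "0 \<le> \<bar>b\<bar> ^ n" "0 \<le> \<bar>c\<bar> ^ n" by simp_all
  have "t ^ n \<le> \<bar>a\<bar> ^ n + \<bar>b\<bar> ^ n + \<bar>c\<bar> ^ n" using t(1)
  proof (elim disjE)
    assume "t = \<bar>a\<bar>" then show ?thesis using p by simp
  next
    assume "t = \<bar>b\<bar>" then show ?thesis using p by simp
  next
    assume "t = \<bar>c\<bar>" then show ?thesis using p by simp
  qed
  then have "(3 * t) ^ n \<le> 3 ^ n * (\<bar>a\<bar> ^ n + \<bar>b\<bar> ^ n + \<bar>c\<bar> ^ n)"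
    by (simp only: power_mult_distrib mult_left_mono zero_le_power zero_le_numeral)
  moreover have "\<bar>a + b + c\<bar> ^ n \<le> (3 * t) ^ n" using t(2) by (intro power_mono) simp_all
  ultimately show ?thesis by (rule order_trans[rotated])
qed

lemma set_nn_integral_power:
  fixes f :: "'a::euclidean_space \<Rightarrow> real"
  assumes "0 < n"
  shows "(\<integral>\<^sup>+x\<in>U. ennreal (\<bar>f x\<bar> powr real n) \<partial>lebesgue) = (\<integral>\<^sup>+x. ennreal (\<bar>indicat_real U x * f x\<bar> ^ n) \<partial>lebesgue)"
  using assms by (intro nn_integral_cong) (auto simp: indicator_def powr_real_of_nat)

text \<open>The measure of \<open>U\<close> is finite and |h|^n is at most 1 + |h|^r for r > n; for
  infinite q the function is essentially bounded.\<close>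

lemma in_Lp_imp_power_finite:
  fixes h :: "'a::euclidean_space \<Rightarrow> real"
  assumes h: "in_Lp q U h" and q: "ereal (real n) < q" and n: "0 < n"
    and U: "U \<in> sets lebesgue" "emeasure lebesgue U < \<infinity>"
  shows "(\<integral>\<^sup>+x. ennreal (\<bar>indicat_real U x * h x\<bar> ^ n) \<partial>lebesgue) < top"
proof (cases q)
  case (real r)
  then have r: "real n < r" using q by simp
  have int: "set_integrable lebesgue U (\<lambda>x. \<bar>h x\<bar> powr r)" using h real by (simp add: in_Lp_def)
  have one: "set_integrable lebesgue U (\<lambda>x. 1::real)"
    unfolding set_integrable_def using U by (simp add: integrable_indicator_iff)
  have i: "integrable lebesgue (\<lambda>x. indicat_real U x *\<^sub>R (1 + \<bar>h x\<bar> powr r))"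
    using set_integral_add(1)[OF one int] by (simp add: set_integrable_def)
  have "(\<integral>\<^sup>+x. ennreal (\<bar>indicat_real U x * h x\<bar> ^ n) \<partial>lebesgue) \<le> (\<integral>\<^sup>+x. ennreal (indicat_real U x *\<^sub>R (1 + \<bar>h x\<bar> powr r)) \<partial>lebesgue)"
  proof (rule nn_integral_mono, rule ennreal_leI)
    fix x
    have "\<bar>h x\<bar> ^ n \<le> 1 + \<bar>h x\<bar> powr r"
    proof (cases "\<bar>h x\<bar> \<le> 1")
      case True
      have "\<bar>h x\<bar> ^ n \<le> 1" using True by (intro power_le_one) simp_all
      then show ?thesis using powr_ge_zero[of "\<bar>h x\<bar>" r] by linarith
    next
      case False
      then have "\<bar>h x\<bar> ^ n = \<bar>h x\<bar> powr real n" using n by (simp add: powr_real_of_nat)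
      also have "\<dots> \<le> \<bar>h x\<bar> powr r" using False r by (intro powr_mono) simp_all
      finally show ?thesis by simp
    qed
    then show "\<bar>indicat_real U x * h x\<bar> ^ n \<le> indicat_real U x *\<^sub>R (1 + \<bar>h x\<bar> powr r)"
      using n by (simp add: indicator_def zero_power)
  qed
  also have "\<dots> = ennreal (LINT x|lebesgue. indicat_real U x *\<^sub>R (1 + \<bar>h x\<bar> powr r))"
    by (rule nn_integral_eq_integral[OF i]) (simp add: indicator_def)
  also have "\<dots> < top" by simp
  finally show ?thesis .
next
  case PInf
  then obtain C where C: "AE x\<in>U in lebesgue. \<bar>h x\<bar> \<le> C" using h by (auto simp: in_Lp_def)
  have "(\<integral>\<^sup>+x. ennreal (\<bar>indicat_real U x * h x\<bar> ^ n) \<partial>lebesgue) \<le> (\<integral>\<^sup>+x. ennreal (\<bar>C\<bar> ^ n) * indicator U x \<partial>lebesgue)"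
  proof (rule nn_integral_mono_AE)
    show "AE x in lebesgue. ennreal (\<bar>indicat_real U x * h x\<bar> ^ n) \<le> ennreal (\<bar>C\<bar> ^ n) * indicator U x"
      using C
    proof eventually_elim
      fix x assume "x \<in> U \<longrightarrow> \<bar>h x\<bar> \<le> C"
      then show "ennreal (\<bar>indicat_real U x * h x\<bar> ^ n) \<le> ennreal (\<bar>C\<bar> ^ n) * indicator U x"
        using n by (cases "x \<in> U") (auto intro!: ennreal_leI power_mono)
    qed
  qed
  also have "\<dots> = ennreal (\<bar>C\<bar> ^ n) * emeasure lebesgue U" using U(1) by (rule nn_integral_cmult_indicator)
  also have "\<dots> < top" using U(2) by (simp add: ennreal_mult_less_top)
  finally show ?thesis .
next
  case MInf
  then show ?thesis using q by simp
qed

text \<open>Off \<open>\<Omega>'\<close> write m as (m - H) + (H - h) + h. The first two terms tend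
  to 0 in L^n, so the integrals of their n-th powers are eventually at most 1.\<close>

lemma Ln_eventually_bounded:
  fixes h :: "'a::euclidean_space \<Rightarrow> real" and m H :: "nat \<Rightarrow> 'a \<Rightarrow> real"
  assumes \<Omega>: "open \<Omega>" "bounded \<Omega>" and \<Omega>': "open \<Omega>'" and n: "0 < n"
    and h: "in_Lp q \<Omega> h" "ereal (real n) < q"
    and H: "tendsto_Lp (real n) \<Omega> H h" and mH: "tendsto_Lp (real n) (\<Omega> - \<Omega>') (\<lambda>j x. m j x - H j x) (\<lambda>x. 0)"
    and c: "\<And>j. continuous_on \<Omega> (m j)" "\<And>j. continuous_on \<Omega> (H j)"
  shows "\<exists>K\<ge>0. \<forall>\<^sub>F j in sequentially. (\<integral>\<^sup>+x. ennreal (\<bar>indicat_real (\<Omega> - \<Omega>') x * m j x\<bar> ^ n) \<partial>lborel) \<le> ennreal K"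
proof -
  have \<Omega>B: "\<Omega> \<in> sets borel" "\<Omega> - \<Omega>' \<in> sets borel" "\<Omega> \<in> sets lebesgue" using \<Omega>(1) \<Omega>' by auto
  have \<Omega>fin: "emeasure lebesgue \<Omega> < \<infinity>" using emeasure_bounded_finite[OF \<Omega>(2)] \<Omega>B by simp
  define hn where "hn = enn2real (\<integral>\<^sup>+x. ennreal (\<bar>indicat_real \<Omega> x * h x\<bar> ^ n) \<partial>lebesgue)"
  have hn: "(\<integral>\<^sup>+x. ennreal (\<bar>indicat_real \<Omega> x * h x\<bar> ^ n) \<partial>lebesgue) = ennreal hn" "0 \<le> hn"
    using in_Lp_imp_power_finite[OF h n \<Omega>B(3) \<Omega>fin] by (simp_all add: hn_def)
  have hm: "(\<lambda>x. indicat_real \<Omega> x * h x) \<in> borel_measurable lebesgue"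
    using h(1) by (simp add: in_Lp_def set_borel_measurable_def)
  have cm: "(\<lambda>x. indicat_real \<Omega> x * g x) \<in> borel_measurable lebesgue" if "continuous_on \<Omega> g" for g :: "'a \<Rightarrow> real"
  proof -
    have "(\<lambda>x. indicat_real \<Omega> x *\<^sub>R g x) \<in> borel_measurable borel"
      by (rule borel_measurable_continuous_on_indicator[OF \<Omega>B(1) that])
    then show ?thesis by (intro measurable_completion) simp
  qed
  have im: "indicat_real (\<Omega> - \<Omega>') \<in> borel_measurable lebesgue"
    using \<Omega>B(2) by (intro measurable_completion) simp
  \<comment> \<open>The indicators turn functions that are controlled only on
    \<open>\<Omega>\<close> into measurable functions on the whole space.\<close>
  define a where "a j x = indicat_real (\<Omega> - \<Omega>') x * (indicat_real \<Omega> x * m j x - indicat_real \<Omega> x * H j x)" for j x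
  define b where "b j x = indicat_real \<Omega> x * H j x - indicat_real \<Omega> x * h x" for j x
  have am: "a j \<in> borel_measurable lebesgue" for j
    unfolding a_def by (intro borel_measurable_times borel_measurable_diff im cm c)
  have bm: "b j \<in> borel_measurable lebesgue" for j
    unfolding b_def by (intro borel_measurable_diff cm c hm)
  have "eventually (\<lambda>j. (\<integral>\<^sup>+x\<in>\<Omega>. ennreal (\<bar>H j x - h x\<bar> powr real n) \<partial>lebesgue) \<le> ennreal 1) sequentially"
    by (rule ennreal_tendsto_0D[OF H[unfolded tendsto_Lp_def]]) simp
  then have evb: "eventually (\<lambda>j. (\<integral>\<^sup>+x. ennreal (\<bar>b j x\<bar> ^ n) \<partial>lebesgue) \<le> ennreal 1) sequentially"
    by (simp only: set_nn_integral_power[OF n] b_def right_diff_distrib)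
  have "eventually (\<lambda>j. (\<integral>\<^sup>+x\<in>\<Omega> - \<Omega>'. ennreal (\<bar>m j x - H j x - 0\<bar> powr real n) \<partial>lebesgue) \<le> ennreal 1) sequentially"
    by (rule ennreal_tendsto_0D[OF mH[unfolded tendsto_Lp_def]]) simp
  moreover have "(\<integral>\<^sup>+x\<in>\<Omega> - \<Omega>'. ennreal (\<bar>m j x - H j x - 0\<bar> powr real n) \<partial>lebesgue) = (\<integral>\<^sup>+x. ennreal (\<bar>a j x\<bar> ^ n) \<partial>lebesgue)" for j
    unfolding set_nn_integral_power[OF n] by (intro nn_integral_cong) (auto simp: a_def indicator_def)
  ultimately have eva: "eventually (\<lambda>j. (\<integral>\<^sup>+x. ennreal (\<bar>a j x\<bar> ^ n) \<partial>lebesgue) \<le> ennreal 1) sequentially"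
    by (simp only:)
  have "eventually (\<lambda>j. (\<integral>\<^sup>+x. ennreal (\<bar>indicat_real (\<Omega> - \<Omega>') x * m j x\<bar> ^ n) \<partial>lborel) \<le> ennreal (3 ^ n * (1 + 1 + hn))) sequentially"
    using eva evb
  proof eventually_elim
    fix j assume A: "(\<integral>\<^sup>+x. ennreal (\<bar>a j x\<bar> ^ n) \<partial>lebesgue) \<le> ennreal 1" and B: "(\<integral>\<^sup>+x. ennreal (\<bar>b j x\<bar> ^ n) \<partial>lebesgue) \<le> ennreal 1"
    have "(\<integral>\<^sup>+x. ennreal (\<bar>indicat_real (\<Omega> - \<Omega>') x * m j x\<bar> ^ n) \<partial>lborel) = (\<integral>\<^sup>+x. ennreal (\<bar>indicat_real (\<Omega> - \<Omega>') x * m j x\<bar> ^ n) \<partial>lebesgue)"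
      by (rule nn_integral_completion[symmetric])
    also have "\<dots> \<le> (\<integral>\<^sup>+x. ennreal (3 ^ n) * (ennreal (\<bar>a j x\<bar> ^ n) + ennreal (\<bar>b j x\<bar> ^ n) + ennreal (\<bar>indicat_real \<Omega> x * h x\<bar> ^ n)) \<partial>lebesgue)"
    proof (rule nn_integral_mono)
      fix x
      have "\<bar>indicat_real (\<Omega> - \<Omega>') x * m j x\<bar> \<le> \<bar>a j x + b j x + indicat_real \<Omega> x * h x\<bar>"
        by (auto simp: a_def b_def indicator_def)
      then have "\<bar>indicat_real (\<Omega> - \<Omega>') x * m j x\<bar> ^ n \<le> \<bar>a j x + b j x + indicat_real \<Omega> x * h x\<bar> ^ n"
        by (rule power_mono) simp
      also have "\<dots> \<le> 3 ^ n * (\<bar>a j x\<bar> ^ n + \<bar>b j x\<bar> ^ n + \<bar>indicat_real \<Omega> x * h x\<bar> ^ n)" by (rule power_add3_le)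
      finally have "ennreal (\<bar>indicat_real (\<Omega> - \<Omega>') x * m j x\<bar> ^ n) \<le> ennreal (3 ^ n * (\<bar>a j x\<bar> ^ n + \<bar>b j x\<bar> ^ n + \<bar>indicat_real \<Omega> x * h x\<bar> ^ n))"
        by (rule ennreal_leI)
      also have "\<dots> = ennreal (3 ^ n) * ennreal (\<bar>a j x\<bar> ^ n + \<bar>b j x\<bar> ^ n + \<bar>indicat_real \<Omega> x * h x\<bar> ^ n)"
        by (intro ennreal_mult add_nonneg_nonneg zero_le_power) simp_all
      also have "ennreal (\<bar>a j x\<bar> ^ n + \<bar>b j x\<bar> ^ n + \<bar>indicat_real \<Omega> x * h x\<bar> ^ n)
          = ennreal (\<bar>a j x\<bar> ^ n) + ennreal (\<bar>b j x\<bar> ^ n) + ennreal (\<bar>indicat_real \<Omega> x * h x\<bar> ^ n)"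
        by (simp add: ennreal_plus)
      finally show "ennreal (\<bar>indicat_real (\<Omega> - \<Omega>') x * m j x\<bar> ^ n) \<le> ennreal (3 ^ n) * (ennreal (\<bar>a j x\<bar> ^ n) + ennreal (\<bar>b j x\<bar> ^ n) + ennreal (\<bar>indicat_real \<Omega> x * h x\<bar> ^ n))" .
    qed
    also have "\<dots> = ennreal (3 ^ n) * ((\<integral>\<^sup>+x. ennreal (\<bar>a j x\<bar> ^ n) \<partial>lebesgue) + (\<integral>\<^sup>+x. ennreal (\<bar>b j x\<bar> ^ n) \<partial>lebesgue) + ennreal hn)"
    proof -
      note [measurable] = am[of j] bm[of j] hm
      show ?thesis
        unfolding hn(1)[symmetric] by (subst nn_integral_cmult, measurable, subst nn_integral_add, measurable, subst nn_integral_add, measurable)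
    qed
    also have "\<dots> \<le> ennreal (3 ^ n) * (ennreal 1 + ennreal 1 + ennreal hn)"
      by (intro mult_left_mono add_mono A B order_refl) simp
    also have "\<dots> = ennreal (3 ^ n * (1 + 1 + hn))"
    proof -
      have "ennreal (1 + 1 + hn) = ennreal 1 + ennreal 1 + ennreal hn" using hn(2) by (subst ennreal_plus) simp_all
      moreover have "ennreal (3 ^ n * (1 + 1 + hn)) = ennreal (3 ^ n) * ennreal (1 + 1 + hn)"
        using hn(2) by (intro ennreal_mult) simp_all
      ultimately show ?thesis by (simp only:)
    qed
    finally show "(\<integral>\<^sup>+x. ennreal (\<bar>indicat_real (\<Omega> - \<Omega>') x * m j x\<bar> ^ n) \<partial>lborel) \<le> ennreal (3 ^ n * (1 + 1 + hn))" .
  qed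
  moreover have "0 \<le> 3 ^ n * (1 + 1 + hn)" using hn(2) by (intro mult_nonneg_nonneg) simp_all
  ultimately show ?thesis by blast
qed

section \<open>Non-extremality applied to level sets\<close>

lemma density_one_lebesgue:
  fixes E :: "'a::euclidean_space set"
  assumes E: "E \<in> sets lebesgue"
  shows "density_one E \<in> sets lebesgue"
proof -
  have "AE x in lebesgue. x \<in> density_one E \<longleftrightarrow> x \<in> E" by (rule AE_density_one[OF E])
  then obtain N where N: "N \<in> null_sets lebesgue" "{x\<in>space lebesgue. \<not> (x \<in> density_one E \<longleftrightarrow> x \<in> E)} \<subseteq> N"
    unfolding eventually_ae_filter by blast
  have "negligible N" using N(1) by (simp add: negligible_iff_null_sets)
  then have "negligible (density_one E - E)" "negligible (E - density_one E)"
    using N(2) by (auto intro: negligible_subset)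
  then have "density_one E - E \<in> sets lebesgue" "E - density_one E \<in> sets lebesgue"
    by (simp_all add: negligible_imp_sets)
  moreover have "density_one E = (E - (E - density_one E)) \<union> (density_one E - E)" by blast
  ultimately show ?thesis using E by (metis sets.Diff sets.Un)
qed

text \<open>The set of points of density one differs from \<open>E\<close> by a null set, which a
  density does not charge.\<close>

lemma dens_density_one:
  fixes m :: "'a::euclidean_space \<Rightarrow> real"
  assumes E: "E \<in> sets borel" "E \<subseteq> \<Omega>" and \<Omega>: "open \<Omega>" and m: "continuous_on \<Omega> m"
  shows "dens m (density_one E \<inter> \<Omega>) = (LINT x|lborel. indicat_real E x * (indicat_real \<Omega> x * m x))"
proof -
  have EL: "E \<in> sets lebesgue" using E(1) by simp
  have \<Omega>B: "\<Omega> \<in> sets borel" using \<Omega> by simp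
  have mb: "(\<lambda>x. indicat_real \<Omega> x * m x) \<in> borel_measurable borel"
    using borel_measurable_continuous_on_indicator[OF \<Omega>B m] by simp
  then have ml: "(\<lambda>x. indicat_real \<Omega> x * m x) \<in> borel_measurable lebesgue" by (intro measurable_completion) simp
  have "dens m (density_one E \<inter> \<Omega>) = (LINT x|lebesgue. indicat_real (density_one E) x * (indicat_real \<Omega> x * m x))"
    unfolding dens_def set_lebesgue_integral_def
    by (intro Bochner_Integration.integral_cong) (auto simp: indicator_def)
  also have "\<dots> = (LINT x|lebesgue. indicat_real E x * (indicat_real \<Omega> x * m x))"
  proof (rule integral_cong_AE)
    show "(\<lambda>x. indicat_real (density_one E) x * (indicat_real \<Omega> x * m x)) \<in> borel_measurable lebesgue"
      using density_one_lebesgue[OF EL] by (intro borel_measurable_times ml borel_measurable_indicator)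
    show "(\<lambda>x. indicat_real E x * (indicat_real \<Omega> x * m x)) \<in> borel_measurable lebesgue"
      using EL by (intro borel_measurable_times ml borel_measurable_indicator)
    show "AE x in lebesgue. indicat_real (density_one E) x * (indicat_real \<Omega> x * m x) = indicat_real E x * (indicat_real \<Omega> x * m x)"
      using AE_density_one[OF EL] by eventually_elim (simp add: indicator_def)
  qed
  also have "\<dots> = (LINT x|lborel. indicat_real E x * (indicat_real \<Omega> x * m x))"
    by (rule integral_completion) (use E(1) mb in measurable)
  finally show ?thesis .
qed

text \<open>f vanishes outside \<open>\<Omega>\<close>, so its level sets with t \<noteq> 0 lie in
  \<open>\<Omega>\<close> and may be inserted into the definition of non-extremality.\<close>

lemma bv_non_extremal_bound:
  fixes f m :: "'a::euclidean_space \<Rightarrow> real"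
  assumes bv: "bv_approx f V" and f0: "\<And>x. x \<notin> \<Omega> \<Longrightarrow> f x = 0" and \<Omega>: "open \<Omega>" and m: "continuous_on \<Omega> m"
    and i: "integrable lborel (\<lambda>x. f x * (indicat_real \<Omega> x * m x))"
    and L: "0 \<le> L" "non_extremal_with L \<Omega> (dens m)"
  shows "ennreal \<bar>LINT x|lborel. f x * (indicat_real \<Omega> x * m x)\<bar> \<le> ennreal L * V"
proof (rule bv_layer_signed[OF bv _ i L(1)])
  have \<Omega>B: "\<Omega> \<in> sets borel" using \<Omega> by simp
  show "(\<lambda>x. indicat_real \<Omega> x * m x) \<in> borel_measurable borel"
    using borel_measurable_continuous_on_indicator[OF \<Omega>B m] by simp
  fix t :: real assume t: "t \<noteq> 0"
  let ?E = "level_set f t"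
  have fm: "f \<in> borel_measurable borel" using bv borel_measurable_integrable by (auto simp: bv_approx_def)
  have E: "?E \<in> sets borel" by (rule borel_level_set[OF fm])
  have sub: "?E \<subseteq> \<Omega>"
  proof
    fix x assume "x \<in> ?E"
    then have "f x \<noteq> 0" using t by (auto simp: level_set_def level_def)
    then show "x \<in> \<Omega>" using f0 by blast
  qed
  have EL: "?E \<in> sets lebesgue" using E by simp
  show "ereal \<bar>LINT x|lborel. indicat_real ?E x * (indicat_real \<Omega> x * m x)\<bar> \<le> ereal L * perimeter ?E"
    using L(2) EL sub unfolding non_extremal_with_def dens_density_one[OF E sub \<Omega> m, symmetric] by blast
qed

section \<open>Borel representatives and distributional gradients\<close>

lemma borel_representative:
  fixes f :: "'a::euclidean_space \<Rightarrow> real"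
  assumes f: "set_integrable lebesgue U f" and U: "U \<in> sets borel"
  obtains g where "integrable lborel g" "AE x\<in>U in lebesgue. g x = f x" "\<And>x. x \<notin> U \<Longrightarrow> g x = 0"
proof -
  have "(\<lambda>x. indicat_real U x *\<^sub>R f x) \<in> borel_measurable (completion lborel)"
    using f unfolding set_integrable_def by (rule borel_measurable_integrable)
  \<comment> \<open>Members of BV are only Lebesgue measurable; Fubini and the translations of
    \<open>lborel\<close> act on Borel versions.\<close>
  from completion_ex_borel_measurable_real[OF this]
  obtain g0 where g0: "g0 \<in> borel_measurable lborel" "AE x in lborel. indicat_real U x *\<^sub>R f x = g0 x" by blast
  have ae: "AE x in lebesgue. indicat_real U x *\<^sub>R f x = g0 x" by (rule AE_completion[OF g0(2)])
  define g where "g x = indicat_real U x * g0 x" for x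
  have gm: "g \<in> borel_measurable lborel" unfolding g_def[abs_def] using g0(1) U by measurable
  have gf: "AE x in lebesgue. indicat_real U x *\<^sub>R f x = g x"
    using ae by eventually_elim (auto simp: g_def indicator_def)
  have "integrable lebesgue g"
    using f gf unfolding set_integrable_def
    by (subst integrable_cong_AE[where g="\<lambda>x. indicat_real U x *\<^sub>R f x"])
      (auto intro: measurable_completion[OF gm] borel_measurable_integrable)
  then have "integrable lborel g" using integrable_completion[OF gm] by simp
  moreover have "AE x\<in>U in lebesgue. g x = f x" using gf by eventually_elim (auto simp: indicator_def)
  ultimately show ?thesis using that by (simp add: g_def)
qed

text \<open>The Jordan parts are built from the whole set function, so agreement on Borel subsets of
  \<open>U\<close> is transferred through the slice sums, which see nothing else.\<close>

lemma signed_integral_cong: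
  fixes \<psi> :: "'a::euclidean_space \<Rightarrow> real"
  assumes \<nu>: "radon_measure U \<nu>" and eq: "\<And>A. A \<in> sets borel \<Longrightarrow> A \<subseteq> U \<Longrightarrow> \<nu>' A = \<nu> A" and U: "U \<in> sets borel"
    and \<psi>: "\<psi> \<in> borel_measurable borel" "\<And>x. \<bar>\<psi> x\<bar> \<le> C"
  shows "signed_integral U \<nu>' \<psi> = signed_integral U \<nu> \<psi>"
proof (rule LIMSEQ_unique)
  have \<nu>': "radon_measure U \<nu>'"
  proof (rule radon_measureI)
    fix A :: "nat \<Rightarrow> 'a set" assume A: "\<And>i. A i \<in> sets borel" "\<And>i. A i \<subseteq> U" "disjoint_family A"
    have "\<nu>' (\<Union>i. A i) = \<nu> (\<Union>i. A i)" using A(1,2) by (intro eq sets.countable_UN UN_least) auto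
    moreover have "\<nu>' (A i) = \<nu> (A i)" for i by (rule eq[OF A(1,2)])
    ultimately show "(\<lambda>i. \<nu>' (A i)) sums \<nu>' (\<Union>i. A i)" using radon_sums[OF \<nu> A] by (simp only:)
  qed
  show "riemann_sum U C \<nu>' \<psi> \<longlonglongrightarrow> signed_integral U \<nu>' \<psi>" by (rule signed_integral_lim[OF \<nu>' U \<psi>])
  have "riemann_sum U C \<nu>' \<psi> = riemann_sum U C \<nu> \<psi>"
    unfolding riemann_sum_def fun_eq_iff
  proof (intro allI sum.cong refl)
    fix n k
    have "\<nu>' {x \<in> U. \<lfloor>real (Suc n) * \<psi> x\<rfloor> = k} = \<nu> {x \<in> U. \<lfloor>real (Suc n) * \<psi> x\<rfloor> = k}"
      by (intro eq floor_slice_borel[OF U \<psi>(1)]) blast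
    then show "of_int k / real (Suc n) * \<nu>' {x \<in> U. \<lfloor>real (Suc n) * \<psi> x\<rfloor> = k} = of_int k / real (Suc n) * \<nu> {x \<in> U. \<lfloor>real (Suc n) * \<psi> x\<rfloor> = k}"
      by (simp only:)
  qed
  then show "riemann_sum U C \<nu>' \<psi> \<longlonglongrightarrow> signed_integral U \<nu> \<psi>" using signed_integral_lim[OF \<nu> U \<psi>] by (simp only:)
qed

lemma test_fun_bounded:
  fixes \<psi> :: "'a::euclidean_space \<Rightarrow> real"
  assumes \<psi>: "test_fun U \<psi>"
  obtains C where "\<And>x. \<bar>\<psi> x\<bar> \<le> C" "\<And>x i. i \<in> Basis \<Longrightarrow> \<bar>partial_deriv \<psi> i x\<bar> \<le> C"
    "\<psi> \<in> borel_measurable borel" "\<And>i. i \<in> Basis \<Longrightarrow> partial_deriv \<psi> i \<in> borel_measurable borel"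
proof -
  have C: "C1c \<psi> (grad_of \<psi>)" by (rule test_fun_C1c[OF \<psi>])
  note D = C1_gradD[OF C1cD[OF C]]
  obtain M1 where M1: "\<And>x. \<bar>\<psi> x\<bar> \<le> M1" using C1c_integrable(4)[OF C] by blast
  obtain M2 where M2: "\<And>x. norm (grad_of \<psi> x) \<le> M2" using C1c_integrable(3)[OF C] by blast
  have pd: "partial_deriv \<psi> i = (\<lambda>x. grad_of \<psi> x \<bullet> i)" if "i \<in> Basis" for i
    by (rule ext) (rule grad_of_inner[OF that, symmetric])
  show ?thesis
  proof (rule that[of "max M1 M2"])
    show "\<bar>\<psi> x\<bar> \<le> max M1 M2" for x using M1[of x] by simp
    show "\<bar>partial_deriv \<psi> i x\<bar> \<le> max M1 M2" if "i \<in> Basis" for x i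
      unfolding pd[OF that] using Basis_le_norm[OF that, of "grad_of \<psi> x"] M2[of x] by simp
    show "\<psi> \<in> borel_measurable borel" by (rule D(4))
    show "partial_deriv \<psi> i \<in> borel_measurable borel" if "i \<in> Basis" for i
      unfolding pd[OF that] using D(5) by measurable
  qed
qed

text \<open>The weak gradient g becomes the vector measure with density g. Integral and inner
  product are exchanged only over Borel subsets of \<open>U\<close>, where g is integrable, hence
  the detour through \<open>signed_integral_cong\<close>.\<close>

lemma W11_distr_grad:
  fixes \<phi> :: "'a::euclidean_space \<Rightarrow> real"
  assumes \<phi>: "\<phi> \<in> W11 U" and U: "U \<in> sets borel"
  obtains \<nu> G where "distr_grad U \<phi> \<nu>" "0 \<le> G" "tvar \<nu> U \<le> ennreal G"
proof -
  obtain g :: "'a \<Rightarrow> 'a" where g: "set_integrable lebesgue U g"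
    "\<And>\<psi> i. test_fun U \<psi> \<Longrightarrow> i \<in> Basis \<Longrightarrow> (LINT x:U|lebesgue. \<phi> x * partial_deriv \<psi> i x) = - (LINT x:U|lebesgue. (g x \<bullet> i) * \<psi> x)"
    using \<phi> unfolding W11_def by blast
  let ?\<nu> = "\<lambda>A. LINT x:A|lebesgue. g x"
  have gA: "set_integrable lebesgue A g" if "A \<in> sets borel" "A \<subseteq> U" for A
    by (rule set_integrable_subset[OF g(1) _ that(2)]) (use that(1) in simp)
  have inn: "?\<nu> A \<bullet> i = (LINT x:A|lebesgue. g x \<bullet> i)" if "A \<in> sets borel" "A \<subseteq> U" for A i
  proof -
    have "(LINT x|lebesgue. (indicat_real A x *\<^sub>R g x) \<bullet> i) = (LINT x|lebesgue. indicat_real A x *\<^sub>R g x) \<bullet> i"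
      by (rule integral_inner_left) (use gA[OF that] in \<open>simp add: set_integrable_def\<close>)
    then show ?thesis unfolding set_lebesgue_integral_def by simp
  qed
  have gi: "set_integrable lebesgue U (\<lambda>x. g x \<bullet> i)" for i
  proof -
    have "integrable lebesgue (\<lambda>x. (indicat_real U x *\<^sub>R g x) \<bullet> i)"
      using g(1) unfolding set_integrable_def by (intro integrable_inner_left) simp
    then show ?thesis by (simp add: set_integrable_def)
  qed
  have "distr_grad U \<phi> ?\<nu>"
    unfolding distr_grad_def
  proof (intro conjI allI impI ballI radon_set_integral g(1))
    fix \<psi> :: "'a \<Rightarrow> real" and i :: 'a assume \<psi>: "test_fun U \<psi>" and i: "i \<in> Basis"
    obtain C where C: "\<And>x. \<bar>\<psi> x\<bar> \<le> C" "\<psi> \<in> borel_measurable borel" using test_fun_bounded[OF \<psi>] by metis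
    have "signed_integral U (\<lambda>A. ?\<nu> A \<bullet> i) \<psi> = signed_integral U (\<lambda>A. LINT x:A|lebesgue. g x \<bullet> i) \<psi>"
      by (rule signed_integral_cong[OF radon_set_integral[OF gi] inn U C(2,1)])
    also have "\<dots> = (LINT x:U|lebesgue. (g x \<bullet> i) * \<psi> x)"
      by (rule signed_integral_density[OF gi U C(2,1)])
    finally show "(LINT x:U|lebesgue. \<phi> x * partial_deriv \<psi> i x) = - signed_integral U (\<lambda>A. ?\<nu> A \<bullet> i) \<psi>"
      using g(2)[OF \<psi> i] by simp
  qed
  moreover have "0 \<le> (LINT x:U|lebesgue. norm (g x))"
    unfolding set_lebesgue_integral_def by (intro Bochner_Integration.integral_nonneg) simp
  ultimately show ?thesis by (rule that) (rule tvar_set_integral_le[OF g(1) U])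
qed

lemma distr_grad_diff:
  fixes u v :: "'a::euclidean_space \<Rightarrow> real"
  assumes u: "distr_grad U u \<nu>" "set_integrable lebesgue U u" and v: "distr_grad U v \<nu>'" "set_integrable lebesgue U v"
    and U: "U \<in> sets borel"
  shows "distr_grad U (\<lambda>x. u x - v x) (\<lambda>A. \<nu> A - \<nu>' A)"
  unfolding distr_grad_def
proof (intro conjI allI impI ballI)
  have \<nu>: "radon_measure U \<nu>" "radon_measure U \<nu>'" using u(1) v(1) unfolding distr_grad_def by blast+
  show "radon_measure U (\<lambda>A. \<nu> A - \<nu>' A)" by (rule radon_diff[OF \<nu>])
  fix \<psi> :: "'a \<Rightarrow> real" and i :: 'a assume \<psi>: "test_fun U \<psi>" and i: "i \<in> Basis"
  obtain C where C: "\<And>x. \<bar>\<psi> x\<bar> \<le> C" "\<And>x. \<bar>partial_deriv \<psi> i x\<bar> \<le> C" "\<psi> \<in> borel_measurable borel"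
    "partial_deriv \<psi> i \<in> borel_measurable borel" using test_fun_bounded[OF \<psi>] i by metis
  have pl: "partial_deriv \<psi> i \<in> borel_measurable lebesgue" using C(4) by (intro measurable_completion) simp
  have int: "set_integrable lebesgue U (\<lambda>x. w x * partial_deriv \<psi> i x)" if "set_integrable lebesgue U w" for w
  proof -
    have wi: "integrable lebesgue (\<lambda>x. indicat_real U x *\<^sub>R w x)" using that by (simp add: set_integrable_def)
    have "integrable lebesgue (\<lambda>x. (indicat_real U x *\<^sub>R w x) * partial_deriv \<psi> i x)"
    proof (rule Bochner_Integration.integrable_bound)
      show "integrable lebesgue (\<lambda>x. (indicat_real U x *\<^sub>R w x) * C)" by (rule integrable_mult_left[OF wi])
      show "(\<lambda>x. (indicat_real U x *\<^sub>R w x) * partial_deriv \<psi> i x) \<in> borel_measurable lebesgue"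
        by (rule borel_measurable_times[OF borel_measurable_integrable[OF wi] pl])
      show "AE x in lebesgue. norm ((indicat_real U x *\<^sub>R w x) * partial_deriv \<psi> i x) \<le> norm ((indicat_real U x *\<^sub>R w x) * C)"
      proof (rule AE_I2)
        fix x
        have "\<bar>partial_deriv \<psi> i x\<bar> \<le> \<bar>C\<bar>" using C(2)[of x] by linarith
        then show "norm ((indicat_real U x *\<^sub>R w x) * partial_deriv \<psi> i x) \<le> norm ((indicat_real U x *\<^sub>R w x) * C)"
          unfolding real_norm_def abs_mult[of "indicat_real U x *\<^sub>R w x"] by (rule mult_left_mono[OF _ abs_ge_zero])
      qed
    qed
    then show ?thesis by (simp add: set_integrable_def mult.assoc)
  qed
  have "(LINT x:U|lebesgue. (u x - v x) * partial_deriv \<psi> i x) = (LINT x:U|lebesgue. u x * partial_deriv \<psi> i x) - (LINT x:U|lebesgue. v x * partial_deriv \<psi> i x)"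
    unfolding left_diff_distrib by (rule set_integral_diff(2)[OF int[OF u(2)] int[OF v(2)]])
  also have "\<dots> = - signed_integral U (\<lambda>A. \<nu> A \<bullet> i) \<psi> + signed_integral U (\<lambda>A. \<nu>' A \<bullet> i) \<psi>"
    using u(1) v(1) \<psi> i unfolding distr_grad_def by simp
  also have "\<dots> = - (signed_integral U (\<lambda>A. \<nu> A \<bullet> i - \<nu>' A \<bullet> i) \<psi>)"
    using signed_integral_diff[OF radon_inner[OF \<nu>(1)] radon_inner[OF \<nu>(2)] U C(3,1), of i i] by simp
  finally show "(LINT x:U|lebesgue. (u x - v x) * partial_deriv \<psi> i x) = - signed_integral U (\<lambda>A. (\<nu> A - \<nu>' A) \<bullet> i) \<psi>"
    by (simp only: inner_diff_left)
qed

lemma bv_approx_mono: "bv_approx f V \<Longrightarrow> V \<le> W \<Longrightarrow> bv_approx f W"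
  unfolding bv_approx_def by (meson order_trans)

text \<open>A point outside the compact set has a ball that misses it, and in this ball the measure
  has no variation.\<close>

lemma measure_support_subset:
  assumes \<Gamma>: "compact \<Gamma>" and U: "open U" and z: "tvar \<nu> (U - \<Gamma>) = 0"
  shows "measure_support U \<nu> \<subseteq> \<Gamma>"
proof
  fix x assume x: "x \<in> measure_support U \<nu>"
  show "x \<in> \<Gamma>"
  proof (rule ccontr)
    assume "x \<notin> \<Gamma>"
    then have "x \<in> - \<Gamma>" by simp
    moreover have "open (- \<Gamma>)" using compact_imp_closed[OF \<Gamma>] by (simp add: open_Compl)
    ultimately obtain r where r: "r > 0" "ball x r \<subseteq> - \<Gamma>" unfolding open_contains_ball by blast
    have "U \<inter> ball x r \<subseteq> U - \<Gamma>" using r(2) by blast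
    moreover have "U - \<Gamma> \<in> sets borel" using U compact_imp_closed[OF \<Gamma>] by (intro sets.Diff borel_open borel_closed)
    ultimately have "tvar \<nu> (U \<inter> ball x r) \<le> tvar \<nu> (U - \<Gamma>)" by (rule tvar_mono)
    moreover have "0 < tvar \<nu> (U \<inter> ball x r)" using x r(1) unfolding measure_support_def by blast
    ultimately show False using z by simp
  qed
qed

text \<open>m is continuous in \<open>\<Omega>\<close> only and may be unbounded near the boundary.
  The distance d makes the closed support of \<eta> a compact subset of \<open>\<Omega>\<close>, on
  which m is bounded.\<close>

lemma integrable_cutoff_mult:
  fixes \<eta> f m :: "'a::euclidean_space \<Rightarrow> real"
  assumes \<eta>: "C1c \<eta> Z" "\<And>x. \<bar>\<eta> x\<bar> \<le> 1" and d: "0 < d" "\<And>x. \<eta> x \<noteq> 0 \<Longrightarrow> cball x d \<subseteq> \<Omega>"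
    and f: "integrable lborel f" and \<Omega>: "open \<Omega>" and m: "continuous_on \<Omega> m"
  shows "integrable lborel (\<lambda>x. \<eta> x * f x * (indicat_real \<Omega> x * m x))"
proof -
  have \<Omega>B: "\<Omega> \<in> sets borel" using \<Omega> by simp
  have mm: "(\<lambda>x. indicat_real \<Omega> x * m x) \<in> borel_measurable borel"
    using borel_measurable_continuous_on_indicator[OF \<Omega>B m] by simp
  have \<eta>m: "\<eta> \<in> borel_measurable borel" by (rule C1_gradD(4)[OF C1cD[OF \<eta>(1)]])
  have fm: "f \<in> borel_measurable borel" using borel_measurable_integrable[OF f] by simp
  let ?K = "closure {x. \<eta> x \<noteq> 0}"
  obtain r where r: "\<And>x. r \<le> norm x \<Longrightarrow> \<eta> x = 0" using \<eta>(1) unfolding C1c_def by blast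
  have "bounded {x. \<eta> x \<noteq> 0}"
  proof (rule boundedI[of _ r])
    fix x assume "x \<in> {x. \<eta> x \<noteq> 0}"
    then have "\<not> r \<le> norm x" using r[of x] by blast
    then show "norm x \<le> r" by simp
  qed
  then have cK: "compact ?K" by (simp add: compact_closure)
  have KO: "?K \<subseteq> \<Omega>"
  proof
    fix x assume "x \<in> ?K"
    then obtain y where y: "\<eta> y \<noteq> 0" "dist y x < d" using d(1) unfolding closure_approachable by blast
    then show "x \<in> \<Omega>" using d(2)[OF y(1)] by (auto simp: subset_iff)
  qed
  have "bounded (m ` ?K)"
    by (intro compact_imp_bounded compact_continuous_image continuous_on_subset[OF m KO] cK)
  then obtain M where M: "\<And>x. x \<in> ?K \<Longrightarrow> \<bar>m x\<bar> \<le> M" unfolding bounded_iff by auto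
  show ?thesis
  proof (rule Bochner_Integration.integrable_bound)
    show "integrable lborel (\<lambda>x. f x * M)" by (rule integrable_mult_left[OF f])
    show "(\<lambda>x. \<eta> x * f x * (indicat_real \<Omega> x * m x)) \<in> borel_measurable lborel"
      using borel_measurable_times[OF borel_measurable_times[OF \<eta>m fm] mm] by simp
    show "AE x in lborel. norm (\<eta> x * f x * (indicat_real \<Omega> x * m x)) \<le> norm (f x * M)"
    proof (rule AE_I2)
      fix x
      show "norm (\<eta> x * f x * (indicat_real \<Omega> x * m x)) \<le> norm (f x * M)"
      proof (cases "\<eta> x = 0")
        case False
        then have "x \<in> ?K" using closure_subset[of "{x. \<eta> x \<noteq> 0}"] by blast
        then have "\<bar>indicat_real \<Omega> x * m x\<bar> \<le> \<bar>M\<bar>" using M[of x] by (auto simp: indicator_def)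
        then have "\<bar>\<eta> x\<bar> * \<bar>f x\<bar> * \<bar>indicat_real \<Omega> x * m x\<bar> \<le> 1 * \<bar>f x\<bar> * \<bar>M\<bar>"
          by (intro mult_mono \<eta>(2)) simp_all
        then show ?thesis by (simp add: abs_mult)
      qed simp
    qed
  qed
qed

text \<open>On \<open>\<Omega>\<close> the product u m splits into w m, \<eta> \<phi> m and (1 -
  \<eta>) \<phi> m. In the first two, w and \<eta> \<phi> vanish outside \<open>\<Omega>\<close>, so
  non-extremality applies with factor L. The third lives off \<open>\<Omega>'\<close>, where the L^n
  bound for m is paired with \<zeta> \<phi>, which equals \<phi> on \<open>\<Omega>\<close> and has
  finite variation in the whole space.\<close>

lemma functional_bound:
  fixes u m w \<phi> \<eta> \<zeta> :: "'a::euclidean_space \<Rightarrow> real"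
  assumes \<Omega>: "open \<Omega>" and \<Omega>': "open \<Omega>'" and m: "continuous_on \<Omega> m"
    and ne: "0 \<le> L" "non_extremal_with L \<Omega> (dens m)"
    and K: "(\<integral>\<^sup>+x. ennreal (\<bar>indicat_real (\<Omega> - \<Omega>') x * m x\<bar> ^ DIM('a)) \<partial>lborel) \<le> ennreal K" "0 \<le> K"
    and w: "bv_approx w (ennreal W)" "0 \<le> W" "\<And>x. x \<notin> \<Omega> \<Longrightarrow> w x = 0"
    and uw: "AE x\<in>\<Omega> in lebesgue. u x = w x + \<phi> x" and \<phi>: "integrable lborel \<phi>"
    and \<eta>: "C1c \<eta> Z" "\<And>x. 0 \<le> \<eta> x" "\<And>x. \<eta> x \<le> 1" "\<And>x. x \<in> \<Omega>' \<Longrightarrow> \<eta> x = 1" "0 < d" "\<And>x. \<eta> x \<noteq> 0 \<Longrightarrow> cball x d \<subseteq> \<Omega>"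
    and \<eta>V: "bv_approx (\<lambda>x. \<eta> x * \<phi> x) (ennreal V1)" "0 \<le> V1"
    and \<zeta>: "\<And>x. x \<in> \<Omega> \<Longrightarrow> \<zeta> x = 1" "bv_approx (\<lambda>x. \<zeta> x * \<phi> x) (ennreal V2)" "0 \<le> V2"
  shows "\<bar>LINT x:\<Omega>|lebesgue. u x * m x\<bar> \<le> L * W + L * V1 + 2 * (1 + 2 * K / unit_ball_vol (real DIM('a))) * V2"
proof (cases "set_integrable lebesgue \<Omega> (\<lambda>x. u x * m x)")
  \<comment> \<open>A product that is not integrable has integral 0 by convention, and the
    right-hand side is nonnegative.\<close>
  case False
  have "0 \<le> L * W + L * V1 + 2 * (1 + 2 * K / unit_ball_vol (real DIM('a))) * V2"
    using ne(1) w(2) \<eta>V(2) \<zeta>(3) K(2)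
    by (intro add_nonneg_nonneg mult_nonneg_nonneg divide_nonneg_nonneg) simp_all
  moreover have "(LINT x:\<Omega>|lebesgue. u x * m x) = 0"
    using False unfolding set_lebesgue_integral_def set_integrable_def by (rule not_integrable_integral_eq)
  ultimately show ?thesis by simp
next
  case True
  let ?C = "2 * (1 + 2 * K / unit_ball_vol (real DIM('a)))"
  have C: "0 \<le> ?C" using K(2) by (intro mult_nonneg_nonneg add_nonneg_nonneg divide_nonneg_nonneg) simp_all
  have \<Omega>B: "\<Omega> \<in> sets borel" "\<Omega> - \<Omega>' \<in> sets borel" using \<Omega> \<Omega>' by auto
  define m' where "m' x = indicat_real \<Omega> x * m x" for x
  define m'' where "m'' x = indicat_real (\<Omega> - \<Omega>') x * m x" for x
  have mb: "m' \<in> borel_measurable borel"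
    using borel_measurable_continuous_on_indicator[OF \<Omega>B(1) m] by (simp add: m'_def[abs_def])
  have m''eq: "m'' = (\<lambda>x. indicat_real (\<Omega> - \<Omega>') x * m' x)"
    by (auto simp: m''_def m'_def indicator_def fun_eq_iff)
  have mb'': "m'' \<in> borel_measurable borel"
    unfolding m''eq using \<Omega>B(2) mb by measurable
  have wm: "w \<in> borel_measurable borel"
    using w(1) borel_measurable_integrable by (auto simp: bv_approx_def)
  have \<phi>m: "\<phi> \<in> borel_measurable borel" using borel_measurable_integrable[OF \<phi>] by simp
  have \<eta>m: "\<eta> \<in> borel_measurable borel" by (rule C1_gradD(4)[OF C1cD[OF \<eta>(1)]])
  have \<eta>1: "\<bar>\<eta> x\<bar> \<le> 1" for x using \<eta>(2,3)[of x] by simp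
  let ?X = "\<lambda>x. indicat_real \<Omega> x *\<^sub>R (u x * m x)"
  let ?Y = "\<lambda>x. \<eta> x * \<phi> x * m' x"
  let ?Z = "\<lambda>x. (1 - \<eta> x) * \<phi> x * m' x"
  have X: "integrable lebesgue ?X" using True by (simp add: set_integrable_def)
  have Y: "integrable lborel ?Y"
    unfolding m'_def by (rule integrable_cutoff_mult[OF \<eta>(1) \<eta>1 \<eta>(5,6) \<phi> \<Omega> m])
  have Zb: "(\<integral>\<^sup>+x. ennreal (norm (?Z x)) \<partial>lborel) \<le> ennreal (?C * V2)"
  proof -
    have "(\<integral>\<^sup>+x. ennreal (norm (?Z x)) \<partial>lborel) \<le> (\<integral>\<^sup>+x. ennreal \<bar>(\<zeta> x * \<phi> x) * m'' x\<bar> \<partial>lborel)"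
    proof (rule nn_integral_mono, rule ennreal_leI)
      fix x
      \<comment> \<open>On \<open>\<Omega>'\<close> the factor 1 - \<eta> is 0 and outside
        \<open>\<Omega>\<close> the density is cut off, so only the set that carries the L^n bound
        matters.\<close>
      show "norm (?Z x) \<le> \<bar>(\<zeta> x * \<phi> x) * m'' x\<bar>"
      proof (cases "x \<in> \<Omega> - \<Omega>'")
        case True
        have "\<bar>1 - \<eta> x\<bar> * \<bar>\<phi> x * m x\<bar> \<le> 1 * \<bar>\<phi> x * m x\<bar>"
          using \<eta>(2,3)[of x] by (intro mult_right_mono) auto
        then show ?thesis using True \<zeta>(1)[of x] by (simp add: m'_def m''_def abs_mult mult.assoc)
      next
        case False
        then have "(1 - \<eta> x) * \<phi> x * m' x = 0" using \<eta>(4)[of x] by (auto simp: m'_def)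
        then show ?thesis by (simp only: norm_zero abs_ge_zero)
      qed
    qed
    also have "\<dots> \<le> ennreal ?C * ennreal V2"
      by (rule bv_Ln_bound[OF \<zeta>(2) mb'' _ K(2)]) (use K(1) in \<open>simp add: m''_def\<close>)
    also have "\<dots> = ennreal (?C * V2)" by (rule ennreal_mult[OF C \<zeta>(3), symmetric])
    finally show ?thesis .
  qed
  have Z: "integrable lborel ?Z"
  proof (rule integrableI_bounded)
    show "?Z \<in> borel_measurable lborel" using \<eta>m \<phi>m mb by measurable
    show "(\<integral>\<^sup>+x. ennreal (norm (?Z x)) \<partial>lborel) < \<infinity>" using Zb by (rule le_less_trans) simp
  qed
  have YZl: "integrable lebesgue ?Y" "integrable lebesgue ?Z"
    using Y Z integrable_completion[OF borel_measurable_integrable[OF Y]] integrable_completion[OF borel_measurable_integrable[OF Z]] by blast+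
  have wmm: "(\<lambda>x. w x * m' x) \<in> borel_measurable lborel" using wm mb by measurable
  have ae: "AE x in lebesgue. ?X x - ?Y x - ?Z x = w x * m' x"
    using uw
  proof eventually_elim
    fix x assume "x \<in> \<Omega> \<longrightarrow> u x = w x + \<phi> x"
    then show "?X x - ?Y x - ?Z x = w x * m' x"
      by (cases "x \<in> \<Omega>") (simp_all add: m'_def algebra_simps)
  qed
  \<comment> \<open>Integrability of w m is not known beforehand; it results from that of u m once
    both parts with \<phi> are integrable.\<close>
  have d: "integrable lebesgue (\<lambda>x. ?X x - ?Y x - ?Z x)"
    by (intro Bochner_Integration.integrable_diff X YZl)
  have "integrable lebesgue (\<lambda>x. w x * m' x)"
    using integrable_cong_AE[OF borel_measurable_integrable[OF d] measurable_completion[OF wmm] ae] d by blast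
  then have wb: "integrable lborel (\<lambda>x. w x * m' x)" using integrable_completion[OF wmm] by blast
  have "(LINT x|lebesgue. w x * m' x) = (LINT x|lebesgue. ?X x - ?Y x - ?Z x)"
    by (rule integral_cong_AE[OF measurable_completion[OF wmm] borel_measurable_integrable[OF d]])
      (use ae in \<open>eventually_elim, simp\<close>)
  also have "\<dots> = (LINT x|lebesgue. ?X x) - (LINT x|lebesgue. ?Y x) - (LINT x|lebesgue. ?Z x)"
    using X YZl by simp
  finally have split: "(LINT x:\<Omega>|lebesgue. u x * m x) = (LINT x|lborel. w x * m' x) + (LINT x|lborel. ?Y x) + (LINT x|lborel. ?Z x)"
    unfolding set_lebesgue_integral_def
    using integral_completion[OF wmm] integral_completion[OF borel_measurable_integrable[OF Y]] integral_completion[OF borel_measurable_integrable[OF Z]]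
    by linarith
  have 1: "\<bar>LINT x|lborel. w x * m' x\<bar> \<le> L * W"
  proof -
    have "ennreal \<bar>LINT x|lborel. w x * m' x\<bar> \<le> ennreal L * ennreal W"
      unfolding m'_def by (rule bv_non_extremal_bound[OF w(1,3) \<Omega> m _ ne]) (use wb in \<open>simp_all add: m'_def\<close>)
    also have "\<dots> = ennreal (L * W)" by (rule ennreal_mult[OF ne(1) w(2), symmetric])
    finally show ?thesis using ne(1) w(2) by (simp add: ennreal_le_iff)
  qed
  have 2: "\<bar>LINT x|lborel. ?Y x\<bar> \<le> L * V1"
  proof -
    have \<eta>0: "\<eta> x * \<phi> x = 0" if "x \<notin> \<Omega>" for x
    proof -
      have "x \<in> cball x d" using \<eta>(5) by simp
      then have "\<eta> x = 0" using \<eta>(6)[of x] that by blast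
      then show ?thesis by simp
    qed
    have "ennreal \<bar>LINT x|lborel. ?Y x\<bar> \<le> ennreal L * ennreal V1"
      unfolding m'_def by (rule bv_non_extremal_bound[OF \<eta>V(1) \<eta>0 \<Omega> m _ ne]) (use Y in \<open>simp_all add: m'_def\<close>)
    also have "\<dots> = ennreal (L * V1)" by (rule ennreal_mult[OF ne(1) \<eta>V(2), symmetric])
    finally show ?thesis using ne(1) \<eta>V(2) by (simp add: ennreal_le_iff)
  qed
  have 3: "\<bar>LINT x|lborel. ?Z x\<bar> \<le> ?C * V2"
  proof -
    have "ennreal (norm (LINT x|lborel. ?Z x)) \<le> ennreal (?C * V2)"
      by (rule order_trans[OF integral_norm_bound_ennreal[OF Z] Zb])
    then show ?thesis using mult_nonneg_nonneg[OF C \<zeta>(3)] by (subst (asm) ennreal_le_iff) simp_all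
  qed
  show ?thesis unfolding split using 1 2 3 by linarith
qed

section \<open>Relative compactness in the space of classes\<close>

lemma relatively_compactin_L1I:
  fixes u :: "nat \<Rightarrow> 'a::euclidean_space \<Rightarrow> real"
  assumes U: "U \<in> sets borel" and u: "\<And>j. set_integrable lebesgue U (u j)"
    and w: "\<And>j. integrable lborel (w j)" "\<And>j x. x \<notin> U \<Longrightarrow> w j x = 0" "\<And>i j. AE x\<in>U in lebesgue. u i x - u j x = w i x - w j x"
    and tb: "\<And>e. 0 < e \<Longrightarrow> \<exists>J. finite J \<and> (\<forall>j. \<exists>i\<in>J. nnL1 (w j) (w i) \<le> ennreal e)"
  shows "relatively_compactin (L1_topology U) (range (\<lambda>j. L1_class U (u j)))"
proof -
  have UL: "U \<in> sets lebesgue" using U by simp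
  interpret M: Metric_space "L1_space U" "L1_dist U" by (rule Metric_space_L1)
  let ?S = "range (\<lambda>j. L1_class U (u j))"
  have S: "?S \<subseteq> L1_space U" unfolding L1_space_def using u by blast
  \<comment> \<open>The differences of the u_j and of the w_j agree on \<open>U\<close> and the w_j
    vanish elsewhere, so distances of classes are distances of Borel functions and finite nets carry
    over.\<close>
  have dist: "ennreal (L1_dist U (L1_class U (u i)) (L1_class U (u j))) = nnL1 (w i) (w j)" for i j
  proof -
    have wij: "(\<lambda>x. \<bar>w i x - w j x\<bar>) \<in> borel_measurable lborel"
      using borel_measurable_integrable[OF w(1)[of i]] borel_measurable_integrable[OF w(1)[of j]] by measurable
    have "(LINT x:U|lebesgue. \<bar>u i x - u j x\<bar>) = (LINT x|lebesgue. \<bar>w i x - w j x\<bar>)"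
      unfolding set_lebesgue_integral_def
    proof (rule integral_cong_AE)
      show "(\<lambda>x. indicat_real U x *\<^sub>R \<bar>u i x - u j x\<bar>) \<in> borel_measurable lebesgue"
        using set_integrable_abs[OF set_integral_diff(1)[OF u u]] unfolding set_integrable_def by (rule borel_measurable_integrable)
      show "(\<lambda>x. \<bar>w i x - w j x\<bar>) \<in> borel_measurable lebesgue" by (rule measurable_completion[OF wij])
      show "AE x in lebesgue. indicat_real U x *\<^sub>R \<bar>u i x - u j x\<bar> = \<bar>w i x - w j x\<bar>"
        using w(3)[of i j]
      proof eventually_elim
        fix x assume "x \<in> U \<longrightarrow> u i x - u j x = w i x - w j x"
        then show "indicat_real U x *\<^sub>R \<bar>u i x - u j x\<bar> = \<bar>w i x - w j x\<bar>"
          by (cases "x \<in> U") (simp_all add: w(2))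
      qed
    qed
    also have "\<dots> = (LINT x|lborel. \<bar>w i x - w j x\<bar>)" by (rule integral_completion[OF wij])
    finally show ?thesis unfolding L1_dist_class[OF u u] nnL1_integral[OF w(1) w(1)] by simp
  qed
  have "M.mtotally_bounded ?S"
    unfolding M.mtotally_bounded_def
  proof (intro allI impI)
    fix e :: real assume e: "0 < e"
    then obtain J where J: "finite J" "\<And>j. \<exists>i\<in>J. nnL1 (w j) (w i) \<le> ennreal (e / 2)" using tb[of "e / 2"] by auto
    show "\<exists>K. finite K \<and> K \<subseteq> ?S \<and> ?S \<subseteq> (\<Union>x\<in>K. M.mball x e)"
    proof (intro exI conjI)
      show "finite ((\<lambda>j. L1_class U (u j)) ` J)" using J(1) by (rule finite_imageI)
      show "(\<lambda>j. L1_class U (u j)) ` J \<subseteq> ?S" by blast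
      show "?S \<subseteq> (\<Union>x\<in>(\<lambda>j. L1_class U (u j)) ` J. M.mball x e)"
      proof
        fix X assume "X \<in> ?S"
        then obtain j where X: "X = L1_class U (u j)" by blast
        obtain i where i: "i \<in> J" "nnL1 (w j) (w i) \<le> ennreal (e / 2)" using J(2) by blast
        have "ennreal (L1_dist U (L1_class U (u i)) X) \<le> ennreal (e / 2)"
          unfolding X dist using i(2) by (simp only: nnL1_commute)
        then have "L1_dist U (L1_class U (u i)) X \<le> e / 2" using e by (simp add: ennreal_le_iff)
        then have "L1_dist U (L1_class U (u i)) X < e" using e by simp
        moreover have "L1_class U (u i) \<in> L1_space U" "X \<in> L1_space U" using S X by blast+
        ultimately have "X \<in> M.mball (L1_class U (u i)) e" by simp
        then show "X \<in> (\<Union>x\<in>(\<lambda>j. L1_class U (u j)) ` J. M.mball x e)" using i(1) by blast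
      qed
    qed
  qed
  then have "compactin M.mtopology (M.mtopology closure_of ?S)"
    using M.mtotally_bounded_eq_compact_closure_of[OF mcomplete_L1[OF UL]] by blast
  then show ?thesis unfolding relatively_compactin_def using S by simp
qed

lemma eventually_le_imp_bounded:
  fixes a :: "nat \<Rightarrow> real"
  assumes "eventually (\<lambda>j. a j \<le> C) sequentially"
  shows "\<exists>A\<ge>0. \<forall>j. a j \<le> A"
proof -
  obtain N where N: "\<And>j. N \<le> j \<Longrightarrow> a j \<le> C" using assms by (auto simp: eventually_sequentially)
  define A where "A = max 0 (max C (Max (a ` {..N})))"
  have "a j \<le> A" for j
  proof (cases "j \<le> N")
    case True
    then have "a j \<le> Max (a ` {..N})" by (intro Max_ge) auto
    then show ?thesis by (simp add: A_def)
  next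
    case False
    then show ?thesis using N[of j] by (simp add: A_def)
  qed
  moreover have "0 \<le> A" by (simp add: A_def)
  ultimately show ?thesis by blast
qed

theorem proposition6p3:
  fixes \<Omega> B \<Gamma> :: "'a::euclidean_space set"
    and c :: 'a and R :: real
    and \<phi> h :: "'a \<Rightarrow> real"
    and \<mu> \<mu>s :: "'a set \<Rightarrow> real"
    and q :: ereal
    and m u :: "nat \<Rightarrow> 'a \<Rightarrow> real"
  assumes "open \<Omega>" and "bounded \<Omega>" and "lipschitz_boundary \<Omega>"
    and "0 < R" and "B = ball c R" and "closure \<Omega> \<subseteq> B"
    and "\<phi> \<in> W11 B"
    and "M_H \<Omega> \<mu>" and "non_extremal \<Omega> \<mu>"
    and "\<And>A. A \<in> sets borel \<Longrightarrow> A \<subseteq> \<Omega> \<Longrightarrow> \<mu> A = dens h A + \<mu>s A"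
    and "ereal (real DIM('a)) < q" and "in_Lp q \<Omega> h"
    and "admissible \<Omega> (dens h)" and "admissible \<Omega> \<mu>s"
    and "compact \<Gamma>" and "\<Gamma> \<subseteq> \<Omega>" and "emeasure lebesgue \<Gamma> = 0"
    and "tvar \<mu>s (\<Omega> - \<Gamma>) = 0"
    and "\<And>j. smooth_on \<Omega> (m j)"
    and "\<forall>\<^sub>F j in sequentially. admissible \<Omega> (dens (m j))"
    and "\<exists>L\<in>{0<..<1}. \<forall>\<^sub>F j in sequentially. non_extremal_with L \<Omega> (dens (m j))"
    and "weak_star_conv \<Omega> (\<lambda>j. dens (m j)) \<mu>"
    and "\<And>\<Omega>'. open \<Omega>' \<Longrightarrow> compact (closure \<Omega>') \<Longrightarrow> closure \<Omega>' \<subseteq> \<Omega> \<Longrightarrow>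
           measure_support \<Omega> \<mu>s \<subseteq> \<Omega>' \<Longrightarrow>
           \<exists>H :: nat \<Rightarrow> 'a \<Rightarrow> real. (\<forall>j. smooth_on \<Omega> (H j)) \<and>
             (\<forall>p::real. 1 \<le> p \<and> ereal p \<le> q \<longrightarrow> tendsto_Lp p \<Omega> H h) \<and>
             tendsto_Lp (real DIM('a)) (\<Omega> - \<Omega>') (\<lambda>j x. m j x - H j x) (\<lambda>x. 0) \<and>
             (\<exists>\<rho> \<delta>. mollifier \<rho> \<and> (\<forall>j. 0 < \<delta> j) \<and> decseq \<delta> \<and> \<delta> \<longlonglongrightarrow> 0 \<and>
               (\<forall>\<^sub>F j in sequentially. \<forall>x\<in>\<Omega>'.
                  m j x = convolve_measure \<Omega> (rescale (\<delta> j) \<rho>) \<mu>s x + H j x))"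
    and "\<And>j. u j \<in> S_class B \<Omega> \<phi>"
    and "bdd_above (range (\<lambda>j. J_functional B \<Omega> (m j) (u j)))"
  shows "relatively_compactin (L1_topology B) (range (\<lambda>j. L1_class B (u j)))"
proof -
  note \<Omega> = assms(1,2) and B = assms(5) and \<Omega>B = assms(6) and \<phi> = assms(7) and q = assms(11) and h = assms(12)
    and \<Gamma> = assms(15,16) and \<mu>s = assms(18) and m = assms(19) and ne = assms(21) and ii = assms(23) and u = assms(24) and J = assms(25)
  let ?n = "DIM('a)"
  have Bo: "open B" "bounded B" "B \<in> sets borel" using B by auto
  have \<Omega>b: "\<Omega> \<in> sets borel" using \<Omega>(1) by simp
  have \<Omega>sub: "\<Omega> \<subseteq> B" using closure_subset \<Omega>B by (rule order_trans)
  have mc: "continuous_on \<Omega> (m j)" for j by (rule smooth_onD(1)[OF m])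
  have cl\<Omega>: "compact (closure \<Omega>)" using \<Omega>(2) by (simp add: compact_closure)
  obtain e\<Gamma> where e\<Gamma>: "e\<Gamma> > 0" "(\<Union>x\<in>\<Gamma>. ball x e\<Gamma>) \<subseteq> \<Omega>"
    using compact_subset_open_imp_ball_epsilon_subset[OF \<Gamma>(1) \<Omega>(1) \<Gamma>(2)] .
  \<comment> \<open>A neighbourhood of \<Gamma> with half the available radius: its closure stays in
    \<Omega>, and it contains the support of \<open>\<mu>s\<close>.\<close>
  obtain \<Omega>' where \<Omega>': "open \<Omega>'" "compact (closure \<Omega>')" "closure \<Omega>' \<subseteq> \<Omega>" "\<Gamma> \<subseteq> \<Omega>'"
  proof -
    define D where "D = (\<Union>x\<in>\<Gamma>. ball x (e\<Gamma> / 2))"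
    have sub: "closure D \<subseteq> (\<Union>x\<in>\<Gamma>. ball x e\<Gamma>)"
    proof
      fix y assume "y \<in> closure D"
      then obtain z where z: "z \<in> D" "dist z y < e\<Gamma> / 2" using e\<Gamma>(1) unfolding closure_approachable by (meson half_gt_zero)
      then obtain x where x: "x \<in> \<Gamma>" "dist x z < e\<Gamma> / 2" unfolding D_def by auto
      have "dist x y < e\<Gamma>" using dist_triangle[of x y z] x(2) z(2) by linarith
      then show "y \<in> (\<Union>x\<in>\<Gamma>. ball x e\<Gamma>)" using x(1) by auto
    qed
    have "open D" unfolding D_def by (intro open_UN ballI open_ball)
    moreover have "closure D \<subseteq> \<Omega>" using sub e\<Gamma>(2) by (rule order_trans)
    moreover have "compact (closure D)"
      using bounded_subset[OF \<Omega>(2) calculation(2)] by (simp add: compact_eq_bounded_closed)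
    moreover have "\<Gamma> \<subseteq> D" unfolding D_def using e\<Gamma>(1) by auto
    ultimately show thesis by (intro that)
  qed
  have "measure_support \<Omega> \<mu>s \<subseteq> \<Omega>'"
    using measure_support_subset[OF \<Gamma>(1) \<Omega>(1) \<mu>s] \<Omega>'(4) by (rule order_trans)
  \<comment> \<open>\<open>H\<close> feeds the L^n bound outside \<Omega>'. The mollifier \<rho> and
    its scales \<delta> are kept as smoothing kernels for functions of bounded variation.\<close>
  from ii[OF \<Omega>'(1-3) this] obtain H and \<rho> :: "'a \<Rightarrow> real" and \<delta> :: "nat \<Rightarrow> real" where H0: "\<forall>j. smooth_on \<Omega> (H j)"
    "\<forall>p::real. 1 \<le> p \<and> ereal p \<le> q \<longrightarrow> tendsto_Lp p \<Omega> H h"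
    and H3: "tendsto_Lp (real ?n) (\<Omega> - \<Omega>') (\<lambda>j x. m j x - H j x) (\<lambda>x. 0)"
    and \<rho>: "mollifier \<rho>" and \<delta>0: "\<forall>j. 0 < \<delta> j" and \<delta>2: "\<delta> \<longlonglongrightarrow> 0"
    by (elim exE conjE) (rule that, assumption+)
  have H1: "smooth_on \<Omega> (H j)" for j using H0(1) by (rule spec)
  have H2: "tendsto_Lp p \<Omega> H h" if "1 \<le> p" "ereal p \<le> q" for p :: real
    using H0(2)[rule_format, OF conjI[OF that]] .
  note H = H1 H2 H3
  have \<delta>1: "0 < \<delta> j" for j using \<delta>0 by (rule spec)
  note \<delta> = \<delta>1 \<delta>2
  have tk: "tkernel (\<delta> j) (rescale (\<delta> j) \<rho>)" for j by (rule mollifier_tkernel[OF \<rho> \<delta>(1)])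
  \<comment> \<open>Rescaling \<rho> makes every scale available, not only those in the sequence
    \<delta>.\<close>
  have ker: "\<exists>\<delta> k \<kappa>. 0 < \<delta> \<and> \<delta> \<le> \<epsilon> \<and> kernel \<delta> k (\<kappa> :: 'a \<Rightarrow> 'a)" if "0 < \<epsilon>" for \<epsilon>
    using mollifier_tkernel[OF \<rho> that] that unfolding tkernel_def by blast
  have Hn: "tendsto_Lp (real ?n) \<Omega> H h"
  proof (rule H(2))
    show "1 \<le> real ?n" using DIM_positive[where 'a='a] by linarith
    show "ereal (real ?n) \<le> q" using q by (rule less_imp_le)
  qed
  obtain K where K: "0 \<le> K" "\<forall>\<^sub>F j in sequentially. (\<integral>\<^sup>+x. ennreal (\<bar>indicat_real (\<Omega> - \<Omega>') x * m j x\<bar> ^ ?n) \<partial>lborel) \<le> ennreal K"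
    using Ln_eventually_bounded[OF \<Omega> \<Omega>'(1) DIM_positive h q Hn H(3) mc smooth_onD(1)[OF H(1)]] by blast
  obtain L where L: "0 < L" "L < 1" "\<forall>\<^sub>F j in sequentially. non_extremal_with L \<Omega> (dens (m j))"
    using ne by auto
  have \<phi>i: "set_integrable lebesgue B \<phi>" using \<phi> unfolding W11_def by blast
  obtain \<nu>\<phi> G where \<nu>\<phi>: "distr_grad B \<phi> \<nu>\<phi>" "0 \<le> G" "tvar \<nu>\<phi> B \<le> ennreal G"
    by (rule W11_distr_grad[OF \<phi> Bo(3)]) (rule that, assumption+)
  obtain \<phi>' where \<phi>': "integrable lborel \<phi>'" "AE x\<in>B in lebesgue. \<phi>' x = \<phi> x" "\<And>x. x \<notin> B \<Longrightarrow> \<phi>' x = 0"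
    by (rule borel_representative[OF \<phi>i Bo(3)]) (rule that, assumption+)
  \<comment> \<open>\<eta> \<phi>' vanishes outside \<Omega> and so falls under
    non-extremality.\<close>
  obtain \<eta> Z d where \<eta>: "C1c \<eta> Z" "\<And>x. 0 \<le> \<eta> x" "\<And>x. \<eta> x \<le> 1" "\<And>x. x \<in> closure \<Omega>' \<Longrightarrow> \<eta> x = 1" "0 < d"
    "\<And>x. \<eta> x \<noteq> 0 \<Longrightarrow> cball x d \<subseteq> \<Omega>"
    by (rule cutoff_exists[OF \<Omega>'(2) \<Omega>(1) \<Omega>'(3) ker], assumption) (rule that)
  have \<eta>1: "\<bar>\<eta> x\<bar> \<le> 1" for x using \<eta>(2,3)[of x] by simp
  have \<eta>B: "cball x d \<subseteq> B" if "\<eta> x \<noteq> 0" for x using \<eta>(6)[OF that] \<Omega>sub by (rule order_trans)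
  obtain V1 where V1: "0 \<le> V1" "bv_approx (\<lambda>x. \<eta> x * \<phi>' x) (ennreal V1)"
    using bv_approx_cutoff[OF Bo(1) \<nu>\<phi>(1) \<phi>'(1,2) \<phi>i \<eta>(1) \<eta>1 \<eta>(5) \<eta>B tk \<delta>(2)] by blast
  \<comment> \<open>\<zeta> \<phi>' agrees with \<phi> on \<Omega> and goes to 0 inside B, which
    avoids a jump at the boundary of B.\<close>
  obtain \<zeta> Z' d' where \<zeta>: "C1c \<zeta> Z'" "\<And>x. 0 \<le> \<zeta> x" "\<And>x. \<zeta> x \<le> 1" "\<And>x. x \<in> closure \<Omega> \<Longrightarrow> \<zeta> x = 1" "0 < d'"
    "\<And>x. \<zeta> x \<noteq> 0 \<Longrightarrow> cball x d' \<subseteq> B"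
    by (rule cutoff_exists[OF cl\<Omega> Bo(1) \<Omega>B ker], assumption) (rule that)
  have \<zeta>1: "\<bar>\<zeta> x\<bar> \<le> 1" for x using \<zeta>(2,3)[of x] by simp
  obtain V2 where V2: "0 \<le> V2" "bv_approx (\<lambda>x. \<zeta> x * \<phi>' x) (ennreal V2)"
    using bv_approx_cutoff[OF Bo(1) \<nu>\<phi>(1) \<phi>'(1,2) \<phi>i \<zeta>(1) \<zeta>1 \<zeta>(5,6) tk \<delta>(2)] by blast
  obtain dB where dB: "dB > 0" "(\<Union>x\<in>closure \<Omega>. ball x dB) \<subseteq> B"
    using compact_subset_open_imp_ball_epsilon_subset[OF cl\<Omega> Bo(1) \<Omega>B] .
  have dB': "ball x dB \<subseteq> B" if "x \<in> \<Omega>" for x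
  proof -
    have "x \<in> closure \<Omega>" using closure_subset that by (rule subsetD)
    then show ?thesis using dB(2) by blast
  qed
  have uBV: "u j \<in> BV B" and u\<phi>: "AE x\<in>B - \<Omega> in lebesgue. u j x = \<phi> x" for j
    using u[of j] unfolding S_class_def by blast+
  have ui: "set_integrable lebesgue B (u j)" for j using uBV[of j] unfolding BV_def by blast
  define a where "a j = area_mass B (u j)" for j
  have a0: "0 \<le> a j" for j unfolding a_def by (rule tvar_BV_grad_le_area_mass(2)[OF uBV Bo(3,2)])
  \<comment> \<open>u_j - \<phi> vanishes almost everywhere in B outside \<Omega>, which keeps a
    positive distance from the boundary of B; extension by 0 therefore creates no further
    variation.\<close>
  have "\<exists>w. bv_approx w (ennreal (a j + G)) \<and> (\<forall>x. x \<notin> \<Omega> \<longrightarrow> w x = 0) \<and> (AE x\<in>B in lebesgue. w x = u j x - \<phi> x)" for j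
  proof -
    have di: "set_integrable lebesgue B (\<lambda>x. u j x - \<phi> x)" by (rule set_integral_diff(1)[OF ui \<phi>i])
    have "set_integrable lebesgue \<Omega> (\<lambda>x. u j x - \<phi> x)"
      by (rule set_integrable_subset[OF di _ \<Omega>sub]) (use \<Omega>b in simp)
    then obtain w where w: "integrable lborel w" "AE x\<in>\<Omega> in lebesgue. w x = u j x - \<phi> x" "\<And>x. x \<notin> \<Omega> \<Longrightarrow> w x = 0"
      by (rule borel_representative[OF _ \<Omega>b]) (rule that)
    have wB: "AE x\<in>B in lebesgue. w x = u j x - \<phi> x"
      using w(2) u\<phi>[of j]
    proof eventually_elim
      fix x assume "x \<in> \<Omega> \<longrightarrow> w x = u j x - \<phi> x" "x \<in> B - \<Omega> \<longrightarrow> u j x = \<phi> x"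
      then show "x \<in> B \<longrightarrow> w x = u j x - \<phi> x" using w(3)[of x] by (cases "x \<in> \<Omega>") auto
    qed
    let ?\<nu> = "\<lambda>A. BV_grad B (u j) A - \<nu>\<phi> A"
    have dg: "distr_grad B (\<lambda>x. u j x - \<phi> x) ?\<nu>"
      by (rule distr_grad_diff[OF BV_grad(1)[OF uBV] ui \<nu>\<phi>(1) \<phi>i Bo(3)])
    have "bv_approx w (tvar ?\<nu> B)"
      by (rule bv_approx_conv[OF Bo(1) dg w(1) wB di \<Omega>(2) w(3) dB(1) dB' tk \<delta>(2)])
    moreover have "tvar ?\<nu> B \<le> ennreal (a j + G)"
    proof -
      have "tvar ?\<nu> B \<le> tvar (BV_grad B (u j)) B + tvar \<nu>\<phi> B"
        by (rule tvar_add_le[OF norm_triangle_ineq4 Bo(3)])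
      also have "\<dots> \<le> ennreal (a j) + ennreal G"
        unfolding a_def by (rule add_mono[OF tvar_BV_grad_le_area_mass(1)[OF uBV Bo(3,2)] \<nu>\<phi>(3)])
      also have "\<dots> = ennreal (a j + G)" by (rule ennreal_plus[OF a0 \<nu>\<phi>(2), symmetric])
      finally show ?thesis .
    qed
    ultimately have "bv_approx w (ennreal (a j + G))" by (rule bv_approx_mono)
    then show ?thesis using w(3) wB by blast
  qed
  then obtain w where w: "\<And>j. bv_approx (w j) (ennreal (a j + G))" "\<And>j x. x \<notin> \<Omega> \<Longrightarrow> w j x = 0"
    "\<And>j. AE x\<in>B in lebesgue. w j x = u j x - \<phi> x"
    by metis
  obtain M where M: "\<And>j. J_functional B \<Omega> (m j) (u j) \<le> M" using J unfolding bdd_above_def by blast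
  let ?C = "2 * (1 + 2 * K / unit_ball_vol (real ?n))"
  have "eventually (\<lambda>j. a j \<le> (M + L * G + L * V1 + ?C * V2) / (1 - L)) sequentially"
    using K(2) L(3)
  proof eventually_elim
    fix j assume Kj: "(\<integral>\<^sup>+x. ennreal (\<bar>indicat_real (\<Omega> - \<Omega>') x * m j x\<bar> ^ ?n) \<partial>lborel) \<le> ennreal K"
      and Lj: "non_extremal_with L \<Omega> (dens (m j))"
    have uw: "AE x\<in>\<Omega> in lebesgue. u j x = w j x + \<phi>' x"
      using w(3)[of j] \<phi>'(2) by eventually_elim (use \<Omega>sub in auto)
    have "\<bar>LINT x:\<Omega>|lebesgue. u j x * m j x\<bar> \<le> L * (a j + G) + L * V1 + ?C * V2"
    proof (rule functional_bound[OF \<Omega>(1) \<Omega>'(1) mc less_imp_le[OF L(1)] Lj Kj K(1) w(1) _ w(2) uw \<phi>'(1) \<eta>(1-3) _ \<eta>(5,6) V1(2,1) _ V2(2,1)])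
      show "0 \<le> a j + G" using a0 \<nu>\<phi>(2) by (rule add_nonneg_nonneg)
      show "\<eta> x = 1" if "x \<in> \<Omega>'" for x using \<eta>(4) subsetD[OF closure_subset that] .
      show "\<zeta> x = 1" if "x \<in> \<Omega>" for x using \<zeta>(4) subsetD[OF closure_subset that] .
    qed
    moreover have "a j + (LINT x:\<Omega>|lebesgue. u j x * m j x) \<le> M"
      using M[of j] by (simp only: J_functional_def a_def)
    \<comment> \<open>The term L a_j is absorbed on the left, where the factor 1 - L > 0
      remains.\<close>
    ultimately have "a j \<le> M + (L * (a j + G) + L * V1 + ?C * V2)" by linarith
    then have "a j * (1 - L) \<le> M + L * G + L * V1 + ?C * V2" by (simp only: right_diff_distrib distrib_left mult_1_right mult.commute[of "a j" L])
    then show "a j \<le> (M + L * G + L * V1 + ?C * V2) / (1 - L)" using L(2) by (subst pos_le_divide_eq) simp_all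
  qed
  \<comment> \<open>The L^n bound and non-extremality hold for large j only. Each remaining a_j is a
    real number, so a maximum over finitely many indices completes the uniform bound.\<close>
  from eventually_le_imp_bounded[OF this] obtain A where A: "0 \<le> A" "\<And>j. a j \<le> A" by blast
  have wA: "bv_approx (w j) (ennreal (A + G))" for j
    by (rule bv_approx_mono[OF w(1)]) (intro ennreal_leI add_right_mono A(2))
  have wi: "integrable lborel (w j)" for j using w(1)[of j] unfolding bv_approx_def by blast
  have AG: "0 \<le> A + G" using A(1) \<nu>\<phi>(2) by (rule add_nonneg_nonneg)
  obtain r where r: "\<Omega> \<subseteq> ball 0 r" using bounded_subset_ballD[OF \<Omega>(2), of 0] by (elim exE conjE)
  have supp: "w j x = 0" if "r \<le> norm x" for j x
  proof -
    have "x \<notin> ball 0 r" using that by simp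
    then have "x \<notin> \<Omega>" using r by blast
    then show ?thesis by (rule w(2))
  qed
  show ?thesis
  proof (rule relatively_compactin_L1I[OF Bo(3) ui wi])
    show "w j x = 0" if "x \<notin> B" for j x using w(2) \<Omega>sub that by blast
    show "AE x\<in>B in lebesgue. u i x - u j x = w i x - w j x" for i j
      using w(3)[of i] w(3)[of j] by eventually_elim auto
    fix e :: real assume e: "0 < e"
    show "\<exists>J. finite J \<and> (\<forall>j. \<exists>i\<in>J. nnL1 (w j) (w i) \<le> ennreal e)"
      by (rule L1_totally_bounded[OF wi supp bv_translation[OF wA] AG ker e])
  qed
qed

end
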